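(* Let $\mathcal F$ be an algebraically closed and inversive difference field of characteristic zero and $F=\{f_1,\ldots,f_s\}\subset\mathcal F\{\mathbb Y\}$ a finite set of difference binomials. Then one can compute (by an algorithm) finitely many regular and coherent difference ascending chains $\mathcal A_1,\ldots,\mathcal A_t$ in $\mathcal F\{\mathbb Y\}$ such that $$\{F\}=\bigcap_{i=1}^t\mathrm{sat}(\mathcal A_i),$$ where for each $i$, every element of $\mathcal A_i$ is either a variable $y_c\in\mathbb Y$ or a difference binomial, and $\mathrm{sat}(\mathcal A_i)$ is a reflexive prime difference ideal. If $t=0$, this means $\{F\}=[1]$.
   Context: A difference field ($\sigma$-field) is a field $\mathcal F$ with a ring endomorphism $\sigma$ with $\sigma(a)=0$ iff $a=0$; inversive means $\sigma$ bijective. $\mathbb Y=\{y_1,\ldots,y_n\}$ are difference indeterminates, $y_i^{(j)}=\sigma^j(y_i)$, $\mathcal F\{\mathbb Y\}=\mathcal F[y_i^{(j)}]$. For $p=\sum c_ix^i\in\mathbb N[x]$, $a^p=\prod_i\sigma^i(a)^{c_i}$ (so $a^{x^k}=\sigma^k(a)$); for $\mathbf a\in\mathbb N[x]^n$, $\mathbb Y^{\mathbf a}=\prod_iy_i^{a_i}$. A difference binomial is an element $a\mathbb Y^{\mathbf a}+b\mathbb Y^{\mathbf b}$ with $a,b\in\mathcal F$, $\mathbf a,\mathbf b\in\mathbb N[x]^n$. A $\sigma$-ideal is an ideal closed under $\sigma$; $[S]$ is the $\sigma$-ideal generated by $S$. A $\sigma$-ideal is reflexive if $\sigma(a)\in\mathcal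 I$ implies $a\in\mathcal I$; prime if prime as an ideal (and not the unit ideal); perfect if $p^a\in\mathcal I$ with $a\in\mathbb N[x]\setminus\{0\}$ implies $p\in\mathcal I$. $\{S\}$ denotes the perfect $\sigma$-ideal generated by $S$ (the smallest perfect $\sigma$-ideal containing it). Ranking: $y_i^{(k)}>y_j^{(l)}$ iff $i>j$, or $i=j$ and $k>l$. For $f\in\mathcal F\{\mathbb Y\}\setminus\mathcal F$, the leader $\mathrm{ld}(f)$ is the largest $y_j^{(k)}$ occurring in $f$, $y_j$ is the leading variable, and the initial is the leading coefficient of $f$ as a polynomial in $\mathrm{ld}(f)$. $q$ has higher rank than $p$ if $\mathrm{ld}(q)>\mathrm{ld}(p)$, or the leaders agree and $q$ has larger degree in it. If $\mathrm{ld}(p)=y_j^{(k)}$, then $q$ is reduced w.r.t. $p$ if $\deg(q,y_j^{(k+l)})<\deg(p,y_j^{(k)})$ for all $l\in\mathbb N$. A difference ascending chain is a finite sequence $A_1,\ldots,A_m$ of nonzero difference polynomials with either $m=1$, or $m>1$ and for $i<j$, $A_j$ of higher rank than $A_i$ and reduced w.r.t. $A_i$. $\mathrm{prem}(f,\mathcal A)$ is the difference pseudo-remainder of $f$ w.r.t. $\mathcal A$, obtained by successive algebraic pseudo-division by transforms of $A_m,\ldots,A_1$ (transforms of each $A_i$ from the highest relevant order down, w.r.t. their leaders); it is reduced w.r.t. $\mathcal A$ and satisfies $\prod_iI_i^{e_i}f\equiv \mathrm{prem}(f,\mathcal A)\bmod[\mathcal A]$ with $I_i$ the initial of $A_i$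 and $e_i\in\mathbb N[x]$. For a chain $\mathcal A=A_1,\ldots,A_m$ let $I_i$ be the initial and $y_{l_i}^{(o_i)}$ the leader of $A_i$. $\mathcal A$ is regular if for every $i$ and every $j\in\mathbb N$, $I_i^{x^j}$ is invertible w.r.t. $\mathcal A$, in the sense that $[A_1,\ldots,A_{i-1},I_i^{x^j}]$ contains a nonzero difference polynomial involving no $y_{l_i}^{(o_i+k)}$, $k\ge0$. For $i<j$ set $\Delta(A_i,A_j)=0$ if the leading variables differ, and otherwise (then $o_i<o_j$) $\Delta(A_i,A_j)=\mathrm{prem}(\sigma^{o_j-o_i}(A_i),A_j)$; $\mathcal A$ is coherent if $\mathrm{prem}(\Delta(A_i,A_j),\mathcal A)=0$ for all $i<j$. The saturation ideal is $\mathrm{sat}(\mathcal A)=\{p\in\mathcal F\{\mathbb Y\}\mid \exists h\in\mathbb I_{\mathcal A},\ hp\in[\mathcal A]\}$, where $\mathbb I_{\mathcal A}$ is the multiplicative set generated by the initials of elements of $\mathcal A$ and their transforms.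
   Formalization: "Regular" is mended: invertibility of I_i^{x^j} may use all chain transforms with leader at most its own, and the polynomial must avoid all leader transforms; as literally defined the claim fails for y·y^{(1)}−1. The empty chain (sat = [0]) is allowed, as F = {0} needs it. *)

theory Defs
  imports
    "HOL-Library.Poly_Mapping"
    "HOL-Library.Product_Lexorder"
    "HOL-Computational_Algebra.Polynomial"
begin

section \<open>Difference fields and difference polynomials\<close>

definition difference_field :: "('a::field \<Rightarrow> 'a) \<Rightarrow> bool" where
  "difference_field \<sigma> \<longleftrightarrow>
     (\<forall>a b. \<sigma> (a + b) = \<sigma> a + \<sigma> b) \<and> (\<forall>a b. \<sigma> (a * b) = \<sigma> a * \<sigma> b) \<and> \<sigma> 1 = 1 \<and>
     (\<forall>a. \<sigma> a = 0 \<longleftrightarrow> a = 0)"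

definition inversive_difference_field :: "('a::field \<Rightarrow> 'a) \<Rightarrow> bool" where
  "inversive_difference_field \<sigma> \<longleftrightarrow> difference_field \<sigma> \<and> bij \<sigma>"

text \<open>The pair \<open>(i, j)\<close> is the variable $y_i^{(j)} = \sigma^j(y_i)$. The $n$ difference indeterminates
  are indexed by a type \<open>'n\<close> of class \<open>{finite, linorder}\<close>, so that $n$ is its cardinality and the
  ranking of the variables is the lexicographic order of \<open>Product_Lexorder\<close>. A difference polynomial
  maps exponent vectors to coefficients, so the type \<open>('n, 'a) dpoly\<close> is the whole ring
  $\mathcal{F}\{\mathbb{Y}\}$.\<close>

type_synonym 'n dvar = "'n \<times> nat"
type_synonym ('n, 'a) dpoly = "('n dvar \<Rightarrow>\<^sub>0 nat) \<Rightarrow>\<^sub>0 'a"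

definition dconst :: "'a::comm_ring_1 \<Rightarrow> ('n, 'a) dpoly" where
  "dconst c = Poly_Mapping.single 0 c"

definition yvar :: "'n dvar \<Rightarrow> ('n, 'a::comm_ring_1) dpoly" where
  "yvar v = Poly_Mapping.single (Poly_Mapping.single v 1) 1"

definition shift_exponent :: "('n dvar \<Rightarrow>\<^sub>0 nat) \<Rightarrow> ('n dvar \<Rightarrow>\<^sub>0 nat)" where
  "shift_exponent m =
     (\<Sum>v\<in>Poly_Mapping.keys m. Poly_Mapping.single (fst v, Suc (snd v)) (Poly_Mapping.lookup m v))"

definition transform :: "('a \<Rightarrow> 'a) \<Rightarrow> ('n, 'a::comm_ring_1) dpoly \<Rightarrow> ('n, 'a) dpoly" where
  "transform \<sigma> p =
     (\<Sum>m\<in>Poly_Mapping.keys p.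
        Poly_Mapping.single (shift_exponent m) (\<sigma> (Poly_Mapping.lookup p m)))"

text \<open>$p^a$ for $a \in \mathbb{N}[x]$, and $\mathbb{Y}^{\mathbf{a}}$ for $\mathbf{a} \in \mathbb{N}[x]^n$.\<close>

definition spower ::
    "('a \<Rightarrow> 'a) \<Rightarrow> ('n, 'a::comm_ring_1) dpoly \<Rightarrow> nat poly \<Rightarrow> ('n, 'a) dpoly" where
  "spower \<sigma> p a = (\<Prod>i\<le>degree a. ((transform \<sigma> ^^ i) p) ^ coeff a i)"

definition Ypower :: "('a \<Rightarrow> 'a) \<Rightarrow> ('n::finite \<Rightarrow> nat poly) \<Rightarrow> ('n, 'a::comm_ring_1) dpoly" where
  "Ypower \<sigma> \<alpha> = (\<Prod>i\<in>UNIV. spower \<sigma> (yvar (i, 0)) (\<alpha> i))"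

definition difference_binomial :: "('a \<Rightarrow> 'a) \<Rightarrow> ('n::finite, 'a::comm_ring_1) dpoly \<Rightarrow> bool" where
  "difference_binomial \<sigma> p \<longleftrightarrow>
     (\<exists>a b \<alpha> \<beta>. p = dconst a * Ypower \<sigma> \<alpha> + dconst b * Ypower \<sigma> \<beta>)"

section \<open>Ideals and difference ideals\<close>

definition is_ideal :: "'r::comm_ring_1 set \<Rightarrow> bool" where
  "is_ideal I \<longleftrightarrow> 0 \<in> I \<and> (\<forall>p\<in>I. \<forall>q\<in>I. p + q \<in> I) \<and> (\<forall>r. \<forall>p\<in>I. r * p \<in> I)"

definition is_prime_ideal :: "'r::comm_ring_1 set \<Rightarrow> bool" where
  "is_prime_ideal I \<longleftrightarrow> is_ideal I \<and> I \<noteq> UNIV \<and> (\<forall>p q. p * q \<in> I \<longrightarrow> p \<in> I \<or> q \<in> I)"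

definition ideal_generated :: "'r::comm_ring_1 set \<Rightarrow> 'r set" where
  "ideal_generated S = \<Inter>{I. is_ideal I \<and> S \<subseteq> I}"

definition sigma_ideal :: "('a \<Rightarrow> 'a) \<Rightarrow> ('n, 'a::comm_ring_1) dpoly set \<Rightarrow> bool" where
  "sigma_ideal \<sigma> I \<longleftrightarrow> is_ideal I \<and> (\<forall>p\<in>I. transform \<sigma> p \<in> I)"

definition sigma_ideal_generated ::
    "('a \<Rightarrow> 'a) \<Rightarrow> ('n, 'a::comm_ring_1) dpoly set \<Rightarrow> ('n, 'a) dpoly set" where
  "sigma_ideal_generated \<sigma> S = \<Inter>{I. sigma_ideal \<sigma> I \<and> S \<subseteq> I}"

definition reflexive_sigma_ideal :: "('a \<Rightarrow> 'a) \<Rightarrow> ('n, 'a::comm_ring_1) dpoly set \<Rightarrow> bool" where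
  "reflexive_sigma_ideal \<sigma> I \<longleftrightarrow> sigma_ideal \<sigma> I \<and> (\<forall>p. transform \<sigma> p \<in> I \<longrightarrow> p \<in> I)"

definition perfect_sigma_ideal :: "('a \<Rightarrow> 'a) \<Rightarrow> ('n, 'a::comm_ring_1) dpoly set \<Rightarrow> bool" where
  "perfect_sigma_ideal \<sigma> I \<longleftrightarrow>
     sigma_ideal \<sigma> I \<and> (\<forall>p a. a \<noteq> 0 \<longrightarrow> spower \<sigma> p a \<in> I \<longrightarrow> p \<in> I)"

definition perfect_ideal_generated ::
    "('a \<Rightarrow> 'a) \<Rightarrow> ('n, 'a::comm_ring_1) dpoly set \<Rightarrow> ('n, 'a) dpoly set" where
  "perfect_ideal_generated \<sigma> S = \<Inter>{I. perfect_sigma_ideal \<sigma> I \<and> S \<subseteq> I}"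

section \<open>Leaders, initials and ascending chains\<close>

definition vars :: "('n, 'a::zero) dpoly \<Rightarrow> 'n dvar set" where
  "vars p = (\<Union>m\<in>Poly_Mapping.keys p. Poly_Mapping.keys m)"

definition deg_in :: "('n, 'a::zero) dpoly \<Rightarrow> 'n dvar \<Rightarrow> nat" where
  "deg_in p v = Max (insert 0 ((\<lambda>m. Poly_Mapping.lookup m v) ` Poly_Mapping.keys p))"

definition coeff_in :: "('n, 'a::comm_monoid_add) dpoly \<Rightarrow> 'n dvar \<Rightarrow> nat \<Rightarrow> ('n, 'a) dpoly" where
  "coeff_in p v k =
     (\<Sum>m\<in>{m \<in> Poly_Mapping.keys p. Poly_Mapping.lookup m v = k}.
        Poly_Mapping.single (Poly_Mapping.update v 0 m) (Poly_Mapping.lookup p m))"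

text \<open>The leader is meaningful only for \<open>vars p \<noteq> {}\<close>, that is for $p \notin \mathcal{F}$.\<close>

definition leader :: "('n::linorder, 'a::zero) dpoly \<Rightarrow> 'n dvar" where
  "leader p = Max (vars p)"

definition initial :: "('n::linorder, 'a::comm_monoid_add) dpoly \<Rightarrow> ('n, 'a) dpoly" where
  "initial p = coeff_in p (leader p) (deg_in p (leader p))"

definition higher_rank ::
    "('n::linorder, 'a::zero) dpoly \<Rightarrow> ('n, 'a) dpoly \<Rightarrow> bool" where
  "higher_rank q p \<longleftrightarrow> vars q \<noteq> {} \<and> vars p \<noteq> {} \<and>
     (leader q > leader p \<or>
      leader q = leader p \<and> deg_in q (leader q) > deg_in p (leader p))"

definition reduced_wrt ::
    "('n::linorder, 'a::zero) dpoly \<Rightarrow> ('n, 'a) dpoly \<Rightarrow> bool" where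
  "reduced_wrt q p \<longleftrightarrow> vars p \<noteq> {} \<and>
     (\<forall>l. deg_in q (fst (leader p), snd (leader p) + l) < deg_in p (leader p))"

text \<open>The empty chain is allowed; its saturation ideal is the zero ideal, which is needed to
  decompose $\{F\} = [0]$ for $F \subseteq \{0\}$.\<close>

definition ascending_chain :: "('n::linorder, 'a::zero) dpoly list \<Rightarrow> bool" where
  "ascending_chain A \<longleftrightarrow> (\<forall>p\<in>set A. p \<noteq> 0) \<and>
     (length A > 1 \<longrightarrow>
       (\<forall>i j. i < j \<and> j < length A \<longrightarrow> higher_rank (A ! j) (A ! i) \<and> reduced_wrt (A ! j) (A ! i)))"

section \<open>Pseudo-remainders\<close>

definition univariate_in :: "'n dvar \<Rightarrow> ('n, 'a::comm_ring_1) dpoly \<Rightarrow> ('n, 'a) dpoly poly" where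
  "univariate_in v p = (\<Sum>k\<le>deg_in p v. monom (coeff_in p v k) k)"

definition alg_prem ::
    "'n::linorder dvar \<Rightarrow> ('n, 'a::idom) dpoly \<Rightarrow> ('n, 'a) dpoly \<Rightarrow> ('n, 'a) dpoly" where
  "alg_prem v f g = poly (pseudo_mod (univariate_in v f) (univariate_in v g)) (yvar v)"

text \<open>\<open>prem_upto \<sigma> g k f\<close> pseudo-divides $f$ successively by
  $\sigma^{k-1}(g), \ldots, \sigma(g), g$, each with respect to its leader.\<close>

fun prem_upto ::
    "('a \<Rightarrow> 'a) \<Rightarrow> ('n::linorder, 'a::idom) dpoly \<Rightarrow> nat \<Rightarrow> ('n, 'a) dpoly \<Rightarrow> ('n, 'a) dpoly" where
  "prem_upto \<sigma> g 0 f = f"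
| "prem_upto \<sigma> g (Suc k) f =
     prem_upto \<sigma> g k
       (alg_prem (fst (leader g), snd (leader g) + k) f ((transform \<sigma> ^^ k) g))"

text \<open>One plus the order of $f$ in $y_i$, and $0$ if no transform of $y_i$ occurs in $f$.\<close>

definition order_bound :: "('n, 'a::zero) dpoly \<Rightarrow> 'n \<Rightarrow> nat" where
  "order_bound f i = Max (insert 0 {Suc k |k. (i, k) \<in> vars f})"

definition prem_single ::
    "('a \<Rightarrow> 'a) \<Rightarrow> ('n::linorder, 'a::idom) dpoly \<Rightarrow> ('n, 'a) dpoly \<Rightarrow> ('n, 'a) dpoly" where
  "prem_single \<sigma> f g = prem_upto \<sigma> g (order_bound f (fst (leader g)) - snd (leader g)) f"

definition prem ::
    "('a \<Rightarrow> 'a) \<Rightarrow> ('n::linorder, 'a::idom) dpoly \<Rightarrow> ('n, 'a) dpoly list \<Rightarrow> ('n, 'a) dpoly" where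
  "prem \<sigma> f A = foldr (\<lambda>g r. prem_single \<sigma> r g) A f"

section \<open>Regular and coherent chains, saturation ideals\<close>

definition leader_transforms :: "('n::linorder, 'a::zero) dpoly list \<Rightarrow> 'n dvar set" where
  "leader_transforms A = {(fst (leader p), snd (leader p) + k) |p k. p \<in> set A}"

text \<open>Invertibility with respect to a chain, in the sense of Gao, Luo and Yuan (A characteristic set
  method for ordinary difference polynomial systems): $f$ is adjoined to those transforms of elements
  of \<open>A\<close> whose leaders do not exceed $\mathrm{ld}(f)$, and the resulting ideal has to contain a nonzero
  polynomial free of all transforms of leaders of \<open>A\<close>. If $f$ is the initial of $A_i$, only transforms
  of $A_1, \ldots, A_{i-1}$ qualify; if $f$ is the $j$-th transform of that initial, transforms
  $\sigma^k(A_i)$ with $k < j$ may qualify too. The latter cannot be left out: with them omitted,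
  already $y\,y^{(1)} - 1$ would not be a regular chain.\<close>

definition invertible_wrt ::
    "('a \<Rightarrow> 'a) \<Rightarrow> ('n::linorder, 'a::idom) dpoly \<Rightarrow> ('n, 'a) dpoly list \<Rightarrow> bool" where
  "invertible_wrt \<sigma> f A \<longleftrightarrow>
     (\<exists>p. p \<noteq> 0 \<and> vars p \<inter> leader_transforms A = {} \<and>
       p \<in> ideal_generated (insert f
         {(transform \<sigma> ^^ k) g |g k. g \<in> set A \<and>
            (\<exists>v\<in>vars f. (fst (leader g), snd (leader g) + k) \<le> v)}))"

definition regular_chain :: "('a \<Rightarrow> 'a) \<Rightarrow> ('n::linorder, 'a::idom) dpoly list \<Rightarrow> bool" where
  "regular_chain \<sigma> A \<longleftrightarrow> ascending_chain A \<and>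
     (\<forall>g\<in>set A. vars g \<noteq> {} \<and> (\<forall>j. invertible_wrt \<sigma> ((transform \<sigma> ^^ j) (initial g)) A))"

definition Delta ::
    "('a \<Rightarrow> 'a) \<Rightarrow> ('n::linorder, 'a::idom) dpoly \<Rightarrow> ('n, 'a) dpoly \<Rightarrow> ('n, 'a) dpoly" where
  "Delta \<sigma> p q =
     (if fst (leader p) \<noteq> fst (leader q) then 0
      else prem \<sigma> ((transform \<sigma> ^^ (snd (leader q) - snd (leader p))) p) [q])"

definition coherent_chain :: "('a \<Rightarrow> 'a) \<Rightarrow> ('n::linorder, 'a::idom) dpoly list \<Rightarrow> bool" where
  "coherent_chain \<sigma> A \<longleftrightarrow> ascending_chain A \<and>
     (\<forall>i j. i < j \<and> j < length A \<longrightarrow> prem \<sigma> (Delta \<sigma> (A ! i) (A ! j)) A = 0)"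

inductive_set initial_products ::
    "('a \<Rightarrow> 'a) \<Rightarrow> ('n::linorder, 'a::idom) dpoly list \<Rightarrow> ('n, 'a) dpoly set"
  for \<sigma> A where
  one: "1 \<in> initial_products \<sigma> A"
| mult: "h \<in> initial_products \<sigma> A \<Longrightarrow> g \<in> set A \<Longrightarrow>
     (transform \<sigma> ^^ j) (initial g) * h \<in> initial_products \<sigma> A"

definition sat :: "('a \<Rightarrow> 'a) \<Rightarrow> ('n::linorder, 'a::idom) dpoly list \<Rightarrow> ('n, 'a) dpoly set" where
  "sat \<sigma> A = {p. \<exists>h\<in>initial_products \<sigma> A. h * p \<in> sigma_ideal_generated \<sigma> (set A)}"

section \<open>Algorithms over a difference field\<close>

text \<open>Since the coefficient field is an abstract (possibly uncountable) field, its elements are atomic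
  data. An algorithm is a finite while-program without field constants other than $0$ and $1$, working
  on binary trees whose leaves may carry field elements. The primitive steps on field elements are
  the arithmetic operations, $\sigma$, $\sigma^{-1}$, the test for zero, and the extraction of a root
  of a nonconstant univariate polynomial.\<close>

datatype 'a tree = Leaf | Elem 'a | Node "'a tree" "'a tree"

datatype primitive =
    Make_leaf | Make_zero | Make_one
  | Left | Right
  | Add | Neg | Mult | Inverse | Sigma | Sigma_inv | Root
  | Is_node | Is_zero

datatype program =
    Skip
  | Prim primitive
  | Seq program program
  | Fork program program
  | Cond program program program
  | While program program

definition of_bool_tree :: "bool \<Rightarrow> 'a tree" where
  "of_bool_tree b = (if b then Node Leaf Leaf else Leaf)"

fun elems :: "'a tree \<Rightarrow> 'a list" where
  "elems (Node (Elem a) t) = a # elems t"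
| "elems _ = []"

text \<open>Primitives applied to an argument of the wrong shape return \<open>Leaf\<close>. The argument of \<open>Root\<close> is
  the list of coefficients of a polynomial, constant coefficient first; \<open>rt\<close> chooses the root.\<close>

fun run_primitive ::
    "('a::field \<Rightarrow> 'a) \<Rightarrow> ('a poly \<Rightarrow> 'a) \<Rightarrow> primitive \<Rightarrow> 'a tree \<Rightarrow> 'a tree" where
  "run_primitive \<sigma> rt Make_zero t = Elem 0"
| "run_primitive \<sigma> rt Make_one t = Elem 1"
| "run_primitive \<sigma> rt Left (Node s t) = s"
| "run_primitive \<sigma> rt Right (Node s t) = t"
| "run_primitive \<sigma> rt Add (Node (Elem a) (Elem b)) = Elem (a + b)"
| "run_primitive \<sigma> rt Neg (Elem a) = Elem (- a)"
| "run_primitive \<sigma> rt Mult (Node (Elem a) (Elem b)) = Elem (a * b)"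
| "run_primitive \<sigma> rt Inverse (Elem a) = Elem (inverse a)"
| "run_primitive \<sigma> rt Sigma (Elem a) = Elem (\<sigma> a)"
| "run_primitive \<sigma> rt Sigma_inv (Elem a) = Elem (inv \<sigma> a)"
| "run_primitive \<sigma> rt Root t =
     (if degree (Poly (elems t)) > 0 then Elem (rt (Poly (elems t))) else Leaf)"
| "run_primitive \<sigma> rt Is_node (Node s t) = of_bool_tree True"
| "run_primitive \<sigma> rt Is_zero (Elem a) = of_bool_tree (a = 0)"
| "run_primitive \<sigma> rt _ _ = Leaf"

definition root_choice :: "('a::field poly \<Rightarrow> 'a) \<Rightarrow> bool" where
  "root_choice rt \<longleftrightarrow> (\<forall>p. degree p > 0 \<longrightarrow> poly p (rt p) = 0)"

text \<open>\<open>runs \<sigma> rt P s t\<close>: the program \<open>P\<close> started on input \<open>s\<close> terminates with output \<open>t\<close>. A condition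
  counts as true if its value is not \<open>Leaf\<close>.\<close>

inductive runs ::
    "('a::field \<Rightarrow> 'a) \<Rightarrow> ('a poly \<Rightarrow> 'a) \<Rightarrow> program \<Rightarrow> 'a tree \<Rightarrow> 'a tree \<Rightarrow> bool"
  for \<sigma> rt where
  skip: "runs \<sigma> rt Skip s s"
| prim: "runs \<sigma> rt (Prim f) s (run_primitive \<sigma> rt f s)"
| seq: "runs \<sigma> rt P s t \<Longrightarrow> runs \<sigma> rt Q t u \<Longrightarrow> runs \<sigma> rt (Seq P Q) s u"
| fork: "runs \<sigma> rt P s t \<Longrightarrow> runs \<sigma> rt Q s u \<Longrightarrow> runs \<sigma> rt (Fork P Q) s (Node t u)"
| cond_true: "runs \<sigma> rt B s b \<Longrightarrow> b \<noteq> Leaf \<Longrightarrow> runs \<sigma> rt P s t \<Longrightarrow> runs \<sigma> rt (Cond B P Q) s t"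
| cond_false: "runs \<sigma> rt B s Leaf \<Longrightarrow> runs \<sigma> rt Q s t \<Longrightarrow> runs \<sigma> rt (Cond B P Q) s t"
| while_true: "runs \<sigma> rt B s b \<Longrightarrow> b \<noteq> Leaf \<Longrightarrow> runs \<sigma> rt P s t \<Longrightarrow>
     runs \<sigma> rt (While B P) t u \<Longrightarrow> runs \<sigma> rt (While B P) s u"
| while_false: "runs \<sigma> rt B s Leaf \<Longrightarrow> runs \<sigma> rt (While B P) s s"

text \<open>A difference polynomial is presented to an algorithm as a list of terms, a term being a
  coefficient together with a list of powers of variables (in no particular normal form).\<close>

type_synonym ('n, 'a) pterm = "'a \<times> ('n dvar \<times> nat) list"

definition pterm_value :: "('n, 'a::comm_ring_1) pterm \<Rightarrow> ('n, 'a) dpoly" where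
  "pterm_value t = dconst (fst t) * prod_list (map (\<lambda>(v, e). yvar v ^ e) (snd t))"

definition dpoly_of :: "('n, 'a::comm_ring_1) pterm list \<Rightarrow> ('n, 'a) dpoly" where
  "dpoly_of ts = sum_list (map pterm_value ts)"

definition tree_list :: "('b \<Rightarrow> 'a tree) \<Rightarrow> 'b list \<Rightarrow> 'a tree" where
  "tree_list enc xs = foldr (\<lambda>x t. Node (enc x) t) xs Leaf"

definition tree_nat :: "nat \<Rightarrow> 'a tree" where
  "tree_nat k = tree_list (\<lambda>_. Leaf) [0..<k]"

definition tree_var :: "'n::{finite,linorder} dvar \<Rightarrow> 'a tree" where
  "tree_var v = Node (tree_nat (card {i. i < fst v})) (tree_nat (snd v))"

definition tree_pterm :: "('n::{finite,linorder}, 'a) pterm \<Rightarrow> 'a tree" where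
  "tree_pterm t = Node (Elem (fst t)) (tree_list (\<lambda>(v, e). Node (tree_var v) (tree_nat e)) (snd t))"

definition tree_dpoly :: "('n::{finite,linorder}, 'a) pterm list \<Rightarrow> 'a tree" where
  "tree_dpoly = tree_list tree_pterm"

end

theory Submission
  imports Defs
begin

text \<open>A perfect difference ideal is the intersection of the reflexive prime difference ideals that contain
  it (\<open>perfect_ideal_is_Inter_of_primes\<close>). So it suffices to produce, for a binomial system $F$, finitely
  many chains whose saturation ideals are reflexive primes containing $F$, such that each reflexive
  prime $Q \supseteq F$ contains one of them.

  Let $S$ be the set of indeterminates that lie in $Q$. The binomials of $F$ whose monomials avoid $S$
  become equations $\mathbb{Y}^{\mathbf{f}} = c$ between units modulo $Q$, where $\mathbf{f}$ is an exponent
  vector in $\mathbb{Z}[x]^n$ and $\sigma$ acts on exponents as $x$. Primality and reflexivity of $Q$, together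
  with roots in the algebraically closed inversive field, extend these equations to the lattice
  $L \subseteq \mathbb{Z}[x]^n$ that consists of all vectors with a multiple $k x^e$ ($k > 0$) in the span of
  the $\mathbf{f}$: on $L$ a $\sigma$-equivariant character $\rho$ is obtained. Since $\mathbb{Z}[x]^n/L$ is
  torsion-free, it can be linearly ordered, and therefore the ideal defined by $S$, $L$ and $\rho$ is prime
  (\<open>prime_torus_ideal\<close>); since $L$ is saturated with respect to $x$, the ideal is reflexive. It is contained
  in $Q$.

  A reduced strong Groebner basis of $L$ over $\mathbb{Z}[x]$ (finite: the minimal leading coefficient
  at a variable decreases with the order) yields the chain. A basis vector
  $\mathbf{u} = \mathbf{u}^+ - \mathbf{u}^-$ gives the binomial
  $\mathbb{Y}^{\mathbf{u}^+} - \rho(\mathbf{u})\mathbb{Y}^{\mathbf{u}^-}$, and an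
  indeterminate of $S$, entered into the lattice as a unit vector with value $1$, gives itself. No nonzero
  element of the ideal is reduced with respect to this chain, so pseudo-division identifies its saturation
  ideal and shows coherence (\<open>characteristic_set\<close>). The initials are monomials, and a monomial can be
  freed of leaders step by step because each chain element equates two monomials up to a unit of the
  field; this is regularity.

  The algorithm runs through the subsets $S$ and looks, by enumerating all finite data, for a certificate:
  a basis $G$, the solutions of the finitely many span problems that make $G$ a Groebner basis, a second
  basis from which the saturation of $G$ can be read off by elimination, and for every element of $G$ a
  multiple $k x^e$ of it in the span of the system. The existence of certificates
  (\<open>certificate_exists\<close>) makes the search terminate. The finitely many candidate values of the character on
  $G$ are $k$-th roots, computed by repeated root extraction, and a finite test selects the consistent
  families (\<open>solution_below\<close>). That all this is done by a while-program is derived from a small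
  calculus of computable functions closed under recursion along lists.\<close>

abbreviation "lookup \<equiv> Poly_Mapping.lookup"
abbreviation "keys \<equiv> Poly_Mapping.keys"
abbreviation "single \<equiv> Poly_Mapping.single"
abbreviation "update \<equiv> Poly_Mapping.update"

section \<open>Difference polynomials as sums of terms\<close>

text \<open>Exponents of polynomials and integer vectors are both finitely supported, and the action of $x$ on both of
  them is a relabelling of variables.\<close>

definition relabel :: "('v \<Rightarrow> 'w) \<Rightarrow> ('v \<Rightarrow>\<^sub>0 'b::comm_monoid_add) \<Rightarrow> 'w \<Rightarrow>\<^sub>0 'b" where
  "relabel f u = (\<Sum>v\<in>keys u. single (f v) (lookup u v))"

lemma relabel_superset:
  assumes "finite K" "keys u \<subseteq> K"
  shows "relabel f u = (\<Sum>v\<in>K. single (f v) (lookup u v))"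
  unfolding relabel_def using assms
  by (intro sum.mono_neutral_left) (auto simp: in_keys_iff)

lemma relabel_zero [simp]: "relabel f 0 = 0"
  by (simp add: relabel_def)

lemma relabel_single [simp]: "relabel f (single v c) = single (f v) c"
  by (cases "c = 0") (simp_all add: relabel_def)

lemma relabel_add: "relabel f (u + w) = relabel f u + relabel f w"
proof -
  let ?K = "keys u \<union> keys w"
  have "keys (u + w) \<subseteq> ?K" by (rule keys_add)
  then show ?thesis
    by (simp add: relabel_superset[of ?K] lookup_add single_add sum.distrib)
qed

lemma lookup_relabel:
  assumes "inj f"
  shows "lookup (relabel f u) (f v) = lookup u v"
proof -
  have "lookup (relabel f u) (f v) =
      (\<Sum>w\<in>keys u. if w = v then lookup u w else 0)"
    using assms by (auto simp: relabel_def lookup_sum lookup_single when_def inj_eq intro!: sum.cong)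
  then show ?thesis by (simp add: in_keys_iff)
qed

lemma lookup_relabel_outside:
  assumes "w \<notin> range f"
  shows "lookup (relabel f u) w = 0"
  using assms by (auto simp: relabel_def lookup_sum lookup_single when_def intro!: sum.neutral)

lemma relabel_inject: "inj f \<Longrightarrow> relabel f u = relabel f w \<longleftrightarrow> u = w"
  by (metis lookup_relabel poly_mapping_eqI)

lemma keys_relabel: "inj f \<Longrightarrow> keys (relabel f u) = f ` keys u"
proof (intro equalityI subsetI)
  fix w assume f: "inj f" and w: "w \<in> keys (relabel f u)"
  then obtain v where "w = f v"
    using lookup_relabel_outside[of w f u] by (auto simp: in_keys_iff)
  with f w show "w \<in> f ` keys u"
    by (auto simp: in_keys_iff lookup_relabel)
qed (auto simp: in_keys_iff lookup_relabel)

definition shift_var :: "'p \<times> nat \<Rightarrow> 'p \<times> nat" where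
  "shift_var v = (fst v, Suc (snd v))"

lemma inj_shift_var: "inj shift_var"
  by (auto simp: inj_def shift_var_def prod_eq_iff)

lemma shift_exponent_relabel: "shift_exponent = relabel shift_var"
  by (auto simp: shift_exponent_def relabel_def shift_var_def fun_eq_iff)

lemma shift_exponent_add: "shift_exponent (a + b) = shift_exponent a + shift_exponent b"
  by (simp add: shift_exponent_relabel relabel_add)

lemma shift_exponent_zero [simp]: "shift_exponent 0 = 0"
  by (simp add: shift_exponent_relabel)

lemma shift_exponent_inject [simp]: "shift_exponent a = shift_exponent b \<longleftrightarrow> a = b"
  by (simp add: shift_exponent_relabel relabel_inject inj_shift_var)

lemma keys_shift_exponent_funpow:
  "keys ((shift_exponent ^^ k) m) = (\<lambda>v. (fst v, snd v + k)) ` keys m"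
proof (induction k)
  case (Suc k)
  then show ?case
    by (simp add: shift_exponent_relabel keys_relabel inj_shift_var image_image)
       (simp add: shift_var_def)
qed simp

lemma lookup_shift_exponent_funpow:
  "lookup ((shift_exponent ^^ k) m) (i, d + k) = lookup m (i, d)"
proof (induction k)
  case (Suc k)
  have "(i, d + Suc k) = shift_var (i, d + k)" by (simp add: shift_var_def)
  then have "lookup (relabel shift_var ((shift_exponent ^^ k) m)) (i, d + Suc k)
      = lookup ((shift_exponent ^^ k) m) (i, d + k)"
    using lookup_relabel[OF inj_shift_var] by metis
  then show ?case using Suc by (simp add: shift_exponent_relabel)
qed simp

lemma dpoly_expand:
  fixes p :: "'k \<Rightarrow>\<^sub>0 'b::comm_monoid_add"
  shows "p = (\<Sum>m\<in>keys p. single m (lookup p m))"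
  by (rule poly_mapping_eqI)
     (auto simp: lookup_sum lookup_single when_def in_keys_iff)

lemma dpoly_induct [case_names zero single add]:
  fixes p :: "'k \<Rightarrow>\<^sub>0 'b::comm_monoid_add"
  assumes "P 0" "\<And>m c. P (single m c)" "\<And>p q. P p \<Longrightarrow> P q \<Longrightarrow> P (p + q)"
  shows "P p"
proof -
  have "P (\<Sum>m\<in>K. single m (lookup p m))" if "finite K" for K
    using that by (induction K) (auto intro: assms)
  from this[OF finite_keys[of p]] show ?thesis by (simp flip: dpoly_expand)
qed

locale difference =
  fixes \<sigma> :: "'a::field \<Rightarrow> 'a"
  assumes difference_field: "difference_field \<sigma>"
begin

lemma sigma_add: "\<sigma> (a + b) = \<sigma> a + \<sigma> b"
  and sigma_mult: "\<sigma> (a * b) = \<sigma> a * \<sigma> b"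
  and sigma_one [simp]: "\<sigma> 1 = 1"
  and sigma_eq_0 [simp]: "\<sigma> a = 0 \<longleftrightarrow> a = 0"
  using difference_field by (auto simp: difference_field_def)

lemma sigma_zero [simp]: "\<sigma> 0 = 0"
  by simp

lemma sigma_uminus: "\<sigma> (- a) = - \<sigma> a"
  by (metis add.inverse_unique sigma_add sigma_zero add.right_inverse)

lemma sigma_inverse: "\<sigma> (inverse a) = inverse (\<sigma> a)"
proof (cases "a = 0")
  case False
  then have "\<sigma> a * \<sigma> (inverse a) = 1" by (simp flip: sigma_mult)
  then show ?thesis by (simp add: inverse_unique)
qed simp

lemma sigma_eq_iff: "\<sigma> a = \<sigma> b \<longleftrightarrow> a = b"
proof
  assume "\<sigma> a = \<sigma> b"
  then have "\<sigma> (a + - b) = 0" by (simp only: sigma_add sigma_uminus) simp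
  then show "a = b" by (simp only: sigma_eq_0) simp
qed simp

lemma sigma_power: "\<sigma> (a ^ k) = \<sigma> a ^ k"
  by (induction k) (auto simp: sigma_mult)

lemma funpow_one [simp]: "(\<sigma> ^^ k) 1 = 1"
  by (induction k) auto

lemma funpow_eq_0 [simp]: "(\<sigma> ^^ k) a = 0 \<longleftrightarrow> a = 0"
  by (induction k) auto

lemma funpow_eq_iff: "(\<sigma> ^^ k) a = (\<sigma> ^^ k) b \<longleftrightarrow> a = b"
  by (induction k) (auto simp: sigma_eq_iff)

subsection \<open>The endomorphism of the polynomial ring\<close>

lemma transform_superset:
  assumes "finite K" "keys p \<subseteq> K"
  shows "transform \<sigma> p =
    (\<Sum>m\<in>K. single (shift_exponent m) (\<sigma> (lookup p m)))"
  unfolding transform_def using assms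
  by (intro sum.mono_neutral_left) (auto simp: in_keys_iff)

lemma transform_single [simp]:
  "transform \<sigma> (single m c) = single (shift_exponent m) (\<sigma> c)"
  by (cases "c = 0") (simp_all add: transform_def)

lemma transform_zero [simp]: "transform \<sigma> 0 = 0"
  by (simp add: transform_def)

lemma transform_add: "transform \<sigma> (p + q) = transform \<sigma> p + transform \<sigma> q"
proof -
  let ?K = "keys p \<union> keys q"
  have "keys (p + q) \<subseteq> ?K" by (rule keys_add)
  then show ?thesis
    by (simp add: transform_superset[of ?K] lookup_add single_add sigma_add sum.distrib)
qed

lemma transform_mult: "transform \<sigma> (p * q) = transform \<sigma> p * transform \<sigma> q"
proof (induction p rule: dpoly_induct)
  case (single m c)
  show ?case
    by (induction q rule: dpoly_induct)
       (simp_all add: mult_single sigma_mult shift_exponent_add transform_add distrib_left)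
qed (simp_all add: transform_add distrib_right)

lemma transform_uminus: "transform \<sigma> (- p) = - transform \<sigma> p"
  by (metis add.inverse_unique transform_add transform_zero add.right_inverse)

lemma transform_minus: "transform \<sigma> (p - q) = transform \<sigma> p - transform \<sigma> q"
  using transform_add[of p "- q"] by (simp add: transform_uminus)

lemma transform_funpow_minus:
  "(transform \<sigma> ^^ k) (p - q) = (transform \<sigma> ^^ k) p - (transform \<sigma> ^^ k) q"
  by (induction k) (auto simp: transform_minus)

lemma transform_funpow_mult:
  "(transform \<sigma> ^^ k) (p * q) = (transform \<sigma> ^^ k) p * (transform \<sigma> ^^ k) q"
  by (induction k) (auto simp: transform_mult)

lemma transform_funpow_single:
  "(transform \<sigma> ^^ k) (single m c) = single ((shift_exponent ^^ k) m) ((\<sigma> ^^ k) c)"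
  by (induction k) auto

lemma lookup_transform: "lookup (transform \<sigma> p) (shift_exponent m) = \<sigma> (lookup p m)"
  by (induction p rule: dpoly_induct)
     (auto simp: lookup_add sigma_add transform_add lookup_single when_def)

lemma lookup_transform_outside:
  "n \<notin> range shift_exponent \<Longrightarrow> lookup (transform \<sigma> p) n = 0"
  by (induction p rule: dpoly_induct) (auto simp: lookup_add transform_add lookup_single when_def)

lemma keys_transform: "keys (transform \<sigma> p) = shift_exponent ` keys p"
proof (intro equalityI subsetI)
  fix n assume n: "n \<in> keys (transform \<sigma> p)"
  then obtain m where "n = shift_exponent m"
    using lookup_transform_outside[of n p] by (auto simp: in_keys_iff)
  with n show "n \<in> shift_exponent ` keys p"
    by (auto simp: in_keys_iff lookup_transform)
qed (auto simp: in_keys_iff lookup_transform)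

lemma keys_transform_funpow:
  "keys ((transform \<sigma> ^^ k) p) = (shift_exponent ^^ k) ` keys p"
  by (induction k) (auto simp: keys_transform image_image)

end

section \<open>Ideals, prime ideals and perfect ideals\<close>

lemma is_ideal_add: "is_ideal I \<Longrightarrow> p \<in> I \<Longrightarrow> q \<in> I \<Longrightarrow> p + q \<in> I"
  and is_ideal_mult: "is_ideal I \<Longrightarrow> p \<in> I \<Longrightarrow> r * p \<in> I"
  and is_ideal_zero: "is_ideal I \<Longrightarrow> 0 \<in> I"
  by (auto simp: is_ideal_def)

lemma is_ideal_mult_right: "is_ideal I \<Longrightarrow> p \<in> I \<Longrightarrow> p * r \<in> I"
  using is_ideal_mult[of I p r] by (simp add: mult.commute)

lemma is_ideal_uminus: "is_ideal I \<Longrightarrow> p \<in> I \<Longrightarrow> - p \<in> I"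
  using is_ideal_mult[of I p "-1"] by simp

lemma is_ideal_diff: "is_ideal I \<Longrightarrow> p \<in> I \<Longrightarrow> q \<in> I \<Longrightarrow> p - q \<in> I"
  using is_ideal_add[of I p "- q"] is_ideal_uminus[of I q] by simp

lemma is_ideal_sum: "is_ideal I \<Longrightarrow> (\<And>x. x \<in> X \<Longrightarrow> f x \<in> I) \<Longrightarrow> sum f X \<in> I"
  by (induction X rule: infinite_finite_induct) (auto intro: is_ideal_add is_ideal_zero)

lemma is_ideal_add_iff: "is_ideal I \<Longrightarrow> q \<in> I \<Longrightarrow> p + q \<in> I \<longleftrightarrow> p \<in> I"
  by (metis add_diff_cancel_right' is_ideal_add is_ideal_diff)

lemma is_ideal_one: "is_ideal I \<Longrightarrow> 1 \<in> I \<Longrightarrow> I = UNIV"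
  using is_ideal_mult[of I 1] by auto

lemma is_ideal_generated: "is_ideal (ideal_generated S)"
  unfolding is_ideal_def ideal_generated_def by blast

lemma ideal_generated_incl: "S \<subseteq> ideal_generated S"
  by (auto simp: ideal_generated_def)

lemma ideal_generated_least: "is_ideal I \<Longrightarrow> S \<subseteq> I \<Longrightarrow> ideal_generated S \<subseteq> I"
  by (auto simp: ideal_generated_def)

lemma sigma_ideal_is_ideal: "sigma_ideal \<sigma> I \<Longrightarrow> is_ideal I"
  by (simp add: sigma_ideal_def)

lemma sigma_ideal_transform_funpow:
  "sigma_ideal \<sigma> I \<Longrightarrow> p \<in> I \<Longrightarrow> (transform \<sigma> ^^ k) p \<in> I"
  by (induction k) (auto simp: sigma_ideal_def)

lemma sigma_ideal_sigma_ideal_generated: "sigma_ideal \<sigma> (sigma_ideal_generated \<sigma> S)"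
  unfolding sigma_ideal_def is_ideal_def sigma_ideal_generated_def by blast

lemma sigma_ideal_generated_incl: "S \<subseteq> sigma_ideal_generated \<sigma> S"
  by (auto simp: sigma_ideal_generated_def)

lemma sigma_ideal_generated_least: "sigma_ideal \<sigma> I \<Longrightarrow> S \<subseteq> I \<Longrightarrow> sigma_ideal_generated \<sigma> S \<subseteq> I"
  by (auto simp: sigma_ideal_generated_def)

lemma is_prime_ideal_prod:
  assumes "is_prime_ideal I" "finite X" "prod f X \<in> I"
  shows "\<exists>x\<in>X. f x \<in> I"
  using assms(2,3)
proof (induction X)
  case empty
  then show ?case using assms(1) is_ideal_one by (auto simp: is_prime_ideal_def)
next
  case (insert x X)
  then show ?case using assms(1) by (auto simp: is_prime_ideal_def)
qed

lemma is_prime_ideal_power: "is_prime_ideal I \<Longrightarrow> p ^ k \<in> I \<Longrightarrow> p \<in> I"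
proof (induction k)
  case 0
  then show ?case using is_ideal_one by (auto simp: is_prime_ideal_def)
qed (auto simp: is_prime_ideal_def)

text \<open>A prime ideal that contains $p^a$ contains one of the transforms that occur in it, and reflexivity leads back
  to $p$.\<close>

lemma reflexive_prime_is_perfect:
  assumes "reflexive_sigma_ideal \<sigma> Q" "is_prime_ideal Q"
  shows "perfect_sigma_ideal \<sigma> Q"
  unfolding perfect_sigma_ideal_def
proof (intro conjI allI impI)
  show "sigma_ideal \<sigma> Q" using assms(1) by (simp add: reflexive_sigma_ideal_def)
  fix p a assume "spower \<sigma> p a \<in> Q"
  then obtain i where "(transform \<sigma> ^^ i) p ^ coeff a i \<in> Q"
    unfolding spower_def using is_prime_ideal_prod[OF assms(2)] by blast
  then have i: "(transform \<sigma> ^^ i) p \<in> Q"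
    using assms(2) is_prime_ideal_power by blast
  then show "p \<in> Q"
  proof (induction i)
    case (Suc i)
    then show ?case using assms(1) by (simp add: reflexive_sigma_ideal_def)
  qed simp
qed

context difference begin

lemma spower_mult: "spower \<sigma> (p * q) a = spower \<sigma> p a * spower \<sigma> q a"
  by (simp add: spower_def transform_funpow_mult power_mult_distrib prod.distrib)

text \<open>For $p = a\,\sigma(b)$ the power $p^{1+x}$ is a multiple of $\sigma(ab)$.\<close>

lemma perfect_product:
  fixes J :: "('n, 'a) dpoly set"
  assumes J: "perfect_sigma_ideal \<sigma> J" and ab: "a * b \<in> J"
  shows "a * transform \<sigma> b \<in> J"
proof -
  have I: "is_ideal J" "sigma_ideal \<sigma> J" using J by (auto simp: perfect_sigma_ideal_def sigma_ideal_def)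
  have "transform \<sigma> (a * b) \<in> J" using I(2) ab by (auto simp: sigma_ideal_def)
  then have "(a * transform \<sigma> (transform \<sigma> b)) * transform \<sigma> (a * b) \<in> J"
    by (rule is_ideal_mult[OF I(1)])
  also have "(a * transform \<sigma> (transform \<sigma> b)) * transform \<sigma> (a * b) =
      spower \<sigma> (a * transform \<sigma> b) [:1, 1:]"
    by (simp add: spower_def transform_mult algebra_simps)
  finally have "spower \<sigma> (a * transform \<sigma> b) [:1, 1:] \<in> J" .
  moreover have "[:1, 1:] \<noteq> (0 :: nat poly)" by simp
  ultimately show ?thesis using J unfolding perfect_sigma_ideal_def by blast
qed

lemma perfect_product_funpow:
  "perfect_sigma_ideal \<sigma> J \<Longrightarrow> a * b \<in> J \<Longrightarrow> a * (transform \<sigma> ^^ k) b \<in> J"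
  by (induction k) (auto intro: perfect_product)

text \<open>If $q^a b \in J$, then $b$ may be replaced by a transform, so that $(qb)^a$ lies in $J$.\<close>

lemma perfect_quotient:
  fixes J :: "('n, 'a) dpoly set"
  assumes J: "perfect_sigma_ideal \<sigma> J"
  shows "perfect_sigma_ideal \<sigma> {q. q * b \<in> J}"
proof -
  have I: "is_ideal J" "sigma_ideal \<sigma> J" using J by (auto simp: perfect_sigma_ideal_def sigma_ideal_def)
  have "sigma_ideal \<sigma> {q. q * b \<in> J}"
    unfolding sigma_ideal_def is_ideal_def
    using I(1) perfect_product[OF J, of b]
    by (auto simp: distrib_right mult.assoc mult.commute[of b] intro: is_ideal_add is_ideal_mult is_ideal_zero)
  moreover have "q * b \<in> J" if a: "a \<noteq> 0" and q: "spower \<sigma> q a * b \<in> J" for q a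
  proof -
    have "coeff a (degree a) \<noteq> 0" using a by simp
    then obtain e where e: "coeff a (degree a) = Suc e" by (cases "coeff a (degree a)") auto
    have "spower \<sigma> b a = (\<Prod>i<degree a. ((transform \<sigma> ^^ i) b) ^ coeff a i) * ((transform \<sigma> ^^ degree a) b) ^ Suc e"
      by (simp add: spower_def e flip: lessThan_Suc_atMost)
    then obtain r where r: "spower \<sigma> b a = r * (transform \<sigma> ^^ degree a) b"
      by (simp only: power_Suc2 mult.assoc[symmetric])
    have "spower \<sigma> q a * (transform \<sigma> ^^ degree a) b \<in> J"
      by (rule perfect_product_funpow[OF J q])
    then have "r * (spower \<sigma> q a * (transform \<sigma> ^^ degree a) b) \<in> J"
      by (rule is_ideal_mult[OF I(1)])
    then have "spower \<sigma> (q * b) a \<in> J" by (simp add: spower_mult r algebra_simps)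
    then show ?thesis using J a unfolding perfect_sigma_ideal_def by blast
  qed
  ultimately show ?thesis unfolding perfect_sigma_ideal_def by blast
qed

lemma perfect_ideal_generated_least:
  "perfect_sigma_ideal \<sigma> I \<Longrightarrow> S \<subseteq> I \<Longrightarrow> perfect_ideal_generated \<sigma> S \<subseteq> I"
  by (auto simp: perfect_ideal_generated_def)

lemma perfect_perfect_ideal_generated: "perfect_sigma_ideal \<sigma> (perfect_ideal_generated \<sigma> S)"
  unfolding perfect_sigma_ideal_def sigma_ideal_def is_ideal_def perfect_ideal_generated_def
  by blast

lemma perfect_ideal_generated_incl: "S \<subseteq> perfect_ideal_generated \<sigma> S"
  by (auto simp: perfect_ideal_generated_def)

text \<open>Adjoining a factor at a time: first $pb$ and then $p^2$ lie in $J$.\<close>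

lemma perfect_splitting:
  fixes J :: "('n, 'a) dpoly set"
  assumes J: "perfect_sigma_ideal \<sigma> J" and ab: "a * b \<in> J"
    and pa: "p \<in> perfect_ideal_generated \<sigma> (insert a J)"
    and pb: "p \<in> perfect_ideal_generated \<sigma> (insert b J)"
  shows "p \<in> J"
proof -
  have I: "is_ideal J" using J by (auto simp: perfect_sigma_ideal_def sigma_ideal_def)
  have "insert a J \<subseteq> {q. q * b \<in> J}" using ab is_ideal_mult_right[OF I] by auto
  then have "p * b \<in> J"
    using perfect_ideal_generated_least[OF perfect_quotient[OF J]] pa by blast
  then have "insert b J \<subseteq> {q. q * p \<in> J}"
    using is_ideal_mult_right[OF I] by (auto simp: mult.commute)
  then have "p * p \<in> J"
    using perfect_ideal_generated_least[OF perfect_quotient[OF J]] pb by blast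
  then have "spower \<sigma> p [:2:] \<in> J" by (simp add: spower_def power2_eq_square)
  moreover have "[:2:] \<noteq> (0 :: nat poly)" by simp
  ultimately show ?thesis using J unfolding perfect_sigma_ideal_def by blast
qed

lemma perfect_reflexive:
  assumes "perfect_sigma_ideal \<sigma> J"
  shows "reflexive_sigma_ideal \<sigma> J"
  unfolding reflexive_sigma_ideal_def
proof (intro conjI allI impI)
  show "sigma_ideal \<sigma> J" using assms by (simp add: perfect_sigma_ideal_def)
  fix p assume "transform \<sigma> p \<in> J"
  then have "spower \<sigma> p [:0, 1:] \<in> J" by (simp add: spower_def)
  moreover have "[:0, 1:] \<noteq> (0 :: nat poly)" by simp
  ultimately show "p \<in> J" using assms unfolding perfect_sigma_ideal_def by blast
qed

text \<open>An ideal that is maximal among the perfect difference ideals that avoid \<open>p\<close> is prime by \<open>perfect_splitting\<close>.\<close>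

lemma reflexive_prime_avoiding:
  fixes J :: "('n, 'a) dpoly set"
  assumes J: "perfect_sigma_ideal \<sigma> J" and p: "p \<notin> J"
  obtains Q where "J \<subseteq> Q" "p \<notin> Q" "reflexive_sigma_ideal \<sigma> Q" "is_prime_ideal Q"
proof -
  define \<A> where "\<A> = {I. perfect_sigma_ideal \<sigma> I \<and> J \<subseteq> I \<and> p \<notin> I}"
  have "J \<in> \<A>" using J p by (simp add: \<A>_def)
  have "\<exists>M\<in>\<A>. \<forall>X\<in>\<A>. M \<subseteq> X \<longrightarrow> X = M"
  proof (rule subset_Zorn_nonempty)
    show "\<A> \<noteq> {}" using \<open>J \<in> \<A>\<close> by auto
    fix C assume C: "C \<noteq> {}" "subset.chain \<A> C"
    have mem: "perfect_sigma_ideal \<sigma> I" "J \<subseteq> I" "p \<notin> I" if "I \<in> C" for I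
      using that C(2) by (auto simp: subset.chain_def \<A>_def)
    have si: "sigma_ideal \<sigma> I" "is_ideal I" if "I \<in> C" for I
      using mem(1)[OF that] by (auto simp: perfect_sigma_ideal_def sigma_ideal_def)
    have "p + q \<in> \<Union>C" if "p \<in> \<Union>C" "q \<in> \<Union>C" for p q
    proof -
      obtain I I' where I: "I \<in> C" "p \<in> I" "I' \<in> C" "q \<in> I'" using \<open>p \<in> \<Union>C\<close> \<open>q \<in> \<Union>C\<close> by auto
      then have "I \<subseteq> I' \<or> I' \<subseteq> I" using C(2) by (auto simp: subset.chain_def)
      then show ?thesis using I si(2) is_ideal_add by blast
    qed
    moreover have "r * q \<in> \<Union>C" if "q \<in> \<Union>C" for r q
      using that si(2) is_ideal_mult by blast
    moreover have "0 \<in> \<Union>C" using C(1) si(2) is_ideal_zero by blast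
    ultimately have "is_ideal (\<Union>C)"
      unfolding is_ideal_def by (intro conjI ballI allI)
    moreover have "transform \<sigma> q \<in> \<Union>C" if "q \<in> \<Union>C" for q
      using that si(1) by (auto simp: sigma_ideal_def)
    moreover have "q \<in> \<Union>C" if a: "a \<noteq> 0" and q: "spower \<sigma> q a \<in> \<Union>C" for q a
    proof -
      obtain I where "I \<in> C" "spower \<sigma> q a \<in> I" using q by auto
      then show ?thesis using mem(1)[of I] a unfolding perfect_sigma_ideal_def by blast
    qed
    ultimately have "perfect_sigma_ideal \<sigma> (\<Union>C)"
      by (simp add: perfect_sigma_ideal_def sigma_ideal_def)
    moreover have "J \<subseteq> \<Union>C" "p \<notin> \<Union>C" using C(1) mem by blast+
    ultimately show "\<Union>C \<in> \<A>" by (simp add: \<A>_def)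
  qed
  then obtain M where M1: "M \<in> \<A>" and "\<forall>X\<in>\<A>. M \<subseteq> X \<longrightarrow> X = M" by (elim bexE)
  then have M2: "X = M" if "X \<in> \<A>" "M \<subseteq> X" for X using that by simp
  have perfM: "perfect_sigma_ideal \<sigma> M" and JM: "J \<subseteq> M" and pM: "p \<notin> M"
    using M1 by (simp_all add: \<A>_def)
  have gen: "p \<in> perfect_ideal_generated \<sigma> (insert a M)" if "a \<notin> M" for a
  proof (rule ccontr)
    assume "p \<notin> perfect_ideal_generated \<sigma> (insert a M)"
    then have "perfect_ideal_generated \<sigma> (insert a M) \<in> \<A>"
      using JM perfect_ideal_generated_incl[of "insert a M"]
      by (auto simp: \<A>_def perfect_perfect_ideal_generated)
    from M2[OF this] have "perfect_ideal_generated \<sigma> (insert a M) = M"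
      using perfect_ideal_generated_incl[of "insert a M"] by blast
    then show False using that perfect_ideal_generated_incl[of "insert a M"] by blast
  qed
  have "is_prime_ideal M"
    unfolding is_prime_ideal_def
  proof (intro conjI allI impI)
    show "is_ideal M" using perfM by (auto simp: perfect_sigma_ideal_def sigma_ideal_def)
    show "M \<noteq> UNIV" using pM by auto
    show "a \<in> M \<or> b \<in> M" if "a * b \<in> M" for a b
      using perfect_splitting[OF perfM that] gen pM by blast
  qed
  with JM pM perfect_reflexive[OF perfM] show ?thesis by (intro that)
qed

theorem perfect_ideal_is_Inter_of_primes:
  fixes \<P> :: "('n, 'a) dpoly set set"
  assumes "\<And>P. P \<in> \<P> \<Longrightarrow> reflexive_sigma_ideal \<sigma> P \<and> is_prime_ideal P \<and> F \<subseteq> P"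
    and "\<And>Q. reflexive_sigma_ideal \<sigma> Q \<Longrightarrow> is_prime_ideal Q \<Longrightarrow> F \<subseteq> Q \<Longrightarrow> \<exists>P\<in>\<P>. P \<subseteq> Q"
  shows "perfect_ideal_generated \<sigma> F = \<Inter>\<P>"
proof
  show "perfect_ideal_generated \<sigma> F \<subseteq> \<Inter>\<P>"
  proof (rule Inter_greatest)
    fix P assume "P \<in> \<P>"
    from assms(1)[OF this] show "perfect_ideal_generated \<sigma> F \<subseteq> P"
      by (intro perfect_ideal_generated_least reflexive_prime_is_perfect) simp_all
  qed
  show "\<Inter>\<P> \<subseteq> perfect_ideal_generated \<sigma> F"
  proof (rule subsetI, rule ccontr)
    fix p assume p: "p \<in> \<Inter>\<P>" "p \<notin> perfect_ideal_generated \<sigma> F"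
    obtain Q where Q: "perfect_ideal_generated \<sigma> F \<subseteq> Q" "p \<notin> Q"
        "reflexive_sigma_ideal \<sigma> Q" "is_prime_ideal Q"
      using reflexive_prime_avoiding[OF perfect_perfect_ideal_generated p(2)] .
    have "F \<subseteq> Q" using Q(1) perfect_ideal_generated_incl[of F] by (rule order_trans[rotated])
    from assms(2)[OF Q(3,4) this] show False using Q(2) p(1) by auto
  qed
qed

end

section \<open>Prime ideals of partial characters\<close>

lemma relabel_uminus: "relabel f (- u) = - relabel f (u :: 'v \<Rightarrow>\<^sub>0 'b::ab_group_add)"
  by (metis add.inverse_unique relabel_add relabel_zero add.right_inverse)

lemma relabel_diff: "relabel f (u - w) = relabel f u - relabel f (w :: 'v \<Rightarrow>\<^sub>0 'b::ab_group_add)"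
  using relabel_add[of f u "- w"] by (simp add: relabel_uminus)

lemma frag_cmul_uminus: "frag_cmul k (- g) = frag_cmul (- k) g"
  by (rule poly_mapping_eqI) simp

text \<open>A torsion-free abelian group can be linearly ordered. The order on the quotient by \<open>L\<close> is given by the set
  \<open>C\<close> of the vectors whose class is nonnegative; it is a maximal one among the submonoids that contain no
  vector together with its negative outside \<open>L\<close>.\<close>

lemma cone_exists:
  fixes L :: "('v \<Rightarrow>\<^sub>0 int) set"
  assumes L: "0 \<in> L" "\<And>u w. u \<in> L \<Longrightarrow> w \<in> L \<Longrightarrow> u + w \<in> L"
    and tf: "\<And>k u. k \<noteq> 0 \<Longrightarrow> frag_cmul k u \<in> L \<Longrightarrow> u \<in> L"
  obtains C where "L \<subseteq> C" "\<And>u w. u \<in> C \<Longrightarrow> w \<in> C \<Longrightarrow> u + w \<in> C"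
    "\<And>u. u \<in> C \<or> - u \<in> C" "\<And>u. u \<in> C \<Longrightarrow> - u \<in> C \<Longrightarrow> u \<in> L"
proof -
  define \<A> where "\<A> = {C. L \<subseteq> C \<and> (\<forall>u\<in>C. \<forall>w\<in>C. u + w \<in> C) \<and> (\<forall>u\<in>C. - u \<in> C \<longrightarrow> u \<in> L)}"
  have "\<exists>M\<in>\<A>. \<forall>X\<in>\<A>. M \<subseteq> X \<longrightarrow> X = M"
  proof (rule subset_Zorn_nonempty)
    have "L \<in> \<A>" using L by (simp add: \<A>_def)
    then show "\<A> \<noteq> {}" by auto
    fix C assume C: "C \<noteq> {}" "subset.chain \<A> C"
    have mem: "L \<subseteq> I" "\<forall>u\<in>I. \<forall>w\<in>I. u + w \<in> I" "\<forall>u\<in>I. - u \<in> I \<longrightarrow> u \<in> L" if "I \<in> C" for I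
      using that C(2) by (auto simp: subset.chain_def \<A>_def)
    have common: "\<exists>I\<in>C. u \<in> I \<and> w \<in> I" if uw: "u \<in> \<Union>C" "w \<in> \<Union>C" for u w
    proof -
      obtain I where I: "I \<in> C" "u \<in> I" using uw(1) by auto
      obtain I' where I': "I' \<in> C" "w \<in> I'" using uw(2) by auto
      have "I \<subseteq> I' \<or> I' \<subseteq> I" using C(2) I(1) I'(1) by (auto simp: subset.chain_def)
      then show ?thesis using I I' by auto
    qed
    have "L \<subseteq> \<Union>C" using C(1) mem(1) by auto
    moreover have "u + w \<in> \<Union>C" if uw: "u \<in> \<Union>C" "w \<in> \<Union>C" for u w
      using common[OF uw] mem(2) by auto
    moreover have "u \<in> L" if uw: "u \<in> \<Union>C" "- u \<in> \<Union>C" for u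
      using common[OF uw] mem(3) by auto
    ultimately show "\<Union>C \<in> \<A>" by (simp add: \<A>_def del: Union_iff)
  qed
  then obtain C where "C \<in> \<A>" and max: "\<forall>X\<in>\<A>. C \<subseteq> X \<longrightarrow> X = C" by (elim bexE)
  then have LC: "L \<subseteq> C" and add: "u \<in> C \<Longrightarrow> w \<in> C \<Longrightarrow> u + w \<in> C"
    and anti: "u \<in> C \<Longrightarrow> - u \<in> C \<Longrightarrow> u \<in> L" for u w
    by (simp_all add: \<A>_def)
  have "0 \<in> C" using LC L(1) by auto
  have mult: "frag_cmul (int k) u \<in> C" if "u \<in> C" for k u
    using that by (induction k) (auto simp: frag_cmul_distrib add \<open>0 \<in> C\<close>)
  \<comment> \<open>Adjoining $g$ violates antisymmetry, so some multiple of $-g$ is already present.\<close>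
  have neg: "\<exists>k>0. frag_cmul (int k) (- g) \<in> C" if g: "g \<notin> C" for g
  proof -
    define C' where "C' = {c + frag_cmul (int n) g |c n. c \<in> C}"
    have sub: "C \<subseteq> C'" unfolding C'_def by (force intro: exI[of _ 0])
    have "g \<in> C'" unfolding C'_def using \<open>0 \<in> C\<close> by (force intro: exI[of _ 1])
    then have "C' \<notin> \<A>" using sub max g by blast
    moreover have "L \<subseteq> C'" using sub LC by simp
    moreover have "a + b \<in> C'" if ab: "a \<in> C'" "b \<in> C'" for a b
    proof -
      obtain c n where a: "a = c + frag_cmul (int n) g" "c \<in> C" using ab(1) by (auto simp: C'_def)
      obtain d m where b: "b = d + frag_cmul (int m) g" "d \<in> C" using ab(2) by (auto simp: C'_def)
      have "a + b = (c + d) + frag_cmul (int (n + m)) g"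
        by (simp add: a b frag_cmul_distrib)
      then show ?thesis using add[OF a(2) b(2)] unfolding C'_def by blast
    qed
    ultimately obtain a where a: "a \<in> C'" "- a \<in> C'" "a \<notin> L" by (auto simp: \<A>_def)
    obtain c n where c: "a = c + frag_cmul (int n) g" "c \<in> C" using a(1) by (auto simp: C'_def)
    obtain d m where d: "- a = d + frag_cmul (int m) g" "d \<in> C" using a(2) by (auto simp: C'_def)
    have "n + m \<noteq> 0" using c d a(3) anti[of c] by (cases n; cases m) auto
    moreover have "frag_cmul (int (n + m)) (- g) = c + d"
    proof -
      have "c = a - frag_cmul (int n) g" "d = - a - frag_cmul (int m) g" using c(1) d(1) by simp_all
      then have "c + d = - frag_cmul (int n) g - frag_cmul (int m) g" by simp
      moreover have "frag_cmul (- int n - int m) g = frag_cmul (- int n) g - frag_cmul (int m) g"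
        by (rule poly_mapping_eqI) (simp add: lookup_minus algebra_simps)
      ultimately show ?thesis by (simp add: frag_cmul_distrib frag_cmul_uminus)
    qed
    ultimately show ?thesis using add[OF c(2) d(2)] by (intro exI[of _ "n + m"]) auto
  qed
  have "u \<in> C \<or> - u \<in> C" for u
  proof (rule ccontr)
    assume u: "\<not> (u \<in> C \<or> - u \<in> C)"
    obtain k where k: "k > 0" "frag_cmul (int k) (- u) \<in> C" using neg[of u] u by auto
    obtain l where l: "l > 0" "frag_cmul (int l) u \<in> C" using neg[of "- u"] u by auto
    have "frag_cmul (int l) (frag_cmul (int k) (- u)) \<in> C" "frag_cmul (int k) (frag_cmul (int l) u) \<in> C"
      using mult k(2) l(2) by blast+
    then have "frag_cmul (int (k * l)) u \<in> L"
      by (intro anti) (simp_all add: mult.commute frag_cmul_uminus)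
    then have "u \<in> L" by (rule tf[rotated]) (use k(1) l(1) in simp)
    then show False using LC u by auto
  qed
  with LC add anti show ?thesis by (intro that)
qed

text \<open>The position of a variable in the ranking is recorded by natural numbers, so that lattices of
  exponent vectors do not depend on the index type.\<close>

definition position :: "'n::{finite,linorder} \<Rightarrow> nat" where
  "position i = card {j. j < i}"

lemma position_less:
  fixes i j :: "'n::{finite,linorder}"
  shows "position i < position j \<longleftrightarrow> i < j"
proof -
  have "position i < position j" if "i < j" for i j :: 'n
    unfolding position_def using that by (intro psubset_card_mono) auto
  then show ?thesis by (metis not_less_iff_gr_or_eq)
qed

lemma position_eq [simp]: "position i = position j \<longleftrightarrow> i = j"
  by (metis position_less less_irrefl neqE)

lemma position_bound: "position (i :: 'n::{finite,linorder}) < card (UNIV :: 'n set)"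
proof -
  have "{j. j < i} \<subset> UNIV" by (auto simp: psubset_eq)
  then show ?thesis unfolding position_def by (intro psubset_card_mono) auto
qed

lemma position_surj:
  assumes "p < card (UNIV :: 'n::{finite,linorder} set)"
  obtains i :: "'n::{finite,linorder}" where "position i = p"
proof -
  have "inj (position :: 'n \<Rightarrow> nat)" by (auto simp: inj_def)
  then have "card (range (position :: 'n \<Rightarrow> nat)) = card {..<card (UNIV :: 'n set)}"
    by (simp add: card_image)
  moreover have "range (position :: 'n \<Rightarrow> nat) \<subseteq> {..<card (UNIV :: 'n set)}" using position_bound by auto
  ultimately have "range (position :: 'n \<Rightarrow> nat) = {..<card (UNIV :: 'n set)}"
    by (intro card_subset_eq) auto
  with assms that show ?thesis by (metis lessThan_iff rangeE)
qed

definition nvar :: "'n::{finite,linorder} dvar \<Rightarrow> nat \<times> nat" where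
  "nvar v = (position (fst v), snd v)"

lemma inj_nvar: "inj nvar"
  by (auto simp: inj_def nvar_def prod_eq_iff)

lemma nvar_eq [simp]: "nvar v = nvar w \<longleftrightarrow> v = w"
  by (auto simp: nvar_def prod_eq_iff)

lemma nvar_less: "nvar v < nvar w \<longleftrightarrow> v < w"
  by (auto simp: nvar_def less_prod_def' position_less)

lemma nvar_le: "nvar v \<le> nvar w \<longleftrightarrow> v \<le> w"
  by (meson not_le nvar_less)

lemma nvar_shift: "nvar (shift_var v) = shift_var (nvar v)"
  by (simp add: nvar_def shift_var_def)

definition exponent_vector :: "('n::{finite,linorder} dvar \<Rightarrow>\<^sub>0 nat) \<Rightarrow> (nat \<times> nat) \<Rightarrow>\<^sub>0 int" where
  "exponent_vector m = (\<Sum>v\<in>keys m. single (nvar v) (int (lookup m v)))"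

lemma lookup_exponent_vector [simp]:
  "lookup (exponent_vector m) (nvar v) = int (lookup m v)"
proof -
  have "lookup (exponent_vector m) (nvar v) =
      (\<Sum>w\<in>keys m. if w = v then int (lookup m w) else 0)"
    by (auto simp: exponent_vector_def lookup_sum lookup_single when_def intro!: sum.cong)
  then show ?thesis by (simp add: in_keys_iff)
qed

lemma lookup_exponent_vector_outside:
  fixes m :: "'n::{finite,linorder} dvar \<Rightarrow>\<^sub>0 nat"
  assumes "card (UNIV :: 'n set) \<le> fst w"
  shows "lookup (exponent_vector m) w = 0"
proof -
  have "nvar v \<noteq> w" for v :: "'n dvar"
    using assms position_bound[of "fst v"] by (auto simp: nvar_def)
  then show ?thesis
    by (auto simp: exponent_vector_def lookup_sum lookup_single when_def intro!: sum.neutral)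
qed

lemma dvar_cases:
  fixes w :: "nat \<times> nat"
  obtains (inside) v :: "'n::{finite,linorder} dvar" where "w = nvar v" | (outside) "card (UNIV :: 'n::{finite,linorder} set) \<le> fst w"
proof (cases "fst w < card (UNIV :: 'n set)")
  case True
  then obtain i :: 'n where "position i = fst w" by (rule position_surj)
  then have "w = nvar (i, snd w)" by (simp add: nvar_def)
  then show ?thesis by (rule inside)
qed (use outside in simp)

lemma vector_eqI:
  fixes u w :: "(nat \<times> nat) \<Rightarrow>\<^sub>0 int"
  assumes "\<And>v :: 'n::{finite,linorder} dvar. lookup u (nvar v) = lookup w (nvar v)"
    and "\<And>v. card (UNIV :: 'n::{finite,linorder} set) \<le> fst v \<Longrightarrow> lookup u v = lookup w v"
  shows "u = w"
proof (rule poly_mapping_eqI)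
  fix v show "lookup u v = lookup w v"
    using assms by (cases v rule: dvar_cases[where 'n = 'n]) auto
qed

lemma exponent_vector_add: "exponent_vector (a + b) = exponent_vector a + exponent_vector b"
  for a b :: "'n::{finite,linorder} dvar \<Rightarrow>\<^sub>0 nat"
  by (rule vector_eqI[where 'n = 'n]) (simp_all add: lookup_add lookup_exponent_vector_outside)

lemma exponent_vector_zero [simp]: "exponent_vector 0 = 0"
  by (simp add: exponent_vector_def)

lemma exponent_vector_eq [simp]: "exponent_vector a = exponent_vector b \<longleftrightarrow> a = b"
proof
  assume "exponent_vector a = exponent_vector b"
  then have "int (lookup a v) = int (lookup b v)" for v
    by (metis lookup_exponent_vector)
  then show "a = b" by (intro poly_mapping_eqI) simp
qed simp

lemma exponent_vector_shift:
  fixes m :: "'n::{finite,linorder} dvar \<Rightarrow>\<^sub>0 nat"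
  shows "exponent_vector (shift_exponent m) = relabel shift_var (exponent_vector m)"
proof -
  have add: "(\<Sum>v\<in>K. exponent_vector (f v)) = exponent_vector (\<Sum>v\<in>K. f v)"
    for K :: "'n dvar set" and f :: "'n dvar \<Rightarrow> 'n dvar \<Rightarrow>\<^sub>0 nat"
    by (induction K rule: infinite_finite_induct) (auto simp: exponent_vector_add)
  have single: "exponent_vector (single v c) = single (nvar v) (int c)"
    for v :: "'n dvar" and c
    by (cases "c = 0") (simp_all add: exponent_vector_def)
  have "relabel shift_var (\<Sum>v\<in>K. f v) = (\<Sum>v\<in>K. relabel shift_var (f v))"
    for K :: "'n dvar set" and f :: "'n dvar \<Rightarrow> (nat \<times> nat) \<Rightarrow>\<^sub>0 int"
    by (induction K rule: infinite_finite_induct) (auto simp: relabel_add)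
  then show ?thesis
    by (simp add: shift_exponent_relabel relabel_def[of shift_var m] exponent_vector_def[of m]
        single nvar_shift flip: add)
qed

definition avoids :: "'n set \<Rightarrow> ('n dvar \<Rightarrow>\<^sub>0 nat) \<Rightarrow> bool" where
  "avoids S m \<longleftrightarrow> (\<forall>v\<in>keys m. fst v \<notin> S)"

lemma avoids_add: "avoids S (m + k) \<longleftrightarrow> avoids S m \<and> avoids S k"
proof -
  have "keys (m + k) = keys m \<union> keys k"
    by (rule set_eqI) (simp add: in_keys_iff lookup_add)
  then show ?thesis by (auto simp: avoids_def)
qed

lemma avoids_zero [simp]: "avoids S 0"
  by (simp add: avoids_def)

lemma avoids_shift [simp]: "avoids S (shift_exponent m) \<longleftrightarrow> avoids S m"
  by (auto simp: avoids_def shift_exponent_relabel keys_relabel inj_shift_var shift_var_def)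

text \<open>A set \<open>S\<close> of indeterminates that are to vanish, a subgroup \<open>L\<close> of exponent vectors that is
  saturated with respect to integers and to $x$, and an equivariant character \<open>\<rho>\<close> on it.\<close>

locale torus = difference \<sigma>
  for \<sigma> :: "'a::field \<Rightarrow> 'a" +
  fixes S :: "'n::{finite,linorder} set"
    and L :: "((nat \<times> nat) \<Rightarrow>\<^sub>0 int) set"
    and \<rho> :: "((nat \<times> nat) \<Rightarrow>\<^sub>0 int) \<Rightarrow> 'a"
  assumes L_zero: "0 \<in> L"
    and L_add: "\<And>u w. u \<in> L \<Longrightarrow> w \<in> L \<Longrightarrow> u + w \<in> L"
    and L_uminus: "\<And>u. u \<in> L \<Longrightarrow> - u \<in> L"
    and L_saturated: "\<And>k u. k \<noteq> 0 \<Longrightarrow> frag_cmul k u \<in> L \<Longrightarrow> u \<in> L"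
    and L_shift: "\<And>u. relabel shift_var u \<in> L \<longleftrightarrow> u \<in> L"
    and rho_add: "\<And>u w. u \<in> L \<Longrightarrow> w \<in> L \<Longrightarrow> \<rho> (u + w) = \<rho> u * \<rho> w"
    and rho_nonzero: "\<And>u. u \<in> L \<Longrightarrow> \<rho> u \<noteq> 0"
    and rho_shift: "\<And>u. u \<in> L \<Longrightarrow> \<rho> (relabel shift_var u) = \<sigma> (\<rho> u)"
begin

definition equiv_mod :: "('n dvar \<Rightarrow>\<^sub>0 nat) \<Rightarrow> ('n dvar \<Rightarrow>\<^sub>0 nat) \<Rightarrow> bool" where
  "equiv_mod m m' \<longleftrightarrow> exponent_vector m - exponent_vector m' \<in> L"

text \<open>The coefficient of the class of \<open>u\<close> in the image of \<open>p\<close> in the group algebra of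
  $\mathbb{Z}^{(\infty)}/L$ twisted by \<open>\<rho>\<close>.\<close>

definition weight :: "('n, 'a) dpoly \<Rightarrow> ((nat \<times> nat) \<Rightarrow>\<^sub>0 int) \<Rightarrow> 'a" where
  "weight p u = (\<Sum>m\<in>keys p.
     if avoids S m \<and> exponent_vector m - u \<in> L
     then lookup p m * \<rho> (exponent_vector m - u) else 0)"

definition torus_ideal :: "('n, 'a) dpoly set" where
  "torus_ideal = {p. \<forall>u. weight p u = 0}"

lemma L_diff: "u \<in> L \<Longrightarrow> w \<in> L \<Longrightarrow> u - w \<in> L"
  using L_add[of u "- w"] L_uminus[of w] by simp

lemma rho_zero [simp]: "\<rho> 0 = 1"
  using rho_add[OF L_zero L_zero] rho_nonzero[OF L_zero] by simp

lemma rho_uminus: "u \<in> L \<Longrightarrow> \<rho> (- u) = inverse (\<rho> u)"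
  using rho_add[of u "- u"] L_uminus[of u] by (simp add: inverse_unique)

lemma weight_superset:
  assumes "finite K" "keys p \<subseteq> K"
  shows "weight p u = (\<Sum>m\<in>K. if avoids S m \<and> exponent_vector m - u \<in> L
     then lookup p m * \<rho> (exponent_vector m - u) else 0)"
  unfolding weight_def using assms
  by (intro sum.mono_neutral_left) (auto simp: in_keys_iff)

lemma weight_zero [simp]: "weight 0 u = 0"
  by (simp add: weight_def)

lemma weight_single: "weight (single m c) u =
    (if avoids S m \<and> exponent_vector m - u \<in> L then c * \<rho> (exponent_vector m - u) else 0)"
  unfolding weight_def by (cases "c = 0") auto

lemma weight_add: "weight (p + q) u = weight p u + weight q u"
proof -
  let ?K = "keys p \<union> keys q"
  have "keys (p + q) \<subseteq> ?K" by (rule keys_add)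
  then show ?thesis
    by (simp add: weight_superset[of ?K] flip: sum.distrib)
       (intro sum.cong, auto simp: lookup_add distrib_right)
qed

lemma weight_mult_single:
  "weight (single k c * p) u = (if avoids S k then c * weight p (u - exponent_vector k) else 0)"
proof (induction p rule: dpoly_induct)
  case (single m d)
  have eq: "exponent_vector (k + m) - u = exponent_vector m - (u - exponent_vector k)"
    by (simp add: exponent_vector_add algebra_simps)
  show ?case unfolding mult_single weight_single eq by (simp add: avoids_add)
qed (simp_all add: distrib_left weight_add)

lemma weight_class: "l \<in> L \<Longrightarrow> weight p (u + l) = inverse (\<rho> l) * weight p u"
proof (induction p rule: dpoly_induct)
  case (single m c)
  have eq: "exponent_vector m - (u + l) = (exponent_vector m - u) + - l" by simp
  have iff: "exponent_vector m - u + - l \<in> L \<longleftrightarrow> exponent_vector m - u \<in> L"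
    using L_add[OF _ single, of "exponent_vector m - u + - l"]
      L_add[OF _ L_uminus[OF single], of "exponent_vector m - u"] by auto
  show ?case
    unfolding weight_single eq iff
    using rho_add[of "exponent_vector m - u" "- l"] rho_uminus[OF single] L_uminus[OF single]
    by simp
qed (simp_all add: weight_add distrib_left)

lemma weight_transform_shift: "weight (transform \<sigma> p) (relabel shift_var u) = \<sigma> (weight p u)"
proof (induction p rule: dpoly_induct)
  case (single m c)
  show ?case
    unfolding transform_single weight_single exponent_vector_shift relabel_diff[symmetric] L_shift
    by (simp add: rho_shift sigma_mult)
qed (simp_all add: weight_add sigma_add transform_add)

lemma weight_nonzeroE:
  assumes "weight p u \<noteq> 0"
  obtains m where "m \<in> keys p" "avoids S m" "exponent_vector m - u \<in> L"
proof -
  obtain m where "m \<in> keys p"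
      "(if avoids S m \<and> exponent_vector m - u \<in> L
       then lookup p m * \<rho> (exponent_vector m - u) else 0) \<noteq> 0"
    using sum.not_neutral_contains_not_neutral[OF assms[unfolded weight_def]] .
  then show ?thesis using that[of m] by metis
qed

lemma weight_nonzero_key:
  assumes "weight p u \<noteq> 0"
  obtains m where "m \<in> keys p" "avoids S m" "exponent_vector m - u \<in> L"
    "weight p (exponent_vector m) \<noteq> 0"
proof -
  obtain m where m: "m \<in> keys p" "avoids S m" "exponent_vector m - u \<in> L"
    using weight_nonzeroE[OF assms] .
  then show ?thesis
    using that assms weight_class[OF m(3), of p u] rho_nonzero[OF m(3)] by simp
qed

lemma is_ideal_torus_ideal: "is_ideal torus_ideal"
proof -
  have "q * p \<in> torus_ideal" if "p \<in> torus_ideal" for p q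
  proof (induction q rule: dpoly_induct)
    case (single m c)
    show ?case using that by (simp add: torus_ideal_def weight_mult_single)
  qed (use that in \<open>auto simp: torus_ideal_def distrib_right weight_add\<close>)
  then show ?thesis by (auto simp: is_ideal_def torus_ideal_def weight_add)
qed

lemma reflexive_torus_ideal: "reflexive_sigma_ideal \<sigma> torus_ideal"
proof -
  have "transform \<sigma> p \<in> torus_ideal" if p: "p \<in> torus_ideal" for p
  proof -
    have "weight (transform \<sigma> p) u = 0" for u
    proof (rule ccontr)
      assume "weight (transform \<sigma> p) u \<noteq> 0"
      then obtain m where "m \<in> keys (transform \<sigma> p)"
          "weight (transform \<sigma> p) (exponent_vector m) \<noteq> 0"
        using weight_nonzero_key by blast
      then show False
        using p by (auto simp: keys_transform exponent_vector_shift weight_transform_shift torus_ideal_def)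
    qed
    then show ?thesis by (simp add: torus_ideal_def)
  qed
  moreover have "p \<in> torus_ideal" if p: "transform \<sigma> p \<in> torus_ideal" for p
  proof -
    have "\<sigma> (weight p u) = 0" for u
      using p by (simp add: torus_ideal_def flip: weight_transform_shift)
    then show ?thesis by (simp add: torus_ideal_def)
  qed
  ultimately show ?thesis
    using is_ideal_torus_ideal unfolding reflexive_sigma_ideal_def sigma_ideal_def by blast
qed

definition separated :: "('n, 'a) dpoly \<Rightarrow> bool" where
  "separated p \<longleftrightarrow> (\<forall>m\<in>keys p. avoids S m) \<and>
     (\<forall>m\<in>keys p. \<forall>m'\<in>keys p. equiv_mod m m' \<longrightarrow> m = m')"

lemma weight_separated:
  assumes "separated p" "m \<in> keys p"
  shows "weight p (exponent_vector m) = lookup p m"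
proof -
  have "weight p (exponent_vector m) = (\<Sum>k\<in>keys p. if k = m then lookup p k else 0)"
    unfolding weight_def
    using assms L_zero by (intro sum.cong) (auto simp: separated_def equiv_mod_def)
  then show ?thesis using assms by simp
qed

lemma separated_torus_ideal: "separated p \<Longrightarrow> p \<in> torus_ideal \<Longrightarrow> p = 0"
  using weight_separated by (fastforce simp: torus_ideal_def in_keys_iff simp flip: keys_eq_empty)

text \<open>Modulo the binomials of the character every polynomial is congruent to one whose monomials are
  pairwise inequivalent: such a polynomial is a coordinate vector with respect to a basis of the
  residue ring.\<close>

lemma separated_representative:
  assumes "0 \<in> I" "\<And>p q. p \<in> I \<Longrightarrow> q \<in> I \<Longrightarrow> p + q \<in> I"
    and mon: "\<And>m c. \<not> avoids S m \<Longrightarrow> single m c \<in> I"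
    and bin: "\<And>m m' c. avoids S m \<Longrightarrow> avoids S m' \<Longrightarrow> equiv_mod m m' \<Longrightarrow>
      single m c - single m' (c * \<rho> (exponent_vector m - exponent_vector m')) \<in> I"
  shows "\<exists>q. p - q \<in> I \<and> separated q"
proof (induction "card (keys p)" arbitrary: p rule: less_induct)
  case less
  have step: ?case if m: "m \<in> keys p" and r: "r \<in> I"
    and keys: "keys (p - r) \<subseteq> keys p - {m}" for m r
  proof -
    have "card (keys (p - r)) \<le> card (keys p - {m})"
      by (rule card_mono) (use keys in auto)
    also have "\<dots> < card (keys p)" using m by (intro psubset_card_mono) auto
    finally obtain q where q: "p - r - q \<in> I" "separated q" using less by blast
    have "(p - r - q) + r \<in> I" using assms(2) q(1) r by blast
    then show ?thesis using q(2) by (intro exI[of _ q]) (simp add: algebra_simps)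
  qed
  show ?case
  proof (cases "\<exists>m\<in>keys p. \<not> avoids S m")
    case True
    then obtain m where m: "m \<in> keys p" "\<not> avoids S m" by blast
    show ?thesis
      by (rule step[OF m(1) mon[OF m(2), of "lookup p m"]])
         (auto simp: in_keys_iff lookup_minus lookup_single when_def split: if_splits)
  next
    case torus: False
    show ?thesis
    proof (cases "\<exists>m\<in>keys p. \<exists>m'\<in>keys p. equiv_mod m m' \<and> m \<noteq> m'")
      case True
      then obtain m m' where m: "m \<in> keys p" "m' \<in> keys p" "equiv_mod m m'" "m \<noteq> m'"
        by blast
      have tm: "avoids S m" "avoids S m'" using torus m by auto
      show ?thesis
        by (rule step[OF m(1) bin[OF tm m(3), of "lookup p m"]])
           (use m in \<open>auto simp: in_keys_iff lookup_minus lookup_single when_def split: if_splits\<close>)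
    next
      case False
      then have "separated p" using torus by (auto simp: separated_def)
      then show ?thesis using assms(1) by (intro exI[of _ p]) simp
    qed
  qed
qed

lemma monomial_in_torus_ideal: "\<not> avoids S m \<Longrightarrow> single m c \<in> torus_ideal"
  by (simp add: torus_ideal_def weight_single)

lemma weight_diff: "weight (p - q) u = weight p u - weight q u"
  using weight_add[of "p - q" q u] by simp

lemma binomial_in_torus_ideal:
  assumes "avoids S m" "avoids S m'" "equiv_mod m m'"
  shows "single m c - single m' (c * \<rho> (exponent_vector m - exponent_vector m')) \<in> torus_ideal"
proof -
  let ?d = "exponent_vector m - exponent_vector m'"
  have d: "?d \<in> L" using assms(3) by (simp add: equiv_mod_def)
  have "weight (single m c) u =
      weight (single m' (c * \<rho> ?d)) u" for u
  proof (cases "exponent_vector m' - u \<in> L")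
    case True
    have eq: "exponent_vector m - u = ?d + (exponent_vector m' - u)" by simp
    show ?thesis
      using assms(1,2) True L_add[OF d True] rho_add[OF d True] unfolding weight_single eq by simp
  next
    case False
    then have "exponent_vector m - u \<notin> L" using L_diff[of "exponent_vector m - u" ?d] d by auto
    with False show ?thesis by (simp add: weight_single)
  qed
  then show ?thesis by (simp add: torus_ideal_def weight_diff)
qed

lemma torus_ideal_representative: "\<exists>q. p - q \<in> torus_ideal \<and> separated q"
  using is_ideal_torus_ideal
  by (intro separated_representative monomial_in_torus_ideal binomial_in_torus_ideal)
     (auto intro: is_ideal_zero is_ideal_add)

text \<open>The ideal is generated by the monomials that involve \<open>S\<close> and the binomials of the character, as both have the same
  separated representatives.\<close>

lemma torus_ideal_least:
  assumes I: "is_ideal I"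
    and mon: "\<And>m c. \<not> avoids S m \<Longrightarrow> single m c \<in> I"
    and bin: "\<And>m m'. avoids S m \<Longrightarrow> avoids S m' \<Longrightarrow> equiv_mod m m' \<Longrightarrow>
      single m 1 - single m' (\<rho> (exponent_vector m - exponent_vector m')) \<in> I"
  shows "torus_ideal \<subseteq> I"
proof
  fix p assume p: "p \<in> torus_ideal"
  have bin': "single m c - single m' (c * \<rho> (exponent_vector m - exponent_vector m')) \<in> I"
    if "avoids S m" "avoids S m'" "equiv_mod m m'" for m m' c
    using is_ideal_mult[OF I bin[OF that], of "single 0 c"]
    by (simp add: right_diff_distrib mult_single)
  have "\<exists>q. p - q \<in> torus_ideal \<inter> I \<and> separated q"
    using is_ideal_torus_ideal I
    by (intro separated_representative IntI monomial_in_torus_ideal binomial_in_torus_ideal mon bin')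
       (auto intro: is_ideal_zero is_ideal_add)
  then obtain q where q: "p - q \<in> torus_ideal" "p - q \<in> I" "separated q" by auto
  have "p - (p - q) \<in> torus_ideal" using is_ideal_diff[OF is_ideal_torus_ideal p q(1)] .
  then have "q = 0" using q(3) by (intro separated_torus_ideal) simp_all
  with q(2) show "p \<in> I" by simp
qed

text \<open>Maximality refers to the preorder with nonnegative set \<open>C\<close>.\<close>

lemma exists_maximal_key:
  assumes "finite K" "K \<noteq> {}" "\<And>u w. u \<in> C \<Longrightarrow> w \<in> C \<Longrightarrow> u + w \<in> C" "\<And>u. u \<in> C \<or> - u \<in> C"
  shows "\<exists>m\<in>K. \<forall>k\<in>K. f m - f k \<in> (C :: ('v \<Rightarrow>\<^sub>0 int) set)"
  using assms(1,2)
proof (induction K rule: finite_ne_induct)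
  case (singleton m)
  show ?case using assms(4)[of 0] by simp
next
  case (insert x K)
  then obtain m where m: "m \<in> K" "\<forall>k\<in>K. f m - f k \<in> C" by auto
  have z: "0 \<in> C" using assms(4)[of 0] by simp
  show ?case
  proof (cases "f m - f x \<in> C")
    case True
    then show ?thesis using m by auto
  next
    case False
    then have "f x - f m \<in> C" using assms(4)[of "f m - f x"] by simp
    then have "f x - f k \<in> C" if "k \<in> K" for k
      using assms(3)[of "f x - f m" "f m - f k"] m(2) that by simp
    then show ?thesis using z by auto
  qed
qed

text \<open>The quotient group by \<open>L\<close> is torsion-free, so it carries a linear order; the leading classes of
  two separated polynomials then cannot cancel in their product.\<close>

lemma prime_torus_ideal: "is_prime_ideal torus_ideal"
proof -
  obtain C where C: "L \<subseteq> C" "\<And>u w. u \<in> C \<Longrightarrow> w \<in> C \<Longrightarrow> u + w \<in> C"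
    "\<And>u. u \<in> C \<or> - u \<in> C" "\<And>u. u \<in> C \<Longrightarrow> - u \<in> C \<Longrightarrow> u \<in> L"
    by (rule cone_exists[OF L_zero L_add L_saturated]) blast+
  have sep: "p * q \<notin> torus_ideal" if p: "separated p" "p \<noteq> 0" and q: "separated q" "q \<noteq> 0" for p q
  proof -
    obtain m where m: "m \<in> keys p"
        "\<forall>k\<in>keys p. exponent_vector m - exponent_vector k \<in> C"
      using exists_maximal_key[OF _ _ C(2,3), of "keys p" exponent_vector] p(2) by auto
    obtain n where n: "n \<in> keys q"
        "\<forall>k\<in>keys q. exponent_vector n - exponent_vector k \<in> C"
      using exists_maximal_key[OF _ _ C(2,3), of "keys q" exponent_vector] q(2) by auto
    let ?u = "exponent_vector m + exponent_vector n"
    \<comment> \<open>Only the two largest classes contribute to the class of their sum.\<close>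
    have unique: "k = m" if k: "k \<in> keys p" and w: "weight q (?u - exponent_vector k) \<noteq> 0" for k
    proof -
      obtain l where l: "l \<in> keys q" "exponent_vector l - (?u - exponent_vector k) \<in> L"
        using weight_nonzeroE[OF w] by blast
      have "exponent_vector l - (?u - exponent_vector k) \<in> C" using l(2) C(1) by auto
      from C(2)[OF this bspec[OF n(2) l(1)]] have "- (exponent_vector m - exponent_vector k) \<in> C"
        by (simp add: algebra_simps)
      then have "equiv_mod m k" using m(2) k C(4) by (simp add: equiv_mod_def)
      then show ?thesis using p(1) m(1) k by (auto simp: separated_def)
    qed
    have lin: "weight ((\<Sum>k\<in>K. single k (a k)) * q) ?u =
        (\<Sum>k\<in>K. weight (single k (a k) * q) ?u)" if "finite K" for K a
      using that by (induction K) (auto simp: distrib_right weight_add)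
    have "weight (p * q) ?u = (\<Sum>k\<in>keys p. weight (single k (lookup p k) * q) ?u)"
      by (subst dpoly_expand[of p]) (rule lin, simp)
    also have "\<dots> = (\<Sum>k\<in>keys p. if k = m then lookup p m * weight q (exponent_vector n) else 0)"
      using p(1) unique by (intro sum.cong) (auto simp: weight_mult_single separated_def)
    also have "\<dots> = lookup p m * lookup q n"
      using m(1) by (simp add: weight_separated[OF q(1) n(1)])
    finally have "weight (p * q) ?u = lookup p m * lookup q n" .
    then show ?thesis using m(1) n(1) by (auto simp: torus_ideal_def in_keys_iff intro!: exI[of _ ?u])
  qed
  have "p \<in> torus_ideal \<or> q \<in> torus_ideal" if pq: "p * q \<in> torus_ideal" for p q
  proof (rule ccontr)
    assume not: "\<not> ?thesis"
    obtain p' where p': "p - p' \<in> torus_ideal" "separated p'" using torus_ideal_representative by blast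
    obtain q' where q': "q - q' \<in> torus_ideal" "separated q'" using torus_ideal_representative by blast
    have "p * q - ((p - p') * q + p' * (q - q')) \<in> torus_ideal"
      by (intro is_ideal_diff is_ideal_add is_ideal_mult is_ideal_mult_right is_ideal_torus_ideal pq p' q')
    then have "p' * q' \<in> torus_ideal" by (simp add: algebra_simps)
    then have "p' = 0 \<or> q' = 0" using sep p' q' by blast
    then show False using not p' q' by auto
  qed
  moreover have "1 \<notin> torus_ideal"
    using weight_single[of 0 1 0] L_zero by (auto simp: torus_ideal_def intro!: exI[of _ 0])
  ultimately show ?thesis using is_ideal_torus_ideal by (auto simp: is_prime_ideal_def)
qed

lemma torus_monomial_notin: "avoids S m \<Longrightarrow> c \<noteq> 0 \<Longrightarrow> single m c \<notin> torus_ideal"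
  using weight_single[of m c "exponent_vector m"] L_zero
  by (auto simp: torus_ideal_def intro!: exI[of _ "exponent_vector m"])

end

section \<open>Pseudo-remainders and characteristic sets\<close>

text \<open>Degree bounds as a predicate: it is stable under ring operations without a case distinction for
  the zero polynomial.\<close>

definition deg_le :: "'n dvar \<Rightarrow> nat \<Rightarrow> ('n, 'a::zero) dpoly \<Rightarrow> bool" where
  "deg_le u d p \<longleftrightarrow> (\<forall>m\<in>keys p. lookup m u \<le> d)"

lemma deg_in_le_iff: "deg_in p u \<le> d \<longleftrightarrow> deg_le u d p"
  by (auto simp: deg_in_def deg_le_def)

lemma deg_le_zero [simp]: "deg_le u d 0"
  by (simp add: deg_le_def)

lemma deg_le_mono: "deg_le u d p \<Longrightarrow> d \<le> e \<Longrightarrow> deg_le u e p"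
  by (auto simp: deg_le_def)

lemma deg_le_single: "lookup m u \<le> d \<Longrightarrow> deg_le u d (single m c)"
  by (auto simp: deg_le_def)

lemma deg_le_add:
  fixes p :: "('n, 'a::comm_ring_1) dpoly"
  shows "deg_le u d p \<Longrightarrow> deg_le u d q \<Longrightarrow> deg_le u d (p + q)"
  using keys_add[of p q] by (auto simp: deg_le_def)

lemma deg_le_uminus:
  fixes p :: "('n, 'a::comm_ring_1) dpoly"
  shows "deg_le u d p \<Longrightarrow> deg_le u d (- p)"
  by (auto simp: deg_le_def in_keys_iff)

lemma deg_le_diff:
  fixes p :: "('n, 'a::comm_ring_1) dpoly"
  shows "deg_le u d p \<Longrightarrow> deg_le u d q \<Longrightarrow> deg_le u d (p - q)"
  using deg_le_add[of u d p "- q"] deg_le_uminus[of u d q] by simp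

lemma deg_le_mult:
  fixes p :: "('n, 'a::comm_ring_1) dpoly"
  assumes "deg_le u d p" "deg_le u e q"
  shows "deg_le u (d + e) (p * q)"
  unfolding deg_le_def
proof
  fix m assume "m \<in> keys (p * q)"
  then obtain a b where "m = a + b" "a \<in> keys p" "b \<in> keys q"
    using keys_mult[of p q] by auto
  then show "lookup m u \<le> d + e"
    using assms by (auto simp: deg_le_def lookup_add intro!: add_mono)
qed

lemma deg_le_sum:
  fixes f :: "'b \<Rightarrow> ('n, 'a::comm_ring_1) dpoly"
  shows "(\<And>x. x \<in> X \<Longrightarrow> deg_le u d (f x)) \<Longrightarrow> deg_le u d (sum f X)"
  by (induction X rule: infinite_finite_induct) (auto intro: deg_le_add)

lemma deg_le_0_iff: "deg_le u 0 p \<longleftrightarrow> u \<notin> vars p"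
  by (auto simp: deg_le_def vars_def in_keys_iff)

lemma finite_vars [simp]: "finite (vars p)"
  by (simp add: vars_def)

lemma leader_in_vars: "vars p \<noteq> {} \<Longrightarrow> leader p \<in> vars p"
  by (simp add: leader_def)

lemma vars_le_leader: "v \<in> vars p \<Longrightarrow> v \<le> leader p"
  by (simp add: leader_def)

lemma deg_leader_pos: "vars p \<noteq> {} \<Longrightarrow> deg_in p (leader p) > 0"
  using leader_in_vars[of p] by (metis deg_in_le_iff deg_le_0_iff le_zero_eq neq0_conv)

subsection \<open>Polynomials in one of the variables\<close>

lemma yvar_power: "yvar v ^ k = (single (single v k) 1 :: ('n, 'a::comm_ring_1) dpoly)"
  by (induction k) (simp_all add: yvar_def mult_single single_add[symmetric])

lemma update_zero_split:
  fixes m :: "'v \<Rightarrow>\<^sub>0 nat"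
  shows "update v 0 m + single v (lookup m v) = m"
  by (rule poly_mapping_eqI) (auto simp: lookup_add lookup_update lookup_single when_def)

lemma coeff_in_superset:
  assumes "finite K" "keys p \<subseteq> K"
  shows "coeff_in p v k = (\<Sum>m\<in>K. if lookup m v = k
    then single (update v 0 m) (lookup p m) else 0)"
proof -
  have "coeff_in p v k = (\<Sum>m\<in>keys p. if lookup m v = k
    then single (update v 0 m) (lookup p m) else 0)"
    unfolding coeff_in_def by (rule sum.inter_filter) simp
  also have "\<dots> = (\<Sum>m\<in>K. if lookup m v = k
    then single (update v 0 m) (lookup p m) else 0)"
    using assms by (intro sum.mono_neutral_left) (auto simp: in_keys_iff)
  finally show ?thesis .
qed

lemma coeff_in_zero [simp]: "coeff_in 0 v k = 0"
  by (simp add: coeff_in_def)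

lemma coeff_in_single: "coeff_in (single m c) v k =
    (if lookup m v = k then single (update v 0 m) c else 0)"
  by (simp add: coeff_in_superset[of "{m}"])

lemma coeff_in_add: "coeff_in (p + q) v k = coeff_in p v k + coeff_in q v k"
proof -
  let ?K = "keys p \<union> keys q"
  have "keys (p + q) \<subseteq> ?K" by (rule keys_add)
  then show ?thesis
    by (simp add: coeff_in_superset[of ?K] flip: sum.distrib)
       (intro sum.cong, auto simp: lookup_add single_add)
qed

lemma lookup_coeff_in:
  assumes "lookup m v = 0"
  shows "lookup (coeff_in p v k) m = lookup p (m + single v k)"
proof (induction p rule: dpoly_induct)
  case (single n c)
  show ?case
  proof (cases "n = m + single v k")
    case True
    have "update v 0 (m + single v k) = m"
      by (rule poly_mapping_eqI) (use assms in \<open>auto simp: lookup_add lookup_update lookup_single when_def\<close>)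
    with True assms show ?thesis by (simp add: coeff_in_single lookup_add)
  next
    case False
    then have "\<not> (lookup n v = k \<and> update v 0 n = m)"
      using update_zero_split[of v n] by metis
    with False show ?thesis by (simp add: coeff_in_single lookup_single)
  qed
qed (simp_all add: coeff_in_add lookup_add)

lemma keys_coeff_in:
  assumes "n \<in> keys (coeff_in p v k)"
  obtains m where "m \<in> keys p" "n = update v 0 m"
proof -
  have "n \<in> (\<Union>m\<in>{m \<in> keys p. lookup m v = k}.
      keys (single (update v 0 m) (lookup p m)))"
  proof (rule ccontr)
    assume not: "\<not> ?thesis"
    have "lookup (coeff_in p v k) n = 0"
      unfolding coeff_in_def lookup_sum
      by (rule sum.neutral) (use not in \<open>auto simp: in_keys_iff lookup_single when_def\<close>)
    then show False using assms by (simp add: in_keys_iff)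
  qed
  then show ?thesis using that by (auto split: if_splits)
qed

lemma deg_le_coeff_in: "deg_le u d p \<Longrightarrow> deg_le u d (coeff_in p v k)"
  unfolding deg_le_def by (metis keys_coeff_in lookup_update le0)

lemma deg_le_coeff_in_self: "deg_le v 0 (coeff_in p v k)"
  unfolding deg_le_def by (metis keys_coeff_in lookup_update le_refl)

lemma coeff_in_beyond: "deg_in p v < k \<Longrightarrow> coeff_in p v k = 0"
proof -
  assume "deg_in p v < k"
  then have "{m \<in> keys p. lookup m v = k} = {}"
    using deg_in_le_iff[of p v "deg_in p v"] by (auto simp: deg_le_def)
  then show ?thesis by (simp only: coeff_in_def sum.empty)
qed

lemma coeff_in_degree_nonzero:
  assumes "p \<noteq> 0"
  shows "coeff_in p v (deg_in p v) \<noteq> 0"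
proof -
  let ?D = "(\<lambda>m. lookup m v) ` keys p"
  have ne: "?D \<noteq> {}" using assms by simp
  then have "deg_in p v = Max ?D" by (simp add: deg_in_def)
  then have "deg_in p v \<in> ?D" using ne by simp
  then obtain m where m: "m \<in> keys p" "deg_in p v = lookup m v" by auto
  have "lookup (coeff_in p v (deg_in p v)) (update v 0 m) = lookup p m"
    by (subst lookup_coeff_in) (simp_all add: lookup_update m(2) update_zero_split)
  then show ?thesis using m(1) by (auto simp: in_keys_iff)
qed

lemma coeff_univariate_in: "coeff (univariate_in v p) k = coeff_in p v k"
proof (cases "k \<le> deg_in p v")
  case True
  then show ?thesis by (simp add: univariate_in_def coeff_sum)
next
  case False
  then show ?thesis
    by (simp add: univariate_in_def coeff_sum coeff_in_beyond)
qed

lemma degree_univariate_in: "p \<noteq> 0 \<Longrightarrow> degree (univariate_in v p) = deg_in p v"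
  by (intro antisym degree_le le_degree)
     (auto simp: coeff_univariate_in coeff_in_beyond coeff_in_degree_nonzero)

lemma univariate_in_nonzero: "p \<noteq> 0 \<Longrightarrow> univariate_in v p \<noteq> 0"
  using coeff_in_degree_nonzero[of p v] by (auto simp: coeff_univariate_in poly_eq_iff)

lemma sum_coeff_in:
  fixes p :: "('n, 'a::comm_ring_1) dpoly"
  assumes "deg_in p v \<le> N"
  shows "(\<Sum>k\<le>N. coeff_in p v k * yvar v ^ k) = p"
proof -
  have "(\<Sum>k\<le>N. coeff_in (single m c) v k * yvar v ^ k) = single m c"
    if "lookup m v \<le> N" for m and c :: 'a
  proof -
    have "(\<Sum>k\<le>N. coeff_in (single m c) v k * yvar v ^ k) =
        (\<Sum>k\<le>N. if k = lookup m v then single m c else 0)"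
      by (intro sum.cong) (auto simp: coeff_in_single yvar_power mult_single update_zero_split)
    then show ?thesis using that by simp
  qed
  moreover have "(\<Sum>k\<le>N. coeff_in (\<Sum>m\<in>K. f m) v k * yvar v ^ k) = (\<Sum>m\<in>K. \<Sum>k\<le>N. coeff_in (f m) v k * yvar v ^ k)"
    if "finite K" for K and f :: "('n dvar \<Rightarrow>\<^sub>0 nat) \<Rightarrow> ('n, 'a) dpoly"
    using that by (induction K) (simp_all add: coeff_in_add distrib_right sum.distrib)
  moreover have "lookup m v \<le> N" if "m \<in> keys p" for m
    using assms that by (auto simp: deg_in_le_iff deg_le_def)
  ultimately show ?thesis
    by (subst (1 2) dpoly_expand[of p]) (simp cong: sum.cong)
qed

lemma poly_univariate_in:
  fixes p :: "('n, 'a::comm_ring_1) dpoly"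
  shows "poly (univariate_in v p) (yvar v) = p"
  by (simp add: univariate_in_def poly_sum poly_monom sum_coeff_in)

lemma deg_le_pseudo_divmod_main:
  fixes r :: "('n, 'a::comm_ring_1) dpoly poly"
  assumes "deg_le u 0 lc" "\<And>i. deg_le u 0 (coeff d i)" "\<And>i. deg_le u D (coeff r i)"
  shows "deg_le u D (coeff (snd (pseudo_divmod_main lc q r d dr n)) i)"
  using assms(3)
proof (induction n arbitrary: q r dr)
  case (Suc n)
  have 1: "deg_le u D (lc * coeff r i)" for i
    using deg_le_mult[OF assms(1) Suc.prems[of i]] by simp
  have 2: "deg_le u D (coeff (monom (coeff r dr) n * d) i)" for i
    using deg_le_mult[OF Suc.prems[of dr] assms(2)] by (simp add: coeff_monom_mult)
  have "deg_le u D (coeff (smult lc r - monom (coeff r dr) n * d) i)" for i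
    using deg_le_diff[OF 1 2] by simp
  then show ?case using Suc.IH by (simp add: Let_def)
qed simp

lemma deg_le_pseudo_mod:
  assumes "\<And>i. deg_le u 0 (coeff g i)" "\<And>i. deg_le u D (coeff f i)"
  shows "deg_le u D (coeff (pseudo_mod f g) i)"
proof (cases "g = 0")
  case False
  then show ?thesis
    unfolding pseudo_mod_def pseudo_divmod_def Let_def
    by (simp only: if_False) (rule deg_le_pseudo_divmod_main; rule assms)
qed (simp add: pseudo_mod_def pseudo_divmod_def assms)

lemma deg_le_poly_yvar:
  fixes r :: "('n, 'a::comm_ring_1) dpoly poly"
  assumes "\<And>i. deg_le u D (coeff r i)"
  shows "u \<noteq> v \<Longrightarrow> deg_le u D (poly r (yvar v))" and "u = v \<Longrightarrow> deg_le v (D + degree r) (poly r (yvar v))"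
proof -
  have p: "poly r (yvar v) = (\<Sum>i\<le>degree r. coeff r i * yvar v ^ i)"
    by (rule poly_altdef)
  show "deg_le u D (poly r (yvar v))" if "u \<noteq> v"
  proof -
    have "deg_le u 0 (yvar v ^ i :: ('n, 'a) dpoly)" for i
      unfolding yvar_power by (rule deg_le_single) (use that in \<open>simp add: lookup_single when_def\<close>)
    from deg_le_mult[OF assms this] show ?thesis unfolding p by (intro deg_le_sum) simp
  qed
  show "deg_le v (D + degree r) (poly r (yvar v))" if "u = v"
    unfolding p
  proof (rule deg_le_sum)
    fix i assume i: "i \<in> {..degree r}"
    have "deg_le v i (yvar v ^ i :: ('n, 'a) dpoly)"
      unfolding yvar_power by (rule deg_le_single) simp
    from deg_le_mult[OF assms[unfolded that] this] show "deg_le v (D + degree r) (coeff r i * yvar v ^ i)"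
      by (rule deg_le_mono) (use i in simp)
  qed
qed

lemma
  fixes f g :: "('n::linorder, 'a::idom) dpoly"
  assumes g: "g \<noteq> 0"
  shows alg_prem_identity: "\<exists>e q. coeff_in g v (deg_in g v) ^ e * f - alg_prem v f g = q * g"
    and deg_alg_prem: "deg_in g v > 0 \<Longrightarrow> deg_le v (deg_in g v - 1) (alg_prem v f g)"
    and deg_alg_prem_other: "u \<noteq> v \<Longrightarrow> deg_le u 0 g \<Longrightarrow> deg_le u D f \<Longrightarrow> deg_le u D (alg_prem v f g)"
    and alg_prem_reduced: "deg_in f v < deg_in g v \<Longrightarrow> alg_prem v f g = f"
proof -
  let ?F = "univariate_in v f" and ?G = "univariate_in v g"
  have G: "?G \<noteq> 0" using g by (rule univariate_in_nonzero)
  obtain q where q: "smult (coeff ?G (degree ?G) ^ (Suc (degree ?F) - degree ?G)) ?F = ?G * q + pseudo_mod ?F ?G"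
    using pseudo_divmod(1)[OF G, of ?F] unfolding pseudo_mod_def by (metis prod.collapse)
  show "\<exists>e q. coeff_in g v (deg_in g v) ^ e * f - alg_prem v f g = q * g"
  proof (intro exI)
    show "coeff_in g v (deg_in g v) ^ (Suc (degree ?F) - degree ?G) * f - alg_prem v f g = poly q (yvar v) * g"
      using arg_cong[OF q, of "\<lambda>p. poly p (yvar v)"]
      by (simp add: alg_prem_def degree_univariate_in[OF g] coeff_univariate_in poly_univariate_in mult.commute)
  qed
  have free: "deg_le v 0 (coeff (pseudo_mod ?F ?G) i)" for i
    by (rule deg_le_pseudo_mod) (simp_all add: coeff_univariate_in deg_le_coeff_in_self)
  show "deg_le v (deg_in g v - 1) (alg_prem v f g)" if "deg_in g v > 0"
  proof -
    have "pseudo_mod ?F ?G = 0 \<or> degree (pseudo_mod ?F ?G) < deg_in g v"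
      using pseudo_mod(2)[OF G, of ?F] degree_univariate_in[OF g, of v] by simp
    then have "degree (pseudo_mod ?F ?G) \<le> deg_in g v - 1" using that by auto
    then show ?thesis
      using deg_le_poly_yvar(2)[OF free refl] unfolding alg_prem_def by (auto intro: deg_le_mono)
  qed
  show "deg_le u D (alg_prem v f g)" if "u \<noteq> v" "deg_le u 0 g" "deg_le u D f"
    unfolding alg_prem_def using that
    by (intro deg_le_poly_yvar(1) deg_le_pseudo_mod) (auto simp: coeff_univariate_in intro: deg_le_coeff_in)
  show "alg_prem v f g = f" if "deg_in f v < deg_in g v"
  proof -
    have "degree ?F \<le> deg_in f v"
      by (rule degree_le) (simp add: coeff_univariate_in coeff_in_beyond)
    then have "degree ?F < degree ?G" using that by (simp add: degree_univariate_in[OF g])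
    then have "1 + length (coeffs ?F) - length (coeffs ?G) = 0"
      using G by (cases "?F = 0") (auto simp: length_coeffs_degree)
    then have "pseudo_mod ?F ?G = ?F"
      using G by (simp add: pseudo_mod_def pseudo_divmod_def Let_def del: One_nat_def)
    then show ?thesis by (simp add: alg_prem_def poly_univariate_in)
  qed
qed

context difference begin

lemma vars_transform_funpow:
  fixes p :: "('n, 'a) dpoly"
  shows "vars ((transform \<sigma> ^^ k) p) = (\<lambda>v. (fst v, snd v + k)) ` vars p"
  by (auto simp: vars_def keys_transform_funpow keys_shift_exponent_funpow)

lemma deg_transform_funpow:
  fixes p :: "('n, 'a) dpoly"
  shows "deg_in ((transform \<sigma> ^^ k) p) (i, d + k) = deg_in p (i, d)"
  by (simp add: deg_in_def keys_transform_funpow image_image lookup_shift_exponent_funpow)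

lemma transform_funpow_eq_0 [simp]:
  fixes p :: "('n, 'a) dpoly"
  shows "(transform \<sigma> ^^ k) p = 0 \<longleftrightarrow> p = 0"
  using keys_transform_funpow[of k p] by (metis image_is_empty keys_eq_empty keys_zero)

lemma coeff_in_transform:
  fixes p :: "('n, 'a) dpoly"
  shows "coeff_in (transform \<sigma> p) (shift_var v) k = transform \<sigma> (coeff_in p v k)"
proof (induction p rule: dpoly_induct)
  case (single m c)
  have "lookup (shift_exponent m) (shift_var v) = lookup m v"
    by (simp add: shift_exponent_relabel lookup_relabel inj_shift_var)
  moreover have "update (shift_var v) 0 (shift_exponent m) = shift_exponent (update v 0 m)"
  proof (rule poly_mapping_eqI)
    fix w
    show "lookup (update (shift_var v) 0 (shift_exponent m)) w =
        lookup (shift_exponent (update v 0 m)) w"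
    proof (cases "w \<in> range shift_var")
      case True
      then show ?thesis using inj_shift_var
        by (auto simp: shift_exponent_relabel lookup_relabel inj_shift_var lookup_update inj_eq)
    qed (auto simp: shift_exponent_relabel lookup_relabel_outside lookup_update)
  qed
  ultimately show ?case by (simp add: coeff_in_single)
qed (simp_all add: coeff_in_add transform_add)

lemma coeff_in_transform_funpow:
  fixes p :: "('n, 'a) dpoly"
  shows "coeff_in ((transform \<sigma> ^^ k) p) (i, d + k) e = (transform \<sigma> ^^ k) (coeff_in p (i, d) e)"
proof (induction k)
  case (Suc k)
  then show ?case
    using coeff_in_transform[of "(transform \<sigma> ^^ k) p" "(i, d + k)" e] by (simp add: shift_var_def)
qed simp

lemma transform_initial:
  fixes g :: "('n::linorder, 'a) dpoly"
  assumes "leader g = (i, d)"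
  shows "coeff_in ((transform \<sigma> ^^ k) g) (i, d + k) (deg_in ((transform \<sigma> ^^ k) g) (i, d + k)) =
    (transform \<sigma> ^^ k) (initial g)"
  by (simp add: deg_transform_funpow coeff_in_transform_funpow initial_def assms)

lemma free_above_leader:
  fixes g :: "('n::linorder, 'a) dpoly"
  assumes "leader g = (i, d)" "(i, d + k) < u"
  shows "deg_le u 0 ((transform \<sigma> ^^ k) g)"
proof -
  have le: "(fst v, snd v + k) \<le> (i, d + k)" if "v \<in> vars g" for v
    using vars_le_leader[OF that] assms(1) by (cases v) auto
  have "u \<notin> (\<lambda>v. (fst v, snd v + k)) ` vars g"
  proof
    assume "u \<in> (\<lambda>v. (fst v, snd v + k)) ` vars g"
    then obtain v where v: "v \<in> vars g" "u = (fst v, snd v + k)" by (elim imageE)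
    from leD[OF le[OF v(1), folded v(2)]] assms(2) show False by (rule notE)
  qed
  then show ?thesis by (simp add: deg_le_0_iff vars_transform_funpow)
qed

definition reduced_bound :: "('n::linorder, 'a) dpoly \<Rightarrow> ('n, 'a) dpoly \<Rightarrow> bool" where
  "reduced_bound q p \<longleftrightarrow>
     (\<forall>l. deg_le (fst (leader p), snd (leader p) + l) (deg_in p (leader p) - 1) q)"

lemma reduced_wrt_iff: "vars p \<noteq> {} \<Longrightarrow> reduced_wrt q p \<longleftrightarrow> reduced_bound q p"
proof -
  assume p: "vars p \<noteq> {}"
  have "x < deg_in p (leader p) \<longleftrightarrow> x \<le> deg_in p (leader p) - 1" for x
    using deg_leader_pos[OF p] by linarith
  with p show ?thesis
    by (simp add: reduced_wrt_def reduced_bound_def flip: deg_in_le_iff)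
qed

lemma initial_products_mult:
  "h \<in> initial_products \<sigma> A \<Longrightarrow> h' \<in> initial_products \<sigma> A \<Longrightarrow> h * h' \<in> initial_products \<sigma> A"
  by (induction h rule: initial_products.induct) (auto simp: mult.assoc intro: initial_products.intros)

lemma initial_products_power:
  assumes "g \<in> set A"
  shows "((transform \<sigma> ^^ j) (initial g)) ^ e \<in> initial_products \<sigma> A"
  by (induction e) (auto intro: initial_products.intros assms)

lemma prem_upto_identity:
  fixes g :: "('n::linorder, 'a) dpoly"
  assumes g: "g \<in> set A" "g \<noteq> 0"
  shows "\<exists>h\<in>initial_products \<sigma> A. h * f - prem_upto \<sigma> g k f \<in> sigma_ideal_generated \<sigma> (set A)"
proof (induction k arbitrary: f)
  case 0
  show ?case
    by (rule bexI[of _ 1])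
       (auto intro: initial_products.one is_ideal_zero sigma_ideal_is_ideal[OF sigma_ideal_sigma_ideal_generated])
next
  case (Suc k)
  note I = sigma_ideal_is_ideal[OF sigma_ideal_sigma_ideal_generated]
  obtain i d where id: "leader g = (i, d)" by (cases "leader g")
  let ?B = "(transform \<sigma> ^^ k) g" and ?r = "alg_prem (i, d + k) f ((transform \<sigma> ^^ k) g)"
  obtain e q where e: "((transform \<sigma> ^^ k) (initial g)) ^ e * f - ?r = q * ?B"
    using alg_prem_identity[of ?B "(i, d + k)" f] g(2) by (auto simp: transform_initial[OF id])
  obtain h where h: "h \<in> initial_products \<sigma> A"
      "h * ?r - prem_upto \<sigma> g k ?r \<in> sigma_ideal_generated \<sigma> (set A)"
    using Suc.IH by blast
  have "?B \<in> sigma_ideal_generated \<sigma> (set A)"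
    using g(1) sigma_ideal_generated_incl
    by (blast intro: sigma_ideal_transform_funpow sigma_ideal_sigma_ideal_generated)
  then have "h * (q * ?B) + (h * ?r - prem_upto \<sigma> g k ?r) \<in> sigma_ideal_generated \<sigma> (set A)"
    by (intro is_ideal_add[OF I] is_ideal_mult[OF I] h(2))
  also have "h * (q * ?B) + (h * ?r - prem_upto \<sigma> g k ?r) =
      (h * ((transform \<sigma> ^^ k) (initial g)) ^ e) * f - prem_upto \<sigma> g (Suc k) f"
    by (simp add: id algebra_simps flip: e)
  finally show ?case
    using initial_products_mult[OF h(1) initial_products_power[OF g(1)]] by blast
qed

lemma prem_identity:
  fixes A :: "('n::linorder, 'a) dpoly list"
  assumes "set A' \<subseteq> set A" "0 \<notin> set A"
  shows "\<exists>h\<in>initial_products \<sigma> A. h * f - prem \<sigma> f A' \<in> sigma_ideal_generated \<sigma> (set A)"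
  using assms(1)
proof (induction A')
  case Nil
  show ?case
    by (rule bexI[of _ 1])
       (auto simp: prem_def intro: initial_products.one is_ideal_zero sigma_ideal_is_ideal[OF sigma_ideal_sigma_ideal_generated])
next
  case (Cons g A')
  note I = sigma_ideal_is_ideal[OF sigma_ideal_sigma_ideal_generated]
  let ?r = "prem \<sigma> f A'"
  obtain h where h: "h \<in> initial_products \<sigma> A" "h * f - ?r \<in> sigma_ideal_generated \<sigma> (set A)"
    using Cons by auto
  have g: "g \<in> set A" "g \<noteq> 0" using Cons.prems assms(2) by auto
  obtain h' where h': "h' \<in> initial_products \<sigma> A"
      "h' * ?r - prem_single \<sigma> ?r g \<in> sigma_ideal_generated \<sigma> (set A)"
    unfolding prem_single_def using prem_upto_identity[OF g] by blast
  have "h' * (h * f - ?r) + (h' * ?r - prem_single \<sigma> ?r g) \<in> sigma_ideal_generated \<sigma> (set A)"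
    by (intro is_ideal_add[OF I] is_ideal_mult[OF I] h(2) h'(2))
  then have "(h' * h) * f - prem \<sigma> f (g # A') \<in> sigma_ideal_generated \<sigma> (set A)"
    by (simp add: prem_def algebra_simps)
  then show ?case using initial_products_mult[OF h'(1) h(1)] by blast
qed

lemma deg_prem_upto:
  fixes g :: "('n::linorder, 'a) dpoly"
  assumes g: "g \<noteq> 0" "leader g = (i, d)"
    and free: "\<And>j. j < k \<Longrightarrow> u \<noteq> (i, d + j) \<and> deg_le u 0 ((transform \<sigma> ^^ j) g)" and f: "deg_le u D f"
  shows "deg_le u D (prem_upto \<sigma> g k f)"
  using free f
proof (induction k arbitrary: f)
  case (Suc k)
  then show ?case using g by (simp add: deg_alg_prem_other)
qed simp

text \<open>The steps run from the highest transform down; a later step, by a lower transform of \<open>g\<close>, is by a polynomial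
  free of the leaders treated before.\<close>

lemma prem_upto_reduces:
  fixes g :: "('n::linorder, 'a) dpoly"
  assumes g: "g \<noteq> 0" "leader g = (i, d)" "deg_in g (i, d) > 0" and j: "j < k"
  shows "deg_le (i, d + j) (deg_in g (i, d) - 1) (prem_upto \<sigma> g k f)"
  using j
proof (induction k arbitrary: f)
  case (Suc k)
  let ?r = "alg_prem (i, d + k) f ((transform \<sigma> ^^ k) g)"
  show ?case
  proof (cases "j = k")
    case True
    have "deg_le (i, d + k) (deg_in g (i, d) - 1) ?r"
      using deg_alg_prem[of "(transform \<sigma> ^^ k) g" "(i, d + k)" f] g by (simp add: deg_transform_funpow)
    then have "deg_le (i, d + k) (deg_in g (i, d) - 1) (prem_upto \<sigma> g k ?r)"
      using g by (intro deg_prem_upto[OF g(1,2)] conjI free_above_leader) auto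
    then show ?thesis using True g(2) by simp
  qed (use Suc g in simp)
qed simp

lemma prem_single_reduced:
  fixes g :: "('n::linorder, 'a) dpoly"
  assumes "g \<noteq> 0" "vars g \<noteq> {}"
  shows "reduced_bound (prem_single \<sigma> f g) g"
proof -
  obtain i d where id: "leader g = (i, d)" by (cases "leader g")
  let ?k = "order_bound f i - d"
  have pos: "deg_in g (i, d) > 0" using deg_leader_pos[OF assms(2)] id by simp
  have "deg_le (i, d + l) (deg_in g (i, d) - 1) (prem_upto \<sigma> g ?k f)" for l
  proof (cases "l < ?k")
    case True
    then show ?thesis using prem_upto_reduces[OF assms(1) id pos] by blast
  next
    case False
    have fin: "finite {Suc k |k. (i, k) \<in> vars f}"
      by (rule finite_subset[of _ "(Suc \<circ> snd) ` vars f"]) (auto intro!: image_eqI)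
    have "(i, d + l) \<notin> vars f"
    proof
      assume "(i, d + l) \<in> vars f"
      then have "Suc (d + l) \<le> order_bound f i"
        unfolding order_bound_def using fin by (intro Max_ge) auto
      then show False using False by simp
    qed
    then have "deg_le (i, d + l) 0 f" by (simp add: deg_le_0_iff)
    then have "deg_le (i, d + l) 0 (prem_upto \<sigma> g ?k f)"
      using False by (intro deg_prem_upto[OF assms(1) id] conjI free_above_leader[OF id]) auto
    then show ?thesis by (rule deg_le_mono) simp
  qed
  then show ?thesis by (simp add: reduced_bound_def prem_single_def id)
qed

text \<open>Reduction by an earlier element \<open>g\<close> of a chain does not spoil reducedness with respect to a later
  one \<open>q\<close>: a transform of \<open>g\<close> either has a leader in which the polynomial is already reduced, because
  \<open>q\<close> has the smaller degree, or it is free of the transforms of the leader of \<open>q\<close>.\<close>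

lemma prem_single_preserves_reduced:
  fixes g q :: "('n::linorder, 'a) dpoly"
  assumes "g \<noteq> 0" and rank: "higher_rank q g" "reduced_wrt q g" and f: "reduced_bound f q"
  shows "reduced_bound (prem_single \<sigma> f g) q"
proof -
  obtain i d where id: "leader g = (i, d)" by (cases "leader g")
  obtain i' d' where id': "leader q = (i', d')" by (cases "leader q")
  let ?a = "deg_in g (i, d)" and ?b = "deg_in q (i', d')"
  have vars: "vars g \<noteq> {}" "vars q \<noteq> {}" using rank(1) by (auto simp: higher_rank_def)
  have red: "deg_in q (i, d + l) < ?a" for l using rank(2) by (simp add: reduced_wrt_def id)
  have lead: "(i, d) < (i', d')"
    using rank(1) red[of 0] by (auto simp: higher_rank_def id id')
  have b: "?b > 0" using deg_leader_pos[OF vars(2)] id' by simp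
  have step: "reduced_bound (alg_prem (i, d + j) f ((transform \<sigma> ^^ j) g)) q" if f: "reduced_bound f q" for f j
  proof (cases "i = i' \<and> d' \<le> d + j")
    case True
    have "?b < ?a" using red[of "d' - d"] True lead by auto
    moreover have "deg_in f (i, d + j) \<le> ?b - 1"
      using f[unfolded reduced_bound_def id', THEN spec, of "d + j - d'"] True
      by (simp add: deg_in_le_iff)
    ultimately have "alg_prem (i, d + j) f ((transform \<sigma> ^^ j) g) = f"
      using assms(1) b by (intro alg_prem_reduced) (auto simp: deg_transform_funpow)
    then show ?thesis using f by simp
  next
    case False
    then have less: "(i, d + j) < (i', d' + l)" for l using lead by auto
    have "deg_le (i', d' + l) (?b - 1) (alg_prem (i, d + j) f ((transform \<sigma> ^^ j) g))" for l
    proof (rule deg_alg_prem_other)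
      show "deg_le (i', d' + l) (?b - 1) f" using f by (simp add: reduced_bound_def id')
    qed (use less[of l] assms(1) in \<open>auto intro: free_above_leader[OF id]\<close>)
    then show ?thesis by (simp add: reduced_bound_def id')
  qed
  have "reduced_bound (prem_upto \<sigma> g k f) q" for k
    using f
  proof (induction k arbitrary: f)
    case (Suc k)
    then show ?case using step by (simp add: id)
  qed simp
  then show ?thesis by (simp add: prem_single_def)
qed

lemma prem_reduced:
  fixes A :: "('n::linorder, 'a) dpoly list"
  assumes "sorted_wrt (\<lambda>p q. higher_rank q p \<and> reduced_wrt q p) A"
    and "\<forall>p\<in>set A. p \<noteq> 0 \<and> vars p \<noteq> {}"
  shows "\<forall>p\<in>set A. reduced_bound (prem \<sigma> f A) p"
  using assms
proof (induction A)
  case (Cons g A)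
  then show ?case
    using prem_single_reduced[of g "prem \<sigma> f A"] prem_single_preserves_reduced[of g _ "prem \<sigma> f A"]
    by (auto simp: prem_def)
qed simp

lemma ascending_chain_iff:
  "ascending_chain A \<longleftrightarrow> (\<forall>p\<in>set A. p \<noteq> 0) \<and> sorted_wrt (\<lambda>p q. higher_rank q p \<and> reduced_wrt q p) A"
  unfolding ascending_chain_def sorted_wrt_iff_nth_less
  by (cases "length A > 1") auto

lemma initial_products_not_in_prime:
  assumes "is_prime_ideal P" "\<And>g j. g \<in> set A \<Longrightarrow> (transform \<sigma> ^^ j) (initial g) \<notin> P"
    and "h \<in> initial_products \<sigma> A"
  shows "h \<notin> P"
  using assms(3)
proof (induction h rule: initial_products.induct)
  case one
  show ?case using assms(1) is_ideal_one by (auto simp: is_prime_ideal_def)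
next
  case (mult h g j)
  then show ?case using assms(1,2) unfolding is_prime_ideal_def by blast
qed

text \<open>Pseudo-division by the chain does not leave the ideal, so the remainder of an element of the ideal is
  reduced and hence vanishes; conversely the initials can be cancelled, as the ideal is prime.\<close>

theorem characteristic_set:
  fixes A :: "('n::linorder, 'a) dpoly list"
  assumes P: "sigma_ideal \<sigma> P" "is_prime_ideal P" and A: "set A \<subseteq> P" "ascending_chain A"
    and vars: "\<And>g. g \<in> set A \<Longrightarrow> vars g \<noteq> {}"
    and init: "\<And>g j. g \<in> set A \<Longrightarrow> (transform \<sigma> ^^ j) (initial g) \<notin> P"
    and red: "\<And>p. p \<in> P \<Longrightarrow> \<forall>g\<in>set A. reduced_bound p g \<Longrightarrow> p = 0"
  shows "sat \<sigma> A = P" "coherent_chain \<sigma> A"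
proof -
  have I: "is_ideal P" using P(1) by (rule sigma_ideal_is_ideal)
  have gen: "sigma_ideal_generated \<sigma> (set A') \<subseteq> P" if "set A' \<subseteq> set A" for A'
    using that A(1) by (intro sigma_ideal_generated_least P(1)) auto
  have nz: "0 \<notin> set A" using A(2) by (auto simp: ascending_chain_iff)
  have prem_in: "prem \<sigma> f A' \<in> P" if f: "f \<in> P" and A': "set A' \<subseteq> set A" for f A'
  proof -
    obtain h where "h * f - prem \<sigma> f A' \<in> sigma_ideal_generated \<sigma> (set A')"
      using prem_identity[of A' A' f] nz A' by auto
    then have "h * f - prem \<sigma> f A' \<in> P" using gen[OF A'] by auto
    from is_ideal_diff[OF I is_ideal_mult[OF I f, of h] this] show ?thesis by simp
  qed
  have prem_0: "prem \<sigma> f A = 0" if "f \<in> P" for f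
    using prem_in[OF that] prem_reduced[of A f] A(2) vars nz
    by (intro red) (auto simp: ascending_chain_iff)
  show "sat \<sigma> A = P"
  proof (intro equalityI subsetI)
    fix p assume "p \<in> sat \<sigma> A"
    then obtain h where h: "h \<in> initial_products \<sigma> A" "h * p \<in> P"
      using gen[of A] by (auto simp: sat_def)
    then show "p \<in> P"
      using P(2) initial_products_not_in_prime[OF P(2) init h(1)] unfolding is_prime_ideal_def by blast
  next
    fix p assume "p \<in> P"
    then show "p \<in> sat \<sigma> A"
      using prem_identity[OF order_refl nz, of p] prem_0 by (auto simp: sat_def)
  qed
  have "Delta \<sigma> p q \<in> P" if "p \<in> set A" "q \<in> set A" for p q
    using that A(1) I
    by (auto simp: Delta_def intro!: prem_in sigma_ideal_transform_funpow[OF P(1)] is_ideal_zero)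
  then show "coherent_chain \<sigma> A"
    using A(2) prem_0 by (auto simp: coherent_chain_def)
qed

end

section \<open>Lattices of exponent vectors\<close>

(* Variables are pairs; quantifiers over them should stay in one piece. *)
declare split_paired_All [simp del] split_paired_Ex [simp del]

type_synonym vect = "(nat \<times> nat) \<Rightarrow>\<^sub>0 int"

definition subgrp :: "vect set \<Rightarrow> bool" where
  "subgrp M \<longleftrightarrow> 0 \<in> M \<and> (\<forall>u\<in>M. \<forall>w\<in>M. u - w \<in> M)"

definition shift_closed :: "vect set \<Rightarrow> bool" where
  "shift_closed M \<longleftrightarrow> (\<forall>u\<in>M. relabel shift_var u \<in> M)"

lemma subgrp_zero: "subgrp M \<Longrightarrow> 0 \<in> M"
  and subgrp_diff: "subgrp M \<Longrightarrow> u \<in> M \<Longrightarrow> w \<in> M \<Longrightarrow> u - w \<in> M"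
  by (auto simp: subgrp_def)

lemma subgrp_uminus: "subgrp M \<Longrightarrow> u \<in> M \<Longrightarrow> - u \<in> M"
  using subgrp_diff[of M 0 u] by (simp add: subgrp_zero)

lemma subgrp_add: "subgrp M \<Longrightarrow> u \<in> M \<Longrightarrow> w \<in> M \<Longrightarrow> u + w \<in> M"
  using subgrp_diff[of M u "- w"] by (simp add: subgrp_uminus)

lemma subgrp_cmul:
  assumes M: "subgrp M" "u \<in> M"
  shows "frag_cmul k u \<in> M"
proof -
  have nat: "frag_cmul (int n) u \<in> M" for n
    using M by (induction n) (auto simp: frag_cmul_distrib intro: subgrp_add subgrp_zero)
  show ?thesis
  proof (cases "k \<ge> 0")
    case True
    then show ?thesis using nat[of "nat k"] by simp
  next
    case False
    then show ?thesis using subgrp_uminus[OF M(1) nat[of "nat (- k)"]] by simp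
  qed
qed

lemma subgrp_frag_extend:
  assumes M: "subgrp M" and "\<And>v. v \<in> keys z \<Longrightarrow> f v \<in> M"
  shows "frag_extend f z \<in> M"
  by (rule frag_induction[of z "keys z" "\<lambda>z. frag_extend f z \<in> M"])
     (simp_all add: frag_extend_diff subgrp_diff[OF M] subgrp_zero[OF M] assms(2))

lemma shift_closed_funpow:
  "shift_closed M \<Longrightarrow> u \<in> M \<Longrightarrow> (relabel shift_var ^^ k) u \<in> M"
  by (induction k) (auto simp: shift_closed_def)

lemma relabel_frag_cmul: "relabel f (frag_cmul k u) = frag_cmul k (relabel f u)"
proof -
  have "relabel f (frag_cmul (int n) u) = frag_cmul (int n) (relabel f u)" for n
    by (induction n) (auto simp: frag_cmul_distrib relabel_add)
  from this[of "nat \<bar>k\<bar>"] have "relabel f (frag_cmul \<bar>k\<bar> u) = frag_cmul \<bar>k\<bar> (relabel f u)" by simp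
  then show ?thesis
    by (cases "k \<ge> 0") (simp_all add: relabel_uminus flip: minus_frag_cmul)
qed

lemma relabel_frag_extend: "relabel f (frag_extend t z) = frag_extend (\<lambda>v. relabel f (t v)) z"
  by (induction z rule: frag_induction[OF subset_UNIV])
     (auto simp: frag_extend_diff relabel_diff)

lemma lookup_shift:
  "lookup ((relabel shift_var ^^ k) u) (p, d) = (if k \<le> d then lookup u (p, d - k) else 0)"
  for u :: "nat \<times> nat \<Rightarrow>\<^sub>0 'b::comm_monoid_add"
proof (induction k arbitrary: d)
  case (Suc k)
  show ?case
  proof (cases d)
    case 0
    have "(p, 0) \<notin> range shift_var" by (auto simp: shift_var_def)
    then show ?thesis by (simp add: 0 lookup_relabel_outside)
  next
    case (Suc e)
    have "(p, d) = shift_var (p, e)" by (simp add: Suc shift_var_def)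
    then show ?thesis using Suc.IH[of e] by (simp only: funpow.simps comp_apply lookup_relabel[OF inj_shift_var]) (simp add: Suc)
  qed
qed simp

lemma lookup_frag_extend:
  "lookup (frag_extend t z) x =
    (\<Sum>v\<in>keys z. lookup z v * lookup (t v) x)"
  by (simp add: frag_extend_def lookup_sum)

subsection \<open>Echelon families\<close>

text \<open>A family of vectors with pairwise different leading variables.\<close>

locale echelon =
  fixes \<Lambda> :: "(nat \<times> nat) set" and t :: "nat \<times> nat \<Rightarrow> vect"
  assumes lead_pos: "v \<in> \<Lambda> \<Longrightarrow> lookup (t v) v > 0"
    and lead_max: "v \<in> \<Lambda> \<Longrightarrow> v < w \<Longrightarrow> lookup (t v) w = 0"
begin

definition lspan :: "vect set" where
  "lspan = {frag_extend t z |z. keys z \<subseteq> \<Lambda>}"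

lemma subgrp_lspan: "subgrp lspan"
  unfolding subgrp_def lspan_def
proof (safe, goal_cases)
  case 1
  then show ?case by (intro exI[of _ 0]) simp
next
  case (2 _ _ z z')
  then show ?case using keys_diff[of z z'] by (intro exI[of _ "z - z'"]) (auto simp: frag_extend_diff)
qed

lemma t_in_lspan: "v \<in> \<Lambda> \<Longrightarrow> t v \<in> lspan"
  unfolding lspan_def by (rule CollectI, rule exI[of _ "frag_of v"]) (simp add: keys_frag_of)

lemma lead_frag_extend:
  assumes "keys z \<subseteq> \<Lambda>" "z \<noteq> 0"
  defines "v \<equiv> Max (keys z)"
  shows "v \<in> keys z" "v \<in> \<Lambda>" "\<And>w. w \<in> keys z \<Longrightarrow> w \<le> v"
    "lookup (frag_extend t z) v = lookup z v * lookup (t v) v"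
    "lookup (frag_extend t z) v \<noteq> 0"
    "\<And>w. v < w \<Longrightarrow> lookup (frag_extend t z) w = 0"
proof -
  have ne: "keys z \<noteq> {}" using assms(2) by simp
  show v: "v \<in> keys z" unfolding v_def using ne by (intro Max_in) auto
  then show L: "v \<in> \<Lambda>" using assms(1) by auto
  show le: "w \<le> v" if "w \<in> keys z" for w unfolding v_def using that by simp
  have "lookup (frag_extend t z) v =
      (\<Sum>w\<in>keys z. if w = v then lookup z v * lookup (t v) v else 0)"
    unfolding lookup_frag_extend
  proof (intro sum.cong refl)
    fix w assume w: "w \<in> keys z"
    show "lookup z w * lookup (t w) v =
        (if w = v then lookup z v * lookup (t v) v else 0)"
    proof (cases "w = v")
      case False
      then have "w < v" using le[OF w] by simp
      then show ?thesis using lead_max[of w v] w assms(1) by auto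
    qed simp
  qed
  then show eq: "lookup (frag_extend t z) v = lookup z v * lookup (t v) v"
    using v by simp
  then show "lookup (frag_extend t z) v \<noteq> 0"
    using lead_pos[OF L] v by (simp add: in_keys_iff)
  show "lookup (frag_extend t z) w = 0" if "v < w" for w
    unfolding lookup_frag_extend
  proof (rule sum.neutral, rule ballI)
    fix x assume x: "x \<in> keys z"
    have "x < w" using order_le_less_trans[OF le[OF x] that] .
    then show "lookup z x * lookup (t x) w = 0"
      using lead_max[of x w] x assms(1) by auto
  qed
qed

lemma lspan_lead:
  assumes "u \<in> lspan" "u \<noteq> 0"
  obtains v where "v \<in> \<Lambda>" "lookup u v \<noteq> 0" "\<And>w. v < w \<Longrightarrow> lookup u w = 0"
    "lookup (t v) v dvd lookup u v"
proof -
  obtain z where z: "u = frag_extend t z" "keys z \<subseteq> \<Lambda>" using assms(1) by (auto simp: lspan_def)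
  then have "z \<noteq> 0" using assms(2) by auto
  note l = lead_frag_extend[OF z(2) this]
  show ?thesis by (rule that[OF l(2)]) (use l(4-6) in \<open>simp_all add: z(1)\<close>)
qed

lemma frag_extend_inject:
  assumes "keys z \<subseteq> \<Lambda>" "keys z' \<subseteq> \<Lambda>" "frag_extend t z = frag_extend t z'"
  shows "z = z'"
proof (rule ccontr)
  assume "z \<noteq> z'"
  then have "z - z' \<noteq> 0" by simp
  moreover have "keys (z - z') \<subseteq> \<Lambda>" using assms(1,2) keys_diff[of z z'] by auto
  ultimately show False
    using lead_frag_extend(5)[of "z - z'"] assms(3) by (simp add: frag_extend_diff)
qed

text \<open>Pseudo-division; the multiplier is a power of a common multiple of the leading coefficients.\<close>

lemma pseudo_reduction:
  fixes u :: vect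
  assumes c: "\<And>v. v \<in> \<Lambda> \<Longrightarrow> lookup (t v) v dvd c"
  shows "\<exists>e r. frag_cmul (c ^ e) u - r \<in> lspan \<and> (\<forall>v\<in>\<Lambda>. lookup r v = 0)"
proof -
  have "\<forall>u :: vect. (\<forall>w\<in>\<Lambda>. lookup u w \<noteq> 0 \<longrightarrow> w < v0) \<longrightarrow>
      (\<exists>e r. frag_cmul (c ^ e) u - r \<in> lspan \<and> (\<forall>v\<in>\<Lambda>. lookup r v = 0))" for v0
  proof (induction v0 rule: less_induct)
    case (less v0)
    show ?case
    proof (intro allI impI)
      fix u :: vect assume u: "\<forall>w\<in>\<Lambda>. lookup u w \<noteq> 0 \<longrightarrow> w < v0"
      let ?K = "keys u \<inter> \<Lambda>"
      show "\<exists>e r. frag_cmul (c ^ e) u - r \<in> lspan \<and> (\<forall>v\<in>\<Lambda>. lookup r v = 0)"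
      proof (cases "?K = {}")
        case True
        then show ?thesis
          by (intro exI[of _ 0] exI[of _ u]) (auto simp: subgrp_zero[OF subgrp_lspan] in_keys_iff)
      next
        case False
        define w where "w = Max ?K"
        have w: "w \<in> \<Lambda>" "w \<in> keys u" using Max_in[of ?K] False by (auto simp: w_def)
        have wmax: "x \<le> w" if "x \<in> \<Lambda>" "lookup u x \<noteq> 0" for x
          unfolding w_def using that by (intro Max_ge) (auto simp: in_keys_iff)
        obtain q where q: "c = lookup (t w) w * q" using c[OF w(1)] by (auto elim: dvdE)
        define u' where "u' = frag_cmul c u - frag_cmul (q * lookup u w) (t w)"
        have "\<forall>x\<in>\<Lambda>. lookup u' x \<noteq> 0 \<longrightarrow> x < w"
        proof (intro ballI impI, rule ccontr)
          fix x assume x: "x \<in> \<Lambda>" "lookup u' x \<noteq> 0" "\<not> x < w"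
          show False
          proof (cases "x = w")
            case True
            then show False using x(2) by (simp add: u'_def lookup_minus q)
          next
            case False
            then have "w < x" using x(3) by simp
            then show False using x(1,2) wmax[of x] lead_max[OF w(1)] by (auto simp: u'_def lookup_minus)
          qed
        qed
        moreover have "w < v0" using u w by (simp add: in_keys_iff)
        ultimately obtain e r where er: "frag_cmul (c ^ e) u' - r \<in> lspan" "\<forall>v\<in>\<Lambda>. lookup r v = 0"
          using less by blast
        have "frag_cmul (c ^ e) u' - r + frag_cmul (c ^ e * (q * lookup u w)) (t w) \<in> lspan"
          by (intro subgrp_add[OF subgrp_lspan] er(1) subgrp_cmul[OF subgrp_lspan] t_in_lspan w(1))
        moreover have "frag_cmul (c ^ e) u' - r + frag_cmul (c ^ e * (q * lookup u w)) (t w) =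
            frag_cmul (c ^ Suc e) u - r"
          by (rule poly_mapping_eqI) (simp add: u'_def lookup_minus lookup_add algebra_simps)
        ultimately show ?thesis using er(2) by (intro exI[of _ "Suc e"] exI[of _ r]) simp
      qed
    qed
  qed
  note * = this
  define v0 where "v0 = (if keys u = {} then (0, 0) else shift_var (Max (keys u)))"
  have "w < v0" if "lookup u w \<noteq> 0" for w
  proof -
    have w: "w \<in> keys u" using that by (simp add: in_keys_iff)
    then have "w \<le> Max (keys u)" by simp
    also have "\<dots> < v0" using w by (auto simp: v0_def shift_var_def less_prod_def')
    finally show ?thesis .
  qed
  then show ?thesis using * by blast
qed

lemma shift_closed_lspan:
  assumes "\<And>v. v \<in> \<Lambda> \<Longrightarrow> relabel shift_var (t v) \<in> lspan"
  shows "shift_closed lspan"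
  unfolding shift_closed_def
proof
  fix u assume "u \<in> lspan"
  then obtain z where z: "u = frag_extend t z" "keys z \<subseteq> \<Lambda>" by (auto simp: lspan_def)
  show "relabel shift_var u \<in> lspan"
    unfolding z relabel_frag_extend
    by (rule subgrp_frag_extend[OF subgrp_lspan]) (use assms z(2) in auto)
qed

end

subsection \<open>Characters on the span of an echelon family\<close>

text \<open>The value of $\prod_v v^{z_v}$ at the point \<open>c\<close>.\<close>

definition chi :: "(nat \<times> nat \<Rightarrow> 'a::field) \<Rightarrow> vect \<Rightarrow> 'a" where
  "chi c z = (\<Prod>v\<in>keys z. power_int (c v) (lookup z v))"

lemma chi_superset:
  assumes "finite K" "keys z \<subseteq> K"
  shows "chi c z = (\<Prod>v\<in>K. power_int (c v) (lookup z v))"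
  unfolding chi_def using assms by (intro prod.mono_neutral_left) (auto simp: in_keys_iff)

lemma chi_zero [simp]: "chi c 0 = 1"
  by (simp add: chi_def)

lemma chi_frag_of [simp]: "chi c (frag_of v) = c v"
  by (simp add: chi_def keys_frag_of)

lemma chi_diff:
  assumes "\<And>v. v \<in> keys y \<union> keys z \<Longrightarrow> c v \<noteq> 0"
  shows "chi c (y - z) = chi c y / chi c z"
proof -
  let ?K = "keys y \<union> keys z"
  have "keys (y - z) \<subseteq> ?K" by (rule keys_diff)
  then have "chi c (y - z) = (\<Prod>v\<in>?K. power_int (c v) (lookup y v) / power_int (c v) (lookup z v))"
    using assms by (subst chi_superset[of ?K]) (auto simp: lookup_minus power_int_diff intro!: prod.cong)
  then show ?thesis by (simp add: prod_dividef chi_superset[of ?K])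
qed

lemma chi_nonzero: "(\<And>v. v \<in> keys z \<Longrightarrow> c v \<noteq> 0) \<Longrightarrow> chi c z \<noteq> 0"
  by (simp add: chi_def)

text \<open>Values on an echelon family define a character on its span, and the condition \<open>c_shift\<close> on the family
  makes the character equivariant.\<close>

locale echelon_character = echelon \<Lambda> t + difference \<sigma>
  for \<Lambda> t and \<sigma> :: "'a::field \<Rightarrow> 'a" +
  fixes c :: "nat \<times> nat \<Rightarrow> 'a"
  assumes c_nonzero: "v \<in> \<Lambda> \<Longrightarrow> c v \<noteq> 0"
    and c_shift: "v \<in> \<Lambda> \<Longrightarrow> \<exists>z. keys z \<subseteq> \<Lambda> \<and> relabel shift_var (t v) = frag_extend t z \<and> \<sigma> (c v) = chi c z"
begin

definition character :: "vect \<Rightarrow> 'a" where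
  "character u = chi c (THE z. keys z \<subseteq> \<Lambda> \<and> frag_extend t z = u)"

lemma character_frag_extend: "keys z \<subseteq> \<Lambda> \<Longrightarrow> character (frag_extend t z) = chi c z"
  unfolding character_def
  by (rule arg_cong[of _ _ "chi c"], rule the_equality) (auto intro: frag_extend_inject)

lemma character_nonzero: "u \<in> lspan \<Longrightarrow> character u \<noteq> 0"
proof -
  assume "u \<in> lspan"
  then obtain z where z: "u = frag_extend t z" "keys z \<subseteq> \<Lambda>" by (auto simp: lspan_def)
  have "chi c z \<noteq> 0" by (rule chi_nonzero) (use z(2) c_nonzero in blast)
  then show ?thesis using z by (simp add: character_frag_extend)
qed

lemma character_diff:
  assumes "u \<in> lspan" "w \<in> lspan"
  shows "character (u - w) = character u / character w"
proof -
  obtain y where y: "u = frag_extend t y" "keys y \<subseteq> \<Lambda>" using assms(1) by (auto simp: lspan_def)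
  obtain z where z: "w = frag_extend t z" "keys z \<subseteq> \<Lambda>" using assms(2) by (auto simp: lspan_def)
  have "keys (y - z) \<subseteq> \<Lambda>" using keys_diff[of y z] y z by auto
  moreover have "chi c (y - z) = chi c y / chi c z"
    by (rule chi_diff) (use y z c_nonzero in blast)
  ultimately show ?thesis
    using y z by (simp add: character_frag_extend flip: frag_extend_diff)
qed

lemma character_zero: "character 0 = 1"
  using character_frag_extend[of 0] by simp

lemma character_uminus: "u \<in> lspan \<Longrightarrow> character (- u) = inverse (character u)"
  using character_diff[OF subgrp_zero[OF subgrp_lspan], of u] by (simp add: character_zero field_simps)

lemma character_add: "u \<in> lspan \<Longrightarrow> w \<in> lspan \<Longrightarrow> character (u + w) = character u * character w"
  using character_diff[of u "- w"] subgrp_uminus[OF subgrp_lspan, of w] by (simp add: character_uminus divide_inverse)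

lemma sigma_divide: "\<sigma> (a / b) = \<sigma> a / \<sigma> b"
  by (simp add: divide_inverse sigma_mult sigma_inverse)

lemma shift_closed_lspan': "shift_closed lspan"
proof (rule shift_closed_lspan)
  fix v assume "v \<in> \<Lambda>"
  from c_shift[OF this] show "relabel shift_var (t v) \<in> lspan" unfolding lspan_def by blast
qed

lemma character_shift:
  assumes "u \<in> lspan"
  shows "character (relabel shift_var u) = \<sigma> (character u)"
proof -
  obtain z where z: "u = frag_extend t z" "keys z \<subseteq> \<Lambda>" using assms by (auto simp: lspan_def)
  have "frag_extend t z \<in> lspan \<and> character (relabel shift_var (frag_extend t z)) = \<sigma> (character (frag_extend t z))"
    using z(2)
  proof (induction z rule: frag_induction)
    case zero
    then show ?case by (simp add: character_zero subgrp_zero[OF subgrp_lspan])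
  next
    case (one v)
    obtain z where z: "keys z \<subseteq> \<Lambda>" "relabel shift_var (t v) = frag_extend t z" "\<sigma> (c v) = chi c z"
      using c_shift[OF one] by blast
    have "character (t v) = c v"
      using character_frag_extend[of "frag_of v"] one by (simp add: keys_frag_of)
    then show ?case using z by (simp add: character_frag_extend t_in_lspan[OF one])
  next
    case (diff a b)
    then have "relabel shift_var (frag_extend t a) \<in> lspan" "relabel shift_var (frag_extend t b) \<in> lspan"
      using shift_closed_lspan' by (auto simp: shift_closed_def)
    with diff show ?case
      by (simp add: frag_extend_diff relabel_diff character_diff sigma_divide subgrp_diff[OF subgrp_lspan])
  qed
  then show ?thesis by (simp add: z)
qed

end

subsection \<open>Existence of reduced strong Groebner bases\<close>

definition leading_at :: "vect \<Rightarrow> nat \<times> nat \<Rightarrow> int \<Rightarrow> bool" where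
  "leading_at u v a \<longleftrightarrow> a > 0 \<and> lookup u v = a \<and> (\<forall>w>v. lookup u w = 0)"

locale shift_lattice =
  fixes M :: "vect set" and n :: nat
  assumes M: "subgrp M" "shift_closed M" and bounded: "u \<in> M \<Longrightarrow> v \<in> keys u \<Longrightarrow> fst v < n"
begin

definition leads :: "(nat \<times> nat) set" where
  "leads = {v. \<exists>u\<in>M. \<exists>a. leading_at u v a}"

definition min_lead :: "nat \<times> nat \<Rightarrow> nat" where
  "min_lead v = (LEAST k. \<exists>u\<in>M. leading_at u v (int k))"

lemma leads_nat: "v \<in> leads \<Longrightarrow> \<exists>k. \<exists>u\<in>M. leading_at u v (int k)"
proof -
  assume "v \<in> leads"
  then obtain u a where u: "u \<in> M" "leading_at u v a" by (auto simp: leads_def)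
  then have "leading_at u v (int (nat a))" by (simp add: leading_at_def)
  with u(1) show ?thesis by blast
qed

lemma min_lead_attained: "v \<in> leads \<Longrightarrow> \<exists>u\<in>M. leading_at u v (int (min_lead v))"
  unfolding min_lead_def using leads_nat LeastI_ex[of "\<lambda>k. \<exists>u\<in>M. leading_at u v (int k)"] by blast

lemma min_lead_le: "u \<in> M \<Longrightarrow> leading_at u v (int k) \<Longrightarrow> min_lead v \<le> k"
  unfolding min_lead_def by (rule Least_le) blast

lemma min_lead_pos: "v \<in> leads \<Longrightarrow> min_lead v > 0"
  using min_lead_attained[of v] by (auto simp: leading_at_def)

lemma leads_shift:
  assumes "v \<in> leads"
  shows "shift_var v \<in> leads" "min_lead (shift_var v) \<le> min_lead v"
proof -
  obtain u where u: "u \<in> M" "leading_at u v (int (min_lead v))" using min_lead_attained[OF assms] by blast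
  have "leading_at (relabel shift_var u) (shift_var v) (int (min_lead v))"
    unfolding leading_at_def
  proof (intro conjI allI impI)
    fix w assume w: "shift_var v < w"
    show "lookup (relabel shift_var u) w = 0"
    proof (cases "w \<in> range shift_var")
      case True
      then obtain x where x: "w = shift_var x" by auto
      then have "v < x" using w by (auto simp: shift_var_def less_prod_def')
      then show ?thesis using u(2) by (simp add: x lookup_relabel[OF inj_shift_var] leading_at_def)
    qed (simp add: lookup_relabel_outside)
  qed (use u(2) in \<open>simp_all add: leading_at_def lookup_relabel[OF inj_shift_var]\<close>)
  moreover have "relabel shift_var u \<in> M" using M(2) u(1) by (simp add: shift_closed_def)
  ultimately show "shift_var v \<in> leads" "min_lead (shift_var v) \<le> min_lead v"
    by (auto simp: leads_def intro: min_lead_le)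
qed

lemma leads_mono:
  assumes "(p, d) \<in> leads" "d \<le> e"
  shows "(p, e) \<in> leads \<and> min_lead (p, e) \<le> min_lead (p, d)"
  using assms(2)
proof (induction e rule: dec_induct)
  case (step e)
  then show ?case using leads_shift[of "(p, e)"] by (auto simp: shift_var_def)
qed (use assms in simp)

lemma min_lead_dvd:
  assumes "u \<in> M" "v \<in> leads" "\<And>w. v < w \<Longrightarrow> lookup u w = 0"
  shows "int (min_lead v) dvd lookup u v"
proof (rule ccontr)
  let ?m = "int (min_lead v)" and ?a = "lookup u v"
  assume "\<not> ?m dvd ?a"
  then have ne: "?a mod ?m \<noteq> 0" by (simp add: dvd_eq_mod_eq_0)
  have m: "?m > 0" using min_lead_pos[OF assms(2)] by simp
  obtain b where b: "b \<in> M" "leading_at b v ?m" using min_lead_attained[OF assms(2)] by blast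
  let ?r = "u - frag_cmul (?a div ?m) b"
  have "?r \<in> M" using assms(1) b(1) M(1) by (intro subgrp_diff subgrp_cmul)
  moreover have "leading_at ?r v (int (nat (?a mod ?m)))"
    using assms(3) b(2) ne m pos_mod_sign[OF m, of ?a]
    by (auto simp: leading_at_def lookup_minus minus_div_mult_eq_mod[symmetric])
  ultimately have "min_lead v \<le> nat (?a mod ?m)" by (rule min_lead_le)
  then show False using pos_mod_bound[OF m, of ?a] m by linarith
qed

lemma lead_in_leads:
  assumes "u \<in> M" "u \<noteq> 0"
  shows "Max (keys u) \<in> leads"
proof -
  let ?v = "Max (keys u)"
  have v: "?v \<in> keys u" using assms(2) by (intro Max_in) auto
  have z: "lookup u w = 0" if "?v < w" for w
  proof (rule ccontr)
    assume "lookup u w \<noteq> 0"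
    then have "w \<le> ?v" by (simp add: in_keys_iff)
    with that show False by simp
  qed
  show ?thesis
  proof (cases "lookup u ?v > 0")
    case True
    then show ?thesis using assms(1) z unfolding leads_def leading_at_def by blast
  next
    case False
    then have "leading_at (- u) ?v (- lookup u ?v)"
      using v z by (auto simp: leading_at_def in_keys_iff)
    then show ?thesis using subgrp_uminus[OF M(1) assms(1)] by (auto simp: leads_def)
  qed
qed

text \<open>Division with remainder from the top variable downwards.\<close>

lemma reduction_below:
  "\<exists>m\<in>M. (\<forall>w\<ge>v. lookup m w = 0) \<and>
     (\<forall>w<v. w \<in> leads \<longrightarrow> 0 \<le> lookup (u - m) w \<and> lookup (u - m) w < int (min_lead w))"
proof (induction v arbitrary: u rule: less_induct)
  case (less v)
  let ?ok = "\<lambda>u w. 0 \<le> lookup u w \<and> lookup u w < int (min_lead w)"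
  let ?bad = "{w. w < v \<and> w \<in> leads \<and> \<not> ?ok u w}"
  have fin: "finite ?bad"
  proof (rule finite_subset)
    show "?bad \<subseteq> keys u" using min_lead_pos by (auto simp: in_keys_iff)
  qed simp
  show ?case
  proof (cases "?bad = {}")
    case True
    then show ?thesis using subgrp_zero[OF M(1)] by (intro bexI[of _ 0]) auto
  next
    case False
    define x where "x = Max ?bad"
    have x: "x < v" "x \<in> leads" using Max_in[OF fin False] by (auto simp: x_def)
    have above: "?ok u w" if "x < w" "w < v" "w \<in> leads" for w
    proof (rule ccontr)
      assume "\<not> ?ok u w"
      then have "w \<le> x" unfolding x_def using that by (intro Max_ge[OF fin]) auto
      with that(1) show False by simp
    qed
    let ?m = "int (min_lead x)"
    have m: "?m > 0" using min_lead_pos[OF x(2)] by simp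
    obtain b where b: "b \<in> M" "leading_at b x ?m" using min_lead_attained[OF x(2)] by blast
    define k where "k = lookup u x div ?m"
    obtain m' where m': "m' \<in> M" "\<forall>w\<ge>x. lookup m' w = 0"
      "\<forall>w<x. w \<in> leads \<longrightarrow> ?ok (u - frag_cmul k b - m') w"
      using less.IH[OF x(1), of "u - frag_cmul k b"] by blast
    let ?s = "frag_cmul k b + m'"
    have "?s \<in> M" using b(1) m'(1) M(1) by (intro subgrp_add subgrp_cmul)
    moreover have "lookup ?s w = 0" if "v \<le> w" for w
    proof -
      have "x < w" using x(1) that by (rule order_less_le_trans)
      then show ?thesis using b(2) m'(2) by (simp add: lookup_add leading_at_def)
    qed
    moreover have "?ok (u - ?s) w" if w: "w < v" "w \<in> leads" for w
    proof -
      consider "w < x" | "w = x" | "x < w" by force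
      then show ?thesis
      proof cases
        case 1
        then show ?thesis using m'(3) w(2) by (simp add: lookup_minus lookup_add algebra_simps)
      next
        case 2
        then show ?thesis using b(2) m'(2) m
          by (simp add: lookup_minus lookup_add leading_at_def k_def minus_div_mult_eq_mod)
      next
        case 3
        then show ?thesis using b(2) m'(2) above[OF 3 w] by (simp add: lookup_minus lookup_add leading_at_def)
      qed
    qed
    ultimately show ?thesis by (intro bexI[of _ ?s]) auto
  qed
qed

text \<open>The bound on absolute values keeps multiples of leading monomials out of both the positive and the negative
  part of the vector.\<close>

lemma reduced_element:
  assumes "v \<in> leads"
  shows "\<exists>u\<in>M. leading_at u v (int (min_lead v)) \<and>
    (\<forall>w<v. w \<in> leads \<longrightarrow> \<bar>lookup u w\<bar> < int (min_lead w))"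
proof -
  obtain b where b: "b \<in> M" "leading_at b v (int (min_lead v))" using min_lead_attained[OF assms] by blast
  obtain m where m: "m \<in> M" "\<forall>w\<ge>v. lookup m w = 0"
     "\<forall>w<v. w \<in> leads \<longrightarrow> 0 \<le> lookup (b - m) w \<and> lookup (b - m) w < int (min_lead w)"
    using reduction_below[of v b] by blast
  show ?thesis
  proof (rule bexI[of _ "b - m"])
    show "b - m \<in> M" using M(1) b(1) m(1) by (rule subgrp_diff)
  qed (use b(2) m(2,3) in \<open>auto simp: leading_at_def lookup_minus\<close>)
qed

definition reduced_at :: "nat \<times> nat \<Rightarrow> vect" where
  "reduced_at v = (SOME u. u \<in> M \<and> leading_at u v (int (min_lead v)) \<and>
    (\<forall>w<v. w \<in> leads \<longrightarrow> \<bar>lookup u w\<bar> < int (min_lead w)))"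

lemma reduced_at:
  assumes "v \<in> leads"
  shows "reduced_at v \<in> M" "leading_at (reduced_at v) v (int (min_lead v))"
    "\<And>w. w < v \<Longrightarrow> w \<in> leads \<Longrightarrow> \<bar>lookup (reduced_at v) w\<bar> < int (min_lead w)"
  using someI_ex[OF reduced_element[OF assms, unfolded Bex_def]]
  unfolding reduced_at_def[symmetric] by blast+

text \<open>The places where a minimal leading coefficient first exists or drops.\<close>

definition jumps :: "(nat \<times> nat) set" where
  "jumps = {v \<in> leads. snd v = 0 \<or> (fst v, snd v - 1) \<notin> leads \<or> min_lead (fst v, snd v - 1) \<noteq> min_lead v}"

lemma jumps_strict:
  assumes "(p, d) \<in> leads" "(p, e) \<in> jumps" "d < e"
  shows "min_lead (p, e) < min_lead (p, d)"
proof -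
  have 1: "(p, e - 1) \<in> leads" "min_lead (p, e - 1) \<le> min_lead (p, d)"
    using leads_mono[OF assms(1), of "e - 1"] assms(3) by auto
  then have "min_lead (p, e) \<noteq> min_lead (p, e - 1)" using assms by (auto simp: jumps_def)
  moreover have "min_lead (p, e) \<le> min_lead (p, e - 1)"
    using leads_mono[OF 1(1), of e] by auto
  ultimately show ?thesis using 1(2) by simp
qed

text \<open>At each indeterminate the minimal leading coefficients form a weakly decreasing sequence of positive integers.\<close>

lemma finite_jumps: "finite jumps"
proof -
  have "finite {d. (p, d) \<in> jumps}" for p
  proof (cases "{d. (p, d) \<in> jumps} = {}")
    case False
    define d0 where "d0 = (LEAST d. (p, d) \<in> jumps)"
    have d0: "(p, d0) \<in> jumps" using False unfolding d0_def by (auto intro: LeastI)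
    then have l0: "(p, d0) \<in> leads" by (simp add: jumps_def)
    have "inj_on (\<lambda>d. min_lead (p, d)) {d. (p, d) \<in> jumps}"
    proof (rule inj_onI)
      fix d e assume de: "d \<in> {d. (p, d) \<in> jumps}" "e \<in> {d. (p, d) \<in> jumps}" "min_lead (p, d) = min_lead (p, e)"
      then have "(p, d) \<in> leads" "(p, e) \<in> leads" by (auto simp: jumps_def)
      then show "d = e"
        using jumps_strict[of p d e] jumps_strict[of p e d] de by (cases d e rule: linorder_cases) auto
    qed
    moreover have "(\<lambda>d. min_lead (p, d)) ` {d. (p, d) \<in> jumps} \<subseteq> {..min_lead (p, d0)}"
    proof safe
      fix d assume "(p, d) \<in> jumps"
      then have "d0 \<le> d" unfolding d0_def by (rule Least_le)
      then show "min_lead (p, d) \<le> min_lead (p, d0)" using leads_mono[OF l0] by auto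
    qed
    ultimately show ?thesis using finite_imageD finite_subset by blast
  qed simp
  moreover have "jumps \<subseteq> (\<Union>p\<in>{..<n}. Pair p ` {d. (p, d) \<in> jumps})"
  proof
    fix v assume v: "v \<in> jumps"
    then obtain u a where "u \<in> M" "leading_at u v a" by (auto simp: jumps_def leads_def)
    then have "fst v < n" using bounded[of u v] by (auto simp: leading_at_def in_keys_iff)
    then show "v \<in> (\<Union>p\<in>{..<n}. Pair p ` {d. (p, d) \<in> jumps})" using v by (cases v) auto
  qed
  ultimately show ?thesis by (meson finite_UN_I finite_imageI finite_lessThan finite_subset)
qed

lemma jump_below:
  assumes "(p, d) \<in> leads"
  shows "\<exists>e\<le>d. (p, e) \<in> jumps"
  using assms
proof (induction d)
  case (Suc d)
  then show ?case by (cases "(p, Suc d) \<in> jumps") (auto simp: jumps_def intro: le_SucI)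
qed (auto simp: jumps_def)

lemma min_lead_last_jump:
  assumes "(p, e) \<in> leads" "e \<le> d" "\<And>k. e < k \<Longrightarrow> k \<le> d \<Longrightarrow> (p, k) \<notin> jumps"
  shows "min_lead (p, d) = min_lead (p, e)"
  using assms(2,3)
proof (induction d rule: dec_induct)
  case (step d)
  then have "(p, Suc d) \<notin> jumps" "min_lead (p, d) = min_lead (p, e)" by auto
  moreover have "(p, Suc d) \<in> leads" "(p, d) \<in> leads"
    using leads_mono[OF assms(1), of "Suc d"] leads_mono[OF assms(1), of d] step by auto
  ultimately show ?case by (auto simp: jumps_def)
qed simp

text \<open>Division by the elements with minimal leading coefficients: these divide all leading coefficients at the same
  variable.\<close>

lemma span_by_leading:
  assumes "echelon leads t" "\<And>v. v \<in> leads \<Longrightarrow> t v \<in> M \<and> leading_at (t v) v (int (min_lead v))"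
  shows "echelon.lspan leads t = M"
proof
  interpret echelon leads t by (rule assms(1))
  show "lspan \<subseteq> M" using assms(2) by (auto simp: lspan_def intro!: subgrp_frag_extend[OF M(1)])
  have "u \<in> lspan" if "u \<in> M" "\<forall>w\<in>keys u. w < v" for u v
    using that
  proof (induction v arbitrary: u rule: less_induct)
    case (less v)
    show ?case
    proof (cases "u = 0")
      case True
      then show ?thesis by (simp add: subgrp_zero[OF subgrp_lspan])
    next
      case False
      let ?x = "Max (keys u)"
      have x: "?x \<in> keys u" "?x \<in> leads"
        using False lead_in_leads[OF less.prems(1) False] by auto
      have above: "lookup u w = 0" if "?x < w" for w
      proof (rule ccontr)
        assume "lookup u w \<noteq> 0"
        then have "w \<le> ?x" by (simp add: in_keys_iff)
        with that show False by simp
      qed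
      obtain q where q: "lookup u ?x = int (min_lead ?x) * q"
        using min_lead_dvd[OF less.prems(1) x(2) above] by (auto elim: dvdE)
      let ?u = "u - frag_cmul q (t ?x)"
      have "?u \<in> M" using less.prems(1) assms(2)[OF x(2)] M(1) by (auto intro: subgrp_diff subgrp_cmul)
      moreover have "\<forall>w\<in>keys ?u. w < ?x"
      proof (rule ballI, rule ccontr)
        fix w assume w: "w \<in> keys ?u" "\<not> w < ?x"
        show False
        proof (cases "w = ?x")
          case True
          then show False using w(1) q assms(2)[OF x(2)] by (simp add: in_keys_iff lookup_minus leading_at_def)
        next
          case False
          then have "?x < w" using w(2) by simp
          then show False using w(1) above assms(2)[OF x(2)] by (simp add: in_keys_iff lookup_minus leading_at_def)
        qed
      qed
      ultimately have "?u \<in> lspan" using less.IH[of ?x ?u] less.prems(2) x(1) by blast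
      then have "?u + frag_cmul q (t ?x) \<in> lspan"
        by (intro subgrp_add[OF subgrp_lspan] subgrp_cmul[OF subgrp_lspan] t_in_lspan x(2))
      then show ?thesis by simp
    qed
  qed
  note * = this
  show "M \<subseteq> lspan"
  proof
    fix u assume u: "u \<in> M"
    show "u \<in> lspan"
    proof (cases "u = 0")
      case True
      then show ?thesis by (simp add: subgrp_zero[OF subgrp_lspan])
    next
      case False
      have "w < shift_var (Max (keys u))" if "w \<in> keys u" for w
      proof -
        have "w \<le> Max (keys u)" using that by simp
        also have "\<dots> < shift_var (Max (keys u))" by (simp add: shift_var_def less_prod_def')
        finally show ?thesis .
      qed
      then show ?thesis using *[OF u] by blast
    qed
  qed
qed

end

section \<open>Certificates for saturated lattices\<close>

lemma frag_cmul_diff2: "frag_cmul k (a - b) = frag_cmul k a - frag_cmul k b"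
  by (rule poly_mapping_eqI) (simp add: lookup_minus algebra_simps)

text \<open>Programs represent an integer vector by a word, a formal sum of signed variables (\<open>True\<close> is the positive
  sign). An entry is a lattice vector split into its leading variable, its positive leading coefficient and the
  word of the remaining terms.\<close>

type_synonym letter = "bool \<times> nat \<times> nat"
type_synonym word = "letter list"
type_synonym entry = "(nat \<times> nat) \<times> nat \<times> word"

definition vec :: "word \<Rightarrow> vect" where
  "vec w = (\<Sum>l\<leftarrow>w. single (snd l) (if fst l then 1 else -1))"

definition neg_word :: "word \<Rightarrow> word" where
  "neg_word w = map (\<lambda>l. (\<not> fst l, snd l)) w"

definition sign_word :: "bool \<Rightarrow> word \<Rightarrow> word" where
  "sign_word s w = (if s then w else neg_word w)"

definition shift_word :: "nat \<Rightarrow> word \<Rightarrow> word" where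
  "shift_word k w = map (\<lambda>l. (fst l, (fst (snd l), snd (snd l) + k))) w"

text \<open>A second copy of the indeterminates, ranked above the first.\<close>

definition raise_word :: "nat \<Rightarrow> word \<Rightarrow> word" where
  "raise_word n w = map (\<lambda>l. (fst l, (fst (snd l) + n, snd (snd l)))) w"

definition occurrences :: "bool \<Rightarrow> nat \<times> nat \<Rightarrow> word \<Rightarrow> nat" where
  "occurrences s v w = length (filter (\<lambda>l. fst l = s \<and> snd l = v) w)"

text \<open>Words are tested for equality as vectors by counting letters.\<close>

definition null_word :: "word \<Rightarrow> bool" where
  "null_word w = list_all (\<lambda>l. occurrences True (snd l) w = occurrences False (snd l) w) w"

definition same_vector :: "word \<Rightarrow> word \<Rightarrow> bool" where
  "same_vector u w = null_word (u @ neg_word w)"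

text \<open>The leading variable of the entry has \<open>v\<close> among its transforms.\<close>

definition matches :: "entry \<Rightarrow> nat \<times> nat \<Rightarrow> bool" where
  "matches g v = (fst (fst g) = fst v \<and> snd (fst g) \<le> snd v)"

definition has_lead :: "entry list \<Rightarrow> nat \<times> nat \<Rightarrow> bool" where
  "has_lead G v = list_ex (\<lambda>g. matches g v) G"

definition entry_word :: "entry \<Rightarrow> word" where
  "entry_word g = replicate (fst (snd g)) (True, fst g) @ snd (snd g)"

text \<open>The transform of an entry that leads at \<open>v\<close>; as \<open>G\<close> is sorted, the last matching entry is the one of
  highest order.\<close>

definition basis_word :: "entry list \<Rightarrow> nat \<times> nat \<Rightarrow> word" where
  "basis_word G v = foldl (\<lambda>b g. if matches g v then shift_word (snd v - snd (fst g)) (entry_word g) else b) [] G"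

definition combination :: "entry list \<Rightarrow> word \<Rightarrow> word" where
  "combination G u = concat (map (\<lambda>l. sign_word (fst l) (basis_word G (snd l))) u)"

text \<open>The word \<open>u\<close> is a coordinate vector of \<open>w\<close> with respect to the vectors \<open>basis_word G v\<close>.\<close>

definition span_ok :: "entry list \<Rightarrow> word \<Rightarrow> word \<Rightarrow> bool" where
  "span_ok G w u = (list_all (\<lambda>l. has_lead G (snd l)) u \<and> same_vector w (combination G u))"

text \<open>The list \<open>U\<close> contains all coordinate vectors that a certificate needs.\<close>

definition in_span :: "entry list \<Rightarrow> word list \<Rightarrow> word \<Rightarrow> bool" where
  "in_span G U w = list_ex (\<lambda>u. span_ok G w u) U"

definition entry_ok :: "nat \<Rightarrow> entry \<Rightarrow> bool" where
  "entry_ok n g = (fst (fst g) < n \<and> 0 < fst (snd g) \<and>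
     list_all (\<lambda>l. snd l < fst g \<and> occurrences (\<not> fst l) (snd l) (snd (snd g)) = 0) (snd (snd g)))"

definition reduced_ok :: "entry \<Rightarrow> entry \<Rightarrow> bool" where
  "reduced_ok g h = (fst g = fst h \<or>
     list_all (\<lambda>l. \<not> matches g (snd l) \<or> occurrences (fst l) (snd l) (entry_word h) < fst (snd g)) (entry_word h))"

definition prev_var :: "nat \<times> nat \<Rightarrow> nat \<times> nat" where
  "prev_var v = (fst v, snd v - 1)"

text \<open>If the leading coefficient drops at an entry, then the shift of the previous basis vector is not itself a
  basis vector, and its membership in the span has to be witnessed. These are the only S-polynomials.\<close>

definition boundary_ok :: "entry list \<Rightarrow> word list \<Rightarrow> entry \<Rightarrow> bool" where
  "boundary_ok G U g = (snd (fst g) = 0 \<or> \<not> has_lead G (prev_var (fst g)) \<or>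
     in_span G U (shift_word 1 (basis_word G (prev_var (fst g)))))"

definition gb_ok :: "nat \<Rightarrow> entry list \<Rightarrow> word list \<Rightarrow> bool" where
  "gb_ok n G U = (sorted_wrt (\<lambda>g h. fst g < fst h) G \<and> list_all (\<lambda>g. entry_ok n g) G \<and>
     list_all (\<lambda>g. boundary_ok G U g) G \<and> list_all (\<lambda>g. list_all (\<lambda>h. reduced_ok g h) G) G)"

definition lead_product :: "entry list \<Rightarrow> nat" where
  "lead_product G = foldl (\<lambda>b g. b * fst (snd g)) 1 G"

definition graph_generator :: "nat \<Rightarrow> nat \<Rightarrow> nat \<Rightarrow> word" where
  "graph_generator n c j = replicate c (True, (j + n, 1)) @ [(True, (j, 0))]"

text \<open>Let $c$ be the product of the leading coefficients of \<open>G\<close>. By the first two conditions the span of \<open>H\<close> contains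
  the vectors $(w, f)$ with $w - c x f$ in the span of \<open>G\<close>, where $w$ is written in the upper copy of the
  indeterminates. If $c x f$ is in the span of \<open>G\<close>, then $(0, f)$ is among them and is a combination of the
  elements of \<open>H\<close> that lead in the lower copy. So the last condition allows $c x$ to be cancelled.\<close>

definition sat_ok :: "nat \<Rightarrow> entry list \<Rightarrow> entry list \<Rightarrow> word list \<Rightarrow> bool" where
  "sat_ok n G H U = (list_all (\<lambda>g. in_span H U (raise_word n (entry_word g))) G \<and>
     list_all (\<lambda>j. in_span H U (graph_generator n (lead_product G) j)) [0..<n] \<and>
     list_all (\<lambda>h. \<not> fst (fst h) < n \<or> in_span G U (entry_word h)) H)"

definition lead_set :: "entry list \<Rightarrow> (nat \<times> nat) set" where
  "lead_set G = {v. has_lead G v}"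

definition basis_vector :: "entry list \<Rightarrow> nat \<times> nat \<Rightarrow> vect" where
  "basis_vector G v = vec (basis_word G v)"

abbreviation gspan :: "entry list \<Rightarrow> vect set" where
  "gspan G \<equiv> echelon.lspan (lead_set G) (basis_vector G)"

lemma vec_Nil [simp]: "vec [] = 0"
  and vec_Cons: "vec (l # w) = single (snd l) (if fst l then 1 else -1) + vec w"
  and vec_append [simp]: "vec (u @ w) = vec u + vec w"
  by (simp_all add: vec_def)

lemma vec_concat: "vec (concat ws) = sum_list (map vec ws)"
  by (induction ws) auto

lemma vec_replicate: "vec (replicate k l) = single (snd l) (if fst l then int k else - int k)"
  by (induction k) (auto simp: vec_Cons single_add[symmetric])

lemma vec_neg_word [simp]: "vec (neg_word w) = - vec w"
  by (induction w) (auto simp: neg_word_def vec_Cons single_uminus[symmetric])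

lemma vec_sign_word: "vec (sign_word s w) = frag_cmul (if s then 1 else -1) (vec w)"
  by (auto simp: sign_word_def intro!: poly_mapping_eqI)

lemma vec_shift_word: "vec (shift_word k w) = (relabel shift_var ^^ k) (vec w)"
proof -
  have 1: "vec (shift_word 1 w) = relabel shift_var (vec w)" for w
    by (induction w) (auto simp: shift_word_def vec_Cons relabel_add shift_var_def)
  show ?thesis
  proof (induction k)
    case (Suc k)
    have "shift_word (Suc k) w = shift_word 1 (shift_word k w)" by (simp add: shift_word_def)
    then show ?case by (simp only: 1 Suc funpow.simps comp_apply)
  qed (simp add: shift_word_def)
qed

lemma vec_raise_word: "vec (raise_word n w) = relabel (\<lambda>v. (fst v + n, snd v)) (vec w)"
  by (induction w) (auto simp: raise_word_def vec_Cons relabel_add)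

lemma lookup_vec: "lookup (vec w) v = int (occurrences True v w) - int (occurrences False v w)"
  by (induction w) (auto simp: vec_Cons occurrences_def lookup_add lookup_single when_def)

lemma occurrences_eq_0: "occurrences s v w = 0 \<longleftrightarrow> (s, v) \<notin> set w"
  by (induction w) (auto simp: occurrences_def)

lemma null_word_iff: "null_word w \<longleftrightarrow> vec w = 0"
proof
  assume w: "null_word w"
  show "vec w = 0"
  proof (rule poly_mapping_eqI)
    fix v
    show "lookup (vec w) v = lookup 0 v"
    proof (cases "v \<in> snd ` set w")
      case True
      then show ?thesis using w by (auto simp: null_word_def list_all_iff lookup_vec)
    next
      case False
      then have "occurrences s v w = 0" for s by (force simp: occurrences_eq_0)
      then show ?thesis by (simp add: lookup_vec)
    qed
  qed
next
  assume "vec w = 0"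
  then have "int (occurrences True v w) - int (occurrences False v w) = 0" for v by (simp flip: lookup_vec)
  then show "null_word w" by (simp add: null_word_def list_all_iff)
qed

lemma same_vector_iff: "same_vector u w \<longleftrightarrow> vec u = vec w"
  by (simp add: same_vector_def null_word_iff)

lemma keys_vec: "keys (vec w) \<subseteq> snd ` set w"
proof
  fix v assume "v \<in> keys (vec w)"
  then have "occurrences True v w \<noteq> 0 \<or> occurrences False v w \<noteq> 0" by (auto simp: in_keys_iff lookup_vec)
  then show "v \<in> snd ` set w" by (force simp: occurrences_eq_0)
qed

lemma vec_combination: "vec (combination G u) = frag_extend (basis_vector G) (vec u)"
proof (induction u)
  case (Cons l u)
  have "single (snd l) (if fst l then 1 else -1) = frag_cmul (if fst l then 1 else -1) (frag_of (snd l))"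
    by (rule poly_mapping_eqI) (auto simp: lookup_single when_def)
  then show ?case
    using Cons by (simp add: combination_def vec_Cons frag_extend_add frag_extend_cmul vec_sign_word basis_vector_def)
qed (simp add: combination_def)

text \<open>The word of a vector in which no variable occurs with both signs.\<close>

definition wordof :: "vect \<Rightarrow> word" where
  "wordof u = concat (map (\<lambda>v. replicate (nat \<bar>lookup u v\<bar>) (lookup u v > 0, v))
     (sorted_list_of_set (keys u)))"

lemma vec_wordof [simp]: "vec (wordof u) = u"
proof -
  have "vec (wordof u) = (\<Sum>v\<leftarrow>sorted_list_of_set (keys u). single v (lookup u v))"
    unfolding wordof_def vec_concat
    by (auto simp: vec_replicate comp_def intro!: arg_cong[of _ _ sum_list])
  also have "\<dots> = (\<Sum>v\<in>keys u. single v (lookup u v))"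
    by (subst sum_list_distinct_conv_sum_set) simp_all
  finally show ?thesis by (simp flip: dpoly_expand)
qed

lemma in_wordof: "(s, v) \<in> set (wordof u) \<Longrightarrow> v \<in> keys u \<and> s = (lookup u v > 0)"
  by (auto simp: wordof_def split: if_splits)

lemma occurrences_wordof:
  assumes "(s, v) \<in> set (wordof u)"
  shows "int (occurrences s v (wordof u)) = \<bar>lookup u v\<bar>" "occurrences (\<not> s) v (wordof u) = 0"
proof -
  have s: "s = (lookup u v > 0)" using in_wordof[OF assms] by simp
  show z: "occurrences (\<not> s) v (wordof u) = 0" using in_wordof[of "\<not> s" v u] s by (auto simp: occurrences_eq_0)
  show "int (occurrences s v (wordof u)) = \<bar>lookup u v\<bar>"
    using z lookup_vec[of "wordof u" v] s by (cases s) auto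
qed

subsection \<open>Soundness of the Groebner basis test\<close>

text \<open>The fold keeps the last match, and the entries are sorted.\<close>

lemma basis_word_match:
  assumes "sorted_wrt (\<lambda>g h. fst g < fst h) G" "has_lead G v"
  shows "\<exists>g\<in>set G. matches g v \<and> basis_word G v = shift_word (snd v - snd (fst g)) (entry_word g) \<and>
    (\<forall>h\<in>set G. matches h v \<longrightarrow> fst h \<le> fst g)"
  using assms
proof (induction G rule: rev_induct)
  case (snoc g G)
  show ?case
  proof (cases "matches g v")
    case True
    have "fst h \<le> fst g" if "h \<in> set (G @ [g])" for h
      using snoc.prems(1) that by (auto simp: sorted_wrt_append intro: less_imp_le)
    then show ?thesis using True by (intro bexI[of _ g]) (auto simp: basis_word_def)
  next
    case False
    then have "has_lead G v" using snoc.prems(2) by (auto simp: has_lead_def)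
    moreover have "sorted_wrt (\<lambda>g h. fst g < fst h) G" using snoc.prems(1) by (simp add: sorted_wrt_append)
    ultimately obtain h where "h \<in> set G" "matches h v" "basis_word G v = shift_word (snd v - snd (fst h)) (entry_word h)"
        "\<forall>k\<in>set G. matches k v \<longrightarrow> fst k \<le> fst h"
      using snoc.IH by blast
    then show ?thesis using False by (intro bexI[of _ h]) (auto simp: basis_word_def)
  qed
qed (simp add: has_lead_def)

lemma sorted_leads_inj:
  fixes G :: "entry list"
  assumes "sorted_wrt (\<lambda>g h. fst g < fst h) G" "g \<in> set G" "h \<in> set G" "fst g = fst h"
  shows "g = h"
proof -
  obtain i where i: "i < length G" "G ! i = g" using assms(2) by (auto simp: in_set_conv_nth)
  obtain j where j: "j < length G" "G ! j = h" using assms(3) by (auto simp: in_set_conv_nth)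
  have "\<not> i < j" using sorted_wrt_nth_less[OF assms(1) _ j(1), of i] i j assms(4) by auto
  moreover have "\<not> j < i" using sorted_wrt_nth_less[OF assms(1) _ i(1), of j] i j assms(4) by auto
  ultimately show ?thesis using i j by simp
qed

lemma lead_entry_word:
  assumes "entry_ok n g"
  shows "lookup (vec (entry_word g)) (fst g) = int (fst (snd g))"
    "\<And>w. fst g < w \<Longrightarrow> lookup (vec (entry_word g)) w = 0"
    "\<And>w. w \<in> keys (vec (entry_word g)) \<Longrightarrow> w \<le> fst g"
proof -
  have tail: "lookup (vec (snd (snd g))) w = 0" if "\<not> w < fst g" for w
  proof -
    have "w \<notin> snd ` set (snd (snd g))" using assms that by (auto simp: entry_ok_def list_all_iff)
    then show ?thesis using keys_vec[of "snd (snd g)"] by (auto simp: in_keys_iff)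
  qed
  show "lookup (vec (entry_word g)) (fst g) = int (fst (snd g))"
    using tail[of "fst g"] by (simp add: entry_word_def vec_replicate lookup_add)
  show above: "lookup (vec (entry_word g)) w = 0" if "fst g < w" for w
    using tail[of w] that by (auto simp: entry_word_def vec_replicate lookup_add lookup_single when_def)
  show "w \<le> fst g" if "w \<in> keys (vec (entry_word g))" for w
    using above[of w] that by (force simp: in_keys_iff)
qed

lemma basis_vector_match:
  assumes "gb_ok n G U" "v \<in> lead_set G"
  obtains g where "g \<in> set G" "matches g v" "entry_ok n g" "\<forall>h\<in>set G. matches h v \<longrightarrow> fst h \<le> fst g"
    "basis_vector G v = (relabel shift_var ^^ (snd v - snd (fst g))) (vec (entry_word g))"
    "lookup (basis_vector G v) v = int (fst (snd g))"
    "\<And>w. v < w \<Longrightarrow> lookup (basis_vector G v) w = 0"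
proof -
  obtain g where g: "g \<in> set G" "matches g v" "basis_word G v = shift_word (snd v - snd (fst g)) (entry_word g)"
      "\<forall>h\<in>set G. matches h v \<longrightarrow> fst h \<le> fst g"
    using basis_word_match[of G v] assms by (auto simp: gb_ok_def lead_set_def)
  have ok: "entry_ok n g" using assms(1) g(1) by (auto simp: gb_ok_def list_all_iff)
  define k where "k = snd v - snd (fst g)"
  have k: "fst g = (fst v, snd v - k)" "k \<le> snd v"
    using g(2) by (auto simp: matches_def k_def prod_eq_iff)
  have t: "basis_vector G v = (relabel shift_var ^^ k) (vec (entry_word g))"
    by (simp add: basis_vector_def g(3) vec_shift_word k_def)
  show ?thesis
  proof (rule that[OF g(1,2) ok g(4)])
    show "basis_vector G v = (relabel shift_var ^^ (snd v - snd (fst g))) (vec (entry_word g))"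
      using t by (simp add: k_def)
    show "lookup (basis_vector G v) v = int (fst (snd g))"
      using lookup_shift[of k "vec (entry_word g)" "fst v" "snd v"] k lead_entry_word(1)[OF ok] by (simp add: t)
    show "lookup (basis_vector G v) w = 0" if "v < w" for w
    proof (cases "k \<le> snd w")
      case True
      then have "fst g < (fst w, snd w - k)" using that k by (auto simp: less_prod_def')
      then show ?thesis
        using lookup_shift[of k "vec (entry_word g)" "fst w" "snd w"] lead_entry_word(2)[OF ok] True by (simp add: t)
    next
      case False
      then show ?thesis using lookup_shift[of k "vec (entry_word g)" "fst w" "snd w"] by (simp add: t)
    qed
  qed
qed

lemma gb_ok_echelon: "gb_ok n G U \<Longrightarrow> echelon (lead_set G) (basis_vector G)"
proof
  fix v assume ok: "gb_ok n G U" and v: "v \<in> lead_set G"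
  obtain g where g: "entry_ok n g" "lookup (basis_vector G v) v = int (fst (snd g))"
      "\<And>w. v < w \<Longrightarrow> lookup (basis_vector G v) w = 0"
    using basis_vector_match[OF ok v] by metis
  show "lookup (basis_vector G v) v > 0" using g(1,2) by (simp add: entry_ok_def)
  show "lookup (basis_vector G v) w = 0" if "v < w" for w using g(3) that .
qed

lemma in_spanD:
  assumes "gb_ok n G U'" "in_span G U w"
  shows "vec w \<in> gspan G"
proof -
  interpret echelon "lead_set G" "basis_vector G" using gb_ok_echelon[OF assms(1)] .
  obtain u where u: "u \<in> set U" "\<forall>l\<in>set u. has_lead G (snd l)" "vec w = vec (combination G u)"
    using assms(2) by (auto simp: in_span_def span_ok_def list_ex_iff list_all_iff same_vector_iff)
  have "keys (vec u) \<subseteq> lead_set G"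
  proof
    fix v assume "v \<in> keys (vec u)"
    then have "v \<in> snd ` set u" using keys_vec[of u] by (rule subsetD[rotated])
    then show "v \<in> lead_set G" using u(2) unfolding lead_set_def by blast
  qed
  then show ?thesis using u(3) by (auto simp: vec_combination lspan_def)
qed

lemma span_ok_exists:
  assumes "gb_ok n G U" "vec w \<in> gspan G"
  shows "\<exists>u. span_ok G w u"
proof -
  interpret echelon "lead_set G" "basis_vector G" using gb_ok_echelon[OF assms(1)] .
  obtain z where z: "vec w = frag_extend (basis_vector G) z" "keys z \<subseteq> lead_set G"
    using assms(2) by (auto simp: lspan_def)
  have "\<forall>l\<in>set (wordof z). has_lead G (snd l)"
  proof
    fix l assume "l \<in> set (wordof z)"
    then have "snd l \<in> keys z" using in_wordof[of "fst l" "snd l" z] by simp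
    then show "has_lead G (snd l)" using z(2) by (auto simp: lead_set_def)
  qed
  then have "span_ok G w (wordof z)" using z(1) by (simp add: span_ok_def list_all_iff same_vector_iff vec_combination)
  then show ?thesis by blast
qed

lemma lead_set_up:
  assumes "v \<in> lead_set G" shows "shift_var v \<in> lead_set G"
  using assms by (auto simp: lead_set_def has_lead_def list_ex_iff matches_def shift_var_def)

lemma matches_shift: "fst g \<noteq> shift_var v \<Longrightarrow> matches g (shift_var v) \<longleftrightarrow> matches g v"
  by (auto simp: matches_def shift_var_def prod_eq_iff)

lemma basis_word_shift:
  "shift_var v \<notin> fst ` set G \<Longrightarrow> basis_word G (shift_var v) = shift_word 1 (basis_word G v)"
proof (induction G rule: rev_induct)
  case (snoc g G)
  have "snd (shift_var v) - snd (fst g) = snd v - snd (fst g) + 1" if "matches g v"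
    using that by (auto simp: matches_def shift_var_def)
  then show ?case using snoc matches_shift[of g v]
    by (auto simp: basis_word_def shift_word_def)
qed (simp add: basis_word_def shift_word_def)

lemma boundary_in_span:
  assumes ok: "gb_ok n G U" and v: "v \<in> lead_set G" and g: "g \<in> set G" "fst g = shift_var v"
  shows "in_span G U (shift_word 1 (basis_word G v))"
proof -
  have "boundary_ok G U g" using ok g(1) by (auto simp: gb_ok_def list_all_iff)
  moreover have "prev_var (fst g) = v" "snd (fst g) \<noteq> 0" by (simp_all add: g(2) prev_var_def shift_var_def)
  ultimately show ?thesis using v by (auto simp: boundary_ok_def lead_set_def)
qed

text \<open>Where no entry leads, a basis vector is the shift of the one before it; at an entry \<open>boundary_ok\<close> applies.\<close>

lemma gb_ok_shift_closed:
  assumes ok: "gb_ok n G U"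
  shows "shift_closed (gspan G)"
proof -
  interpret echelon "lead_set G" "basis_vector G" using gb_ok_echelon[OF ok] .
  show ?thesis
  proof (rule shift_closed_lspan)
    fix v assume v: "v \<in> lead_set G"
    show "relabel shift_var (basis_vector G v) \<in> lspan"
    proof (cases "shift_var v \<in> fst ` set G")
      case True
      then obtain g where "g \<in> set G" "fst g = shift_var v" by auto
      from in_spanD[OF ok boundary_in_span[OF ok v this]] show ?thesis by (simp add: vec_shift_word basis_vector_def)
    next
      case False
      then show ?thesis
        using t_in_lspan[OF lead_set_up[OF v]] by (simp add: basis_vector_def basis_word_shift vec_shift_word)
    qed
  qed
qed

lemma gspan_bounded:
  assumes ok: "gb_ok n G U" and u: "u \<in> gspan G" "v \<in> keys u"
  shows "fst v < n"
proof -
  interpret echelon "lead_set G" "basis_vector G" using gb_ok_echelon[OF ok] .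
  obtain l where l: "l \<in> lead_set G" "\<And>w. l < w \<Longrightarrow> lookup u w = 0"
    using lspan_lead[OF u(1)] u(2) by (metis keys_zero empty_iff)
  obtain g where g: "entry_ok n g" "matches g l" using basis_vector_match[OF ok l(1)] by metis
  have "\<not> l < v" using l(2)[of v] u(2) by (auto simp: in_keys_iff)
  then have "fst v \<le> fst l" by (auto simp: less_prod_def')
  then show ?thesis using g by (auto simp: entry_ok_def matches_def)
qed

lemma entry_word_in_gspan:
  assumes ok: "gb_ok n G U" and g: "g \<in> set G"
  shows "vec (entry_word g) \<in> gspan G" "fst g \<in> lead_set G" "basis_vector G (fst g) = vec (entry_word g)"
proof -
  interpret echelon "lead_set G" "basis_vector G" using gb_ok_echelon[OF ok] .
  show l: "fst g \<in> lead_set G" using g by (auto simp: lead_set_def has_lead_def list_ex_iff matches_def)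
  obtain h where h: "h \<in> set G" "matches h (fst g)" "\<forall>k\<in>set G. matches k (fst g) \<longrightarrow> fst k \<le> fst h"
      "basis_vector G (fst g) = (relabel shift_var ^^ (snd (fst g) - snd (fst h))) (vec (entry_word h))"
    using basis_vector_match[OF ok l] by metis
  have "fst g \<le> fst h" using h(3) g by (auto simp: matches_def)
  moreover have "fst h \<le> fst g" using h(2) by (auto simp: matches_def less_eq_prod_def)
  ultimately have "fst g = fst h" by (rule antisym)
  then have "g = h" using sorted_leads_inj[OF _ g h(1)] ok unfolding gb_ok_def by blast
  then show t: "basis_vector G (fst g) = vec (entry_word g)" using h(4) by simp
  show "vec (entry_word g) \<in> gspan G" using t_in_lspan[OF l] t by simp
qed

subsection \<open>Soundness of the saturation test\<close>

lemma dvd_lead_product: "g \<in> set G \<Longrightarrow> fst (snd g) dvd lead_product G"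
proof -
  have "lead_product G = prod_list (map (\<lambda>g. fst (snd g)) G)"
  proof -
    have "foldl (\<lambda>b g. b * fst (snd g)) a G = a * prod_list (map (\<lambda>g. fst (snd g)) G)" for a
      by (induction G arbitrary: a) (auto simp: mult.assoc)
    then show ?thesis by (simp add: lead_product_def)
  qed
  then show "g \<in> set G \<Longrightarrow> fst (snd g) dvd lead_product G" by (auto intro: prod_list_dvd)
qed

text \<open>The vectors in the first \<open>n\<close> indeterminates are generated over $\mathbb{Z}[x]$ by the unit vectors.\<close>

lemma bounded_generated:
  fixes f :: vect
  assumes M: "subgrp M" "shift_closed M"
    and gen: "\<And>j. j < n \<Longrightarrow> h (frag_of (j, 0)) \<in> M"
    and h: "\<And>u w. h (u - w) = h u - h w" "\<And>u. h (relabel shift_var u) = relabel shift_var (h u)"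
    and f: "\<And>v. v \<in> keys f \<Longrightarrow> fst v < n"
  shows "h f \<in> M"
proof -
  have "h (frag_of v) \<in> M" if "fst v < n" for v
  proof -
    have "h (frag_of (j, d)) \<in> M" if "j < n" for j d
    proof (induction d)
      case (Suc d)
      then show ?case using h(2)[of "frag_of (j, d)"] M(2) by (simp add: shift_closed_def shift_var_def)
    qed (use gen that in simp)
    from this[OF that, of "snd v"] show ?thesis by simp
  qed
  moreover have "keys f \<subseteq> {v. fst v < n}" using f by auto
  ultimately show ?thesis
    using h(1)[of 0 0] subgrp_zero[OF M(1)]
    by (intro frag_induction[of f "{v. fst v < n}" "\<lambda>f. h f \<in> M"])
       (auto simp: h(1) intro: subgrp_diff[OF M(1)])
qed

text \<open>Cancellation of $c x$ suffices: pseudo-division by the basis multiplies with a power of $c$, and if a multiple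
  of \<open>u\<close> is in the lattice, the remainder vanishes, since an element of the lattice has a leading variable.\<close>

theorem sat_ok_saturated:
  assumes G: "gb_ok n G U" and H: "gb_ok (2 * n) H U" and sat: "sat_ok n G H U"
  shows "k \<noteq> 0 \<Longrightarrow> frag_cmul k u \<in> gspan G \<Longrightarrow> u \<in> gspan G"
    and "relabel shift_var u \<in> gspan G \<longleftrightarrow> u \<in> gspan G"
proof -
  interpret G: echelon "lead_set G" "basis_vector G" using gb_ok_echelon[OF G] .
  interpret H: echelon "lead_set H" "basis_vector H" using gb_ok_echelon[OF H] .
  note GM = G.subgrp_lspan gb_ok_shift_closed[OF G]
  note HM = H.subgrp_lspan gb_ok_shift_closed[OF H]
  let ?c = "int (lead_product G)"
  let ?up = "relabel (\<lambda>v. (fst v + n, snd v)) :: vect \<Rightarrow> vect"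
  have inj: "inj (\<lambda>v :: nat \<times> nat. (fst v + n, snd v))" by (auto simp: inj_def prod_eq_iff)
  have up_shift: "?up (relabel shift_var w) = relabel shift_var (?up w)" for w
    by (induction w rule: frag_induction[OF subset_UNIV]) (auto simp: relabel_diff shift_var_def)
  have up_span: "?up w \<in> gspan H" if w: "w \<in> gspan G" for w
  proof -
    obtain z where z: "w = frag_extend (basis_vector G) z" "keys z \<subseteq> lead_set G"
      using w by (auto simp: G.lspan_def)
    show ?thesis unfolding z relabel_frag_extend
    proof (rule subgrp_frag_extend[OF HM(1)])
      fix v assume "v \<in> keys z"
      then obtain g where g: "g \<in> set G"
          "basis_vector G v = (relabel shift_var ^^ (snd v - snd (fst g))) (vec (entry_word g))"
        using basis_vector_match[OF G] z(2) by (metis subsetD)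
      have "in_span H U (raise_word n (entry_word g))" using sat g(1) by (simp add: sat_ok_def list_all_iff)
      from in_spanD[OF H this] have "?up (vec (entry_word g)) \<in> gspan H" by (simp add: vec_raise_word)
      then have "(relabel shift_var ^^ k) (?up (vec (entry_word g))) \<in> gspan H" for k
        by (rule shift_closed_funpow[OF HM(2)])
      moreover have "?up ((relabel shift_var ^^ k) w) = (relabel shift_var ^^ k) (?up w)" for k w
        by (induction k) (simp_all add: up_shift)
      ultimately show "?up (basis_vector G v) \<in> gspan H" by (simp add: g(2))
    qed
  qed
  have graph: "?up (frag_cmul ?c (relabel shift_var f)) + f \<in> gspan H"
    if "\<And>v. v \<in> keys f \<Longrightarrow> fst v < n" for f
  proof (rule bounded_generated[OF HM, of n "\<lambda>f. ?up (frag_cmul ?c (relabel shift_var f)) + f"])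
    fix j assume "j < n"
    then have "in_span H U (graph_generator n (lead_product G) j)" using sat by (simp add: sat_ok_def list_all_iff)
    then have "vec (graph_generator n (lead_product G) j) \<in> gspan H" by (rule in_spanD[OF H])
    moreover have "vec (graph_generator n (lead_product G) j) = ?up (frag_cmul ?c (relabel shift_var (frag_of (j, 0)))) + frag_of (j, 0)"
      by (rule poly_mapping_eqI)
         (simp add: graph_generator_def vec_replicate vec_Cons lookup_add shift_var_def relabel_frag_cmul lookup_single when_def)
    ultimately show "?up (frag_cmul ?c (relabel shift_var (frag_of (j, 0)))) + frag_of (j, 0) \<in> gspan H" by simp
  qed (simp_all add: frag_cmul_diff2 relabel_diff relabel_add relabel_frag_cmul up_shift that)
  \<comment> \<open>Subtracting $(cxf, 0)$ from $(cxf, f)$ leaves $(0, f)$; only lower basis elements enter its representation.\<close>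
  have cancel: "f \<in> gspan G" if f: "frag_cmul ?c (relabel shift_var f) \<in> gspan G"
    and b: "\<And>v. v \<in> keys f \<Longrightarrow> fst v < n" for f
  proof -
    have "?up (frag_cmul ?c (relabel shift_var f)) + f \<in> gspan H" by (rule graph) (rule b)
    from subgrp_diff[OF HM(1) this up_span[OF f]] have "f \<in> gspan H" by simp
    then obtain z where z: "f = frag_extend (basis_vector H) z" "keys z \<subseteq> lead_set H"
      by (auto simp: H.lspan_def)
    have low: "fst v < n" if "v \<in> keys z" for v
    proof -
      have "z \<noteq> 0" using that by auto
      note l = H.lead_frag_extend[OF z(2) this]
      have "fst (Max (keys z)) < n" using b l(5) by (simp add: z(1) in_keys_iff)
      moreover have "fst v \<le> fst (Max (keys z))" using l(3)[OF that] by (auto simp: less_eq_prod_def)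
      ultimately show ?thesis by simp
    qed
    show ?thesis unfolding z
    proof (rule subgrp_frag_extend[OF GM(1)])
      fix v assume v: "v \<in> keys z"
      then obtain h where h: "h \<in> set H" "matches h v"
          "basis_vector H v = (relabel shift_var ^^ (snd v - snd (fst h))) (vec (entry_word h))"
        using basis_vector_match[OF H] z(2) by (metis subsetD)
      have "fst (fst h) < n" using low[OF v] h(2) by (simp add: matches_def)
      then have "in_span G U (entry_word h)" using sat h(1) by (auto simp: sat_ok_def list_all_iff)
      then have "vec (entry_word h) \<in> gspan G" by (rule in_spanD[OF G])
      then show "basis_vector H v \<in> gspan G" unfolding h(3) by (rule shift_closed_funpow[OF GM(2)])
    qed
  qed
  have cancel_c: "f \<in> gspan G" if f: "frag_cmul ?c f \<in> gspan G" "\<And>v. v \<in> keys f \<Longrightarrow> fst v < n" for f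
  proof (rule cancel)
    have "relabel shift_var (frag_cmul ?c f) \<in> gspan G" using GM(2) f(1) unfolding shift_closed_def by blast
    then show "frag_cmul ?c (relabel shift_var f) \<in> gspan G" by (simp only: relabel_frag_cmul)
  qed (rule f(2))
  have cancel_x: "f \<in> gspan G" if f: "relabel shift_var f \<in> gspan G" for f
  proof (rule cancel)
    show "frag_cmul ?c (relabel shift_var f) \<in> gspan G" using GM(1) f by (rule subgrp_cmul)
    show "fst v < n" if "v \<in> keys f" for v
      using gspan_bounded[OF G f, of "shift_var v"] that
      by (auto simp: keys_relabel inj_shift_var shift_var_def)
  qed
  show "relabel shift_var u \<in> gspan G \<longleftrightarrow> u \<in> gspan G"
    using cancel_x[of u] GM(2) unfolding shift_closed_def by blast
  show "u \<in> gspan G" if k: "k \<noteq> 0" and ku: "frag_cmul k u \<in> gspan G"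
  proof -
    have b: "fst v < n" if "v \<in> keys u" for v
      using gspan_bounded[OF G ku] that k by simp
    have "lookup (basis_vector G v) v dvd ?c" if v: "v \<in> lead_set G" for v
    proof -
      obtain g where "g \<in> set G" "lookup (basis_vector G v) v = int (fst (snd g))"
        using basis_vector_match[OF G v] by metis
      then show ?thesis using dvd_lead_product by simp
    qed
    then obtain e r where er: "frag_cmul (?c ^ e) u - r \<in> gspan G" "\<forall>v\<in>lead_set G. lookup r v = 0"
      using G.pseudo_reduction by blast
    have "frag_cmul (?c ^ e) (frag_cmul k u) - frag_cmul k (frag_cmul (?c ^ e) u - r) \<in> gspan G"
      by (intro subgrp_diff[OF GM(1)] subgrp_cmul[OF GM(1)] ku er(1))
    then have kr: "frag_cmul k r \<in> gspan G"
      by (simp add: frag_cmul_diff2 mult.commute)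
    have "frag_cmul k r = 0"
    proof (rule ccontr)
      assume "frag_cmul k r \<noteq> 0"
      from G.lspan_lead[OF kr this] obtain v where "v \<in> lead_set G" "lookup (frag_cmul k r) v \<noteq> 0" by blast
      then show False using er(2) by simp
    qed
    then have "r = 0" using k by simp
    then have "frag_cmul (?c ^ e) u \<in> gspan G" using er(1) by simp
    then show ?thesis
    proof (induction e)
      case (Suc e)
      then have "frag_cmul ?c (frag_cmul (?c ^ e) u) \<in> gspan G" by simp
      then have "frag_cmul (?c ^ e) u \<in> gspan G" by (rule cancel_c) (use b in auto)
      then show ?case by (rule Suc.IH)
    qed simp
  qed
qed

subsection \<open>Existence of certificates\<close>

lemma in_span_mono: "in_span G U w \<Longrightarrow> set U \<subseteq> set U' \<Longrightarrow> in_span G U' w"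
  by (auto simp: in_span_def list_ex_iff)

lemma gb_ok_mono: "gb_ok n G U \<Longrightarrow> set U \<subseteq> set U' \<Longrightarrow> gb_ok n G U'"
  using in_span_mono by (fastforce simp: gb_ok_def list_all_iff boundary_ok_def)

lemma (in shift_lattice) leads_mono_var:
  "v \<in> leads \<Longrightarrow> fst v = fst w \<Longrightarrow> snd v \<le> snd w \<Longrightarrow> w \<in> leads \<and> min_lead w \<le> min_lead v"
  using leads_mono[of "fst v" "snd v" "snd w"] by (cases v; cases w) simp

text \<open>The reduced elements at the places where the minimal leading coefficient drops form the basis.\<close>

lemma (in shift_lattice) exists_gb: "\<exists>G U. gb_ok n G U \<and> gspan G = M"
proof -
  define entry where "entry v = (v, min_lead v, wordof (reduced_at v - single v (int (min_lead v))))" for v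
  define G where "G = map entry (sorted_list_of_set jumps)"
  have set_G: "set G = entry ` jumps" using finite_jumps by (simp add: G_def)
  have jl: "v \<in> leads" if "v \<in> jumps" for v using that by (simp add: jumps_def)
  have fst_entry [simp]: "fst (entry v) = v" "fst (snd (entry v)) = min_lead v" for v by (simp_all add: entry_def)
  have vec_entry: "vec (entry_word (entry v)) = reduced_at v" for v
    by (simp add: entry_word_def entry_def vec_replicate)
  have sorted: "sorted_wrt (\<lambda>g h. fst g < fst h) G"
    using strict_sorted_list_of_set[of jumps] by (simp add: G_def sorted_wrt_map strict_sorted_iff)
  have tail: "v' < v \<and> lookup (reduced_at v - single v (int (min_lead v))) v' = lookup (reduced_at v) v'"
    if "v \<in> jumps" "(s, v') \<in> set (snd (snd (entry v)))" for v v' s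
  proof -
    have k: "lookup (reduced_at v - single v (int (min_lead v))) v' \<noteq> 0"
      using in_wordof[of s v' "reduced_at v - single v (int (min_lead v))"] that(2)
      by (simp add: entry_def in_keys_iff)
    have "\<not> v \<le> v'"
    proof
      assume "v \<le> v'"
      then show False using k reduced_at(2)[OF jl[OF that(1)]]
        by (cases "v = v'") (auto simp: leading_at_def lookup_minus lookup_single when_def)
    qed
    then show ?thesis by (auto simp: lookup_minus lookup_single when_def)
  qed
  have entry_ok: "entry_ok n (entry v)" if v: "v \<in> jumps" for v
    unfolding entry_ok_def list_all_iff
  proof (intro conjI ballI)
    have "v \<in> keys (reduced_at v)"
      using reduced_at(2)[OF jl[OF v]] by (auto simp: leading_at_def in_keys_iff)
    then show "fst (fst (entry v)) < n" using bounded[OF reduced_at(1)[OF jl[OF v]]] by simp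
    show "0 < fst (snd (entry v))" using min_lead_pos[OF jl[OF v]] by simp
    fix l assume l: "l \<in> set (snd (snd (entry v)))"
    then show "snd l < fst (entry v)" using tail[OF v, of "fst l" "snd l"] by simp
    show "occurrences (\<not> fst l) (snd l) (snd (snd (entry v))) = 0"
      using l occurrences_wordof(2)[of "fst l" "snd l"] by (simp add: entry_def)
  qed
  have has: "has_lead G v \<longleftrightarrow> v \<in> leads" for v
  proof
    assume "has_lead G v"
    then obtain w where "w \<in> jumps" "fst w = fst v" "snd w \<le> snd v"
      unfolding has_lead_def list_ex_iff set_G matches_def by fastforce
    then show "v \<in> leads" using leads_mono[of "fst w" "snd w" "snd v"] jl[of w] by (cases w; cases v) simp
  next
    assume "v \<in> leads"
    then obtain e where "e \<le> snd v" "(fst v, e) \<in> jumps" using jump_below[of "fst v" "snd v"] by auto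
    then show "has_lead G v" by (auto simp: has_lead_def list_ex_iff set_G matches_def intro!: bexI[of _ "(fst v, e)"])
  qed
  then have lead_set: "lead_set G = leads" by (auto simp: lead_set_def)
  have tv: "basis_vector G v \<in> M \<and> leading_at (basis_vector G v) v (int (min_lead v))" if v: "v \<in> leads" for v
  proof -
    obtain g where g: "g \<in> set G" "matches g v" "basis_word G v = shift_word (snd v - snd (fst g)) (entry_word g)"
        "\<forall>h\<in>set G. matches h v \<longrightarrow> fst h \<le> fst g"
      using basis_word_match[OF sorted, of v] v has by blast
    then obtain w where w: "w \<in> jumps" "g = entry w" by (auto simp: set_G)
    define k where "k = snd v - snd w"
    have k: "w = (fst v, snd v - k)" "k \<le> snd v" using g(2) by (auto simp: w matches_def k_def prod_eq_iff)
    have t: "basis_vector G v = (relabel shift_var ^^ k) (reduced_at w)"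
      by (simp add: basis_vector_def g(3) vec_shift_word w vec_entry k_def)
    have "min_lead (fst v, snd v) = min_lead (fst v, snd v - k)"
    proof (rule min_lead_last_jump)
      show "(fst v, snd v - k) \<in> leads" using jl[OF w(1)] k by simp
      fix e assume e: "snd v - k < e" "e \<le> snd v"
      show "(fst v, e) \<notin> jumps"
      proof
        assume "(fst v, e) \<in> jumps"
        then have "(fst v, e) \<le> w" using g(4) e(2) by (auto simp: set_G matches_def w)
        then show False using e(1) k by auto
      qed
    qed simp
    then have m: "min_lead v = min_lead w" using k by simp
    have "lookup (basis_vector G v) x = 0" if "v < x" for x
    proof (cases "k \<le> snd x")
      case True
      then have "w < (fst x, snd x - k)" using that k by (auto simp: less_prod_def')
      then show ?thesis
        using lookup_shift[of k "reduced_at w" "fst x" "snd x"] reduced_at(2)[OF jl[OF w(1)]] True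
        by (simp add: t leading_at_def)
    next
      case False
      then show ?thesis using lookup_shift[of k "reduced_at w" "fst x" "snd x"] by (simp add: t)
    qed
    moreover have "lookup (basis_vector G v) v = int (min_lead v)"
      using lookup_shift[of k "reduced_at w" "fst v" "snd v"] k reduced_at(2)[OF jl[OF w(1)]]
      by (simp add: t m leading_at_def)
    moreover have "basis_vector G v \<in> M" unfolding t by (rule shift_closed_funpow[OF M(2) reduced_at(1)[OF jl[OF w(1)]]])
    ultimately show ?thesis using min_lead_pos[OF v] by (simp add: leading_at_def)
  qed
  have ech: "echelon leads (basis_vector G)" by standard (use tv in \<open>auto simp: leading_at_def\<close>)
  then have span: "gspan G = M" using span_by_leading[OF ech tv] by (simp add: lead_set)
  \<comment> \<open>The leading coefficient of an entry exceeds all later minimal ones, which in turn bound the tails.\<close>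
  have red: "reduced_ok (entry v) (entry w)" if v: "v \<in> jumps" and w: "w \<in> jumps" for v w
  proof (cases "v = w")
    case False
    have "occurrences (fst l) (snd l) (entry_word (entry w)) < min_lead v"
      if l: "l \<in> set (entry_word (entry w))" "matches (entry v) (snd l)" for l
    proof -
      have vl: "fst v = fst (snd l)" "snd v \<le> snd (snd l)" using l(2) by (auto simp: matches_def)
      consider "l = (True, w)" | "l \<in> set (snd (snd (entry w)))" using l(1) by (auto simp: entry_word_def entry_def)
      then show ?thesis
      proof cases
        case 1
        have "(s, w) \<notin> set (snd (snd (entry w)))" for s using tail[OF w, of s w] by auto
        then have "occurrences (fst l) (snd l) (entry_word (entry w)) = min_lead w"
          using 1 by (simp add: entry_word_def occurrences_def filter_empty_conv) (metis fst_conv prod.collapse snd_conv)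
        moreover have "snd v < snd w" using vl 1 False by (auto simp: prod_eq_iff)
        moreover have fw: "(fst v, snd w) = w" using vl 1 by (simp add: prod_eq_iff)
        ultimately show ?thesis
          using jumps_strict[of "fst v" "snd v" "snd w", unfolded fw prod.collapse, OF jl[OF v] w] by simp
      next
        case 2
        then have lw: "snd l < w" "lookup (reduced_at w - single w (int (min_lead w))) (snd l) = lookup (reduced_at w) (snd l)"
          using tail[OF w, of "fst l" "snd l"] by auto
        have ml: "snd l \<in> leads" "min_lead (snd l) \<le> min_lead v"
          using leads_mono_var[OF jl[OF v] vl] by auto
        have "occurrences (fst l) (snd l) (entry_word (entry w)) = occurrences (fst l) (snd l) (snd (snd (entry w)))"
          using lw(1) by (auto simp: entry_word_def occurrences_def filter_empty_conv)
        moreover have "int (occurrences (fst l) (snd l) (snd (snd (entry w)))) = \<bar>lookup (reduced_at w) (snd l)\<bar>"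
          using occurrences_wordof(1)[of "fst l" "snd l"] 2 lw(2) by (simp add: entry_def)
        moreover have "\<bar>lookup (reduced_at w) (snd l)\<bar> < int (min_lead (snd l))"
          by (rule reduced_at(3)[OF jl[OF w] lw(1) ml(1)])
        ultimately show ?thesis using ml(2) by linarith
      qed
    qed
    then show ?thesis by (auto simp: reduced_ok_def list_all_iff)
  qed (simp add: reduced_ok_def)
  have "\<exists>U. \<forall>g\<in>set G. boundary_ok G U g"
  proof -
    have sp: "\<exists>u. span_ok G w u" if "vec w \<in> M" for w
    proof -
      have "vec w \<in> echelon.lspan leads (basis_vector G)" using that span lead_set by simp
      then obtain z where z: "vec w = frag_extend (basis_vector G) z" "keys z \<subseteq> leads"
        unfolding echelon.lspan_def[OF ech] by blast
      have "\<forall>l\<in>set (wordof z). has_lead G (snd l)"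
      proof
        fix l assume "l \<in> set (wordof z)"
        then have "snd l \<in> keys z" using in_wordof[of "fst l" "snd l" z] by simp
        then show "has_lead G (snd l)" using z(2) has by auto
      qed
      then have "span_ok G w (wordof z)" using z(1) by (simp add: span_ok_def list_all_iff same_vector_iff vec_combination)
      then show ?thesis by blast
    qed
    define W where "W g = shift_word 1 (basis_word G (prev_var (fst g)))" for g :: entry
    define U where "U = map (\<lambda>g. SOME u. span_ok G (W g) u) G"
    have "boundary_ok G U g" if "g \<in> set G" for g
    proof (cases "has_lead G (prev_var (fst g))")
      case True
      then have "basis_vector G (prev_var (fst g)) \<in> M" using tv has by blast
      then have "vec (W g) \<in> M" using M(2) by (simp add: W_def vec_shift_word basis_vector_def shift_closed_def)
      then have "span_ok G (W g) (SOME u. span_ok G (W g) u)" using sp someI_ex[of "span_ok G (W g)"] by blast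
      then have "in_span G U (W g)" using that by (auto simp: in_span_def U_def list_ex_iff)
      then show ?thesis by (simp add: boundary_ok_def W_def)
    qed (simp add: boundary_ok_def)
    then show ?thesis by blast
  qed
  then obtain U where "\<forall>g\<in>set G. boundary_ok G U g" by blast
  then have "gb_ok n G U"
    using sorted entry_ok red by (auto simp: gb_ok_def list_all_iff set_G)
  then show ?thesis using span by blast
qed

subsection \<open>The certificate of a system of generators\<close>

definition generator_at :: "(word \<times> 'a::one) list \<Rightarrow> nat \<Rightarrow> word \<times> 'a" where
  "generator_at F i = (if i < length F then F ! i else ([], 1))"

definition generator_combination :: "(word \<times> 'a::one) list \<Rightarrow> (bool \<times> nat \<times> nat) list \<Rightarrow> word" where
  "generator_combination F q = concat (map (\<lambda>l. sign_word (fst l) (shift_word (fst (snd l)) (fst (generator_at F (snd (snd l)))))) q)"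

text \<open>The triple $(k, e, q)$ states that $k x^e$ times the entry is the combination \<open>q\<close> of the transforms of the
  generators; a letter of \<open>q\<close> is a sign, an order of transformation and the index of a generator.\<close>

definition pow_ok :: "(word \<times> 'a::one) list \<Rightarrow> entry \<Rightarrow> nat \<times> nat \<times> (bool \<times> nat \<times> nat) list \<Rightarrow> bool" where
  "pow_ok F g v = (0 < fst v \<and>
     same_vector (concat (replicate (fst v) (shift_word (fst (snd v)) (entry_word g)))) (generator_combination F (snd (snd v))))"

text \<open>The components are a basis of the saturated lattice, a basis for the elimination of \<open>sat_ok\<close>, the list of
  coordinate vectors, and the multiples of the basis elements in the span of the generators.\<close>

type_synonym certificate = "entry list \<times> entry list \<times> word list \<times> (nat \<times> nat \<times> (bool \<times> nat \<times> nat) list) list"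

definition check :: "nat \<Rightarrow> (word \<times> 'a::one) list \<Rightarrow> certificate \<Rightarrow> bool" where
  "check n F C = (gb_ok n (fst C) (fst (snd (snd C))) \<and>
     gb_ok (2 * n) (fst (snd C)) (fst (snd (snd C))) \<and>
     sat_ok n (fst C) (fst (snd C)) (fst (snd (snd C))) \<and>
     list_all (\<lambda>f. in_span (fst C) (fst (snd (snd C))) (fst f)) F \<and>
     list_all (\<lambda>g. list_ex (\<lambda>v. pow_ok F g v) (snd (snd (snd C)))) (fst C))"

lemma vec_concat_replicate: "vec (concat (replicate k w)) = frag_cmul (int k) (vec w)"
  by (induction k) (auto simp: frag_cmul_distrib)

lemma generator_combination_shift: "generator_combination F (map (\<lambda>l. (fst l, fst (snd l) + k, snd (snd l))) q) = shift_word k (generator_combination F q)"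
  by (induction q) (auto simp: generator_combination_def shift_word_def sign_word_def neg_word_def ac_simps)

lemma generator_combination_neg: "generator_combination F (map (\<lambda>l. (\<not> fst l, snd l)) q) = neg_word (generator_combination F q)"
  by (induction q) (auto simp: generator_combination_def sign_word_def neg_word_def comp_def)

lemma funpow_shift_cmul: "(relabel shift_var ^^ k) (frag_cmul c u) = frag_cmul c ((relabel shift_var ^^ k) u)"
  by (induction k) (simp_all add: relabel_frag_cmul)

lemma funpow_shift_diff: "(relabel shift_var ^^ k) (u - w :: vect) = (relabel shift_var ^^ k) u - (relabel shift_var ^^ k) w"
  by (induction k) (simp_all add: relabel_diff)

lemma funpow_shift_uminus: "(relabel shift_var ^^ k) (- u :: vect) = - (relabel shift_var ^^ k) u"
  by (induction k) (simp_all add: relabel_uminus)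

text \<open>The lattice to which the search for a certificate leads: the saturation of the span of the
  generators with respect to positive integers and to $x$.\<close>

definition saturation :: "nat \<Rightarrow> (word \<times> 'a::one) list \<Rightarrow> vect set" where
  "saturation n F = {u. (\<forall>v\<in>keys u. fst v < n) \<and>
     (\<exists>k e q. 0 < k \<and> frag_cmul (int k) ((relabel shift_var ^^ e) u) = vec (generator_combination F q))}"

lemma saturation_shift_lattice: "shift_lattice (saturation n F) n"
proof
  show "subgrp (saturation n F)"
    unfolding subgrp_def
  proof (intro conjI ballI)
    show "0 \<in> saturation n F"
      unfolding saturation_def
      by (intro CollectI conjI exI[of _ "1::nat"] exI[of _ "0::nat"] exI[of _ "[]"]) (simp_all add: generator_combination_def)
    fix u w assume u: "u \<in> saturation n F" and w: "w \<in> saturation n F"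
    obtain k e q where 1: "0 < k" "frag_cmul (int k) ((relabel shift_var ^^ e) u) = vec (generator_combination F q)"
      using u by (auto simp: saturation_def)
    obtain k' e' q' where 2: "0 < k'" "frag_cmul (int k') ((relabel shift_var ^^ e') w) = vec (generator_combination F q')"
      using w by (auto simp: saturation_def)
    define r where "r = concat (replicate k' (map (\<lambda>l. (fst l, fst (snd l) + e', snd (snd l))) q)) @
      concat (replicate k (map (\<lambda>l. (fst l, fst (snd l) + e, snd (snd l))) (map (\<lambda>l. (\<not> fst l, snd l)) q')))"
    have generator_combination_app: "generator_combination F (a @ b) = generator_combination F a @ generator_combination F b" for a b by (simp add: generator_combination_def)
    have generator_combination_rep: "vec (generator_combination F (concat (replicate k a))) = frag_cmul (int k) (vec (generator_combination F a))" for k a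
    proof (induction k)
      case (Suc k)
      then show ?case by (simp add: generator_combination_app frag_cmul_distrib)
    qed (simp add: generator_combination_def)
    have "vec (generator_combination F r) = frag_cmul (int k') ((relabel shift_var ^^ e') (vec (generator_combination F q))) -
        frag_cmul (int k) ((relabel shift_var ^^ e) (vec (generator_combination F q')))"
      unfolding r_def generator_combination_app vec_append generator_combination_rep generator_combination_shift generator_combination_neg vec_shift_word
      by (simp add: funpow_shift_uminus frag_cmul_uminus)
    also have "\<dots> = frag_cmul (int (k * k')) ((relabel shift_var ^^ (e + e')) (u - w))"
    proof -
      have "(relabel shift_var ^^ e') ((relabel shift_var ^^ e) u) = (relabel shift_var ^^ (e + e')) u"
        by (simp add: add.commute[of e] funpow_add)
      moreover have "(relabel shift_var ^^ e) ((relabel shift_var ^^ e') w) = (relabel shift_var ^^ (e + e')) w"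
        by (simp add: funpow_add)
      ultimately show ?thesis
        unfolding 1(2)[symmetric] 2(2)[symmetric] funpow_shift_diff frag_cmul_diff2 funpow_shift_cmul frag_cmul_cmul
        by (simp add: mult.commute)
    qed
    finally have "frag_cmul (int (k * k')) ((relabel shift_var ^^ (e + e')) (u - w)) = vec (generator_combination F r)" by simp
    moreover have "0 < k * k'" using 1(1) 2(1) by simp
    moreover have "\<forall>v\<in>keys (u - w). fst v < n"
      using keys_diff[of u w] u w by (auto simp: saturation_def)
    ultimately show "u - w \<in> saturation n F" unfolding saturation_def by blast
  qed
  show "shift_closed (saturation n F)"
    unfolding shift_closed_def
  proof
    fix u assume u: "u \<in> saturation n F"
    then obtain k e q where 1: "0 < k" "frag_cmul (int k) ((relabel shift_var ^^ e) u) = vec (generator_combination F q)"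
      by (auto simp: saturation_def)
    have "frag_cmul (int k) ((relabel shift_var ^^ e) (relabel shift_var u)) =
        vec (generator_combination F (map (\<lambda>l. (fst l, fst (snd l) + 1, snd (snd l))) q))"
      using arg_cong[OF 1(2), of "relabel shift_var"]
      by (simp only: generator_combination_shift vec_shift_word) (simp add: relabel_frag_cmul funpow_swap1)
    moreover have "\<forall>v\<in>keys (relabel shift_var u). fst v < n"
      using u by (auto simp: keys_relabel inj_shift_var saturation_def shift_var_def)
    ultimately show "relabel shift_var u \<in> saturation n F" using 1(1) unfolding saturation_def by blast
  qed
  show "fst v < n" if "u \<in> saturation n F" "v \<in> keys u" for u v
    using that by (auto simp: saturation_def)
qed

lemma saturation_cancel:
  assumes "u \<in> saturation n F" "u = frag_cmul (int c) (relabel shift_var f)" "c > 0"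
  shows "f \<in> saturation n F"
proof -
  obtain k e q where 1: "0 < k" "frag_cmul (int k) ((relabel shift_var ^^ e) u) = vec (generator_combination F q)"
    using assms(1) by (auto simp: saturation_def)
  have "frag_cmul (int (k * c)) ((relabel shift_var ^^ Suc e) f) = vec (generator_combination F q)"
    using 1(2) by (simp add: assms(2) funpow_shift_cmul funpow_swap1)
  moreover have "fst v < n" if "v \<in> keys f" for v
  proof -
    have "shift_var v \<in> keys u"
      using that assms(3) by (simp add: assms(2) keys_relabel inj_shift_var)
    then show ?thesis using assms(1) by (auto simp: saturation_def shift_var_def)
  qed
  moreover have "0 < k * c" using 1(1) assms(3) by simp
  ultimately show ?thesis unfolding saturation_def by blast
qed

lemma lead_product_pos: "gb_ok n G U \<Longrightarrow> lead_product G > 0"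
proof -
  assume "gb_ok n G U"
  then have "\<forall>g\<in>set G. fst (snd g) > 0" by (auto simp: gb_ok_def list_all_iff entry_ok_def)
  then have "foldl (\<lambda>b g. b * fst (snd g)) a G > 0" if "a > 0" for a
    using that by (induction G arbitrary: a) auto
  then show ?thesis by (simp add: lead_product_def)
qed

text \<open>Both bases exist by \<open>exists_gb\<close>, for the saturation and for the graph lattice of multiplication by $cx$ on it.
  All span problems are solvable, so choosing one solution of each gives the coordinate vectors.\<close>

theorem certificate_exists:
  assumes F: "\<And>f l. f \<in> set F \<Longrightarrow> l \<in> set (fst f) \<Longrightarrow> fst (snd l) < n"
  shows "\<exists>C. check n F C"
proof -
  let ?M = "saturation n F"
  let ?up = "relabel (\<lambda>v. (fst v + n, snd v)) :: vect \<Rightarrow> vect"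
  have inj: "inj (\<lambda>v :: nat \<times> nat. (fst v + n, snd v))" by (auto simp: inj_def prod_eq_iff)
  interpret M: shift_lattice ?M n by (rule saturation_shift_lattice)
  obtain G UG where G: "gb_ok n G UG" "gspan G = ?M" using M.exists_gb by blast
  define c where "c = lead_product G"
  have c: "c > 0" using lead_product_pos[OF G(1)] by (simp add: c_def)
  let ?b = "\<lambda>f. frag_cmul (int c) (relabel shift_var f) :: vect"
  let ?low = "\<lambda>f :: vect. \<forall>v\<in>keys f. fst v < n"
  define K where "K = {?up w + f |w f. ?low w \<and> ?low f \<and> w - ?b f \<in> ?M}"
  have up_shift: "?up (relabel shift_var w) = relabel shift_var (?up w)" for w
    by (induction w rule: frag_induction[OF subset_UNIV]) (auto simp: relabel_diff shift_var_def)
  have low_diff: "?low (u - w)" if "?low u" "?low w" for u w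
    using keys_diff[of u w] that by auto
  have low_shift: "?low (relabel shift_var u)" if "?low u" for u
    using that by (auto simp: keys_relabel inj_shift_var shift_var_def)
  have "shift_lattice K (2 * n)"
  proof
    show "subgrp K"
      unfolding subgrp_def
    proof (intro conjI ballI)
      show "0 \<in> K" unfolding K_def using subgrp_zero[OF M.M(1)] by (force intro: exI[of _ 0])
      fix u w assume "u \<in> K" "w \<in> K"
      then obtain u1 u2 w1 w2 where *: "u = ?up u1 + u2" "?low u1" "?low u2" "u1 - ?b u2 \<in> ?M"
          "w = ?up w1 + w2" "?low w1" "?low w2" "w1 - ?b w2 \<in> ?M"
        by (auto simp: K_def)
      have "(u1 - ?b u2) - (w1 - ?b w2) \<in> ?M" using subgrp_diff[OF M.M(1) *(4,8)] .
      then have "(u1 - w1) - ?b (u2 - w2) \<in> ?M"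
        by (simp add: frag_cmul_diff2 relabel_diff algebra_simps)
      moreover have "u - w = ?up (u1 - w1) + (u2 - w2)" by (simp add: * relabel_diff)
      ultimately show "u - w \<in> K" unfolding K_def using low_diff *(2,3,6,7) by blast
    qed
    show "shift_closed K"
      unfolding shift_closed_def
    proof
      fix u assume "u \<in> K"
      then obtain u1 u2 where *: "u = ?up u1 + u2" "?low u1" "?low u2" "u1 - ?b u2 \<in> ?M"
        by (auto simp: K_def)
      have "relabel shift_var (u1 - ?b u2) \<in> ?M" using M.M(2) *(4) by (simp add: shift_closed_def)
      then have "relabel shift_var u1 - ?b (relabel shift_var u2) \<in> ?M"
        by (simp add: relabel_diff relabel_frag_cmul)
      moreover have "relabel shift_var u = ?up (relabel shift_var u1) + relabel shift_var u2"
        by (simp add: * relabel_add up_shift)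
      ultimately show "relabel shift_var u \<in> K" unfolding K_def using low_shift *(2,3) by blast
    qed
    show "fst v < 2 * n" if uv: "u \<in> K" "v \<in> keys u" for u v
    proof -
      obtain u1 u2 where *: "u = ?up u1 + u2" "?low u1" "?low u2" using uv(1) by (auto simp: K_def)
      have "v \<in> keys (?up u1) \<union> keys u2"
        using keys_add[of "?up u1" u2] uv(2) * by auto
      then show ?thesis using *(2,3) by (auto simp: keys_relabel inj)
    qed
  qed
  then interpret K: shift_lattice K "2 * n" .
  obtain H UH where H: "gb_ok (2 * n) H UH" "gspan H = K" using K.exists_gb by blast
  have F_in: "vec (fst f) \<in> ?M" if f: "f \<in> set F" for f
  proof -
    obtain i where i: "i < length F" "F ! i = f" using f by (auto simp: in_set_conv_nth)
    have low: "?low (vec (fst f))"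
    proof
      fix v assume "v \<in> keys (vec (fst f))"
      then have "v \<in> snd ` set (fst f)" using keys_vec[of "fst f"] by (rule subsetD[rotated])
      then show "fst v < n" using F[OF f] by auto
    qed
    have "generator_combination F [(True, 0, i)] = fst f" using i by (simp add: generator_combination_def generator_at_def sign_word_def shift_word_def)
    then have eq: "frag_cmul (int 1) ((relabel shift_var ^^ 0) (vec (fst f))) = vec (generator_combination F [(True, 0, i)])" by simp
    show ?thesis unfolding saturation_def
      by (intro CollectI conjI low exI[of _ "1::nat"] exI[of _ "0::nat"] exI[of _ "[(True, 0, i)]"] eq) simp
  qed
  have G_in: "vec (entry_word g) \<in> ?M" if "g \<in> set G" for g
    using entry_word_in_gspan(1)[OF G(1) that] by (simp add: G(2))
  have raise_in: "vec (raise_word n (entry_word g)) \<in> K" if g: "g \<in> set G" for g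
    unfolding K_def vec_raise_word
    by (intro CollectI exI[of _ "vec (entry_word g)"] exI[of _ 0])
       (use G_in[OF g] M.bounded in auto)
  have gen_in: "vec (graph_generator n c j) \<in> K" if j: "j < n" for j
  proof -
    have "vec (graph_generator n c j) = ?up (?b (frag_of (j, 0))) + frag_of (j, 0)"
      by (rule poly_mapping_eqI)
         (simp add: graph_generator_def vec_replicate vec_Cons lookup_add shift_var_def relabel_frag_cmul lookup_single when_def)
    moreover have "?low (frag_of (j, 0))" "?low (?b (frag_of (j, 0)))"
      using j by (auto simp: keys_frag_of shift_var_def)
    moreover have "?b (frag_of (j, 0)) - ?b (frag_of (j, 0)) \<in> ?M" using subgrp_zero[OF M.M(1)] by simp
    ultimately show ?thesis unfolding K_def by blast
  qed
  have H_in: "vec (entry_word h) \<in> ?M" if h: "h \<in> set H" "fst (fst h) < n" for h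
  proof -
    have "vec (entry_word h) \<in> K" using entry_word_in_gspan(1)[OF H(1) h(1)] by (simp add: H(2))
    then obtain w f where wf: "vec (entry_word h) = ?up w + f" "?low w" "?low f" "w - ?b f \<in> ?M" by (auto simp: K_def)
    have ok: "entry_ok (2 * n) h" using H(1) h(1) by (auto simp: gb_ok_def list_all_iff)
    have "w = 0"
    proof (rule poly_mapping_eqI)
      fix v
      have "(fst v + n, snd v) \<notin> keys (vec (entry_word h))"
        using lead_entry_word(3)[OF ok, of "(fst v + n, snd v)"] h(2) by (cases "fst h") auto
      moreover have "(fst v + n, snd v) \<notin> keys f" using wf(3) by auto
      ultimately show "lookup w v = lookup 0 v"
        using lookup_relabel[OF inj, of w v] by (simp add: wf(1) in_keys_iff lookup_add)
    qed
    then have "- (w - ?b f) = ?b f" by simp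
    then have "?b f \<in> ?M" using subgrp_uminus[OF M.M(1) wf(4)] by (simp only:)
    from saturation_cancel[OF this refl c] have "f \<in> ?M" .
    then show ?thesis using \<open>w = 0\<close> wf(1) by simp
  qed
  define wordsG where "wordsG = map fst F @ map entry_word (filter (\<lambda>h. fst (fst h) < n) H)"
  define wordsH where "wordsH = map (\<lambda>g. raise_word n (entry_word g)) G @ map (graph_generator n c) [0..<n]"
  define U where "U = UG @ UH @ map (\<lambda>w. SOME u. span_ok G w u) wordsG @ map (\<lambda>w. SOME u. span_ok H w u) wordsH"
  have UG: "in_span G U w" if w: "w \<in> set wordsG" for w
  proof -
    have "vec w \<in> gspan G" using w F_in H_in by (auto simp: wordsG_def G(2))
    then have "span_ok G w (SOME u. span_ok G w u)" using span_ok_exists[OF G(1)] by (metis someI_ex)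
    then show ?thesis using w by (auto simp: in_span_def U_def list_ex_iff)
  qed
  have UH: "in_span H U w" if w: "w \<in> set wordsH" for w
  proof -
    have "vec w \<in> gspan H" using w raise_in gen_in by (auto simp: wordsH_def H(2))
    then have "span_ok H w (SOME u. span_ok H w u)" using span_ok_exists[OF H(1)] by (metis someI_ex)
    then show ?thesis using w by (auto simp: in_span_def U_def list_ex_iff)
  qed
  have "\<exists>v. pow_ok F g v" if g: "g \<in> set G" for g
  proof -
    obtain k e q where "0 < k" "frag_cmul (int k) ((relabel shift_var ^^ e) (vec (entry_word g))) = vec (generator_combination F q)"
      using G_in[OF g] by (auto simp: saturation_def)
    then have "pow_ok F g (k, e, q)" by (simp add: pow_ok_def same_vector_iff vec_concat_replicate vec_shift_word)
    then show ?thesis by blast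
  qed
  then have pow: "pow_ok F g (SOME v. pow_ok F g v)" if "g \<in> set G" for g
    using that by (meson someI_ex)
  define V where "V = map (\<lambda>g. SOME v. pow_ok F g v) G"
  have "check n F (G, H, U, V)"
    unfolding check_def fst_conv snd_conv
  proof (intro conjI)
    show "gb_ok n G U" using G(1) by (rule gb_ok_mono) (auto simp: U_def)
    show "gb_ok (2 * n) H U" using H(1) by (rule gb_ok_mono) (auto simp: U_def)
    show "sat_ok n G H U"
      using UG UH unfolding sat_ok_def list_all_iff wordsG_def wordsH_def c_def[symmetric] by auto
    show "list_all (\<lambda>f. in_span G U (fst f)) F" using UG by (auto simp: list_all_iff wordsG_def)
    show "list_all (\<lambda>g. list_ex (\<lambda>v. pow_ok F g v) V) G"
      unfolding list_all_iff list_ex_iff V_def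
    proof
      fix g assume g: "g \<in> set G"
      show "\<exists>v\<in>set (map (\<lambda>g. SOME v. pow_ok F g v) G). pow_ok F g v"
        by (rule bexI[of _ "SOME v. pow_ok F g v"], rule pow[OF g]) (use g in simp)
    qed
  qed
  then show ?thesis by blast
qed

section \<open>The chain of a consistent certificate\<close>

text \<open>The \<open>\<sigma>\<close>-transform of the value of the entry chosen by \<open>basis_word\<close>.\<close>

definition basis_value :: "('a::field \<Rightarrow> 'a) \<Rightarrow> (entry \<times> 'a) list \<Rightarrow> nat \<times> nat \<Rightarrow> 'a" where
  "basis_value \<sigma> G v = foldl (\<lambda>b g. if matches (fst g) v then (\<sigma> ^^ (snd v - snd (fst (fst g)))) (snd g) else b) 1 G"

definition signed :: "bool \<Rightarrow> 'a::field \<Rightarrow> 'a" where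
  "signed s c = (if s then c else inverse c)"

definition combination_value :: "('a::field \<Rightarrow> 'a) \<Rightarrow> (entry \<times> 'a) list \<Rightarrow> word \<Rightarrow> 'a" where
  "combination_value \<sigma> G u = foldl (\<lambda>b l. b * signed (fst l) (basis_value \<sigma> G (snd l))) 1 u"

definition generator_value :: "('a::field \<Rightarrow> 'a) \<Rightarrow> (word \<times> 'a) list \<Rightarrow> (bool \<times> nat \<times> nat) list \<Rightarrow> 'a" where
  "generator_value \<sigma> F q = foldl (\<lambda>b l. b * signed (fst l) ((\<sigma> ^^ fst (snd l)) (snd (generator_at F (snd (snd l)))))) 1 q"

text \<open>A family of values on the basis extends to an equivariant character if it respects the relations
  witnessed in \<open>boundary_ok\<close>; moreover the character has to take the prescribed values on the generators.\<close>

definition consistent :: "('a::field \<Rightarrow> 'a) \<Rightarrow> (word \<times> 'a) list \<Rightarrow> word list \<Rightarrow> (entry \<times> 'a) list \<Rightarrow> bool" where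
  "consistent \<sigma> F U G =
    (list_all (\<lambda>g. snd (fst (fst g)) = 0 \<or> \<not> has_lead (map fst G) (prev_var (fst (fst g))) \<or>
       list_all (\<lambda>u. \<not> span_ok (map fst G) (shift_word 1 (basis_word (map fst G) (prev_var (fst (fst g))))) u \<or>
         \<sigma> (basis_value \<sigma> G (prev_var (fst (fst g)))) = combination_value \<sigma> G u) U) G \<and>
     list_all (\<lambda>f. list_all (\<lambda>u. \<not> span_ok (map fst G) (fst f) u \<or> combination_value \<sigma> G u = snd f) U) F)"

definition in_positions :: "nat list \<Rightarrow> nat \<Rightarrow> bool" where
  "in_positions S p = list_ex (\<lambda>q. q = p) S"

text \<open>A vanishing indeterminate contributes itself, any other entry the binomial of its positive and negative part.\<close>

definition entry_poly :: "nat list \<Rightarrow> entry \<times> 'a::field \<Rightarrow> ('a \<times> ((nat \<times> nat) \<times> nat) list) list" where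
  "entry_poly S g = (if in_positions S (fst (fst (fst g))) then [(1, [((fst (fst (fst g)), 0), 1)])]
     else [(1, (fst (fst g), fst (snd (fst g))) # map (\<lambda>l. (snd l, 1)) (filter (\<lambda>l. fst l) (snd (snd (fst g))))),
           (- snd g, map (\<lambda>l. (snd l, 1)) (filter (\<lambda>l. \<not> fst l) (snd (snd (fst g)))))])"

definition unvar :: "nat \<times> nat \<Rightarrow> 'n::{finite,linorder} dvar" where
  "unvar v = (inv position (fst v), snd v)"

definition unnumbered :: "'a \<times> ((nat \<times> nat) \<times> nat) list \<Rightarrow> ('n::{finite,linorder}, 'a) pterm" where
  "unnumbered t = (fst t, map (\<lambda>(v, e). (unvar v, e)) (snd t))"

definition term_exponent :: "((nat \<times> nat) \<times> nat) list \<Rightarrow> ('n::{finite,linorder} dvar \<Rightarrow>\<^sub>0 nat)" where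
  "term_exponent vs = (\<Sum>p\<leftarrow>vs. single (unvar (fst p)) (snd p))"

lemma inj_position: "inj position"
  by (auto simp: inj_def)

lemma unvar_nvar [simp]: "unvar (nvar v) = v"
  by (simp add: unvar_def nvar_def inv_f_f[OF inj_position])

lemma nvar_unvar: "fst v < card (UNIV :: 'n set) \<Longrightarrow> nvar (unvar v :: 'n::{finite,linorder} dvar) = v"
proof -
  assume "fst v < card (UNIV :: 'n set)"
  then obtain i :: 'n where "position i = fst v" by (rule position_surj)
  then have "v = nvar (i, snd v)" by (simp add: nvar_def)
  then show ?thesis by (metis unvar_nvar)
qed

lemma prod_list_yvar:
  "prod_list (map (\<lambda>(v, e). yvar v ^ e) (map (\<lambda>(v, e). (unvar v, e)) vs)) = (single (term_exponent vs) 1 :: ('n::{finite,linorder}, 'a::comm_ring_1) dpoly)"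
  by (induction vs) (auto simp: term_exponent_def yvar_power mult_single)

lemma pterm_value_lift: "pterm_value (unnumbered t) = single (term_exponent (snd t)) (fst t)"
  unfolding pterm_value_def unnumbered_def fst_conv snd_conv prod_list_yvar
  by (simp add: dconst_def mult_single)

lemma Ypower_single:
  fixes \<alpha> :: "'n::{finite,linorder} \<Rightarrow> nat poly" and \<sigma> :: "'a::field \<Rightarrow> 'a"
  assumes "difference_field \<sigma>"
  shows "\<exists>m. Ypower \<sigma> \<alpha> = single m 1 \<and> (\<forall>i d. lookup m (i, d) = coeff (\<alpha> i) d)"
proof -
  interpret difference \<sigma> by standard (rule assms)
  have tr: "(transform \<sigma> ^^ k) (yvar (i, 0)) = yvar (i, k)" for i :: 'n and k
    by (induction k) (auto simp: yvar_def shift_exponent_relabel shift_var_def)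
  have prod: "(\<Prod>x\<in>X. single (f x) (1::'a)) = single (\<Sum>x\<in>X. f x) 1"
    for X :: "'c set" and f :: "'c \<Rightarrow> 'n dvar \<Rightarrow>\<^sub>0 nat"
    by (induction X rule: infinite_finite_induct) (auto simp: mult_single)
  have sp: "spower \<sigma> (yvar (i, 0)) a = single (\<Sum>k\<le>degree a. single (i, k) (coeff a k)) 1"
    for i :: 'n and a
    unfolding spower_def tr yvar_power prod by simp
  define m where "m = (\<Sum>i\<in>UNIV. \<Sum>k\<le>degree (\<alpha> i). single (i, k) (coeff (\<alpha> i) k))"
  have "Ypower \<sigma> \<alpha> = single m 1" unfolding Ypower_def sp prod m_def by simp
  moreover have "lookup m (j, d) = coeff (\<alpha> j) d" for j d
  proof -
    have "lookup m (j, d) = (\<Sum>i\<in>UNIV. if i = j then (\<Sum>k\<le>degree (\<alpha> i). if k = d then coeff (\<alpha> i) k else 0) else 0)"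
      unfolding m_def lookup_sum by (intro sum.cong refl) (auto simp: lookup_single when_def intro!: sum.neutral)
    also have "\<dots> = coeff (\<alpha> j) d" by (simp add: coeff_eq_0)
    finally show ?thesis .
  qed
  ultimately show ?thesis by blast
qed

lemma single_is_Ypower:
  fixes m :: "'n::{finite,linorder} dvar \<Rightarrow>\<^sub>0 nat" and \<sigma> :: "'a::field \<Rightarrow> 'a"
  assumes "difference_field \<sigma>"
  shows "\<exists>\<alpha>. single m 1 = Ypower \<sigma> \<alpha>"
proof -
  have "\<exists>p :: nat poly. \<forall>d. coeff p d = lookup m (i, d)" for i
  proof -
    have "finite {d. lookup m (i, d) \<noteq> 0}"
      by (rule finite_subset[of _ "snd ` keys m"]) (force simp: in_keys_iff, simp)
    then have "\<forall>\<^sub>\<infinity>d. lookup m (i, d) = 0" by (simp add: eventually_cofinite)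
    then have "coeff (Abs_poly (\<lambda>d. lookup m (i, d))) d = lookup m (i, d)" for d
      by (subst Abs_poly_inverse) auto
    then show ?thesis by blast
  qed
  then obtain \<alpha> where \<alpha>: "\<And>i d. coeff (\<alpha> i) d = lookup m (i, d)" by metis
  obtain m' where m': "Ypower \<sigma> \<alpha> = single m' 1" "\<forall>i d. lookup m' (i, d) = coeff (\<alpha> i) d"
    using Ypower_single[OF assms] by blast
  have "m' = m" by (rule poly_mapping_eqI) (metis \<alpha> m'(2) surj_pair)
  then show ?thesis using m'(1) by metis
qed

lemma difference_binomial_single:
  fixes m k :: "'n::{finite,linorder} dvar \<Rightarrow>\<^sub>0 nat" and \<sigma> :: "'a::field \<Rightarrow> 'a"
  assumes "difference_field \<sigma>"
  shows "difference_binomial \<sigma> (single m a + single k b)"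
proof -
  obtain \<alpha> \<beta> where "single m 1 = (Ypower \<sigma> \<alpha> :: ('n, 'a) dpoly)"
      "single k 1 = (Ypower \<sigma> \<beta> :: ('n, 'a) dpoly)"
    using single_is_Ypower[OF assms] by metis
  moreover have "single m a = dconst a * single m 1" for m and a :: 'a
    by (simp add: dconst_def mult_single)
  ultimately show ?thesis unfolding difference_binomial_def by metis
qed

lemma lookup_term_exponent:
  fixes v :: "'n::{finite,linorder} dvar"
  assumes "\<forall>p\<in>set vs. fst (fst p) < card (UNIV :: 'n set)"
  shows "lookup (term_exponent vs) v = (\<Sum>p\<leftarrow>vs. if fst p = nvar v then snd p else 0)"
  using assms
proof (induction vs)
  case (Cons p vs)
  have "unvar (fst p) = v \<longleftrightarrow> fst p = nvar v"
    using nvar_unvar[of "fst p", where 'n = 'n] Cons.prems by auto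
  then show ?case using Cons by (simp add: term_exponent_def lookup_add lookup_single when_def)
qed (simp add: term_exponent_def)

lemma sum_signed_terms:
  "(\<Sum>p\<leftarrow>map (\<lambda>l. (snd l, 1)) (filter (\<lambda>l. fst l) w). if fst p = x then snd p else 0) = occurrences True x w"
  "(\<Sum>p\<leftarrow>map (\<lambda>l. (snd l, 1)) (filter (\<lambda>l. \<not> fst l) w). if fst p = x then snd p else 0) = occurrences False x w"
  by (induction w) (auto simp: occurrences_def)

lemma combination_value_chi:
  assumes "\<And>l. l \<in> set u \<Longrightarrow> basis_value \<sigma> G (snd l) \<noteq> 0"
  shows "combination_value \<sigma> G u = chi (basis_value \<sigma> G) (vec u)"
  using assms
proof (induction u rule: rev_induct)
  case Nil
  then show ?case by (simp add: combination_value_def)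
next
  case (snoc l u)
  have nz: "basis_value \<sigma> G v \<noteq> 0" if "v \<in> keys (vec u) \<union> keys (frag_of (snd l))" for v
  proof -
    have "v \<in> snd ` set (u @ [l])" using that keys_vec[of u] by (auto simp: keys_frag_of)
    then obtain l' where "v = snd l'" "l' \<in> set (u @ [l])" by (rule imageE)
    then show ?thesis using snoc.prems[of l'] by simp
  qed
  have "vec (u @ [l]) = (if fst l then vec u - - frag_of (snd l) else vec u - frag_of (snd l))"
    by (auto simp: vec_Cons single_uminus)
  moreover have "chi (basis_value \<sigma> G) (- frag_of (snd l)) = inverse (basis_value \<sigma> G (snd l))"
    using chi_diff[of 0 "frag_of (snd l)" "basis_value \<sigma> G"] nz by (simp add: divide_inverse)
  ultimately have "chi (basis_value \<sigma> G) (vec (u @ [l])) = chi (basis_value \<sigma> G) (vec u) * signed (fst l) (basis_value \<sigma> G (snd l))"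
    using chi_diff[of "vec u" "frag_of (snd l)" "basis_value \<sigma> G"] chi_diff[of "vec u" "- frag_of (snd l)" "basis_value \<sigma> G"] nz
    by (simp add: signed_def divide_inverse)
  then show ?case using snoc by (simp add: combination_value_def)
qed

lemma basis_value_shift:
  assumes "difference_field \<sigma>" "shift_var v \<notin> fst ` set (map fst G)"
  shows "basis_value \<sigma> G (shift_var v) = \<sigma> (basis_value \<sigma> G v)"
proof -
  interpret difference \<sigma> by standard (rule assms(1))
  show ?thesis
    using assms(2)
  proof (induction G rule: rev_induct)
    case (snoc g G)
    have "snd (shift_var v) - snd (fst (fst g)) = Suc (snd v - snd (fst (fst g)))" if "matches (fst g) v"
      using that by (auto simp: matches_def shift_var_def)
    then show ?case using snoc matches_shift[of "fst g" v] by (auto simp: basis_value_def)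
  qed (simp add: basis_value_def)
qed

lemma basis_value_nonzero:
  assumes "difference_field \<sigma>" "\<forall>g\<in>set G. snd g \<noteq> 0"
  shows "basis_value \<sigma> G v \<noteq> 0"
proof -
  interpret difference \<sigma> by standard (rule assms(1))
  show ?thesis
    using assms(2) by (induction G rule: rev_induct) (auto simp: basis_value_def)
qed

lemma basis_value_entry:
  assumes "sorted_wrt (\<lambda>g h. fst g < fst h) (map fst G)" "g \<in> set G"
  shows "basis_value \<sigma> G (fst (fst g)) = snd g"
  using assms
proof (induction G rule: rev_induct)
  case (snoc h G)
  show ?case
  proof (cases "g = h")
    case True
    then show ?thesis by (simp add: basis_value_def matches_def)
  next
    case False
    then have g: "g \<in> set G" using snoc.prems(2) by auto
    have "fst (fst g) < fst (fst h)" using snoc.prems(1) g by (auto simp: sorted_wrt_append)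
    then have "\<not> matches (fst h) (fst (fst g))" by (auto simp: matches_def less_prod_def')
    then show ?thesis using snoc g by (simp add: basis_value_def sorted_wrt_append)
  qed
qed simp

text \<open>A checked certificate with a consistent family of values \<open>GV\<close>; \<open>SL\<close> lists the positions of the indeterminates
  in \<open>S\<close>, which the system \<open>F\<close> contains as unit vectors with value $1$. The value is a dummy: monomials that
  involve \<open>S\<close> vanish anyway, and the unit vectors keep \<open>S\<close> out of all other entries.\<close>

locale certified_chain = difference \<sigma>
  for \<sigma> :: "'a::field \<Rightarrow> 'a" +
  fixes S :: "'n::{finite,linorder} set" and SL :: "nat list" and F :: "(word \<times> 'a) list"
    and GV :: "(entry \<times> 'a) list" and H :: "entry list" and U :: "word list"
    and N :: nat and G :: "entry list"
  assumes N_def: "N = card (UNIV :: 'n set)" and G_def: "G = map fst GV"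
    and SL: "set SL = position ` S"
    and ok: "gb_ok N G U" and ok_H: "gb_ok (2 * N) H U" and sat: "sat_ok N G H U"
    and F_in: "\<And>f. f \<in> set F \<Longrightarrow> in_span G U (fst f)"
    and cons: "consistent \<sigma> F U GV"
    and nonzero: "\<And>g. g \<in> set GV \<Longrightarrow> snd g \<noteq> 0"
    and F_S: "\<And>p. p \<in> set SL \<Longrightarrow> ([(True, (p, 0))], 1) \<in> set F"
begin

lemma basis_value_nz: "basis_value \<sigma> GV v \<noteq> 0"
  using basis_value_nonzero[OF difference_field] nonzero by blast

text \<open>At an entry the relation is supplied by consistency, elsewhere it holds by construction.\<close>

lemma value_shift_relation:
  assumes v: "v \<in> lead_set G"
  shows "\<exists>z. keys z \<subseteq> lead_set G \<and> relabel shift_var (basis_vector G v) = frag_extend (basis_vector G) z \<and>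
    \<sigma> (basis_value \<sigma> GV v) = chi (basis_value \<sigma> GV) z"
proof (cases "shift_var v \<in> fst ` set G")
  case True
  then obtain g where g: "g \<in> set GV" "fst (fst g) = shift_var v" by (auto simp: G_def)
  then have "in_span G U (shift_word 1 (basis_word G v))"
    using boundary_in_span[OF ok v, of "fst g"] by (auto simp: G_def)
  then obtain u where u: "u \<in> set U" "span_ok G (shift_word 1 (basis_word G v)) u"
    by (auto simp: in_span_def list_ex_iff)
  have "prev_var (fst (fst g)) = v" "snd (fst (fst g)) \<noteq> 0" by (simp_all add: g(2) prev_var_def shift_var_def)
  then have "\<sigma> (basis_value \<sigma> GV v) = combination_value \<sigma> GV u"
    using cons g(1) u v unfolding consistent_def list_all_iff G_def[symmetric]
    by (auto simp: lead_set_def)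
  moreover have "vec (shift_word 1 (basis_word G v)) = vec (combination G u)" "\<forall>l\<in>set u. has_lead G (snd l)"
    using u(2) by (auto simp: span_ok_def same_vector_iff list_all_iff)
  moreover have "keys (vec u) \<subseteq> lead_set G"
    using keys_vec[of u] calculation(3) by (fastforce simp: lead_set_def)
  ultimately show ?thesis
    using combination_value_chi[of u \<sigma> GV] basis_value_nz
    by (intro exI[of _ "vec u"]) (simp add: vec_shift_word basis_vector_def vec_combination)
next
  case False
  then have "relabel shift_var (basis_vector G v) = basis_vector G (shift_var v)"
    by (simp add: basis_vector_def basis_word_shift vec_shift_word)
  moreover have "basis_value \<sigma> GV (shift_var v) = \<sigma> (basis_value \<sigma> GV v)"
    using basis_value_shift[OF difference_field, of v GV] False by (simp add: G_def)
  ultimately show ?thesis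
    using lead_set_up[OF v] by (intro exI[of _ "frag_of (shift_var v)"]) (simp add: keys_frag_of)
qed

sublocale E: echelon "lead_set G" "basis_vector G"
  by (rule gb_ok_echelon[OF ok])

sublocale EC: echelon_character "lead_set G" "basis_vector G" \<sigma> "basis_value \<sigma> GV"
  by unfold_locales (use basis_value_nz value_shift_relation in auto)

sublocale T: torus \<sigma> S "gspan G" EC.character
proof
  show "0 \<in> gspan G" by (rule subgrp_zero[OF E.subgrp_lspan])
  show "u + w \<in> gspan G" if "u \<in> gspan G" "w \<in> gspan G" for u w
    using that by (rule subgrp_add[OF E.subgrp_lspan])
  show "- u \<in> gspan G" if "u \<in> gspan G" for u
    using that by (rule subgrp_uminus[OF E.subgrp_lspan])
  show "u \<in> gspan G" if "k \<noteq> 0" "frag_cmul k u \<in> gspan G" for k u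
    using sat_ok_saturated(1)[OF ok ok_H sat that] .
  show "relabel shift_var u \<in> gspan G \<longleftrightarrow> u \<in> gspan G" for u
    by (rule sat_ok_saturated(2)[OF ok ok_H sat])
  show "EC.character (u + w) = EC.character u * EC.character w" if "u \<in> gspan G" "w \<in> gspan G" for u w
    using that by (rule EC.character_add)
  show "EC.character u \<noteq> 0" if "u \<in> gspan G" for u
    using that by (rule EC.character_nonzero)
  show "EC.character (relabel shift_var u) = \<sigma> (EC.character u)" if "u \<in> gspan G" for u
    using that by (rule EC.character_shift)
qed

lemma character_in_span:
  assumes "span_ok G w u"
  shows "vec w \<in> gspan G" "EC.character (vec w) = combination_value \<sigma> GV u"
proof -
  have u: "vec w = frag_extend (basis_vector G) (vec u)" "\<forall>l\<in>set u. has_lead G (snd l)"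
    using assms by (auto simp: span_ok_def same_vector_iff list_all_iff vec_combination)
  have "keys (vec u) \<subseteq> lead_set G"
    using keys_vec[of u] u(2) by (fastforce simp: lead_set_def)
  then show "vec w \<in> gspan G" "EC.character (vec w) = combination_value \<sigma> GV u"
    using u(1) combination_value_chi[of u \<sigma> GV] basis_value_nz by (auto simp: E.lspan_def EC.character_frag_extend)
qed

lemma character_F:
  assumes "f \<in> set F"
  shows "vec (fst f) \<in> gspan G" "EC.character (vec (fst f)) = snd f"
proof -
  obtain u where u: "u \<in> set U" "span_ok G (fst f) u"
    using F_in[OF assms] by (auto simp: in_span_def list_ex_iff)
  then have "combination_value \<sigma> GV u = snd f"
    using cons assms unfolding consistent_def list_all_iff G_def[symmetric] by auto
  then show "vec (fst f) \<in> gspan G" "EC.character (vec (fst f)) = snd f"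
    using character_in_span[OF u(2)] by auto
qed

lemma entry_facts:
  assumes "g \<in> set G"
  shows "entry_ok N g" "fst (fst g) < N" "fst (snd g) > 0"
    "\<And>l. l \<in> set (entry_word g) \<Longrightarrow> fst (snd l) < N"
proof -
  show e: "entry_ok N g" using ok assms by (auto simp: gb_ok_def list_all_iff)
  show p: "fst (fst g) < N" "fst (snd g) > 0" using e by (auto simp: entry_ok_def)
  show "fst (snd l) < N" if "l \<in> set (entry_word g)" for l
  proof -
    have "snd l \<le> fst g" using that e by (auto simp: entry_word_def entry_ok_def list_all_iff less_imp_le)
    then have "fst (snd l) \<le> fst (fst g)" by (auto simp: less_eq_prod_def)
    then show ?thesis using p by simp
  qed
qed

lemma reduced_occurrences:
  assumes "g \<in> set G" "h \<in> set G" "fst g \<noteq> fst h" "matches g v"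
  shows "occurrences s v (entry_word h) < fst (snd g)"
proof (cases "(s, v) \<in> set (entry_word h)")
  case True
  have "reduced_ok g h" using ok assms(1,2) by (auto simp: gb_ok_def list_all_iff)
  then have "\<forall>l\<in>set (entry_word h). \<not> matches g (snd l) \<or> occurrences (fst l) (snd l) (entry_word h) < fst (snd g)"
    using assms(3) unfolding reduced_ok_def list_all_iff by blast
  from bspec[OF this True] show ?thesis using assms(4) by simp
next
  case False
  then have "occurrences s v (entry_word h) = 0" by (simp add: occurrences_eq_0)
  then show ?thesis using entry_facts(3)[OF assms(1)] by simp
qed

lemma lead_occurrences:
  assumes "g \<in> set G"
  shows "occurrences True (fst g) (entry_word g) = fst (snd g)" "occurrences False (fst g) (entry_word g) = 0"
proof -
  have "(s, fst g) \<notin> set (snd (snd g))" for s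
    using entry_facts(1)[OF assms] by (auto simp: entry_ok_def list_all_iff)
  then have z: "occurrences s (fst g) (snd (snd g)) = 0" for s by (simp add: occurrences_eq_0)
  show "occurrences True (fst g) (entry_word g) = fst (snd g)" "occurrences False (fst g) (entry_word g) = 0"
    using z[of True] z[of False] by (simp_all add: entry_word_def occurrences_def)
qed

text \<open>An indeterminate that vanishes contributes the entry \<open>y\<close> to the chain and occurs in no other
  entry, by reducedness.\<close>

lemma vanishing_entry:
  assumes "p \<in> set SL"
  obtains g where "g \<in> set G" "fst g = (p, 0)" "fst (snd g) = 1"
proof -
  have "vec [(True, (p, 0))] \<in> gspan G" using character_F(1)[OF F_S[OF assms]] by simp
  then have e: "frag_of (p, 0) \<in> gspan G" by (simp add: vec_Cons)
  obtain v where v: "v \<in> lead_set G" "lookup (frag_of (p, 0)) v \<noteq> 0"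
      "lookup (basis_vector G v) v dvd lookup (frag_of (p, 0)) v"
    by (rule E.lspan_lead[OF e]) auto
  then have "v = (p, 0)" by (auto simp: lookup_single when_def split: if_splits)
  with v have v: "(p, 0) \<in> lead_set G" "lookup (basis_vector G (p, 0)) (p, 0) dvd 1" by simp_all
  obtain g where g: "g \<in> set G" "matches g (p, 0)"
      "lookup (basis_vector G (p, 0)) (p, 0) = int (fst (snd g))"
    by (rule basis_vector_match[OF ok v(1)]) blast
  have "fst (snd g) = 1" using v(2) by (simp add: g(3))
  moreover have "fst g = (p, 0)" using g(2) by (auto simp: matches_def prod_eq_iff)
  ultimately show ?thesis using that g(1) by blast
qed

lemma entry_without_S:
  assumes "h \<in> set G" "fst (fst h) \<notin> set SL" "p \<in> set SL"
  shows "occurrences s (p, d) (entry_word h) = 0"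
proof -
  obtain g where g: "g \<in> set G" "fst g = (p, 0)" "fst (snd g) = 1" using vanishing_entry[OF assms(3)] .
  have "fst g \<noteq> fst h" using assms(2,3) g(2) by (metis fst_conv)
  then show ?thesis using reduced_occurrences[OF g(1) assms(1), of "(p, d)" s] g(2,3) by (simp add: matches_def)
qed

lemma vanishing_lead:
  assumes "h \<in> set G" "fst (fst h) \<in> set SL"
  shows "fst h = (fst (fst h), 0)" "fst (snd h) = 1"
proof -
  obtain g where g: "g \<in> set G" "fst g = (fst (fst h), 0)" "fst (snd g) = 1" using vanishing_entry[OF assms(2)] .
  have eq: "fst g = fst h"
  proof (rule ccontr)
    assume "fst g \<noteq> fst h"
    then have "occurrences True (fst h) (entry_word h) < 1" using reduced_occurrences[OF g(1) assms(1), of "fst h" True] g(2,3) by (simp add: matches_def)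
    then show False using lead_occurrences(1)[OF assms(1)] entry_facts(3)[OF assms(1)] by simp
  qed
  then show "fst h = (fst (fst h), 0)" using g(2) by simp
  have "g = h" using sorted_leads_inj[OF _ g(1) assms(1) eq] ok unfolding gb_ok_def by blast
  then show "fst (snd h) = 1" using g(3) by simp
qed

subsection \<open>The polynomials of the chain\<close>

definition pos_exp :: "entry \<Rightarrow> 'n dvar \<Rightarrow>\<^sub>0 nat" where
  "pos_exp g = term_exponent ((fst g, fst (snd g)) # map (\<lambda>l. (snd l, 1)) (filter (\<lambda>l. fst l) (snd (snd g))))"

definition neg_exp :: "entry \<Rightarrow> 'n dvar \<Rightarrow>\<^sub>0 nat" where
  "neg_exp g = term_exponent (map (\<lambda>l. (snd l, 1)) (filter (\<lambda>l. \<not> fst l) (snd (snd g))))"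

definition chain_poly :: "entry \<times> 'a \<Rightarrow> ('n, 'a) dpoly" where
  "chain_poly g = dpoly_of (map unnumbered (entry_poly SL g))"

definition chain :: "('n, 'a) dpoly list" where
  "chain = map chain_poly GV"

lemma lookup_exps:
  assumes "g \<in> set G"
  shows "lookup (pos_exp g) v = occurrences True (nvar v) (entry_word g)"
    "lookup (neg_exp g) v = occurrences False (nvar v) (entry_word g)"
proof -
  have b: "fst (snd l) < card (UNIV :: 'n set)" if "l \<in> set (snd (snd g))" for l
    using entry_facts(4)[OF assms, of l] that by (simp add: entry_word_def N_def)
  have l: "fst (fst g) < card (UNIV :: 'n set)" using entry_facts(2)[OF assms] by (simp add: N_def)
  have "lookup (pos_exp g) v = (if fst g = nvar v then fst (snd g) else 0) + occurrences True (nvar v) (snd (snd g))"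
    unfolding pos_exp_def by (subst lookup_term_exponent) (use b l in \<open>auto simp only: list.map sum_list.Cons fst_conv snd_conv sum_signed_terms set_map list.set set_filter\<close>)
  then show "lookup (pos_exp g) v = occurrences True (nvar v) (entry_word g)"
    by (auto simp: occurrences_def entry_word_def filter_empty_conv)
  have "lookup (neg_exp g) v = occurrences False (nvar v) (snd (snd g))"
    unfolding neg_exp_def by (subst lookup_term_exponent) (use b in \<open>auto simp only: fst_conv snd_conv sum_signed_terms set_map set_filter\<close>)
  then show "lookup (neg_exp g) v = occurrences False (nvar v) (entry_word g)"
    by (auto simp: occurrences_def entry_word_def filter_empty_conv)
qed

lemma exps_difference:
  assumes "g \<in> set G"
  shows "exponent_vector (pos_exp g) - exponent_vector (neg_exp g) = vec (entry_word g)"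
proof (rule vector_eqI[where 'n = 'n])
  show "lookup (exponent_vector (pos_exp g) - exponent_vector (neg_exp g)) (nvar v) =
      lookup (vec (entry_word g)) (nvar v)" for v :: "'n dvar"
    by (simp add: lookup_minus lookup_exps[OF assms] lookup_vec)
  fix v :: "nat \<times> nat" assume v: "card (UNIV :: 'n set) \<le> fst v"
  have "(s, v) \<notin> set (entry_word g)" for s using entry_facts(4)[OF assms, of "(s, v)"] v by (auto simp: N_def)
  then have "occurrences s v (entry_word g) = 0" for s by (simp add: occurrences_eq_0)
  then show "lookup (exponent_vector (pos_exp g) - exponent_vector (neg_exp g)) v =
      lookup (vec (entry_word g)) v"
    using v by (simp add: lookup_minus lookup_exponent_vector_outside lookup_vec)
qed

lemma chain_poly_vanishing:
  assumes "g \<in> set GV" "fst (fst (fst g)) \<in> set SL"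
  shows "chain_poly g = single (single (unvar (fst (fst g))) 1) 1"
    and "chain_poly g = yvar (inv position (fst (fst (fst g))), 0)"
proof -
  have "in_positions SL (fst (fst (fst g)))" using assms(2) by (auto simp: in_positions_def list_ex_iff)
  then have c: "chain_poly g = single (single (unvar (fst (fst (fst g)), 0)) 1) 1"
    by (simp add: chain_poly_def entry_poly_def dpoly_of_def pterm_value_lift term_exponent_def)
  have "(fst (fst (fst g)), 0) = fst (fst g)"
    using vanishing_lead(1)[of "fst g"] assms by (simp add: G_def)
  with c show "chain_poly g = single (single (unvar (fst (fst g))) 1) 1" by simp
  show "chain_poly g = yvar (inv position (fst (fst (fst g))), 0)" using c by (simp add: yvar_def unvar_def)
qed

lemma chain_poly_binomial:
  assumes "g \<in> set GV" "fst (fst (fst g)) \<notin> set SL"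
  shows "chain_poly g = single (pos_exp (fst g)) 1 - single (neg_exp (fst g)) (snd g)"
proof -
  have "\<not> in_positions SL (fst (fst (fst g)))" using assms(2) by (auto simp: in_positions_def list_ex_iff)
  then show ?thesis
    by (simp add: chain_poly_def entry_poly_def dpoly_of_def pterm_value_lift pos_exp_def neg_exp_def single_uminus)
qed

lemma deg_chain_poly:
  assumes g: "g \<in> set GV" and "\<And>s. occurrences s (nvar v) (entry_word (fst g)) \<le> D"
  shows "deg_le v D (chain_poly g)"
proof (cases "fst (fst (fst g)) \<in> set SL")
  case True
  have G: "fst g \<in> set G" using g by (simp add: G_def)
  have "lookup (single (unvar (fst (fst g))) 1) v \<le> D"
    using assms(2)[of True] lead_occurrences(1)[OF G] vanishing_lead(2)[OF G True] entry_facts(2)[OF G] nvar_unvar[of "fst (fst g)", where 'n = 'n]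
    by (auto simp: lookup_single when_def N_def)
  then show ?thesis using chain_poly_vanishing(1)[OF g True] by (simp add: deg_le_single)
next
  case False
  have G: "fst g \<in> set G" using g by (simp add: G_def)
  show ?thesis unfolding chain_poly_binomial[OF g False]
    by (intro deg_le_diff deg_le_single) (simp_all add: lookup_exps[OF G] assms(2))
qed

lemma nvar_lead: "g \<in> set G \<Longrightarrow> nvar (unvar (fst g) :: 'n dvar) = fst g"
  using entry_facts(2) by (simp add: nvar_unvar N_def)

lemma lead_coeff_chain_poly:
  assumes g: "g \<in> set GV"
  defines "v \<equiv> unvar (fst (fst g)) :: 'n dvar"
  shows "deg_in (chain_poly g) v = fst (snd (fst g))"
    and "\<exists>m. coeff_in (chain_poly g) v (fst (snd (fst g))) = single m 1 \<and> avoids S m"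
    and "chain_poly g \<noteq> 0"
proof -
  have G: "fst g \<in> set G" using g by (simp add: G_def)
  have nv: "nvar v = fst (fst g)" using nvar_lead[OF G] by (simp add: v_def)
  let ?a = "fst (snd (fst g))"
  have le: "deg_in (chain_poly g) v \<le> ?a"
    unfolding deg_in_le_iff
  proof (rule deg_chain_poly[OF g])
    show "occurrences s (nvar v) (entry_word (fst g)) \<le> ?a" for s using lead_occurrences[OF G] nv by (cases s) simp_all
  qed
  show co: "\<exists>m. coeff_in (chain_poly g) v ?a = single m 1 \<and> avoids S m"
  proof (cases "fst (fst (fst g)) \<in> set SL")
    case True
    have "update v 0 (single v 1) = (0 :: 'n dvar \<Rightarrow>\<^sub>0 nat)"
      by (rule poly_mapping_eqI) (auto simp: lookup_update lookup_single when_def)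
    then show ?thesis
      using vanishing_lead(2)[OF G True] chain_poly_vanishing(1)[OF g True]
      by (intro exI[of _ 0]) (simp add: coeff_in_single flip: v_def)
  next
    case False
    have c: "coeff_in (chain_poly g) v ?a = coeff_in (single (pos_exp (fst g)) 1) v ?a +
        coeff_in (single (neg_exp (fst g)) (- snd g)) v ?a"
      unfolding chain_poly_binomial[OF g False] by (simp add: single_uminus flip: coeff_in_add)
    have "avoids S (pos_exp (fst g))"
      unfolding avoids_def
    proof (intro ballI notI)
      fix w assume w: "w \<in> keys (pos_exp (fst g))" "fst w \<in> S"
      then have "occurrences True (nvar w) (entry_word (fst g)) = 0"
        using entry_without_S[OF G False, of "position (fst w)" True "snd w"] SL by (simp add: nvar_def)
      then show False using w(1) by (simp add: in_keys_iff lookup_exps[OF G])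
    qed
    then have "avoids S (update v 0 (pos_exp (fst g)))"
      by (auto simp: avoids_def in_keys_iff lookup_update split: if_splits)
    moreover have "coeff_in (chain_poly g) v ?a = single (update v 0 (pos_exp (fst g))) 1"
      using lead_occurrences[OF G] entry_facts(3)[OF G] nv by (simp add: c coeff_in_single lookup_exps[OF G])
    ultimately show ?thesis by blast
  qed
  then have nz: "coeff_in (chain_poly g) v ?a \<noteq> 0"
    by (metis keys_single keys_zero insert_not_empty zero_neq_one)
  then show "chain_poly g \<noteq> 0" by auto
  have "\<not> deg_in (chain_poly g) v < ?a" using nz coeff_in_beyond by blast
  then show "deg_in (chain_poly g) v = ?a" using le by simp
qed

lemma leader_chain_poly:
  assumes g: "g \<in> set GV"
  shows "leader (chain_poly g) = unvar (fst (fst g))" "vars (chain_poly g) \<noteq> {}"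
proof -
  let ?v = "unvar (fst (fst g)) :: 'n dvar"
  have G: "fst g \<in> set G" using g by (simp add: G_def)
  have nv: "nvar ?v = fst (fst g)" by (rule nvar_lead[OF G])
  have "\<not> deg_le ?v 0 (chain_poly g)"
    using lead_coeff_chain_poly(1)[OF g] entry_facts(3)[OF G] by (auto simp flip: deg_in_le_iff)
  then have v: "?v \<in> vars (chain_poly g)" by (simp add: deg_le_0_iff)
  then show "vars (chain_poly g) \<noteq> {}" by auto
  have "w \<le> ?v" if "w \<in> vars (chain_poly g)" for w
  proof (rule ccontr)
    assume "\<not> w \<le> ?v"
    then have "fst (fst g) < nvar w" using nvar_le[of w ?v] nv by simp
    then have "(s, nvar w) \<notin> set (entry_word (fst g))" for s
      using entry_facts(1)[OF G] by (auto simp: entry_word_def entry_ok_def list_all_iff)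
    then have "occurrences s (nvar w) (entry_word (fst g)) = 0" for s by (simp add: occurrences_eq_0)
    then have "deg_le w 0 (chain_poly g)" by (intro deg_chain_poly[OF g]) simp
    then show False using that by (simp add: deg_le_0_iff)
  qed
  then show "leader (chain_poly g) = ?v" unfolding leader_def using v by (intro Max_eqI) auto
qed

lemma initial_chain_poly:
  assumes "g \<in> set GV"
  shows "\<exists>m. initial (chain_poly g) = single m 1 \<and> avoids S m"
  using lead_coeff_chain_poly[OF assms] leader_chain_poly[OF assms] by (simp add: initial_def)

lemma chain_poly_in_ideal:
  assumes g: "g \<in> set GV"
  shows "chain_poly g \<in> T.torus_ideal"
proof (cases "fst (fst (fst g)) \<in> set SL")
  case True
  then obtain i where "i \<in> S" "position i = fst (fst (fst g))" using SL by auto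
  then have "fst (unvar (fst (fst g)) :: 'n dvar) \<in> S"
    by (metis fst_conv inv_f_f inj_position unvar_def)
  then have "\<not> avoids S (single (unvar (fst (fst g))) 1)"
    by (simp add: avoids_def)
  then show ?thesis using chain_poly_vanishing(1)[OF g True] T.monomial_in_torus_ideal by simp
next
  case False
  have G: "fst g \<in> set G" using g by (simp add: G_def)
  have tor: "avoids S (pos_exp (fst g))" "avoids S (neg_exp (fst g))"
    using entry_without_S[OF G False] SL
    by (auto simp: avoids_def in_keys_iff lookup_exps[OF G] nvar_def)
  have t: "vec (entry_word (fst g)) \<in> gspan G" "basis_vector G (fst (fst g)) = vec (entry_word (fst g))" "fst (fst g) \<in> lead_set G"
    using entry_word_in_gspan[OF ok G] by simp_all
  have eq: "T.equiv_mod (pos_exp (fst g)) (neg_exp (fst g))"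
    using t(1) by (simp add: T.equiv_mod_def exps_difference[OF G])
  have "EC.character (vec (entry_word (fst g))) = basis_value \<sigma> GV (fst (fst g))"
    using EC.character_frag_extend[of "frag_of (fst (fst g))"] t by (simp add: keys_frag_of)
  also have "\<dots> = snd g" using ok g by (intro basis_value_entry) (simp_all add: gb_ok_def G_def)
  finally have "EC.character (vec (entry_word (fst g))) = snd g" .
  then show ?thesis
    using T.binomial_in_torus_ideal[OF tor eq, of 1]
    by (simp add: chain_poly_binomial[OF g False] exps_difference[OF G])
qed

lemma ascending_chain_chain: "ascending_chain chain"
  unfolding ascending_chain_iff
proof
  show "\<forall>p\<in>set chain. p \<noteq> 0" using lead_coeff_chain_poly(3) by (auto simp: chain_def)
  have "sorted_wrt (\<lambda>g h. fst (fst g) < fst (fst h)) GV" using ok by (simp add: gb_ok_def G_def sorted_wrt_map)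
  then have "sorted_wrt (\<lambda>g h. higher_rank (chain_poly h) (chain_poly g) \<and> reduced_wrt (chain_poly h) (chain_poly g)) GV"
  proof (rule sorted_wrt_mono_rel[rotated])
    fix g h assume gh: "g \<in> set GV" "h \<in> set GV" "fst (fst g) < fst (fst h)"
    have G: "fst g \<in> set G" "fst h \<in> set G" using gh by (simp_all add: G_def)
    have "leader (chain_poly g) < leader (chain_poly h)"
      using gh(3) by (simp add: leader_chain_poly gh nvar_lead G flip: nvar_less)
    moreover have "reduced_wrt (chain_poly h) (chain_poly g)"
      unfolding reduced_wrt_iff[OF leader_chain_poly(2)[OF gh(1)]] reduced_bound_def
    proof
      fix l
      let ?w = "(fst (leader (chain_poly g)), snd (leader (chain_poly g)) + l)"
      have "nvar ?w = (fst (fst (fst g)), snd (fst (fst g)) + l)"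
        using nvar_lead[OF G(1)] by (simp add: leader_chain_poly gh nvar_def prod_eq_iff)
      then have "matches (fst g) (nvar ?w)" by (simp add: matches_def)
      moreover have "fst (fst g) \<noteq> fst (fst h)" using gh(3) by simp
      ultimately have lt: "occurrences s (nvar ?w) (entry_word (fst h)) < fst (snd (fst g))" for s
        using reduced_occurrences[OF G] by blast
      have "occurrences s (nvar ?w) (entry_word (fst h)) \<le> fst (snd (fst g)) - 1" for s
        using lt[of s] by linarith
      then have "deg_le ?w (fst (snd (fst g)) - 1) (chain_poly h)" by (rule deg_chain_poly[OF gh(2)])
      then show "deg_le ?w (deg_in (chain_poly g) (leader (chain_poly g)) - 1) (chain_poly h)"
        using lead_coeff_chain_poly(1)[OF gh(1)] leader_chain_poly(1)[OF gh(1)] by simp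
    qed
    ultimately show "higher_rank (chain_poly h) (chain_poly g) \<and> reduced_wrt (chain_poly h) (chain_poly g)"
      using leader_chain_poly(2) gh by (simp add: higher_rank_def)
  qed
  then show "sorted_wrt (\<lambda>p q. higher_rank q p \<and> reduced_wrt q p) chain"
    by (simp add: chain_def sorted_wrt_map)
qed

text \<open>Two equivalent monomials of a polynomial differ by a lattice vector, and one of them then has in
  its leading variable at least the degree of a chain element.\<close>

lemma reduced_in_ideal:
  assumes p: "p \<in> T.torus_ideal" and red: "\<forall>q\<in>set chain. reduced_bound p q"
  shows "p = 0"
proof -
  have bound: "lookup m v < fst (snd g)"
    if g: "g \<in> set G" and m: "m \<in> keys p" and v: "matches g (nvar v)" for g m v
  proof -
    obtain c where c: "(g, c) \<in> set GV" using g by (auto simp: G_def)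
    let ?l = "snd v - snd (fst g)"
    have "reduced_bound p (chain_poly (g, c))" using red c by (auto simp: chain_def)
    moreover have "(fst (leader (chain_poly (g, c))), snd (leader (chain_poly (g, c))) + ?l) = v"
      using v nvar_lead[OF g] leader_chain_poly(1)[OF c] by (auto simp: matches_def nvar_def prod_eq_iff unvar_def)
    ultimately have "deg_le v (fst (snd g) - 1) p"
      using lead_coeff_chain_poly(1)[OF c] leader_chain_poly(1)[OF c] unfolding reduced_bound_def by (metis fst_conv)
    then show ?thesis using m entry_facts(3)[OF g] by (fastforce simp: deg_le_def)
  qed
  have "T.separated p"
    unfolding T.separated_def
  proof (intro conjI ballI impI)
    fix m assume m: "m \<in> keys p"
    show "avoids S m"
      unfolding avoids_def
    proof (intro ballI notI)
      fix v assume v: "v \<in> keys m" "fst v \<in> S"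
      then have "position (fst v) \<in> set SL" using SL by auto
      then obtain g where g: "g \<in> set G" "fst g = (position (fst v), 0)" "fst (snd g) = 1"
        by (rule vanishing_entry)
      then have "lookup m v < 1"
        using bound[OF g(1) m, of v] by (simp add: matches_def nvar_def)
      then show False using v(1) by (simp add: in_keys_iff)
    qed
    fix m' assume m': "m' \<in> keys p" and eq: "T.equiv_mod m m'"
    show "m = m'"
    proof (rule ccontr)
      assume "m \<noteq> m'"
      let ?u = "exponent_vector m - exponent_vector m'"
      have u: "?u \<in> gspan G" "?u \<noteq> 0" using eq \<open>m \<noteq> m'\<close> by (simp_all add: T.equiv_mod_def)
      obtain v where v: "v \<in> lead_set G" "lookup ?u v \<noteq> 0"
          "lookup (basis_vector G v) v dvd lookup ?u v"
        by (rule E.lspan_lead[OF u]) auto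
      obtain g where g: "g \<in> set G" "matches g v" "lookup (basis_vector G v) v = int (fst (snd g))"
        by (rule basis_vector_match[OF ok v(1)]) blast
      have "fst v < card (UNIV :: 'n set)"
        using gspan_bounded[OF ok u(1), of v] v(2) by (simp add: in_keys_iff N_def)
      then have nv: "nvar (unvar v :: 'n dvar) = v" by (rule nvar_unvar)
      have look: "lookup ?u v = int (lookup m (unvar v)) - int (lookup m' (unvar v))"
        using lookup_exponent_vector[of m "unvar v"] lookup_exponent_vector[of m' "unvar v"]
        by (simp add: lookup_minus nv)
      have "lookup m (unvar v) < fst (snd g)" "lookup m' (unvar v) < fst (snd g)"
        using bound[OF g(1) m, of "unvar v"] bound[OF g(1) m', of "unvar v"] g(2) by (simp_all add: nv)
      then have "\<bar>lookup ?u v\<bar> < int (fst (snd g))" unfolding look by linarith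
      moreover have "int (fst (snd g)) \<le> \<bar>lookup ?u v\<bar>"
        using dvd_imp_le_int[OF v(2,3)] g(3) by simp
      ultimately show False by simp
    qed
  qed
  then show ?thesis using p by (rule T.separated_torus_ideal)
qed

text \<open>The conditions of \<open>characteristic_set\<close> hold: initials are monomials free of \<open>S\<close>, hence outside the prime ideal, and
  by \<open>reduced_in_ideal\<close> reduced elements of the ideal vanish.\<close>

theorem sat_chain: "sat \<sigma> chain = T.torus_ideal" and coherent_chain_chain: "coherent_chain \<sigma> chain"
proof -
  have 1: "sigma_ideal \<sigma> T.torus_ideal"
    using T.reflexive_torus_ideal by (simp add: reflexive_sigma_ideal_def)
  have 2: "set chain \<subseteq> T.torus_ideal" using chain_poly_in_ideal by (auto simp: chain_def)
  have 3: "vars g \<noteq> {}" if "g \<in> set chain" for g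
    using that leader_chain_poly(2) by (auto simp: chain_def)
  have 4: "(transform \<sigma> ^^ j) (initial g) \<notin> T.torus_ideal" if g: "g \<in> set chain" for g j
  proof -
    obtain h where h: "g = chain_poly h" "h \<in> set GV" using g unfolding chain_def set_map by (rule imageE)
    obtain m where m: "initial g = single m 1" "avoids S m"
      using initial_chain_poly[OF h(2)] h(1) by blast
    have "avoids S ((shift_exponent ^^ j) m)" using m(2) by (induction j) simp_all
    then show ?thesis by (simp add: m(1) transform_funpow_single T.torus_monomial_notin)
  qed
  show "sat \<sigma> chain = T.torus_ideal"
    by (rule characteristic_set(1)[OF 1 T.prime_torus_ideal 2 ascending_chain_chain 3 4 reduced_in_ideal])
  show "coherent_chain \<sigma> chain"
    by (rule characteristic_set(2)[OF 1 T.prime_torus_ideal 2 ascending_chain_chain 3 4 reduced_in_ideal])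
qed

subsection \<open>Regularity\<close>

lemma single_power: "(single m c :: ('n, 'a) dpoly) ^ e = single (\<Sum>i<e. m) (c ^ e)"
  by (induction e) (simp_all add: mult_single add.commute)

text \<open>The transforms that \<open>invertible_wrt\<close> admits for a monomial.\<close>

definition allowed :: "('n dvar \<Rightarrow>\<^sub>0 nat) \<Rightarrow> ('n, 'a) dpoly set" where
  "allowed m = {(transform \<sigma> ^^ k) g |g k. g \<in> set chain \<and>
     (\<exists>v\<in>keys m. (fst (leader g), snd (leader g) + k) \<le> v)}"

text \<open>A monomial is freed of its largest variable that is the leader of a transform of a chain element:
  modulo this transform the power of the variable becomes a monomial in smaller variables, since the
  binomial has a monomial on either side.\<close>

lemma monomial_invertible:
  assumes "avoids S m" "\<And>v. v \<in> keys m \<Longrightarrow> nvar v < x"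
  shows "\<exists>m'. (\<forall>v\<in>keys m'. nvar v \<notin> lead_set G) \<and>
    single m' 1 \<in> ideal_generated (insert (single m 1) (allowed m))"
  using assms
proof (induction x arbitrary: m rule: less_induct)
  case (less x)
  let ?J = "ideal_generated (insert (single m 1) (allowed m))"
  note J = is_ideal_generated[of "insert (single m 1) (allowed m)"]
  have mJ: "single m 1 \<in> ?J" and aJ: "allowed m \<subseteq> ?J"
    using ideal_generated_incl[of "insert (single m 1) (allowed m)"] by auto
  show ?case
  proof (cases "m = 0")
    case True
    then show ?thesis using mJ by (intro exI[of _ 0]) simp
  next
    case False
    define v where "v = Max (keys m)"
    have v: "v \<in> keys m" unfolding v_def using False by (intro Max_in) (auto simp: in_keys_iff poly_mapping_eq_iff fun_eq_iff)
    have vmax: "w \<le> v" if "w \<in> keys m" for w unfolding v_def using that by simp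
    define e where "e = lookup m v"
    define m0 where "m0 = update v 0 m"
    have m: "m = m0 + single v e" unfolding m0_def e_def by (rule update_zero_split[symmetric])
    have k0: "w \<in> keys m \<and> w < v" if "w \<in> keys m0" for w
      using that vmax[of w] by (auto simp: m0_def in_keys_iff lookup_update le_less split: if_splits)
    have t0: "avoids S m0" using less.prems(1) k0 by (auto simp: avoids_def)
    have allowed_mono: "allowed k \<subseteq> allowed m" if "\<And>w. w \<in> keys k \<Longrightarrow> w \<le> v" for k
      unfolding allowed_def using that v order_trans by blast
    have vx: "nvar v < x" using less.prems(2) v by blast
    show ?thesis
    proof (cases "nvar v \<in> lead_set G")
      case free: False
      have "nvar w < nvar v" if "w \<in> keys m0" for w using k0[OF that] by (simp add: nvar_less)
      then obtain m' where m': "\<forall>w\<in>keys m'. nvar w \<notin> lead_set G"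
          "single m' 1 \<in> ideal_generated (insert (single m0 1) (allowed m0))"
        using less.IH[OF vx t0] by blast
      let ?I = "{q. single (single v e) 1 * q \<in> ?J}"
      have "is_ideal ?I"
        using J unfolding is_ideal_def by (auto simp: distrib_left mult.left_commute)
      moreover have "single m0 1 \<in> ?I" using mJ by (simp add: m mult_single add.commute)
      moreover have "allowed m0 \<subseteq> allowed m" using k0 by (intro allowed_mono) (auto intro: less_imp_le)
      then have "allowed m0 \<subseteq> ?I" using aJ is_ideal_mult[OF J] by auto
      ultimately have "single m' 1 \<in> ?I"
        using m'(2) ideal_generated_least[of ?I "insert (single m0 1) (allowed m0)"] by auto
      then have "single (single v e + m') 1 \<in> ?J" by (simp add: mult_single)
      moreover have "nvar w \<notin> lead_set G" if "w \<in> keys (single v e + m')" for w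
        using that free m'(1) keys_add[of "single v e" m'] by (auto split: if_splits)
      ultimately show ?thesis by blast
    next
      case True
      obtain g where g: "g \<in> set G" "matches g (nvar v)" by (rule basis_vector_match[OF ok True]) blast
      obtain c where c: "(g, c) \<in> set GV" using g(1) by (auto simp: G_def)
      have cnz: "c \<noteq> 0" using nonzero[OF c] by simp
      have notS: "fst (fst (fst (g, c))) \<notin> set SL"
      proof
        assume "fst (fst (fst (g, c))) \<in> set SL"
        then obtain i where "i \<in> S" "fst (fst g) = position i" using SL by auto
        then have "fst v \<in> S" using g(2) by (simp add: matches_def nvar_def)
        then show False using less.prems(1) v by (auto simp: avoids_def)
      qed
      define k where "k = snd v - snd (fst g)"
      let ?\<alpha> = "(shift_exponent ^^ k) (pos_exp g)" and ?\<beta> = "(shift_exponent ^^ k) (neg_exp g)"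
      let ?c = "(\<sigma> ^^ k) c"
      have lead: "(fst (leader (chain_poly (g, c))), snd (leader (chain_poly (g, c))) + k) = v"
        using g(2) nvar_lead[OF g(1)] leader_chain_poly(1)[OF c]
        by (auto simp: matches_def nvar_def prod_eq_iff unvar_def k_def)
      have B: "single ?\<alpha> 1 - single ?\<beta> ?c = (transform \<sigma> ^^ k) (chain_poly (g, c))"
        by (simp add: chain_poly_binomial[OF c notS] transform_funpow_minus transform_funpow_single)
      have "(transform \<sigma> ^^ k) (chain_poly (g, c)) \<in> allowed m"
        unfolding allowed_def
      proof (intro CollectI exI conjI)
        show "chain_poly (g, c) \<in> set chain" using c by (simp add: chain_def)
        show "\<exists>w\<in>keys m. (fst (leader (chain_poly (g, c))), snd (leader (chain_poly (g, c))) + k) \<le> w"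
          unfolding lead using v by blast
      qed simp
      then have BJ: "single ?\<alpha> 1 - single ?\<beta> ?c \<in> ?J" using aJ B by auto
      have keys: "w < v \<and> fst w \<notin> S" if w: "w \<in> keys ?\<beta>" for w
      proof -
        obtain y where y: "y \<in> keys (neg_exp g)" "w = (fst y, snd y + k)"
          using w by (auto simp: keys_shift_exponent_funpow)
        then have cn: "occurrences False (nvar y) (entry_word g) \<noteq> 0" by (simp add: in_keys_iff lookup_exps[OF g(1)])
        then have "(False, nvar y) \<in> set (snd (snd g))" by (auto simp: occurrences_eq_0 entry_word_def)
        then have "nvar y < fst g" using entry_facts(1)[OF g(1)] by (auto simp: entry_ok_def list_all_iff)
        then have "y < unvar (fst g)" using nvar_lead[OF g(1)] nvar_less[of y "unvar (fst g)"] by simp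
        moreover have "v = (fst (unvar (fst g) :: 'n dvar), snd (unvar (fst g) :: 'n dvar) + k)"
          using lead leader_chain_poly(1)[OF c] by simp
        moreover have "fst y \<notin> S"
          using entry_without_S[OF g(1), of "position (fst y)" False "snd y"] notS SL cn by (auto simp: nvar_def)
        ultimately show ?thesis using y(2) by (auto simp: less_prod_def')
      qed
      have lv: "lookup ?\<alpha> v = fst (snd g)"
      proof -
        have "v = (fst v, snd (fst g) + k)" using g(2) by (simp add: k_def matches_def nvar_def)
        then have "lookup ?\<alpha> v = lookup (pos_exp g) (fst v, snd (fst g))"
          using lookup_shift_exponent_funpow by metis
        also have "nvar (fst v, snd (fst g)) = fst g" using g(2) by (auto simp: matches_def nvar_def prod_eq_iff)
        then have "lookup (pos_exp g) (fst v, snd (fst g)) = fst (snd g)"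
          using lead_occurrences(1)[OF g(1)] by (simp add: lookup_exps[OF g(1)])
        finally show ?thesis .
      qed
      \<comment> \<open>The $e$-th power of the leading monomial is a multiple of $v^e$, so it may be replaced by the $e$-th power of
        the smaller side of the binomial.\<close>
      let ?m1 = "m0 + (\<Sum>i<e. ?\<beta>)"
      have "single m0 1 * single ?\<alpha> 1 ^ e \<in> ?J"
      proof -
        have "(\<Sum>i<e. ?\<alpha>) = single v e + ((\<Sum>i<e. ?\<alpha>) - single v e)"
        proof (rule poly_mapping_eqI)
          fix w
          have "e \<le> e * fst (snd g)" using entry_facts(3)[OF g(1)] by simp
          then show "lookup (\<Sum>i<e. ?\<alpha>) w =
              lookup (single v e + ((\<Sum>i<e. ?\<alpha>) - single v e)) w"
            by (cases "w = v") (simp_all add: lookup_add lookup_minus lookup_sum lookup_single lv)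
        qed
        then have "m0 + (\<Sum>i<e. ?\<alpha>) = m0 + (single v e + ((\<Sum>i<e. ?\<alpha>) - single v e))"
          by (rule arg_cong)
        also have "\<dots> = ((\<Sum>i<e. ?\<alpha>) - single v e) + m"
          by (subst m) (simp only: ac_simps)
        finally have "m0 + (\<Sum>i<e. ?\<alpha>) = ((\<Sum>i<e. ?\<alpha>) - single v e) + m" .
        then have "single m0 1 * single ?\<alpha> 1 ^ e =
            single ((\<Sum>i<e. ?\<alpha>) - single v e) 1 * (single m 1 :: ('n, 'a) dpoly)"
          by (simp add: single_power mult_single)
        then show ?thesis using is_ideal_mult[OF J mJ] by simp
      qed
      moreover have "single m0 1 * (single ?\<alpha> 1 ^ e - single ?\<beta> ?c ^ e) \<in> ?J"
        by (subst power_diff_sumr2) (intro is_ideal_mult[OF J] is_ideal_mult_right[OF J] BJ)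
      ultimately have "single m0 1 * single ?\<alpha> 1 ^ e -
          single m0 1 * (single ?\<alpha> 1 ^ e - single ?\<beta> ?c ^ e) \<in> ?J"
        by (rule is_ideal_diff[OF J])
      then have "single ?m1 (?c ^ e) \<in> ?J"
        by (simp add: right_diff_distrib single_power mult_single)
      from is_ideal_mult[OF J this, of "single 0 (inverse (?c ^ e))"]
      have m1J: "single ?m1 1 \<in> ?J" using cnz by (simp add: mult_single)
      have k1: "w < v \<and> fst w \<notin> S" if w: "w \<in> keys ?m1" for w
      proof -
        have "w \<in> keys m0 \<or> w \<in> keys ?\<beta>"
          using w by (auto simp: in_keys_iff lookup_add lookup_sum)
        then show ?thesis using k0[of w] keys[of w] t0 unfolding avoids_def by blast
      qed
      then have "avoids S ?m1" "\<And>w. w \<in> keys ?m1 \<Longrightarrow> nvar w < nvar v"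
        by (auto simp: avoids_def nvar_less)
      then obtain m' where m': "\<forall>w\<in>keys m'. nvar w \<notin> lead_set G"
          "single m' 1 \<in> ideal_generated (insert (single ?m1 1) (allowed ?m1))"
        using less.IH[OF vx] by blast
      have "allowed ?m1 \<subseteq> allowed m" using k1 by (intro allowed_mono) (auto intro: less_imp_le)
      then have "insert (single ?m1 1) (allowed ?m1) \<subseteq> ?J" using m1J aJ by auto
      then show ?thesis using m' ideal_generated_least[OF J] by blast
    qed
  qed
qed

theorem regular_chain_chain: "regular_chain \<sigma> chain"
  unfolding regular_chain_def
proof (intro conjI ballI allI)
  show "ascending_chain chain" by (rule ascending_chain_chain)
  fix g assume "g \<in> set chain"
  then obtain h where h: "g = chain_poly h" "h \<in> set GV" unfolding chain_def set_map by (rule imageE)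
  show "vars g \<noteq> {}" using leader_chain_poly(2)[OF h(2)] h(1) by simp
  fix j
  obtain m where m: "initial g = single m 1" "avoids S m"
    using initial_chain_poly[OF h(2)] h(1) by blast
  let ?m = "(shift_exponent ^^ j) m"
  have t: "avoids S ?m" using m(2) by (induction j) simp_all
  obtain x where x: "\<And>v. v \<in> keys ?m \<Longrightarrow> nvar v < x"
  proof
    fix v assume "v \<in> keys ?m"
    then have "nvar v \<le> Max (nvar ` keys ?m)" by simp
    also have "\<dots> < shift_var (Max (nvar ` keys ?m))" by (simp add: shift_var_def less_prod_def')
    finally show "nvar v < shift_var (Max (nvar ` keys ?m))" .
  qed
  obtain m' where m': "\<forall>v\<in>keys m'. nvar v \<notin> lead_set G"
      "single m' 1 \<in> ideal_generated (insert (single ?m 1) (allowed ?m))"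
    using monomial_invertible[OF t x] by blast
  have f: "(transform \<sigma> ^^ j) (initial g) = single ?m 1" by (simp add: m(1) transform_funpow_single)
  have disj: "vars (single m' (1::'a)) \<inter> leader_transforms chain = {}"
  proof -
    have "nvar v \<in> lead_set G" if "v \<in> leader_transforms chain" for v
    proof -
      obtain p k where p: "v = (fst (leader p), snd (leader p) + k)" "p \<in> set chain"
        using \<open>v \<in> leader_transforms chain\<close> by (auto simp: leader_transforms_def)
      obtain h where h: "p = chain_poly h" "h \<in> set GV" using p(2) unfolding chain_def set_map by (rule imageE)
      have G: "fst h \<in> set G" using h(2) by (simp add: G_def)
      have "matches (fst h) (nvar v)"
        using nvar_lead[OF G] leader_chain_poly(1)[OF h(2)] by (simp add: p(1) h(1) matches_def nvar_def prod_eq_iff)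
      then show ?thesis using G by (auto simp: lead_set_def has_lead_def list_ex_iff)
    qed
    then show ?thesis using m'(1) by (auto simp: vars_def)
  qed
  have nz: "single m' (1::'a) \<noteq> 0"
    by (metis keys_single keys_zero insert_not_empty zero_neq_one)
  have vm: "vars (single ?m (1::'a)) = keys ?m" by (simp add: vars_def)
  show "invertible_wrt \<sigma> ((transform \<sigma> ^^ j) (initial g)) chain"
    unfolding invertible_wrt_def f vm using nz disj m'(2)[unfolded allowed_def]
    by (intro exI[of _ "single m' 1"] conjI)
qed

lemma chain_elements:
  assumes "g \<in> set chain"
  shows "(\<exists>c. g = yvar (c, 0)) \<or> difference_binomial \<sigma> g"
proof -
  obtain h where h: "g = chain_poly h" "h \<in> set GV" using assms unfolding chain_def set_map by (rule imageE)
  show ?thesis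
  proof (cases "fst (fst (fst h)) \<in> set SL")
    case True
    then show ?thesis using chain_poly_vanishing(2)[OF h(2)] h(1) by blast
  next
    case False
    then show ?thesis
      using difference_binomial_single[OF difference_field, of "pos_exp (fst h)" 1 "neg_exp (fst h)" "- snd h"]
      by (simp add: h chain_poly_binomial single_uminus)
  qed
qed

end

section \<open>Roots by deflation\<close>

definition head_or :: "'b \<Rightarrow> 'b list \<Rightarrow> 'b" where
  "head_or d xs = (if xs = [] then d else hd xs)"

text \<open>The coefficients of the quotient by $X - r$, preceded by the value at $r$.\<close>

definition horner :: "'a::field \<Rightarrow> 'a list \<Rightarrow> 'a list" where
  "horner r cs = foldr (\<lambda>a b. (a + r * head_or 0 b) # b) cs []"

text \<open>Constant polynomials get the dummy root $0$.\<close>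

definition poly_root :: "('a::field poly \<Rightarrow> 'a) \<Rightarrow> 'a list \<Rightarrow> 'a" where
  "poly_root rt cs = (if degree (Poly cs) > 0 then rt (Poly cs) else 0)"

text \<open>A root is split off the polynomial in the first component and collected in the second.\<close>

definition root_step :: "('a::field poly \<Rightarrow> 'a) \<Rightarrow> 'a list \<times> 'a list \<Rightarrow> 'a list \<times> 'a list" where
  "root_step rt s = (tl (horner (poly_root rt (fst s)) (fst s)), poly_root rt (fst s) # snd s)"

definition nth_roots :: "('a::field poly \<Rightarrow> 'a) \<Rightarrow> nat \<Rightarrow> 'a \<Rightarrow> 'a list" where
  "nth_roots rt k a = snd ((root_step rt ^^ k) ((- a) # (replicate (k - 1) 0 @ [1]), []))"

lemma horner_Cons: "horner r (a # cs) = (a + r * head_or 0 (horner r cs)) # horner r cs"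
  by (simp add: horner_def)

lemma length_horner [simp]: "length (horner r cs) = length cs"
  by (induction cs) (simp_all add: horner_Cons, simp add: horner_def)

lemma Poly_head_or: "Poly b = pCons (head_or 0 b) (Poly (tl b))"
  by (cases b) (simp_all add: head_or_def)

lemma Poly_horner: "Poly cs = [:- r, 1:] * Poly (tl (horner r cs)) + [:head_or 0 (horner r cs):]"
proof (induction cs)
  case (Cons a cs)
  let ?b = "horner r cs"
  have "Poly (a # cs) = pCons a ([:- r, 1:] * Poly (tl ?b) + [:head_or 0 ?b:])"
    using Cons by simp
  also have "\<dots> = [:- r, 1:] * pCons (head_or 0 ?b) (Poly (tl ?b)) + [:a + r * head_or 0 ?b:]"
    by simp
  finally show ?case unfolding horner_Cons Poly_head_or[of ?b, symmetric] by (simp add: head_or_def)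
qed (simp add: horner_def head_or_def)

lemma last_horner: "cs \<noteq> [] \<Longrightarrow> last (horner r cs) = last cs"
proof (induction cs)
  case (Cons a cs)
  then show ?case
  proof (cases "cs = []")
    case False
    then have "horner r cs \<noteq> []" by (metis length_0_conv length_horner)
    then show ?thesis using Cons False by (simp add: horner_Cons)
  qed (simp add: horner_def head_or_def)
qed simp

text \<open>The polynomial stays monic, so it has a root as long as it has more than one coefficient.\<close>

lemma root_step_invariant:
  assumes rt: "root_choice rt" and i: "i \<le> k" and cs0: "length cs0 = Suc k" "last cs0 = 1"
  shows "\<exists>cs acc. (root_step rt ^^ i) (cs0, []) = (cs, acc) \<and> length cs = Suc k - i \<and> last cs = 1 \<and>
    (\<forall>z. poly (Poly cs0) z = 0 \<longleftrightarrow> z \<in> set acc \<or> poly (Poly cs) z = 0)"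
  using i
proof (induction i)
  case 0
  then show ?case using cs0 by simp
next
  case (Suc i)
  then obtain cs acc where c: "(root_step rt ^^ i) (cs0, []) = (cs, acc)" "length cs = Suc k - i" "last cs = 1"
      "\<forall>z. poly (Poly cs0) z = 0 \<longleftrightarrow> z \<in> set acc \<or> poly (Poly cs) z = 0"
    by auto
  have len: "length cs \<ge> 2" using c(2) Suc.prems by simp
  then have ne: "cs \<noteq> []" by auto
  have "coeff (Poly cs) (length cs - 1) \<noteq> 0"
    using c(3) ne by (simp add: nth_default_def last_conv_nth)
  then have "length cs - 1 \<le> degree (Poly cs)" by (rule le_degree)
  then have deg: "degree (Poly cs) > 0" using len by simp
  define r where "r = poly_root rt cs"
  have r: "poly (Poly cs) r = 0" using rt deg by (simp add: r_def poly_root_def root_choice_def)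
  let ?q = "tl (horner r cs)"
  have "head_or 0 (horner r cs) = 0"
    using arg_cong[OF Poly_horner[of cs r], of "\<lambda>p. poly p r"] r by simp
  then have P: "Poly cs = [:- r, 1:] * Poly ?q" using Poly_horner[of cs r] by simp
  have "length ?q \<noteq> 0" using len by simp
  then have "?q \<noteq> []" by (metis list.size(3))
  then have "last ?q = 1" using last_horner[OF ne, of r] c(3) by (simp add: last_tl)
  moreover have "length ?q = Suc k - Suc i" using c(2) by simp
  moreover have "poly (Poly cs) z = 0 \<longleftrightarrow> z = r \<or> poly (Poly ?q) z = 0" for z
    unfolding P by auto
  moreover have "(root_step rt ^^ Suc i) (cs0, []) = (?q, r # acc)"
    by (simp only: funpow.simps comp_apply c(1)) (simp add: root_step_def r_def)
  ultimately have "(root_step rt ^^ Suc i) (cs0, []) = (?q, r # acc) \<and> length ?q = Suc k - Suc i \<and> last ?q = 1 \<and>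
      (\<forall>z. poly (Poly cs0) z = 0 \<longleftrightarrow> z \<in> set (r # acc) \<or> poly (Poly ?q) z = 0)"
    using c(4) by (intro conjI allI) auto
  then show ?case by blast
qed

lemma set_nth_roots:
  assumes "root_choice rt" "k > 0"
  shows "set (nth_roots rt k a) = {z. z ^ k = a}"
proof -
  let ?cs = "(- a) # (replicate (k - 1) 0 @ [1])"
  obtain cs acc where c: "(root_step rt ^^ k) (?cs, []) = (cs, acc)" "length cs = 1" "last cs = 1"
      "\<forall>z. poly (Poly ?cs) z = 0 \<longleftrightarrow> z \<in> set acc \<or> poly (Poly cs) z = 0"
    using root_step_invariant[OF assms(1) order_refl, of ?cs k] assms(2) by auto
  have "cs = [1]" using c(2,3) by (cases cs) auto
  moreover have "poly (Poly (replicate j 0 @ [1])) z = z ^ j" for j and z :: 'a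
    by (induction j) auto
  then have "poly (Poly ?cs) z = z ^ k - a" for z
    using assms(2) by (cases k) auto
  ultimately show ?thesis using c(1,4) by (auto simp: nth_roots_def)
qed

section \<open>The solutions that lie on a torus\<close>

text \<open>The vector is the difference of two monomials, coordinates in \<open>S\<close> being disregarded.\<close>

definition represents :: "'n::{finite,linorder} set \<Rightarrow> vect \<Rightarrow> ('n dvar \<Rightarrow>\<^sub>0 nat) \<Rightarrow> ('n dvar \<Rightarrow>\<^sub>0 nat) \<Rightarrow> bool" where
  "represents S u \<alpha> \<beta> \<longleftrightarrow> avoids S \<alpha> \<and> avoids S \<beta> \<and>
     (\<forall>v. fst v \<notin> S \<longrightarrow> lookup u (nvar v) = int (lookup \<alpha> v) - int (lookup \<beta> v))"

lemma avoids_lookup: "avoids S m \<Longrightarrow> fst v \<in> S \<Longrightarrow> lookup m v = 0"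
  by (auto simp: avoids_def in_keys_iff)

lemma avoidsI: "(\<And>v. fst v \<in> S \<Longrightarrow> lookup m v = 0) \<Longrightarrow> avoids S m"
  by (force simp: avoids_def in_keys_iff)

lemma represents_exists:
  fixes u :: vect
  shows "\<exists>\<alpha> \<beta> :: 'n::{finite,linorder} dvar \<Rightarrow>\<^sub>0 nat. represents S u \<alpha> \<beta>"
proof -
  let ?K = "{v :: 'n dvar. nvar v \<in> keys u \<and> fst v \<notin> S}"
  have fin: "finite ?K"
  proof -
    have "finite (nvar -` keys u :: 'n dvar set)" by (rule finite_vimageI[OF _ inj_nvar]) simp
    then show ?thesis by (rule finite_subset[rotated]) auto
  qed
  have look: "lookup (\<Sum>v\<in>?K. single v (f (lookup u (nvar v)))) w =
      (if fst w \<in> S then 0 else f (lookup u (nvar w)))" if "f 0 = 0" for w and f :: "int \<Rightarrow> nat"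
  proof -
    have "lookup (\<Sum>v\<in>?K. single v (f (lookup u (nvar v)))) w =
        (\<Sum>v\<in>?K. if v = w then f (lookup u (nvar w)) else 0)"
      unfolding lookup_sum by (intro sum.cong refl) (auto simp: lookup_single when_def)
    then show ?thesis using fin that by (auto simp: in_keys_iff)
  qed
  define \<alpha> where "\<alpha> = (\<Sum>v\<in>?K. single v (nat (lookup u (nvar v))))"
  define \<beta> where "\<beta> = (\<Sum>v\<in>?K. single v (nat (- lookup u (nvar v))))"
  have "lookup \<alpha> w = (if fst w \<in> S then 0 else nat (lookup u (nvar w)))" for w
    unfolding \<alpha>_def by (rule look) simp
  moreover have "lookup \<beta> w = (if fst w \<in> S then 0 else nat (- lookup u (nvar w)))" for w
    unfolding \<beta>_def by (rule look) simp
  ultimately have "represents S u \<alpha> \<beta>"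
    unfolding represents_def by (intro conjI avoidsI allI impI) simp_all
  then show ?thesis by blast
qed

lemma represents_diff:
  assumes "represents S u \<alpha> \<beta>" "represents S w \<gamma> \<delta>"
  shows "represents S (u - w) (\<alpha> + \<delta>) (\<beta> + \<gamma>)"
  using assms by (auto simp: represents_def avoids_add lookup_add lookup_minus)

lemma represents_shift:
  assumes "represents S u \<alpha> \<beta>"
  shows "represents S (relabel shift_var u) (shift_exponent \<alpha>) (shift_exponent \<beta>)"
  unfolding represents_def
proof (intro conjI allI impI)
  fix v :: "'a dvar" assume v: "fst v \<notin> S"
  show "lookup (relabel shift_var u) (nvar v) =
      int (lookup (shift_exponent \<alpha>) v) - int (lookup (shift_exponent \<beta>) v)"
  proof (cases "v \<in> range shift_var")
    case True
    then obtain w where w: "v = shift_var w" by auto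
    then have "fst w \<notin> S" using v by (simp add: shift_var_def)
    then show ?thesis using assms
      by (simp add: w nvar_shift shift_exponent_relabel lookup_relabel inj_shift_var represents_def)
  next
    case False
    have "snd v = 0"
    proof (rule ccontr)
      assume "snd v \<noteq> 0"
      then have "v = shift_var (fst v, snd v - 1)" by (simp add: shift_var_def prod_eq_iff)
      then show False using False by blast
    qed
    then have "nvar v \<notin> range shift_var" by (auto simp: nvar_def shift_var_def)
    then show ?thesis using False by (simp add: shift_exponent_relabel lookup_relabel_outside)
  qed
qed (use assms in \<open>auto simp: represents_def\<close>)

text \<open>A reflexive prime with its set of vanishing indeterminates: modulo \<open>Q\<close> all monomials that avoid \<open>S\<close> are nonzero, so
  a generic zero of \<open>Q\<close> has its other coordinates on a torus.\<close>

locale torus_point = difference \<sigma>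
  for \<sigma> :: "'a::{alg_closed_field, field_char_0} \<Rightarrow> 'a" +
  fixes Q :: "('n::{finite,linorder}, 'a) dpoly set" and S :: "'n set"
  assumes bij: "bij \<sigma>"
    and reflexive: "reflexive_sigma_ideal \<sigma> Q" and prime: "is_prime_ideal Q"
    and S_def: "S = {i. yvar (i, 0) \<in> Q}"
begin

lemma ideal: "is_ideal Q"
  using reflexive unfolding reflexive_sigma_ideal_def sigma_ideal_def by (elim conjE)

lemma transform_iff: "transform \<sigma> p \<in> Q \<longleftrightarrow> p \<in> Q"
  using reflexive unfolding reflexive_sigma_ideal_def sigma_ideal_def by blast

lemma yvar_iff: "yvar v \<in> Q \<longleftrightarrow> fst v \<in> S"
proof -
  have "yvar (i, d) \<in> Q \<longleftrightarrow> i \<in> S" for i d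
  proof (induction d)
    case (Suc d)
    have "yvar (i, Suc d) = transform \<sigma> (yvar (i, d) :: ('n, 'a) dpoly)"
      by (simp add: yvar_def shift_exponent_relabel shift_var_def)
    then show ?case using Suc by (simp add: transform_iff)
  qed (simp add: S_def)
  then show ?thesis by (cases v) simp
qed

lemma single_prod: "single m 1 = (\<Prod>v\<in>keys m. yvar v ^ lookup m v :: ('n, 'a) dpoly)"
proof -
  have "(\<Prod>v\<in>X. single (f v) (1::'a)) = single (\<Sum>v\<in>X. f v) 1"
    for X :: "'n dvar set" and f :: "'n dvar \<Rightarrow> 'n dvar \<Rightarrow>\<^sub>0 nat"
    by (induction X rule: infinite_finite_induct) (auto simp: mult_single)
  then show ?thesis by (simp add: yvar_power flip: dpoly_expand)
qed

lemma monomial_iff: "single m 1 \<in> Q \<longleftrightarrow> \<not> avoids S m"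
proof
  assume "single m 1 \<in> Q"
  then obtain v where v: "v \<in> keys m" "yvar v ^ lookup m v \<in> Q"
    unfolding single_prod using is_prime_ideal_prod[OF prime finite_keys] by blast
  then have "yvar v \<in> Q" using is_prime_ideal_power[OF prime] by blast
  then show "\<not> avoids S m" using v(1) by (auto simp: avoids_def yvar_iff)
next
  assume "\<not> avoids S m"
  then obtain v where v: "v \<in> keys m" "fst v \<in> S" by (auto simp: avoids_def)
  have "single (update v 0 m) 1 * (yvar v ^ (lookup m v - 1) * yvar v) \<in> Q"
    using v(2) by (intro is_ideal_mult[OF ideal]) (simp add: yvar_iff)
  moreover have "yvar v ^ (lookup m v - 1) * yvar v = (single (single v (lookup m v)) 1 :: ('n, 'a) dpoly)"
    using v(1) by (simp add: power_eq_if[symmetric] in_keys_iff flip: power_Suc2 yvar_power)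
  ultimately show "single m 1 \<in> Q" by (simp add: mult_single update_zero_split)
qed

lemma single_in: "\<not> avoids S m \<Longrightarrow> single m c \<in> Q"
  using is_ideal_mult[OF ideal, of "single m 1" "single 0 c"]
  by (simp add: monomial_iff mult_single)

lemma single_notin: "avoids S m \<Longrightarrow> c \<noteq> 0 \<Longrightarrow> single m c \<notin> Q"
  using is_ideal_mult[OF ideal, of "single m c" "single 0 (inverse c)"]
  by (auto simp: monomial_iff mult_single)

text \<open>The Laurent monomial with exponent \<open>u\<close> takes the value \<open>c\<close> at the generic zero of \<open>Q\<close>.\<close>

definition takes_value :: "vect \<Rightarrow> 'a \<Rightarrow> bool" where
  "takes_value u c \<longleftrightarrow> c \<noteq> 0 \<and> (\<exists>\<alpha> \<beta>. represents S u \<alpha> \<beta> \<and> single \<alpha> 1 - single \<beta> c \<in> Q)"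

lemma takes_value_all:
  assumes "takes_value u c" "represents S u \<alpha> \<beta>"
  shows "single \<alpha> 1 - single \<beta> c \<in> Q"
proof -
  obtain \<alpha>' \<beta>' where r: "represents S u \<alpha>' \<beta>'" "single \<alpha>' 1 - single \<beta>' c \<in> Q"
    using assms(1) by (auto simp: takes_value_def)
  have "\<alpha> + \<beta>' = \<alpha>' + \<beta>"
  proof (rule poly_mapping_eqI)
    fix v show "lookup (\<alpha> + \<beta>') v = lookup (\<alpha>' + \<beta>) v"
    proof (cases "fst v \<in> S")
      case True
      then show ?thesis using r(1) assms(2) by (simp add: represents_def lookup_add avoids_lookup[OF _ True])
    next
      case False
      have "int (lookup \<alpha> v) - int (lookup \<beta> v) = int (lookup \<alpha>' v) - int (lookup \<beta>' v)"
        using r(1) assms(2) False unfolding represents_def by metis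
      then show ?thesis by (simp add: lookup_add)
    qed
  qed
  then have eq: "single \<beta>' 1 * (single \<alpha> 1 - single \<beta> c) =
      single \<beta> 1 * (single \<alpha>' 1 - single \<beta>' c :: ('n, 'a) dpoly)"
    by (simp add: right_diff_distrib mult_single add.commute)
  have "single \<beta>' 1 * (single \<alpha> 1 - single \<beta> c) \<in> Q"
    unfolding eq by (rule is_ideal_mult[OF ideal r(2)])
  moreover have "single \<beta>' 1 \<notin> Q" using r(1) by (simp add: monomial_iff represents_def)
  ultimately show ?thesis using prime unfolding is_prime_ideal_def by blast
qed

lemma takes_value_zero: "takes_value 0 1"
  unfolding takes_value_def using is_ideal_zero[OF ideal]
  by (intro conjI exI[of _ 0]) (auto simp: represents_def avoids_def)

lemma takes_value_diff:
  assumes "takes_value u c" "takes_value w d"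
  shows "takes_value (u - w) (c / d)"
proof -
  obtain \<alpha> \<beta> where 1: "c \<noteq> 0" "represents S u \<alpha> \<beta>" "single \<alpha> 1 - single \<beta> c \<in> Q"
    using assms(1) by (auto simp: takes_value_def)
  obtain \<gamma> \<delta> where 2: "d \<noteq> 0" "represents S w \<gamma> \<delta>" "single \<gamma> 1 - single \<delta> d \<in> Q"
    using assms(2) by (auto simp: takes_value_def)
  have "single \<delta> 1 * (single \<alpha> 1 - single \<beta> c) -
      single \<beta> (c / d) * (single \<gamma> 1 - single \<delta> d) \<in> Q"
    by (intro is_ideal_diff[OF ideal] is_ideal_mult[OF ideal] 1(3) 2(3))
  also have "single \<delta> 1 * (single \<alpha> 1 - single \<beta> c) -
      single \<beta> (c / d) * (single \<gamma> 1 - single \<delta> d) =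
      single (\<alpha> + \<delta>) 1 - single (\<beta> + \<gamma>) (c / d)"
    using 2(1) by (simp add: right_diff_distrib mult_single add.commute)
  finally show ?thesis using represents_diff[OF 1(2) 2(2)] 1(1) 2(1) by (auto simp: takes_value_def)
qed

lemma takes_value_unique:
  assumes "takes_value u c" "takes_value u d"
  shows "c = d"
proof (rule ccontr)
  assume "c \<noteq> d"
  obtain \<alpha> \<beta> where r: "represents S u \<alpha> \<beta>" using assms(1) by (auto simp: takes_value_def)
  have "(single \<alpha> 1 - single \<beta> c) - (single \<alpha> 1 - single \<beta> d) \<in> Q"
    by (intro is_ideal_diff[OF ideal] takes_value_all[OF _ r] assms)
  then have "single \<beta> (d - c) \<in> Q" by (simp add: single_diff)
  then show False using single_notin[of \<beta> "d - c"] r \<open>c \<noteq> d\<close> by (simp add: represents_def)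
qed

lemma takes_value_shift: "takes_value (relabel shift_var u) (\<sigma> c) \<longleftrightarrow> takes_value u c"
proof -
  obtain \<alpha> \<beta> :: "'n dvar \<Rightarrow>\<^sub>0 nat" where r: "represents S u \<alpha> \<beta>" using represents_exists by blast
  have "takes_value u c \<longleftrightarrow> c \<noteq> 0 \<and> single \<alpha> 1 - single \<beta> c \<in> Q"
    using takes_value_all[OF _ r] r unfolding takes_value_def by blast
  also have "\<dots> \<longleftrightarrow> \<sigma> c \<noteq> 0 \<and> single (shift_exponent \<alpha>) 1 - single (shift_exponent \<beta>) (\<sigma> c) \<in> Q"
    using transform_iff[of "single \<alpha> 1 - single \<beta> c"] by (simp add: transform_minus)
  also have "\<dots> \<longleftrightarrow> takes_value (relabel shift_var u) (\<sigma> c)"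
    using takes_value_all[OF _ represents_shift[OF r]] represents_shift[OF r] unfolding takes_value_def by blast
  finally show ?thesis by simp
qed

lemma takes_value_shift_funpow: "takes_value ((relabel shift_var ^^ k) u) ((\<sigma> ^^ k) c) \<longleftrightarrow> takes_value u c"
  by (induction k) (simp_all add: takes_value_shift)

lemma sigma_inv: "(\<sigma> ^^ k) ((inv \<sigma> ^^ k) c) = c"
proof (induction k arbitrary: c)
  case (Suc k)
  have "(\<sigma> ^^ Suc k) ((inv \<sigma> ^^ Suc k) c) = \<sigma> ((\<sigma> ^^ k) ((inv \<sigma> ^^ k) (inv \<sigma> c)))" by (simp add: funpow_swap1)
  then show ?case using Suc by (simp only: surj_f_inv_f[OF bij_is_surj[OF bij]])
qed simp

lemma takes_value_frag_extend:
  assumes "\<And>v. v \<in> K \<Longrightarrow> takes_value (t v) (c v)" "keys z \<subseteq> K"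
  shows "takes_value (frag_extend t z) (chi c z)"
proof -
  have nz: "c v \<noteq> 0" if "v \<in> K" for v using assms(1)[OF that] by (simp add: takes_value_def)
  have "takes_value (frag_extend t z) (chi c z) \<and> keys z \<subseteq> K"
    using assms(2)
  proof (induction z rule: frag_induction)
    case zero
    then show ?case using takes_value_zero by simp
  next
    case (one v)
    then show ?case using assms(1) by (simp add: keys_frag_of)
  next
    case (diff a b)
    have "chi c (a - b) = chi c a / chi c b" by (rule chi_diff) (use diff nz in blast)
    moreover have "keys (a - b) \<subseteq> K" using keys_diff[of a b] diff by blast
    ultimately show ?case using diff takes_value_diff by (simp add: frag_extend_diff)
  qed
  then show ?thesis by simp
qed

definition homogenized :: "nat \<Rightarrow> 'a poly \<Rightarrow> ('n, 'a) dpoly \<Rightarrow> ('n, 'a) dpoly \<Rightarrow> ('n, 'a) dpoly" where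
  "homogenized m p X Y = (\<Sum>k\<le>m. dconst (coeff p k) * X ^ k * Y ^ (m - k))"

lemma homogenized_linear_factor:
  assumes "degree q \<le> m"
  shows "homogenized (Suc m) ([:- d, 1:] * q) X Y = (X - dconst d * Y) * homogenized m q X Y"
proof -
  have c: "dconst (a + b) = dconst a + (dconst b :: ('n, 'a) dpoly)" "dconst (a - d * b) = dconst a - dconst d * (dconst b :: ('n, 'a) dpoly)" for a b d
    by (simp_all add: dconst_def single_add mult_single single_diff)
  have 1: "homogenized (Suc m) (pCons 0 q) X Y = X * homogenized m q X Y"
    unfolding homogenized_def by (subst sum.atMost_Suc_shift) (simp add: dconst_def sum_distrib_left ac_simps)
  have "coeff q (Suc m) = 0" using assms by (simp add: coeff_eq_0)
  then have "homogenized (Suc m) q X Y = (\<Sum>k\<le>m. dconst (coeff q k) * X ^ k * Y ^ (Suc m - k))"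
    unfolding homogenized_def by (simp add: dconst_def)
  also have "\<dots> = Y * homogenized m q X Y"
    unfolding homogenized_def sum_distrib_left
    by (intro sum.cong refl) (simp add: Suc_diff_le ac_simps)
  finally have 2: "homogenized (Suc m) q X Y = Y * homogenized m q X Y" .
  have "homogenized (Suc m) (smult (- d) q + pCons 0 q) X Y = - dconst d * homogenized (Suc m) q X Y + homogenized (Suc m) (pCons 0 q) X Y"
    unfolding homogenized_def sum_distrib_left sum.distrib[symmetric]
    by (intro sum.cong refl) (simp add: c left_diff_distrib mult.assoc)
  then show ?thesis by (simp add: 1 2 left_diff_distrib mult.assoc)
qed

text \<open>The homogenized polynomial splits into linear factors over the algebraically closed field, and a prime ideal
  that contains it contains one of them.\<close>

lemma homogenized_root:
  assumes "p \<noteq> 0" "homogenized (degree p) p X Y \<in> Q"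
  shows "\<exists>d. poly p d = 0 \<and> X - dconst d * Y \<in> Q"
  using assms
proof (induction "degree p" arbitrary: p)
  case 0
  then have "p = [:coeff p 0:]" by (metis degree_eq_zeroE coeff_pCons_0)
  then have "coeff p 0 \<noteq> 0" using 0 by auto
  moreover have "single 0 (coeff p 0) \<in> Q" using 0 by (simp add: homogenized_def dconst_def)
  ultimately show ?case using single_notin[of 0 "coeff p 0"] by (simp add: avoids_def)
next
  case (Suc m)
  obtain d where d: "poly p d = 0" using alg_closed_imp_poly_has_root[of p] Suc(2) by auto
  then obtain q where q: "p = [:- d, 1:] * q" by (metis poly_eq_0_iff_dvd dvdE)
  have q0: "q \<noteq> 0" using q Suc.prems by auto
  have "degree p = Suc (degree q)" unfolding q using q0 by (subst degree_mult_eq) auto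
  then have deg: "m = degree q" using Suc(2) by simp
  have "(X - dconst d * Y) * homogenized m q X Y \<in> Q"
    using Suc.prems(2) homogenized_linear_factor[of q m d X Y] deg Suc(2) q by simp
  then have "X - dconst d * Y \<in> Q \<or> homogenized m q X Y \<in> Q" using prime unfolding is_prime_ideal_def by blast
  then show ?case
  proof
    assume "X - dconst d * Y \<in> Q"
    then show ?thesis using d by blast
  next
    assume "homogenized m q X Y \<in> Q"
    then obtain e where "poly q e = 0" "X - dconst e * Y \<in> Q" using Suc(1)[OF deg q0] deg by auto
    then show ?thesis using q by (intro exI[of _ e]) simp
  qed
qed

text \<open>Linear factors of $X^k - c Y^k$.\<close>

lemma takes_value_root:
  assumes "takes_value (frag_cmul (int k) u) c" "k > 0"
  shows "\<exists>d. d ^ k = c \<and> takes_value u d"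
proof -
  obtain \<alpha> \<beta> :: "'n dvar \<Rightarrow>\<^sub>0 nat" where r: "represents S u \<alpha> \<beta>" using represents_exists by blast
  have av: "avoids S (\<Sum>i<k. \<alpha>)" "avoids S (\<Sum>i<k. \<beta>)"
    using r by (auto simp: represents_def lookup_sum avoids_lookup intro!: avoidsI)
  have "represents S (frag_cmul (int k) u) (\<Sum>i<k. \<alpha>) (\<Sum>i<k. \<beta>)"
    using r av by (simp add: represents_def lookup_sum right_diff_distrib)
  then have Q: "single (\<Sum>i<k. \<alpha>) 1 - single (\<Sum>i<k. \<beta>) c \<in> Q"
    by (rule takes_value_all[OF assms(1)])
  let ?X = "single \<alpha> 1 :: ('n, 'a) dpoly" and ?Y = "single \<beta> 1 :: ('n, 'a) dpoly"
  define p where "p = monom 1 k + [:- c:]"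
  have "degree p = degree (monom (1::'a) k)"
    unfolding p_def by (rule degree_add_eq_left) (simp add: degree_monom_eq assms(2))
  then have deg: "degree p = k" by (simp add: degree_monom_eq)
  then have p0: "p \<noteq> 0" using assms(2) by auto
  have pow: "(single m 1 :: ('n, 'a) dpoly) ^ e = single (\<Sum>i<e. m) 1" for m e
    by (induction e) (simp_all add: mult_single add.commute)
  have "homogenized k p ?X ?Y = (\<Sum>j\<le>k. if j = k then ?X ^ k else if j = 0 then - (dconst c * ?Y ^ k) else 0)"
    unfolding homogenized_def p_def using assms(2)
    by (intro sum.cong refl) (auto simp: dconst_def single_uminus coeff_pCons split: nat.splits)
  also have "\<dots> = ?X ^ k - dconst c * ?Y ^ k"
  proof -
    have "{..k} = insert 0 (insert k {1..<k})" using assms(2) by auto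
    then show ?thesis using assms(2) by simp
  qed
  also have "\<dots> = single (\<Sum>i<k. \<alpha>) 1 - single (\<Sum>i<k. \<beta>) c"
    by (simp add: pow dconst_def mult_single)
  finally have "homogenized (degree p) p ?X ?Y \<in> Q" using Q deg by simp
  from homogenized_root[OF p0 this] obtain d where d: "poly p d = 0" "?X - dconst d * ?Y \<in> Q" by blast
  have dk: "d ^ k = c" using d(1) by (simp add: p_def poly_monom)
  have "c \<noteq> 0" using assms(1) by (simp add: takes_value_def)
  then have "d \<noteq> 0" using dk assms(2) by auto
  then have "takes_value u d" using d(2) r by (auto simp: takes_value_def dconst_def mult_single)
  then show ?thesis using dk by blast
qed

lemma takes_value_generator_combination:
  assumes "\<And>f. f \<in> set F \<Longrightarrow> takes_value (vec (fst f)) (snd f)"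
  shows "takes_value (vec (generator_combination F q)) (generator_value \<sigma> F q)"
proof (induction q rule: rev_induct)
  case Nil
  show ?case using takes_value_zero by (simp add: generator_combination_def generator_value_def)
next
  case (snoc l q)
  have gen: "takes_value (vec (fst (generator_at F i))) (snd (generator_at F i))" for i
    using assms takes_value_zero by (auto simp: generator_at_def)
  let ?w = "vec (shift_word (fst (snd l)) (fst (generator_at F (snd (snd l)))))"
  let ?c = "(\<sigma> ^^ fst (snd l)) (snd (generator_at F (snd (snd l))))"
  have w: "takes_value ?w ?c" unfolding vec_shift_word takes_value_shift_funpow by (rule gen)
  have "takes_value (0 - ?w) (1 / ?c)" by (rule takes_value_diff[OF takes_value_zero w])
  then have neg: "takes_value (- ?w) (inverse ?c)" by (simp add: divide_inverse)
  have add: "takes_value (u + w) (c * d)" if "takes_value u c" "takes_value w d" for u w c d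
    using takes_value_diff[OF that(1) takes_value_diff[OF takes_value_zero that(2)]] by (simp add: divide_inverse)
  have "takes_value (vec (sign_word (fst l) (shift_word (fst (snd l)) (fst (generator_at F (snd (snd l))))))) (signed (fst l) ?c)"
    using w neg by (simp add: sign_word_def signed_def)
  from add[OF snoc this] show ?case by (simp add: generator_combination_def generator_value_def)
qed

lemma takes_value_basis_word:
  assumes "\<And>p. p \<in> set GV \<Longrightarrow> takes_value (vec (entry_word (fst p))) (snd p)" "has_lead (map fst GV) v"
  shows "takes_value (basis_vector (map fst GV) v) (basis_value \<sigma> GV v)"
  using assms
proof (induction GV rule: rev_induct)
  case (snoc p GV)
  show ?case
  proof (cases "matches (fst p) v")
    case True
    then show ?thesis using snoc.prems(1)[of p]
      by (simp add: basis_vector_def basis_word_def basis_value_def vec_shift_word takes_value_shift_funpow)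
  next
    case False
    then have "has_lead (map fst GV) v" using snoc.prems(2) by (simp add: has_lead_def)
    then have "takes_value (basis_vector (map fst GV) v) (basis_value \<sigma> GV v)" using snoc by simp
    then show ?thesis using False by (simp add: basis_vector_def basis_word_def basis_value_def)
  qed
qed (simp add: has_lead_def)

end

definition tuples :: "('g \<Rightarrow> 'c list) \<Rightarrow> 'g list \<Rightarrow> ('g \<times> 'c) list list" where
  "tuples c G = foldl (\<lambda>b g. concat (map (\<lambda>t. map (\<lambda>x. t @ [(g, x)]) (c g)) b)) [[]] G"

lemma in_tuples: "GV \<in> set (tuples c G) \<longleftrightarrow> map fst GV = G \<and> (\<forall>p\<in>set GV. snd p \<in> set (c (fst p)))"
proof (induction G arbitrary: GV rule: rev_induct)
  case Nil
  then show ?case by (auto simp: tuples_def)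
next
  case (snoc g G)
  have "tuples c (G @ [g]) = concat (map (\<lambda>t. map (\<lambda>x. t @ [(g, x)]) (c g)) (tuples c G))"
    by (simp add: tuples_def)
  then have "GV \<in> set (tuples c (G @ [g])) \<longleftrightarrow> (\<exists>t x. GV = t @ [(g, x)] \<and> t \<in> set (tuples c G) \<and> x \<in> set (c g))"
    by auto
  also have "\<dots> \<longleftrightarrow> map fst GV = G @ [g] \<and> (\<forall>p\<in>set GV. snd p \<in> set (c (fst p)))"
    by (cases GV rule: rev_cases) (auto simp: snoc.IH)
  finally show ?case .
qed

text \<open>If $k x^e$ times the entry has the value $a$, then the $k$-th power of the value of the entry is
  $\sigma^{-e}(a)$.\<close>

definition root_candidates :: "('a::field \<Rightarrow> 'a) \<Rightarrow> ('a poly \<Rightarrow> 'a) \<Rightarrow> (word \<times> 'a) list \<Rightarrow>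
    (nat \<times> nat \<times> (bool \<times> nat \<times> nat) list) list \<Rightarrow> entry \<Rightarrow> 'a list" where
  "root_candidates \<sigma> rt F V g = concat (map (\<lambda>v. if pow_ok F g v
     then nth_roots rt (fst v) ((inv \<sigma> ^^ fst (snd v)) (generator_value \<sigma> F (snd (snd v)))) else []) V)"

definition solutions :: "('a::field \<Rightarrow> 'a) \<Rightarrow> ('a poly \<Rightarrow> 'a) \<Rightarrow> (word \<times> 'a) list \<Rightarrow> certificate \<Rightarrow> (entry \<times> 'a) list list" where
  "solutions \<sigma> rt F C = filter (\<lambda>GV. consistent \<sigma> F (fst (snd (snd C))) GV)
     (tuples (\<lambda>g. root_candidates \<sigma> rt F (snd (snd (snd C))) g) (fst C))"

lemma generator_value_nonzero:
  assumes "difference_field \<sigma>" "\<forall>f\<in>set F. snd f \<noteq> 0"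
  shows "generator_value \<sigma> F q \<noteq> 0"
proof -
  interpret difference \<sigma> by standard (rule assms(1))
  have "snd (generator_at F i) \<noteq> 0" for i using assms(2) by (simp add: generator_at_def)
  then show ?thesis by (induction q rule: rev_induct) (auto simp: generator_value_def signed_def)
qed

lemma solution_certified:
  fixes \<sigma> :: "'a::field \<Rightarrow> 'a" and S :: "'n::{finite,linorder} set"
  assumes \<sigma>: "inversive_difference_field \<sigma>" and rt: "root_choice rt"
    and check: "check (card (UNIV :: 'n set)) F C" and SL: "set SL = position ` S"
    and F: "\<forall>f\<in>set F. snd f \<noteq> 0" "\<And>p. p \<in> set SL \<Longrightarrow> ([(True, (p, 0))], 1) \<in> set F"
    and GV: "GV \<in> set (solutions \<sigma> rt F C)"
  shows "certified_chain \<sigma> S SL F GV (fst (snd C)) (fst (snd (snd C))) (card (UNIV :: 'n set)) (fst C)"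
proof
  show df: "difference_field \<sigma>" using \<sigma> by (simp add: inversive_difference_field_def)
  then interpret difference \<sigma> by unfold_locales
  have bij: "bij \<sigma>" using \<sigma> by (simp add: inversive_difference_field_def)
  have GV: "map fst GV = fst C" "\<forall>p\<in>set GV. snd p \<in> set (root_candidates \<sigma> rt F (snd (snd (snd C))) (fst p))"
      "consistent \<sigma> F (fst (snd (snd C))) GV"
    using GV by (auto simp: solutions_def in_tuples)
  show "fst C = map fst GV" using GV(1) by simp
  show "consistent \<sigma> F (fst (snd (snd C))) GV" by (rule GV(3))
  show "snd g \<noteq> 0" if g: "g \<in> set GV" for g
  proof -
    obtain v where v: "pow_ok F (fst g) v" "snd g \<in> set (nth_roots rt (fst v) ((inv \<sigma> ^^ fst (snd v)) (generator_value \<sigma> F (snd (snd v)))))"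
      using GV(2) g by (auto simp: root_candidates_def split: if_splits)
    then have "snd g ^ fst v = (inv \<sigma> ^^ fst (snd v)) (generator_value \<sigma> F (snd (snd v)))" "fst v > 0"
      using set_nth_roots[OF rt, of "fst v"] by (auto simp: pow_ok_def)
    moreover have "inv \<sigma> a \<noteq> 0" if "a \<noteq> 0" for a
      using that surj_f_inv_f[OF bij_is_surj[OF bij], of a] by (metis sigma_zero)
    then have "(inv \<sigma> ^^ k) a \<noteq> 0" if "a \<noteq> 0" for k a
      using that by (induction k) auto
    ultimately show ?thesis using generator_value_nonzero[OF df F(1)] by (metis zero_power)
  qed
qed (use check SL F(2) in \<open>auto simp: check_def list_all_iff\<close>)

text \<open>The values that the basis elements take at the generic zero of \<open>Q\<close> are among the candidates and are consistent.
  The resulting ideal is generated by monomials and binomials that vanish there.\<close>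

theorem (in torus_point) solution_below:
  assumes rt: "root_choice rt"
    and check: "check (card (UNIV :: 'n set)) F C" and SL: "set SL = position ` S"
    and F: "\<And>f. f \<in> set F \<Longrightarrow> takes_value (vec (fst f)) (snd f)" "\<And>p. p \<in> set SL \<Longrightarrow> ([(True, (p, 0))], 1) \<in> set F"
  shows "\<exists>GV\<in>set (solutions \<sigma> rt F C). sat \<sigma> (certified_chain.chain SL GV) \<subseteq> Q"
proof -
  define G where "G = fst C"
  define U where "U = fst (snd (snd C))"
  have ok: "gb_ok (card (UNIV :: 'n set)) G U" using check by (simp add: check_def G_def U_def)
  have "\<exists>c. c \<in> set (root_candidates \<sigma> rt F (snd (snd (snd C))) g) \<and> takes_value (vec (entry_word g)) c" if g: "g \<in> set G" for g
  proof -
    obtain v where v: "v \<in> set (snd (snd (snd C)))" "pow_ok F g v"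
      using check g by (auto simp: check_def G_def list_all_iff list_ex_iff)
    define k e q where "k = fst v" and "e = fst (snd v)" and "q = snd (snd v)"
    have k: "k > 0" "frag_cmul (int k) ((relabel shift_var ^^ e) (vec (entry_word g))) = vec (generator_combination F q)"
      using v(2) by (simp_all add: pow_ok_def same_vector_iff vec_concat_replicate vec_shift_word k_def e_def q_def)
    have "takes_value (frag_cmul (int k) ((relabel shift_var ^^ e) (vec (entry_word g)))) (generator_value \<sigma> F q)"
      unfolding k(2) by (rule takes_value_generator_combination) (rule F(1))
    from takes_value_root[OF this k(1)] obtain d where d: "d ^ k = generator_value \<sigma> F q" "takes_value ((relabel shift_var ^^ e) (vec (entry_word g))) d"
      by blast
    let ?c = "(inv \<sigma> ^^ e) d"
    have "takes_value (vec (entry_word g)) ?c" using d(2) takes_value_shift_funpow[of e "vec (entry_word g)" ?c] by (simp add: sigma_inv)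
    moreover have "(\<sigma> ^^ e) (a ^ k) = (\<sigma> ^^ e) a ^ k" for a by (induction e) (simp_all add: sigma_power)
    then have "(\<sigma> ^^ e) (?c ^ k) = (\<sigma> ^^ e) ((inv \<sigma> ^^ e) (generator_value \<sigma> F q))" by (simp add: sigma_inv d(1))
    then have "?c ^ k = (inv \<sigma> ^^ e) (generator_value \<sigma> F q)" by (simp only: funpow_eq_iff)
    then have "?c \<in> set (root_candidates \<sigma> rt F (snd (snd (snd C))) g)"
      using v set_nth_roots[OF rt k(1)] by (auto simp: root_candidates_def k_def e_def q_def intro!: bexI[of _ v])
    ultimately show ?thesis by blast
  qed
  then obtain c where c: "\<And>g. g \<in> set G \<Longrightarrow> c g \<in> set (root_candidates \<sigma> rt F (snd (snd (snd C))) g)"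
      "\<And>g. g \<in> set G \<Longrightarrow> takes_value (vec (entry_word g)) (c g)"
    by metis
  define GV where "GV = map (\<lambda>g. (g, c g)) G"
  have G: "map fst GV = G" by (simp add: GV_def comp_def)
  have takes_value_GV: "takes_value (vec (entry_word (fst p))) (snd p)" if "p \<in> set GV" for p
    using that c(2) by (auto simp: GV_def)
  have takes_value_t: "takes_value (basis_vector G v) (basis_value \<sigma> GV v)" if "v \<in> lead_set G" for v
    using takes_value_basis_word[of GV v, OF takes_value_GV] that by (simp add: G lead_set_def)
  have basis_value_nz: "basis_value \<sigma> GV v \<noteq> 0" for v
    by (rule basis_value_nonzero[OF difference_field]) (use takes_value_GV in \<open>auto simp: takes_value_def\<close>)
  have unique: "combination_value \<sigma> GV u = d" if u: "span_ok G w u" and d: "takes_value (vec w) d" for u w d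
  proof -
    have "\<forall>l\<in>set u. has_lead G (snd l)" "vec w = frag_extend (basis_vector G) (vec u)"
      using u by (auto simp: span_ok_def list_all_iff same_vector_iff vec_combination)
    moreover have "keys (vec u) \<subseteq> lead_set G"
      using keys_vec[of u] calculation(1) by (fastforce simp: lead_set_def)
    ultimately have "takes_value (vec w) (combination_value \<sigma> GV u)"
      using takes_value_frag_extend[of "lead_set G" "basis_vector G" "basis_value \<sigma> GV" "vec u", OF takes_value_t] combination_value_chi[of u \<sigma> GV] basis_value_nz by simp
    then show ?thesis using d by (rule takes_value_unique)
  qed
  have cons: "consistent \<sigma> F U GV"
    unfolding consistent_def G list_all_iff
  proof (intro conjI ballI)
    fix g assume "g \<in> set GV"
    let ?w = "prev_var (fst (fst g))"
    show "snd (fst (fst g)) = 0 \<or> \<not> has_lead G ?w \<or> (\<forall>u\<in>set U. \<not> span_ok G (shift_word 1 (basis_word G ?w)) u \<or> \<sigma> (basis_value \<sigma> GV ?w) = combination_value \<sigma> GV u)"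
    proof (cases "has_lead G ?w")
      case True
      then have r: "takes_value (vec (shift_word 1 (basis_word G ?w))) (\<sigma> (basis_value \<sigma> GV ?w))"
        using takes_value_t[of ?w] takes_value_shift by (simp add: vec_shift_word lead_set_def basis_vector_def)
      have "\<sigma> (basis_value \<sigma> GV ?w) = combination_value \<sigma> GV u" if "span_ok G (shift_word 1 (basis_word G ?w)) u" for u
        using unique[OF that r] by simp
      then show ?thesis by blast
    qed simp
  next
    fix f u assume "f \<in> set F" "u \<in> set U"
    then show "\<not> span_ok G (fst f) u \<or> combination_value \<sigma> GV u = snd f" using unique F(1) by blast
  qed
  have sol: "GV \<in> set (solutions \<sigma> rt F C)"
    using cons G c(1) by (auto simp: solutions_def in_tuples U_def[symmetric] G_def[symmetric] GV_def)
  have nz: "\<forall>f\<in>set F. snd f \<noteq> 0" using F(1) by (auto simp: takes_value_def)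
  have inv: "inversive_difference_field \<sigma>"
    using difference_field bij by (simp add: inversive_difference_field_def)
  interpret CC: certified_chain \<sigma> S SL F GV "fst (snd C)" "fst (snd (snd C))" "card (UNIV :: 'n set)" "fst C"
    by (rule solution_certified[OF inv rt check SL nz F(2) sol])
  have "CC.T.torus_ideal \<subseteq> Q"
  proof (rule CC.T.torus_ideal_least[OF ideal])
    show "single m c \<in> Q" if "\<not> avoids S m" for m c
      using that by (intro single_in) (simp add: avoids_def)
    fix m m' assume m: "avoids S m" "avoids S m'" "CC.T.equiv_mod m m'"
    let ?u = "exponent_vector m - exponent_vector m'"
    have "?u \<in> gspan G" using m(3) by (simp add: CC.T.equiv_mod_def G_def)
    then obtain z where z: "?u = frag_extend (basis_vector G) z" "keys z \<subseteq> lead_set G"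
      unfolding G_def CC.E.lspan_def by blast
    have "takes_value (frag_extend (basis_vector G) z) (chi (basis_value \<sigma> GV) z)"
      by (rule takes_value_frag_extend[OF _ z(2)]) (rule takes_value_t)
    moreover have "CC.EC.character ?u = chi (basis_value \<sigma> GV) z"
      using CC.EC.character_frag_extend[of z] z by (simp add: G_def)
    ultimately have "takes_value ?u (CC.EC.character ?u)" by (simp add: z(1))
    moreover have "represents S ?u m m'"
      using m(1,2) by (auto simp: represents_def avoids_def lookup_minus)
    ultimately show "single m 1 - single m' (CC.EC.character ?u) \<in> Q" by (rule takes_value_all)
  qed
  then show ?thesis using CC.sat_chain sol by auto
qed

section \<open>Reading the input\<close>

text \<open>Terms with the indeterminates replaced by their positions, which is the form that the trees encode.\<close>

type_synonym 'a numbered_term = "'a \<times> ((nat \<times> nat) \<times> nat) list"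

definition expand :: "'a numbered_term \<Rightarrow> (nat \<times> nat) list" where
  "expand t = concat (map (\<lambda>p. replicate (snd p) (fst p)) (snd t))"

definition multiplicity_in :: "nat \<times> nat \<Rightarrow> (nat \<times> nat) list \<Rightarrow> nat" where
  "multiplicity_in v m = length (filter (\<lambda>w. w = v) m)"

definition same_mono :: "(nat \<times> nat) list \<Rightarrow> (nat \<times> nat) list \<Rightarrow> bool" where
  "same_mono m m' = list_all (\<lambda>v. multiplicity_in v m = multiplicity_in v m') (m @ m')"

definition avoids_listed :: "nat list \<Rightarrow> 'a numbered_term \<Rightarrow> bool" where
  "avoids_listed SL t = list_all (\<lambda>v. \<not> in_positions SL (fst v)) (expand t)"

definition coef_of :: "'a::field numbered_term list \<Rightarrow> (nat \<times> nat) list \<Rightarrow> 'a" where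
  "coef_of ts m = foldl (\<lambda>b t. if same_mono (expand t) m then b + fst t else b) 0 ts"

text \<open>The input is not in normal form: terms with the same monomial are added up, and a monomial survives if its total
  coefficient is nonzero.\<close>

definition surviving :: "'a::field numbered_term list \<Rightarrow> 'a numbered_term list" where
  "surviving ts = filter (\<lambda>t. coef_of ts (expand t) \<noteq> 0) ts"

definition other_terms :: "'a::field numbered_term list \<Rightarrow> 'a numbered_term list" where
  "other_terms ts = filter (\<lambda>t. \<not> same_mono (expand t) (expand (head_or (0, []) ts))) ts"

text \<open>The outcome is the empty list for a single monomial, which has no zero on the torus, and otherwise
  the binomial equation as a lattice vector with its value.\<close>

definition parse_terms :: "'a::field numbered_term list \<Rightarrow> (word \<times> 'a) list" where
  "parse_terms ts = (if surviving ts = [] then [([], 1)] else if other_terms (surviving ts) = [] then []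
     else [(map (\<lambda>v. (True, v)) (expand (head_or (0, []) (surviving ts))) @
              map (\<lambda>v. (False, v)) (expand (head_or (0, []) (other_terms (surviving ts)))),
            - coef_of ts (expand (head_or (0, []) (other_terms (surviving ts)))) *
              inverse (coef_of ts (expand (head_or (0, []) (surviving ts)))))])"

definition parse :: "nat list \<Rightarrow> 'a::field numbered_term list \<Rightarrow> (word \<times> 'a) list" where
  "parse SL f = parse_terms (filter (\<lambda>t. avoids_listed SL t) f)"

definition numbered :: "('n::{finite,linorder}, 'a) pterm \<Rightarrow> 'a numbered_term" where
  "numbered t = (fst t, map (\<lambda>(v, e). (nvar v, e)) (snd t))"

abbreviation tmono :: "'a numbered_term \<Rightarrow> 'n::{finite,linorder} dvar \<Rightarrow>\<^sub>0 nat" where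
  "tmono t \<equiv> term_exponent (snd t)"

lemma lift_numbered: "unnumbered (numbered t) = t"
  by (cases t) (auto simp: unnumbered_def numbered_def comp_def case_prod_beta)

lemma fst_numbered [simp]: "fst (numbered t) = fst t"
  by (simp add: numbered_def)

lemma pterm_value_numbered:
  fixes t :: "('n::{finite,linorder}, 'a::comm_ring_1) pterm"
  shows "pterm_value t = single (tmono (numbered t) :: 'n dvar \<Rightarrow>\<^sub>0 nat) (fst t)"
proof -
  have "pterm_value (unnumbered (numbered t) :: ('n, 'a) pterm) = single (tmono (numbered t)) (fst (numbered t))"
    by (rule pterm_value_lift)
  then show ?thesis by (simp only: lift_numbered fst_numbered)
qed

lemma multiplicity_in_expand: "multiplicity_in v (expand t) = (\<Sum>p\<leftarrow>snd t. if fst p = v then snd p else 0)"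
proof -
  have "multiplicity_in v (concat (map (\<lambda>p. replicate (snd p) (fst p)) ps)) = (\<Sum>p\<leftarrow>ps. if fst p = v then snd p else 0)" for ps
    by (induction ps) (auto simp: multiplicity_in_def filter_empty_conv)
  then show ?thesis by (simp add: expand_def)
qed

lemma lookup_tmono:
  fixes t :: "('n::{finite,linorder}, 'a) pterm" and v :: "'n dvar"
  shows "lookup (tmono (numbered t)) v = multiplicity_in (nvar v) (expand (numbered t))"
proof -
  have "\<forall>p\<in>set (snd (numbered t)). fst (fst p) < card (UNIV :: 'n set)"
    by (auto simp: numbered_def nvar_def position_bound)
  then show ?thesis by (simp add: lookup_term_exponent multiplicity_in_expand)
qed

lemma expand_numbered_range: "v \<in> set (expand (numbered (t :: ('n::{finite,linorder}, 'a) pterm))) \<Longrightarrow> \<exists>w :: 'n dvar. v = nvar w"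
  by (auto simp: expand_def numbered_def)

lemma multiplicity_in_eq_0: "multiplicity_in v m = 0 \<longleftrightarrow> v \<notin> set m"
  by (auto simp: multiplicity_in_def filter_empty_conv)

lemma same_mono_iff:
  fixes t t' :: "('n::{finite,linorder}, 'a) pterm"
  shows "same_mono (expand (numbered t)) (expand (numbered t')) \<longleftrightarrow> (tmono (numbered t) :: 'n dvar \<Rightarrow>\<^sub>0 nat) = tmono (numbered t')"
proof
  assume s: "same_mono (expand (numbered t)) (expand (numbered t'))"
  show "(tmono (numbered t) :: 'n dvar \<Rightarrow>\<^sub>0 nat) = tmono (numbered t')"
  proof (rule poly_mapping_eqI)
    fix v :: "'n dvar"
    have "multiplicity_in (nvar v) (expand (numbered t)) = multiplicity_in (nvar v) (expand (numbered t'))"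
    proof (cases "nvar v \<in> set (expand (numbered t) @ expand (numbered t'))")
      case True
      then show ?thesis using s by (simp add: same_mono_def list_all_iff)
    next
      case False
      then have "multiplicity_in (nvar v) (expand (numbered t)) = 0" "multiplicity_in (nvar v) (expand (numbered t')) = 0"
        by (simp_all add: multiplicity_in_eq_0)
      then show ?thesis by simp
    qed
    then show "lookup (tmono (numbered t)) v = lookup (tmono (numbered t')) v"
      by (simp add: lookup_tmono)
  qed
next
  assume eq: "(tmono (numbered t) :: 'n dvar \<Rightarrow>\<^sub>0 nat) = tmono (numbered t')"
  have "multiplicity_in v (expand (numbered t)) = multiplicity_in v (expand (numbered t'))" if v: "v \<in> set (expand (numbered t) @ expand (numbered t'))" for v
  proof -
    obtain w :: "'n dvar" where w: "v = nvar w"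
      using v expand_numbered_range[of v t] expand_numbered_range[of v t'] by auto
    show ?thesis using arg_cong[OF eq, of "\<lambda>m. lookup m w"] by (simp add: lookup_tmono w)
  qed
  then show "same_mono (expand (numbered t)) (expand (numbered t'))" by (simp add: same_mono_def list_all_iff)
qed

lemma avoids_listed_iff:
  fixes t :: "('n::{finite,linorder}, 'a) pterm"
  assumes "set SL = position ` S"
  shows "avoids_listed SL (numbered t) \<longleftrightarrow> avoids S (tmono (numbered t) :: 'n dvar \<Rightarrow>\<^sub>0 nat)"
proof -
  have pos: "in_positions SL (position i) \<longleftrightarrow> i \<in> S" for i :: 'n
    using assms by (auto simp: in_positions_def list_ex_iff)
  have "nvar v \<in> set (expand (numbered t)) \<longleftrightarrow> v \<in> keys (tmono (numbered t))" for v :: "'n dvar"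
    using multiplicity_in_eq_0[of "nvar v" "expand (numbered t)"] by (simp add: in_keys_iff lookup_tmono)
  then have "set (expand (numbered t)) = nvar ` keys (tmono (numbered t) :: 'n dvar \<Rightarrow>\<^sub>0 nat)"
    using expand_numbered_range[of _ t] by blast
  then show ?thesis by (simp add: avoids_listed_def avoids_def list_all_iff nvar_def pos)
qed

lemma lookup_dpoly_of:
  fixes f :: "('n::{finite,linorder}, 'a::comm_ring_1) pterm list"
  shows "lookup (dpoly_of f) m = (\<Sum>t\<leftarrow>f. if (tmono (numbered t) :: 'n dvar \<Rightarrow>\<^sub>0 nat) = m then fst t else 0)"
  by (induction f) (auto simp: dpoly_of_def pterm_value_numbered lookup_add lookup_single when_def)

lemma coef_of_sum: "coef_of ts m = (\<Sum>t\<leftarrow>ts. if same_mono (expand t) m then fst t else 0)"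
proof -
  have "foldl (\<lambda>b t. if same_mono (expand t) m then b + fst t else b) a ts =
      a + (\<Sum>t\<leftarrow>ts. if same_mono (expand t) m then fst t else 0)" for a
    by (induction ts arbitrary: a) auto
  then show ?thesis by (simp add: coef_of_def)
qed

lemma coef_of_lookup:
  fixes f :: "('n::{finite,linorder}, 'a::field) pterm list" and t :: "('n, 'a) pterm"
  assumes SL: "set SL = position ` S" and av: "avoids S (tmono (numbered t) :: 'n dvar \<Rightarrow>\<^sub>0 nat)"
  shows "coef_of (filter (\<lambda>t. avoids_listed SL t) (map numbered f)) (expand (numbered t)) =
    lookup (dpoly_of f) (tmono (numbered t))"
proof -
  have "(\<Sum>t'\<leftarrow>filter (\<lambda>t. avoids_listed SL t) (map numbered f). if same_mono (expand t') (expand (numbered t)) then fst t' else 0) =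
      (\<Sum>t'\<leftarrow>f. if (tmono (numbered t') :: 'n dvar \<Rightarrow>\<^sub>0 nat) = tmono (numbered t) then fst t' else 0)"
  proof (induction f)
    case (Cons t' f)
    show ?case using Cons avoids_listed_iff[OF SL, of t'] same_mono_iff[of t' t] av by auto
  qed simp
  then show ?thesis by (simp add: coef_of_sum lookup_dpoly_of)
qed

lemma binomial_keys:
  fixes p :: "('n::{finite,linorder}, 'a::field) dpoly"
  assumes "difference_field \<sigma>" "difference_binomial \<sigma> p"
  shows "\<exists>m1 m2. keys p \<subseteq> {m1, m2}"
proof -
  obtain a b \<alpha> \<beta> where p: "p = dconst a * Ypower \<sigma> \<alpha> + dconst b * Ypower \<sigma> \<beta>"
    using assms(2) by (auto simp: difference_binomial_def)
  obtain m1 where m1: "Ypower \<sigma> \<alpha> = (single m1 1 :: ('n, 'a) dpoly)"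
    using Ypower_single[OF assms(1)] by blast
  obtain m2 where m2: "Ypower \<sigma> \<beta> = (single m2 1 :: ('n, 'a) dpoly)"
    using Ypower_single[OF assms(1)] by blast
  have "keys p \<subseteq> {m1, m2}"
    unfolding p m1 m2 dconst_def mult_single
    using keys_add[of "single (0 + m1) (a * 1)" "single (0 + m2) (b * 1)"]
    by (auto split: if_splits)
  then show ?thesis by blast
qed

lemma vec_binomial_word:
  fixes t t' :: "('n::{finite,linorder}, 'a) pterm"
  shows "vec (map (\<lambda>v. (True, v)) (expand (numbered t)) @ map (\<lambda>v. (False, v)) (expand (numbered t'))) =
    exponent_vector (tmono (numbered t) :: 'n dvar \<Rightarrow>\<^sub>0 nat) - exponent_vector (tmono (numbered t') :: 'n dvar \<Rightarrow>\<^sub>0 nat)"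
proof (rule vector_eqI[where 'n = 'n])
  have c: "occurrences True v (map (\<lambda>v. (True, v)) m @ map (\<lambda>v. (False, v)) m') = multiplicity_in v m"
    "occurrences False v (map (\<lambda>v. (True, v)) m @ map (\<lambda>v. (False, v)) m') = multiplicity_in v m'" for v m m'
    by (simp_all add: occurrences_def multiplicity_in_def filter_map comp_def)
  let ?e = "\<lambda>t :: ('n, 'a) pterm. exponent_vector (tmono (numbered t) :: 'n dvar \<Rightarrow>\<^sub>0 nat)"
  show "lookup (vec (map (\<lambda>v. (True, v)) (expand (numbered t)) @ map (\<lambda>v. (False, v)) (expand (numbered t')))) (nvar v) =
      lookup (?e t - ?e t') (nvar v)" for v :: "'n dvar"
    by (simp only: lookup_vec c lookup_minus lookup_exponent_vector lookup_tmono)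
  fix v :: "nat \<times> nat" assume v: "card (UNIV :: 'n set) \<le> fst v"
  have "v \<notin> set (expand (numbered s))" for s :: "('n, 'a) pterm"
  proof
    assume "v \<in> set (expand (numbered s))"
    then obtain w :: "'n dvar" where "v = nvar w" using expand_numbered_range by blast
    then show False using v position_bound[of "fst w"] by (simp add: nvar_def)
  qed
  then have "multiplicity_in v (expand (numbered s)) = 0" for s :: "('n, 'a) pterm" by (simp add: multiplicity_in_eq_0)
  then show "lookup (vec (map (\<lambda>v. (True, v)) (expand (numbered t)) @ map (\<lambda>v. (False, v)) (expand (numbered t')))) v =
      lookup (?e t - ?e t') v"
    using v by (simp only: lookup_vec c lookup_minus lookup_exponent_vector_outside)
qed

text \<open>Modulo the monomials that involve \<open>S\<close>, the polynomial is \<open>r\<close>: it vanishes, or it is a monomial, or it is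
  equivalent to an equation between the lattice vector \<open>w\<close> and a value.\<close>

lemma parse_spec:
  fixes f :: "('n::{finite,linorder}, 'a::field) pterm list"
  assumes \<sigma>: "difference_field \<sigma>" and bin: "difference_binomial \<sigma> (dpoly_of f)" and SL: "set SL = position ` S"
  obtains r :: "('n, 'a) dpoly" where "\<And>m. m \<in> keys (dpoly_of f - r) \<Longrightarrow> \<not> avoids S m"
    "(parse SL (map numbered f) = [([], 1)] \<and> r = 0) \<or>
     (parse SL (map numbered f) = [] \<and> (\<exists>m c. c \<noteq> 0 \<and> avoids S m \<and> r = single m c)) \<or>
     (\<exists>m1 m2 c1 c2 w. parse SL (map numbered f) = [(w, - c2 * inverse c1)] \<and> c1 \<noteq> 0 \<and> c2 \<noteq> 0 \<and>
        avoids S m1 \<and> avoids S m2 \<and> vec w = exponent_vector m1 - exponent_vector m2 \<and>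
        (\<forall>l\<in>set w. fst (snd l) < card (UNIV :: 'n set)) \<and>
        r = single m1 c1 + single m2 c2)"
proof -
  let ?p = "dpoly_of f :: ('n, 'a) dpoly"
  let ?ts = "filter (\<lambda>t. avoids_listed SL t) (map numbered f)"
  define K where "K = {m \<in> keys ?p. avoids S m}"
  have in_ts: "\<exists>t :: ('n, 'a) pterm. s = numbered t \<and> avoids S (tmono (numbered t) :: 'n dvar \<Rightarrow>\<^sub>0 nat)" if s: "s \<in> set ?ts" for s
  proof -
    have "s \<in> numbered ` set f" "avoids_listed SL s" using s by auto
    then obtain t :: "('n, 'a) pterm" where "s = numbered t" by blast
    then show ?thesis using avoids_listed_iff[OF SL, of t] \<open>avoids_listed SL s\<close> by blast
  qed
  have surviving: "\<exists>t :: ('n, 'a) pterm. s = numbered t \<and> tmono (numbered t) \<in> K \<and> coef_of ?ts (expand s) = lookup ?p (tmono (numbered t))"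
    if s: "s \<in> set (surviving ?ts)" for s
  proof -
    have s: "s \<in> set ?ts" "coef_of ?ts (expand s) \<noteq> 0" using s by (auto simp: surviving_def)
    obtain t :: "('n, 'a) pterm" where t: "s = numbered t" "avoids S (tmono (numbered t) :: 'n dvar \<Rightarrow>\<^sub>0 nat)" using in_ts[OF s(1)] by blast
    then show ?thesis using s(2) coef_of_lookup[OF SL t(2), of f] by (auto simp: K_def in_keys_iff)
  qed
  have K: "\<exists>s\<in>set (surviving ?ts). tmono s = m" if m: "m \<in> K" for m
  proof -
    have "lookup ?p m \<noteq> 0" using m by (simp add: K_def in_keys_iff)
    then have "\<exists>t\<in>set f. tmono (numbered t) = m"
      unfolding lookup_dpoly_of by (auto intro: ccontr simp: sum_list_0 cong: map_cong)
    then obtain t where t: "t \<in> set f" "tmono (numbered t) = m" by blast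
    then have av: "avoids S (tmono (numbered t) :: 'n dvar \<Rightarrow>\<^sub>0 nat)" using m by (simp add: K_def)
    have "numbered t \<in> set (surviving ?ts)"
      using t m av coef_of_lookup[OF SL av, of f] avoids_listed_iff[OF SL, of t]
      by (auto simp: surviving_def K_def in_keys_iff)
    then show ?thesis using t(2) by blast
  qed
  have rest: "\<not> avoids S m" if r: "\<And>m. lookup r m = (if m \<in> K then lookup ?p m else 0)"
    and m: "m \<in> keys (?p - r)" for r m
    using m by (auto simp: K_def in_keys_iff lookup_minus r split: if_splits)
  show ?thesis
  proof (cases "surviving ?ts = []")
    case True
    then have "K = {}" using K by auto
    show ?thesis
      by (rule that[of 0]) (use rest[of 0] \<open>K = {}\<close> True in \<open>simp_all add: parse_def parse_terms_def\<close>)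
  next
    case False
    define s1 where "s1 = head_or (0, []) (surviving ?ts)"
    have s1: "s1 \<in> set (surviving ?ts)" using False by (simp add: s1_def head_or_def)
    obtain t1 :: "('n, 'a) pterm" where t1: "s1 = numbered t1" "tmono (numbered t1) \<in> K"
        "coef_of ?ts (expand s1) = lookup ?p (tmono (numbered t1))"
      using surviving[OF s1] by blast
    let ?m1 = "tmono (numbered t1) :: 'n dvar \<Rightarrow>\<^sub>0 nat"
    show ?thesis
    proof (cases "other_terms (surviving ?ts) = []")
      case True
      have only: "m = ?m1" if mK: "m \<in> K" for m
      proof -
        obtain s where s: "s \<in> set (surviving ?ts)" "tmono s = m" using K[OF mK] by blast
        obtain t :: "('n, 'a) pterm" where t: "s = numbered t" using surviving[OF s(1)] by blast
        have "same_mono (expand s) (expand s1)"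
          using True s(1) by (auto simp: other_terms_def filter_empty_conv s1_def)
        then show ?thesis using same_mono_iff[of t t1] t t1(1) s(2) by simp
      qed
      have "K = {?m1}"
      proof (intro equalityI subsetI)
        show "m \<in> {?m1}" if "m \<in> K" for m using only[OF that] by (rule ssubst) (rule singletonI)
        show "m \<in> K" if "m \<in> {?m1}" for m using t1(2) that by (simp only: singleton_iff)
      qed
      let ?r = "single ?m1 (lookup ?p ?m1)"
      have lr: "lookup ?r m = (if m \<in> K then lookup ?p m else 0)" for m
        unfolding \<open>K = {?m1}\<close> by (simp add: lookup_single when_def)
      have "lookup ?p ?m1 \<noteq> 0" "avoids S ?m1" using t1(2) by (auto simp: K_def in_keys_iff)
      moreover have "parse SL (map numbered f) = []" using False True by (simp add: parse_def parse_terms_def)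
      ultimately show ?thesis using that[of ?r] rest[OF lr] by blast
    next
      case two: False
      define s2 where "s2 = head_or (0, []) (other_terms (surviving ?ts))"
      have s2: "s2 \<in> set (other_terms (surviving ?ts))" using two by (simp add: s2_def head_or_def)
      then have s2': "s2 \<in> set (surviving ?ts)" "\<not> same_mono (expand s2) (expand s1)"
        by (simp_all add: other_terms_def s1_def)
      obtain t2 :: "('n, 'a) pterm" where t2: "s2 = numbered t2" "tmono (numbered t2) \<in> K"
          "coef_of ?ts (expand s2) = lookup ?p (tmono (numbered t2))"
        using surviving[OF s2'(1)] by blast
      let ?m2 = "tmono (numbered t2) :: 'n dvar \<Rightarrow>\<^sub>0 nat"
      have ne: "?m2 \<noteq> ?m1" using s2'(2) same_mono_iff[of t2 t1] by (simp add: t1(1) t2(1))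
      obtain k1 k2 where k: "keys ?p \<subseteq> {k1, k2}" using binomial_keys[OF \<sigma> bin] by blast
      have "K = {?m1, ?m2}" using t1(2) t2(2) ne k by (auto simp: K_def)
      let ?c1 = "lookup ?p ?m1" and ?c2 = "lookup ?p ?m2"
      let ?r = "single ?m1 ?c1 + single ?m2 ?c2"
      let ?w = "map (\<lambda>v. (True, v)) (expand s1) @ map (\<lambda>v. (False, v)) (expand s2)"
      have lr: "lookup ?r m = (if m \<in> K then lookup ?p m else 0)" for m
        unfolding \<open>K = {?m1, ?m2}\<close> using ne by (simp add: lookup_single lookup_add when_def)
      have c: "?c1 \<noteq> 0" "avoids S ?m1" "?c2 \<noteq> 0" "avoids S ?m2" using t1(2) t2(2) by (auto simp: K_def in_keys_iff)
      moreover have "parse SL (map numbered f) = [(?w, - ?c2 * inverse ?c1)]"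
        using False two unfolding parse_def parse_terms_def s1_def[symmetric] s2_def[symmetric] t1(3) t2(3) by simp
      moreover have "vec ?w = exponent_vector ?m1 - exponent_vector ?m2"
        unfolding t1(1) t2(1) by (rule vec_binomial_word)
      moreover have "fst (snd l) < card (UNIV :: 'n set)" if "l \<in> set ?w" for l
      proof -
        have "snd l \<in> set (expand (numbered t1)) \<union> set (expand (numbered t2))" using that by (auto simp: t1(1) t2(1))
        then obtain w :: "'n dvar" where "snd l = nvar w" using expand_numbered_range by blast
        then show ?thesis by (simp add: nvar_def position_bound)
      qed
      ultimately show ?thesis using that[of ?r] rest[OF lr] by blast
    qed
  qed
qed

definition system :: "nat list \<Rightarrow> 'a::field numbered_term list list \<Rightarrow> (word \<times> 'a) list" where
  "system SL fs = map (\<lambda>p. ([(True, (p, 0))], 1)) SL @ concat (map (\<lambda>f. parse SL f) fs)"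

definition solvable :: "nat list \<Rightarrow> 'a::field numbered_term list list \<Rightarrow> bool" where
  "solvable SL fs = list_all (\<lambda>f. parse SL f \<noteq> []) fs"

text \<open>The second component lists certificates, each of which is used for all the sets \<open>SL\<close> whose system it certifies.\<close>

definition all_chains :: "('a::field \<Rightarrow> 'a) \<Rightarrow> ('a poly \<Rightarrow> 'a) \<Rightarrow> nat \<Rightarrow> nat list list \<Rightarrow>
    'a numbered_term list list \<times> certificate list \<Rightarrow> 'a numbered_term list list list" where
  "all_chains \<sigma> rt n Ss x = concat (map (\<lambda>SL. if solvable SL (fst x)
     then concat (map (\<lambda>C. if check n (system SL (fst x)) C
       then map (\<lambda>GV. map (\<lambda>g. entry_poly SL g) GV) (solutions \<sigma> rt (system SL (fst x)) C) else []) (snd x))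
     else []) Ss)"

definition certified :: "nat \<Rightarrow> nat list list \<Rightarrow> 'a::field numbered_term list list \<times> certificate list \<Rightarrow> bool" where
  "certified n Ss x = list_all (\<lambda>SL. \<not> solvable SL (fst x) \<or>
     list_ex (\<lambda>C. check n (system SL (fst x)) C) (snd x)) Ss"

lemma vanishing_set: "(\<exists>S :: 'n::{finite,linorder} set. set SL = position ` S)" if "SL \<in> set (subseqs [0..<card (UNIV :: 'n set)])"
proof -
  have "set SL \<in> set ` set (subseqs [0..<card (UNIV :: 'n set)])" using that by blast
  then have sub: "set SL \<subseteq> {..<card (UNIV :: 'n set)}" unfolding subseqs_powset by auto
  have "set SL = position ` {i :: 'n. position i \<in> set SL}"
    using sub by (auto elim!: position_surj)
  then show ?thesis by blast
qed

lemma ideal_from_rest: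
  assumes I: "is_ideal I" "\<And>m c. \<not> avoids S m \<Longrightarrow> single m c \<in> I"
    and "\<And>m. m \<in> keys (p - r) \<Longrightarrow> \<not> avoids S m"
  shows "p \<in> I \<longleftrightarrow> r \<in> I"
proof -
  have d: "p - r \<in> I"
    by (subst dpoly_expand) (intro is_ideal_sum I assms(3))
  have "p = r + (p - r)" by simp
  then show ?thesis using is_ideal_add_iff[OF I(1) d, of r] by metis
qed

lemma filter_in_subseqs: "filter P xs \<in> set (subseqs xs)"
  by (induction xs) (auto simp: Let_def)

lemma in_concat_if: "y \<in> set (concat (map (\<lambda>x. if P x then f x else []) xs)) \<longleftrightarrow> (\<exists>x\<in>set xs. P x \<and> y \<in> set (f x))"
  by (induction xs) auto

lemma in_all_chains: "y \<in> set (all_chains \<sigma> rt n Ss x) \<longleftrightarrow> (\<exists>SL\<in>set Ss. solvable SL (fst x) \<and>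
   (\<exists>C\<in>set (snd x). check n (system SL (fst x)) C \<and>
     (\<exists>GV\<in>set (solutions \<sigma> rt (system SL (fst x)) C). y = map (\<lambda>g. entry_poly SL g) GV)))"
  unfolding all_chains_def in_concat_if set_map image_iff by (rule refl)

text \<open>For every reflexive prime above the system, the set of its vanishing indeterminates is one of the \<open>SL\<close>, and a certificate
  for that set gives a chain below the prime.\<close>

theorem decomposition:
  fixes \<sigma> :: "'a::{alg_closed_field, field_char_0} \<Rightarrow> 'a" and fs :: "('n::{finite,linorder}, 'a) pterm list list"
  assumes \<sigma>: "inversive_difference_field \<sigma>" and rt: "root_choice rt"
    and bin: "\<And>f. f \<in> set fs \<Longrightarrow> difference_binomial \<sigma> (dpoly_of f)"
    and cert: "certified (card (UNIV :: 'n set)) (subseqs [0..<card (UNIV :: 'n set)]) (map (map numbered) fs, CS)"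
  defines "As \<equiv> map (map (map unnumbered)) (all_chains \<sigma> rt (card (UNIV :: 'n set)) (subseqs [0..<card (UNIV :: 'n set)]) (map (map numbered) fs, CS)) :: ('n, 'a) pterm list list list"
  shows "\<forall>A\<in>set (map (map dpoly_of) As).
       regular_chain \<sigma> A \<and> coherent_chain \<sigma> A \<and>
       (\<forall>g\<in>set A. (\<exists>c. g = yvar (c, 0)) \<or> difference_binomial \<sigma> g) \<and>
       reflexive_sigma_ideal \<sigma> (sat \<sigma> A) \<and> is_prime_ideal (sat \<sigma> A)"
    and "perfect_ideal_generated \<sigma> (set (map dpoly_of fs)) = (\<Inter>A\<in>set (map (map dpoly_of) As). sat \<sigma> A)"
proof -
  let ?n = "card (UNIV :: 'n set)"
  let ?fs = "map (map numbered) fs :: 'a numbered_term list list"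
  let ?Ss = "subseqs [0..<?n]"
  have df: "difference_field \<sigma>" using \<sigma> by (simp add: inversive_difference_field_def)
  interpret difference \<sigma> by unfold_locales (rule df)
  have bij: "bij \<sigma>" using \<sigma> by (simp add: inversive_difference_field_def)
  have sysnz: "\<forall>f\<in>set (system SL ?fs). snd f \<noteq> 0" if SL: "SL \<in> set ?Ss" for SL
  proof
    fix f assume "f \<in> set (system SL ?fs)"
    then consider "snd f = 1" | g where "g \<in> set fs" "f \<in> set (parse SL (map numbered g))"
      by (auto simp: system_def)
    then show "snd f \<noteq> 0"
    proof cases
      case 2
      obtain S :: "'n set" where S: "set SL = position ` S" using vanishing_set[OF SL] by blast
      show ?thesis
        by (rule parse_spec[OF df bin[OF 2(1)] S]) (use 2(2) in auto)
    qed simp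
  qed
  have sysS: "([(True, (p, 0))], 1) \<in> set (system SL ?fs)" if "p \<in> set SL" for p SL
    using that by (simp add: system_def)
  let ?chain = "\<lambda>SL GV. map dpoly_of (map (map unnumbered) (map (\<lambda>g. entry_poly SL g) GV)) :: ('n, 'a) dpoly list"
  have chains: "A \<in> set (map (map dpoly_of) As) \<longleftrightarrow> (\<exists>SL\<in>set ?Ss. \<exists>C\<in>set CS. solvable SL ?fs \<and> check ?n (system SL ?fs) C \<and>
      (\<exists>GV\<in>set (solutions \<sigma> rt (system SL ?fs) C). A = ?chain SL GV))" for A
  proof -
    have "A \<in> set (map (map dpoly_of) As) \<longleftrightarrow>
        (\<exists>x. x \<in> set (all_chains \<sigma> rt ?n ?Ss (?fs, CS)) \<and> A = map dpoly_of (map (map unnumbered) x))"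
      unfolding As_def set_map image_iff by blast
    then show ?thesis unfolding in_all_chains fst_conv snd_conv by blast
  qed
  have cc: "\<exists>S :: 'n set. set SL = position ` S \<and>
      certified_chain \<sigma> S SL (system SL ?fs) GV (fst (snd C)) (fst (snd (snd C))) ?n (fst C)"
    if "SL \<in> set ?Ss" "check ?n (system SL ?fs) C" "GV \<in> set (solutions \<sigma> rt (system SL ?fs) C)" for SL C GV
  proof -
    obtain S :: "'n set" where S: "set SL = position ` S" using vanishing_set[OF \<open>SL \<in> set ?Ss\<close>] by blast
    show ?thesis
      using solution_certified[OF \<sigma> rt that(2) S sysnz[OF that(1)] sysS that(3)] S by blast
  qed
  have good: "regular_chain \<sigma> A \<and> coherent_chain \<sigma> A \<and>
       (\<forall>g\<in>set A. (\<exists>c. g = yvar (c, 0)) \<or> difference_binomial \<sigma> g) \<and>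
       reflexive_sigma_ideal \<sigma> (sat \<sigma> A) \<and> is_prime_ideal (sat \<sigma> A) \<and> set (map dpoly_of fs) \<subseteq> sat \<sigma> A"
    if A: "A \<in> set (map (map dpoly_of) As)" for A
  proof -
    obtain SL C GV where a: "SL \<in> set ?Ss" "solvable SL ?fs" "check ?n (system SL ?fs) C"
        "GV \<in> set (solutions \<sigma> rt (system SL ?fs) C)" "A = ?chain SL GV"
      using A unfolding chains by blast
    obtain S :: "'n set" where S: "set SL = position ` S"
        "certified_chain \<sigma> S SL (system SL ?fs) GV (fst (snd C)) (fst (snd (snd C))) ?n (fst C)"
      using cc[OF a(1,3,4)] by blast
    interpret CC: certified_chain \<sigma> S SL "system SL ?fs" GV "fst (snd C)" "fst (snd (snd C))" ?n "fst C"
      by (rule S(2))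
    have A: "A = CC.chain" unfolding a(5) CC.chain_def CC.chain_poly_def by (simp add: comp_def)
    note I = CC.T.is_ideal_torus_ideal
    have "dpoly_of f \<in> CC.T.torus_ideal" if f: "f \<in> set fs" for f
    proof -
      obtain r :: "('n, 'a) dpoly" where r: "\<And>m. m \<in> keys (dpoly_of f - r) \<Longrightarrow> \<not> avoids S m"
        "(parse SL (map numbered f) = [([], 1)] \<and> r = 0) \<or>
         (parse SL (map numbered f) = [] \<and> (\<exists>m c. c \<noteq> 0 \<and> avoids S m \<and> r = single m c)) \<or>
         (\<exists>m1 m2 c1 c2 w. parse SL (map numbered f) = [(w, - c2 * inverse c1)] \<and> c1 \<noteq> 0 \<and> c2 \<noteq> 0 \<and>
            avoids S m1 \<and> avoids S m2 \<and> vec w = exponent_vector m1 - exponent_vector m2 \<and>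
            (\<forall>l\<in>set w. fst (snd l) < ?n) \<and>
            r = single m1 c1 + single m2 c2)"
        by (rule parse_spec[OF df bin[OF f] S(1)]) blast
      have "parse SL (map numbered f) \<noteq> []" using a(2) f by (auto simp: solvable_def list_all_iff)
      with r(2) consider "r = 0" | m1 m2 c1 c2 w where "parse SL (map numbered f) = [(w, - c2 * inverse c1)]" "c1 \<noteq> 0" "c2 \<noteq> 0"
        "avoids S m1" "avoids S m2" "vec w = exponent_vector m1 - exponent_vector m2"
        "r = single m1 c1 + single m2 c2" by blast
      then have "r \<in> CC.T.torus_ideal"
      proof cases
        case 1
        then show ?thesis using is_ideal_zero[OF I] by simp
      next
        case 2
        have "(w, - c2 * inverse c1) \<in> set (system SL ?fs)"
          using f 2(1) by (force simp: system_def)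
        note ch = CC.character_F[OF this]
        have "single m1 c1 - single m2 (c1 * CC.EC.character (exponent_vector m1 - exponent_vector m2)) \<in> CC.T.torus_ideal"
          using 2(4,5,6) ch(1)
          by (intro CC.T.binomial_in_torus_ideal) (auto simp: avoids_def CC.T.equiv_mod_def)
        moreover have "c1 * CC.EC.character (exponent_vector m1 - exponent_vector m2) = - c2"
          using ch(2) 2(2,6) by simp
        ultimately show ?thesis by (simp add: 2(7) single_uminus)
      qed
      moreover have "single m c \<in> CC.T.torus_ideal" if "\<not> avoids S m" for m c
        using that by (intro CC.T.monomial_in_torus_ideal) (simp add: avoids_def)
      ultimately show ?thesis using ideal_from_rest[OF I _ r(1)] by blast
    qed
    then show ?thesis
      unfolding A CC.sat_chain
      using CC.regular_chain_chain CC.coherent_chain_chain CC.chain_elements CC.T.reflexive_torus_ideal CC.T.prime_torus_ideal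
      by auto
  qed
  show "\<forall>A\<in>set (map (map dpoly_of) As).
       regular_chain \<sigma> A \<and> coherent_chain \<sigma> A \<and>
       (\<forall>g\<in>set A. (\<exists>c. g = yvar (c, 0)) \<or> difference_binomial \<sigma> g) \<and>
       reflexive_sigma_ideal \<sigma> (sat \<sigma> A) \<and> is_prime_ideal (sat \<sigma> A)"
    using good by blast
  have below: "\<exists>P\<in>sat \<sigma> ` set (map (map dpoly_of) As). P \<subseteq> Q"
    if Q: "reflexive_sigma_ideal \<sigma> Q" "is_prime_ideal Q" "set (map dpoly_of fs) \<subseteq> Q" for Q
  proof -
    define S where "S = {i :: 'n. yvar (i, 0) \<in> Q}"
    interpret TP: torus_point \<sigma> Q S
      by unfold_locales (use bij Q S_def in auto)
    define SL where "SL = filter (\<lambda>p. p \<in> position ` S) [0..<?n]"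
    have S: "set SL = position ` S" using position_bound by (auto simp: SL_def)
    have SLs: "SL \<in> set ?Ss" unfolding SL_def by (rule filter_in_subseqs)
    have parse: "parse SL (map numbered f) \<noteq> [] \<and> (\<forall>g\<in>set (parse SL (map numbered f)). TP.takes_value (vec (fst g)) (snd g))"
      if f: "f \<in> set fs" for f
    proof -
      obtain r :: "('n, 'a) dpoly" where r: "\<And>m. m \<in> keys (dpoly_of f - r) \<Longrightarrow> \<not> avoids S m"
        "(parse SL (map numbered f) = [([], 1)] \<and> r = 0) \<or>
         (parse SL (map numbered f) = [] \<and> (\<exists>m c. c \<noteq> 0 \<and> avoids S m \<and> r = single m c)) \<or>
         (\<exists>m1 m2 c1 c2 w. parse SL (map numbered f) = [(w, - c2 * inverse c1)] \<and> c1 \<noteq> 0 \<and> c2 \<noteq> 0 \<and>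
            avoids S m1 \<and> avoids S m2 \<and> vec w = exponent_vector m1 - exponent_vector m2 \<and>
            (\<forall>l\<in>set w. fst (snd l) < ?n) \<and>
            r = single m1 c1 + single m2 c2)"
        by (rule parse_spec[OF df bin[OF f] S(1)]) blast
      have "dpoly_of f \<in> Q" using Q(3) f by auto
      then have rQ: "r \<in> Q" using ideal_from_rest[OF TP.ideal TP.single_in r(1)] by blast
      from r(2) consider "parse SL (map numbered f) = [([], 1)]" |
        m c where "c \<noteq> 0" "avoids S m" "r = single m c" |
        m1 m2 c1 c2 w where "parse SL (map numbered f) = [(w, - c2 * inverse c1)]" "c1 \<noteq> 0" "c2 \<noteq> 0"
        "avoids S m1" "avoids S m2" "vec w = exponent_vector m1 - exponent_vector m2"
        "r = single m1 c1 + single m2 c2" by blast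
      then show ?thesis
      proof cases
        case 1
        then show ?thesis using TP.takes_value_zero by simp
      next
        case 2
        then show ?thesis using rQ TP.single_notin by blast
      next
        case 3
        have "single 0 (inverse c1) * r \<in> Q" by (rule is_ideal_mult[OF TP.ideal rQ])
        then have "single m1 1 - single m2 (- c2 * inverse c1) \<in> Q"
          using 3(2) by (simp add: 3(7) distrib_left mult_single single_uminus mult.commute)
        moreover have "represents S (vec w) m1 m2"
          using 3(4,5) by (simp add: represents_def 3(6) lookup_minus)
        ultimately have "TP.takes_value (vec w) (- c2 * inverse c1)"
          using 3(2,3) unfolding TP.takes_value_def by (intro conjI exI[of _ m1] exI[of _ m2]) auto
        then show ?thesis using 3(1) by simp
      qed
    qed
    have solv: "solvable SL ?fs" using parse by (simp add: solvable_def list_all_iff)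
    then obtain C where C: "C \<in> set CS" "check ?n (system SL ?fs) C"
      using cert SLs by (auto simp: certified_def list_all_iff list_ex_iff)
    have "TP.takes_value (vec (fst g)) (snd g)" if g: "g \<in> set (system SL ?fs)" for g
    proof -
      from g consider p where "p \<in> set SL" "g = ([(True, (p, 0))], 1)" | f where "f \<in> set fs" "g \<in> set (parse SL (map numbered f))"
        by (auto simp: system_def)
      then show ?thesis
      proof cases
        case 1
        have "represents S (vec (fst g)) 0 0"
          unfolding represents_def
        proof (intro conjI allI impI)
          fix v :: "'n dvar" assume "fst v \<notin> S"
          then have "(p, 0) \<noteq> nvar v" using 1(1) S by (auto simp: nvar_def)
          then show "lookup (vec (fst g)) (nvar v) = int (lookup 0 v) - int (lookup 0 v)"
            by (simp add: 1(2) vec_Cons lookup_single when_def)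
        qed (simp_all add: avoids_def)
        then show ?thesis unfolding TP.takes_value_def using is_ideal_zero[OF TP.ideal] 1(2) by (intro conjI exI[of _ 0]) auto
      next
        case 2
        then show ?thesis using parse by blast
      qed
    qed
    from TP.solution_below[OF rt C(2) S this sysS] obtain GV where
      GV: "GV \<in> set (solutions \<sigma> rt (system SL ?fs) C)" "sat \<sigma> (certified_chain.chain SL GV :: ('n, 'a) dpoly list) \<subseteq> Q"
      by blast
    obtain S' :: "'n set" where "certified_chain \<sigma> S' SL (system SL ?fs) GV (fst (snd C)) (fst (snd (snd C))) ?n (fst C)"
      using cc[OF SLs C(2) GV(1)] by blast
    then interpret CC: certified_chain \<sigma> S' SL "system SL ?fs" GV "fst (snd C)" "fst (snd (snd C))" ?n "fst C" .
    have A: "?chain SL GV = CC.chain" unfolding CC.chain_def CC.chain_poly_def by (simp add: comp_def)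
    have "?chain SL GV \<in> set (map (map dpoly_of) As)"
      unfolding chains using SLs C solv GV(1) by blast
    then show ?thesis using GV(2) unfolding A by blast
  qed
  show "perfect_ideal_generated \<sigma> (set (map dpoly_of fs)) = (\<Inter>A\<in>set (map (map dpoly_of) As). sat \<sigma> A)"
    by (rule perfect_ideal_is_Inter_of_primes) (use good below in auto)
qed

text \<open>A certificate for each of the finitely many sets \<open>SL\<close>.\<close>

lemma certified_exists:
  fixes \<sigma> :: "'a::field \<Rightarrow> 'a" and fs :: "('n::{finite,linorder}, 'a) pterm list list"
  assumes df: "difference_field \<sigma>" and bin: "\<And>f. f \<in> set fs \<Longrightarrow> difference_binomial \<sigma> (dpoly_of f)"
  shows "\<exists>CS. certified (card (UNIV :: 'n set)) (subseqs [0..<card (UNIV :: 'n set)]) (map (map numbered) fs, CS)"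
proof -
  let ?n = "card (UNIV :: 'n set)" and ?fs = "map (map numbered) fs :: 'a numbered_term list list"
  let ?Ss = "subseqs [0..<?n]"
  have "\<exists>C. check ?n (system SL ?fs) C" if SL: "SL \<in> set ?Ss" for SL
  proof (rule certificate_exists)
    fix f l assume f: "f \<in> set (system SL ?fs)" "l \<in> set (fst f)"
    obtain S :: "'n set" where S: "set SL = position ` S" using vanishing_set[OF SL] by blast
    from f consider p where "p \<in> set SL" "f = ([(True, (p, 0))], 1)" | g where "g \<in> set fs" "f \<in> set (parse SL (map numbered g))"
      by (auto simp: system_def)
    then show "fst (snd l) < ?n"
    proof cases
      case 1
      then show ?thesis using f(2) S position_bound by auto
    next
      case 2
      show ?thesis
        by (rule parse_spec[OF df bin[OF 2(1)] S]) (use 2(2) f(2) in auto)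
    qed
  qed
  then have "\<forall>SL\<in>set ?Ss. \<exists>C. check ?n (system SL ?fs) C" by blast
  then obtain c where "\<forall>SL\<in>set ?Ss. check ?n (system SL ?fs) (c SL)" by (rule bchoice[THEN exE])
  then have "certified ?n ?Ss (?fs, map c ?Ss)" by (auto simp: certified_def list_all_iff list_ex_iff)
  then show ?thesis by blast
qed

section \<open>A calculus of computable functions\<close>

locale computation =
  fixes \<sigma> :: "'a::field \<Rightarrow> 'a"
begin

text \<open>A single program has to serve all root choices; \<open>A\<close> and \<open>B\<close> encode argument and result.\<close>

definition computable :: "('x \<Rightarrow> 'a tree) \<Rightarrow> ('y \<Rightarrow> 'a tree) \<Rightarrow> (('a poly \<Rightarrow> 'a) \<Rightarrow> 'x \<Rightarrow> 'y) \<Rightarrow> bool" where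
  "computable A B f \<longleftrightarrow> (\<exists>P. \<forall>rt. root_choice rt \<longrightarrow> (\<forall>x. runs \<sigma> rt P (A x) (B (f rt x))))"

definition eP :: "('x \<Rightarrow> 'a tree) \<Rightarrow> ('y \<Rightarrow> 'a tree) \<Rightarrow> 'x \<times> 'y \<Rightarrow> 'a tree" where
  "eP A B p = Node (A (fst p)) (B (snd p))"

abbreviation eL :: "('x \<Rightarrow> 'a tree) \<Rightarrow> 'x list \<Rightarrow> 'a tree" where
  "eL \<equiv> tree_list"

abbreviation eN :: "nat \<Rightarrow> 'a tree" where
  "eN \<equiv> tree_nat"

abbreviation eB :: "bool \<Rightarrow> 'a tree" where
  "eB \<equiv> of_bool_tree"

abbreviation eE :: "'a \<Rightarrow> 'a tree" where
  "eE \<equiv> Elem"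

lemma eL_Nil [simp]: "eL A [] = Leaf"
  and eL_Cons [simp]: "eL A (x # xs) = Node (A x) (eL A xs)"
  by (simp_all add: tree_list_def)

lemma computableI:
  assumes "\<And>rt x. root_choice rt \<Longrightarrow> runs \<sigma> rt P (A x) (B (f rt x))"
  shows "computable A B f"
  using assms unfolding computable_def by blast

lemma c_prim:
  assumes "\<And>rt x. root_choice rt \<Longrightarrow> run_primitive \<sigma> rt p (A x) = B (f rt x)"
  shows "computable A B f"
  by (rule computableI[of "Prim p"]) (simp flip: assms add: runs.prim)

lemma c_id: "computable A A (\<lambda>rt x. x)"
  by (rule computableI[of Skip]) (rule runs.skip)

lemma c_comp:
  assumes "computable A B f" "computable B C g"
  shows "computable A C (\<lambda>rt x. g rt (f rt x))"
proof -
  obtain P where P: "\<And>rt x. root_choice rt \<Longrightarrow> runs \<sigma> rt P (A x) (B (f rt x))" using assms(1) unfolding computable_def by blast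
  obtain R where R: "\<And>rt x. root_choice rt \<Longrightarrow> runs \<sigma> rt R (B x) (C (g rt x))" using assms(2) unfolding computable_def by blast
  show ?thesis by (rule computableI[of "Seq P R"]) (rule runs.seq[OF P R])
qed

lemma c_Pair:
  assumes "computable A B f" "computable A C g"
  shows "computable A (eP B C) (\<lambda>rt x. (f rt x, g rt x))"
proof -
  obtain P where P: "\<And>rt x. root_choice rt \<Longrightarrow> runs \<sigma> rt P (A x) (B (f rt x))" using assms(1) unfolding computable_def by blast
  obtain R where R: "\<And>rt x. root_choice rt \<Longrightarrow> runs \<sigma> rt R (A x) (C (g rt x))" using assms(2) unfolding computable_def by blast
  show ?thesis by (rule computableI[of "Fork P R"]) (simp add: eP_def runs.fork P R)
qed

text \<open>Composition with a function of several arguments, in the form in which the rules are applied backwards: the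
  first premise is proved once for each function, the others by descending into the arguments.\<close>

lemma c_1: "computable A B f \<Longrightarrow> computable X A g \<Longrightarrow> computable X B (\<lambda>rt x. f rt (g rt x))"
  by (rule c_comp)

lemma c_2:
  assumes "computable (eP A B) C (\<lambda>rt z. f rt (fst z) (snd z))" "computable X A g" "computable X B h"
  shows "computable X C (\<lambda>rt x. f rt (g rt x) (h rt x))"
  using c_comp[OF c_Pair[OF assms(2,3)] assms(1)] by simp

lemma c_3:
  assumes "computable (eP A (eP B C)) D (\<lambda>rt z. f rt (fst z) (fst (snd z)) (snd (snd z)))"
    "computable X A g" "computable X B h" "computable X C k"
  shows "computable X D (\<lambda>rt x. f rt (g rt x) (h rt x) (k rt x))"
  using c_comp[OF c_Pair[OF assms(2) c_Pair[OF assms(3,4)]] assms(1)] by simp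

lemma c_fst: "computable A (eP B C) f \<Longrightarrow> computable A B (\<lambda>rt x. fst (f rt x))"
  by (erule c_comp) (rule c_prim[of Left], simp add: eP_def)

lemma c_snd: "computable A (eP B C) f \<Longrightarrow> computable A C (\<lambda>rt x. snd (f rt x))"
  by (erule c_comp) (rule c_prim[of Right], simp add: eP_def)

lemma c_if:
  assumes "computable A eB b" "computable A B f" "computable A B g"
  shows "computable A B (\<lambda>rt x. if b rt x then f rt x else g rt x)"
proof -
  obtain Q where Q: "\<And>rt x. root_choice rt \<Longrightarrow> runs \<sigma> rt Q (A x) (eB (b rt x))" using assms(1) unfolding computable_def by blast
  obtain P where P: "\<And>rt x. root_choice rt \<Longrightarrow> runs \<sigma> rt P (A x) (B (f rt x))" using assms(2) unfolding computable_def by blast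
  obtain R where R: "\<And>rt x. root_choice rt \<Longrightarrow> runs \<sigma> rt R (A x) (B (g rt x))" using assms(3) unfolding computable_def by blast
  show ?thesis
  proof (rule computableI[of "Cond Q P R"])
    fix rt x assume rt: "root_choice (rt :: 'a poly \<Rightarrow> 'a)"
    show "runs \<sigma> rt (Cond Q P R) (A x) (B (if b rt x then f rt x else g rt x))"
    proof (cases "b rt x")
      case True
      then show ?thesis using runs.cond_true[OF Q[OF rt] _ P[OF rt], of x] by (simp add: of_bool_tree_def)
    next
      case False
      then have "runs \<sigma> rt Q (A x) Leaf" using Q[OF rt, of x] by (simp add: of_bool_tree_def)
      then show ?thesis using False runs.cond_false[OF _ R[OF rt]] by simp
    qed
  qed
qed

text \<open>Trees without field elements are the constants of the language.\<close>

fun pure_tree :: "'a tree \<Rightarrow> bool" where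
  "pure_tree Leaf = True"
| "pure_tree (Elem a) = False"
| "pure_tree (Node s t) = (pure_tree s \<and> pure_tree t)"

lemma pure_tree_program: "pure_tree t \<Longrightarrow> \<exists>P. \<forall>rt s. runs \<sigma> rt P s t"
proof (induction t)
  case Leaf
  have "run_primitive \<sigma> rt Make_leaf s = Leaf" for rt and s :: "'a tree" by simp
  then show ?case using runs.prim[of \<sigma> _ Make_leaf] by metis
next
  case (Node t u)
  then obtain P R where "\<forall>rt s. runs \<sigma> rt P s t" "\<forall>rt s. runs \<sigma> rt R s u" by auto
  then show ?case using runs.fork by blast
qed simp

lemma c_const: "pure_tree (B c) \<Longrightarrow> computable A B (\<lambda>rt x. c)"
  using pure_tree_program unfolding computable_def by blast

lemma pure_eL: "(\<And>x. x \<in> set xs \<Longrightarrow> pure_tree (A x)) \<Longrightarrow> pure_tree (eL A xs)"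
  by (induction xs) auto

lemma pure_eN: "pure_tree (eN k)"
  unfolding tree_nat_def by (rule pure_eL) simp

lemma c_const_nat: "computable A eN (\<lambda>rt x. k)"
  by (rule c_const) (rule pure_eN)

lemma c_const_bool: "computable A eB (\<lambda>rt x. b)"
  by (rule c_const) (simp add: of_bool_tree_def)

lemma c_const_nats: "computable A (eL eN) (\<lambda>rt x. ks)"
  by (rule c_const) (intro pure_eL pure_eN)

lemma c_const_Nil: "computable A (eL B) (\<lambda>rt x. [])"
  by (rule c_const) simp

lemma c_zero: "computable A eE (\<lambda>rt x. 0)"
  by (rule c_prim[of Make_zero]) simp

lemma c_one: "computable A eE (\<lambda>rt x. 1)"
  by (rule c_prim[of Make_one]) simp

lemma c_add: "computable A eE f \<Longrightarrow> computable A eE g \<Longrightarrow> computable A eE (\<lambda>rt x. f rt x + g rt x)"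
  by (rule c_2[of eE eE _ "\<lambda>rt. (+)"]) (rule c_prim[of Add], simp add: eP_def)

lemma c_mult: "computable A eE f \<Longrightarrow> computable A eE g \<Longrightarrow> computable A eE (\<lambda>rt x. f rt x * g rt x)"
  by (rule c_2[of eE eE _ "\<lambda>rt a b. a * b"]) (rule c_prim[of Mult], simp add: eP_def)

lemma c_uminus: "computable A eE f \<Longrightarrow> computable A eE (\<lambda>rt x. - f rt x)"
  by (rule c_1[of eE _ "\<lambda>rt. uminus"]) (rule c_prim[of Neg], simp)

lemma c_inverse: "computable A eE f \<Longrightarrow> computable A eE (\<lambda>rt x. inverse (f rt x))"
  by (rule c_1[of eE _ "\<lambda>rt. inverse"]) (rule c_prim[of Inverse], simp)

lemma c_sigma: "computable A eE f \<Longrightarrow> computable A eE (\<lambda>rt x. \<sigma> (f rt x))"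
  by (rule c_1[of eE _ "\<lambda>rt. \<sigma>"]) (rule c_prim[of Sigma], simp)

lemma c_sigma_inv: "computable A eE f \<Longrightarrow> computable A eE (\<lambda>rt x. inv \<sigma> (f rt x))"
  by (rule c_1[of eE _ "\<lambda>rt. inv \<sigma>"]) (rule c_prim[of Sigma_inv], simp)

lemma c_is_zero: "computable A eE f \<Longrightarrow> computable A eB (\<lambda>rt x. f rt x = 0)"
  by (rule c_1[of eE _ "\<lambda>rt a. a = 0"]) (rule c_prim[of Is_zero], simp)

lemma c_not:
  assumes "computable A eB f"
  shows "computable A eB (\<lambda>rt x. \<not> f rt x)"
proof -
  have "(\<lambda>rt x. \<not> f rt x) = (\<lambda>rt x. if f rt x then False else True)" by (simp add: fun_eq_iff)
  then show ?thesis using c_if[OF assms c_const_bool[of A False] c_const_bool[of A True]] by simp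
qed

lemma c_and:
  assumes "computable A eB f" "computable A eB g"
  shows "computable A eB (\<lambda>rt x. f rt x \<and> g rt x)"
proof -
  have "(\<lambda>rt x. f rt x \<and> g rt x) = (\<lambda>rt x. if f rt x then g rt x else False)" by (simp add: fun_eq_iff)
  then show ?thesis using c_if[OF assms c_const_bool[of A False]] by simp
qed

lemma c_or:
  assumes "computable A eB f" "computable A eB g"
  shows "computable A eB (\<lambda>rt x. f rt x \<or> g rt x)"
proof -
  have "(\<lambda>rt x. f rt x \<or> g rt x) = (\<lambda>rt x. if f rt x then True else g rt x)" by (simp add: fun_eq_iff)
  then show ?thesis using c_if[OF assms(1) c_const_bool[of A True] assms(2)] by simp
qed

lemma c_eq_elem: "computable A eE f \<Longrightarrow> computable A eE g \<Longrightarrow> computable A eB (\<lambda>rt x. f rt x = g rt x)"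
  using c_is_zero[OF c_add[OF _ c_uminus], of A f g] by (simp add: add_eq_0_iff2)

lemma c_eq_bool: "computable A eB f \<Longrightarrow> computable A eB g \<Longrightarrow> computable A eB (\<lambda>rt x. f rt x = g rt x)"
proof -
  assume fg: "computable A eB f" "computable A eB g"
  have "(\<lambda>rt x. f rt x = g rt x) = (\<lambda>rt x. if f rt x then g rt x else \<not> g rt x)" by (simp add: fun_eq_iff)
  then show ?thesis using c_if[OF fg(1,2) c_not[OF fg(2)]] by simp
qed

lemma c_Cons: "computable A B f \<Longrightarrow> computable A (eL B) g \<Longrightarrow> computable A (eL B) (\<lambda>rt x. f rt x # g rt x)"
  by (rule c_2[of B "eL B" _ "\<lambda>rt. (#)"]) (rule computableI[of Skip], simp add: eP_def runs.skip)

lemma c_nonempty: "computable A (eL B) f \<Longrightarrow> computable A eB (\<lambda>rt x. f rt x \<noteq> [])"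
proof (rule c_1[of "eL B" eB "\<lambda>rt xs. xs \<noteq> []"])
  have "run_primitive \<sigma> rt Is_node (eL B xs) = eB (xs \<noteq> [])" for rt xs
    by (cases xs) (simp_all add: of_bool_tree_def)
  then show "computable (eL B) eB (\<lambda>rt xs. xs \<noteq> [])" by (rule c_prim)
qed

lemma c_is_Nil: "computable A (eL B) f \<Longrightarrow> computable A eB (\<lambda>rt x. f rt x = [])"
  using c_not[OF c_nonempty] by simp

lemma c_tl: "computable A (eL B) f \<Longrightarrow> computable A (eL B) (\<lambda>rt x. tl (f rt x))"
proof (rule c_1[of "eL B" "eL B" "\<lambda>rt. tl"])
  have "run_primitive \<sigma> rt Right (eL B xs) = eL B (tl xs)" for rt xs
    by (cases xs) simp_all
  then show "computable (eL B) (eL B) (\<lambda>rt. tl)" by (rule c_prim)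
qed

lemma c_head_or:
  assumes "computable A B d" "computable A (eL B) f"
  shows "computable A B (\<lambda>rt x. head_or (d rt x) (f rt x))"
proof (rule c_2[of B "eL B" _ "\<lambda>rt. head_or", OF _ assms])
  let ?P = "Cond (Seq (Prim Right) (Prim Is_node)) (Seq (Prim Right) (Prim Left)) (Prim Left)"
  show "computable (eP B (eL B)) B (\<lambda>rt z. head_or (fst z) (snd z))"
  proof (rule computableI[of ?P])
    fix rt and z :: "'c \<times> 'c list"
    have R: "runs \<sigma> rt (Prim Right) (eP B (eL B) z) (eL B (snd z))"
      using runs.prim[of \<sigma> rt Right "eP B (eL B) z"] by (simp add: eP_def)
    show "runs \<sigma> rt ?P (eP B (eL B) z) (B (head_or (fst z) (snd z)))"
    proof (cases "snd z")
      case Nil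
      have "runs \<sigma> rt (Seq (Prim Right) (Prim Is_node)) (eP B (eL B) z) Leaf"
        using runs.seq[OF R runs.prim[of \<sigma> rt Is_node]] Nil by simp
      moreover have "runs \<sigma> rt (Prim Left) (eP B (eL B) z) (B (head_or (fst z) (snd z)))"
        using runs.prim[of \<sigma> rt Left "eP B (eL B) z"] Nil by (simp add: eP_def head_or_def)
      ultimately show ?thesis by (rule runs.cond_false)
    next
      case (Cons y ys)
      have 1: "runs \<sigma> rt (Seq (Prim Right) (Prim Is_node)) (eP B (eL B) z) (Node Leaf Leaf)"
        using runs.seq[OF R runs.prim[of \<sigma> rt Is_node]] Cons by (simp add: of_bool_tree_def)
      have 2: "runs \<sigma> rt (Seq (Prim Right) (Prim Left)) (eP B (eL B) z) (B (head_or (fst z) (snd z)))"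
        using runs.seq[OF R runs.prim[of \<sigma> rt Left]] Cons by (simp add: head_or_def)
      show ?thesis by (rule runs.cond_true[OF 1 _ 2]) simp
    qed
  qed
qed

text \<open>The only source of loops besides the unbounded search. The loop carries the environment \<open>x\<close>, the accumulator
  and the remaining list.\<close>

lemma c_foldl:
  assumes l: "computable A (eL E) l" and i: "computable A B i"
    and s: "computable (eP A (eP B E)) B (\<lambda>rt z. s rt (fst z) (fst (snd z)) (snd (snd z)))"
  shows "computable A B (\<lambda>rt x. foldl (\<lambda>b e. s rt x b e) (i rt x) (l rt x))"
proof -
  obtain Pl where Pl: "\<And>rt x. root_choice rt \<Longrightarrow> runs \<sigma> rt Pl (A x) (eL E (l rt x))" using l unfolding computable_def by blast
  obtain Pi where Pi: "\<And>rt x. root_choice rt \<Longrightarrow> runs \<sigma> rt Pi (A x) (B (i rt x))" using i unfolding computable_def by blast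
  obtain Ps where Ps: "\<And>rt z. root_choice rt \<Longrightarrow> runs \<sigma> rt Ps (eP A (eP B E) z) (B (s rt (fst z) (fst (snd z)) (snd (snd z))))"
    using s unfolding computable_def by blast
  define L R where "L = Prim Left" and "R = Prim Right"
  define cond where "cond = Seq R (Seq R (Prim Is_node))"
  define body where "body = Fork L (Fork (Seq (Fork L (Fork (Seq R L) (Seq R (Seq R L)))) Ps) (Seq R (Seq R R)))"
  have L: "runs \<sigma> rt L (Node t u) t" and R: "runs \<sigma> rt R (Node t u) u" for rt t u
    using runs.prim[of \<sigma> rt Left "Node t u"] runs.prim[of \<sigma> rt Right "Node t u"] by (simp_all add: L_def R_def)
  have N: "runs \<sigma> rt (Prim Is_node) Leaf Leaf" "runs \<sigma> rt (Prim Is_node) (Node t u) (Node Leaf Leaf)" for rt t u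
    using runs.prim[of \<sigma> rt Is_node Leaf] runs.prim[of \<sigma> rt Is_node "Node t u"] by (simp_all add: of_bool_tree_def)
  have loop: "runs \<sigma> rt (While cond body) (Node (A x) (Node (B b) (eL E es))) (Node (A x) (Node (B (foldl (\<lambda>b e. s rt x b e) b es)) Leaf))"
    if rt: "root_choice rt" for rt x b es
  proof (induction es arbitrary: b)
    case Nil
    have "runs \<sigma> rt cond (Node (A x) (Node (B b) Leaf)) Leaf"
      unfolding cond_def by (intro runs.seq[OF R] N)
    from runs.while_false[OF this] show ?case by simp
  next
    case (Cons e es)
    have 1: "runs \<sigma> rt cond (Node (A x) (Node (B b) (eL E (e # es)))) (Node Leaf Leaf)"
      unfolding cond_def eL_Cons by (intro runs.seq[OF R] N)
    have "runs \<sigma> rt Ps (Node (A x) (Node (B b) (E e))) (B (s rt x b e))"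
      using Ps[OF rt, of "(x, b, e)"] by (simp add: eP_def)
    then have 2: "runs \<sigma> rt body (Node (A x) (Node (B b) (eL E (e # es)))) (Node (A x) (Node (B (s rt x b e)) (eL E es)))"
      unfolding body_def eL_Cons
      by (intro runs.fork L runs.seq[OF R] R) (rule runs.seq[rotated], assumption, intro runs.fork L runs.seq[OF R])
    show ?case using runs.while_true[OF 1 _ 2 Cons.IH] by simp
  qed
  show ?thesis
  proof (rule computableI[of "Seq (Fork Skip (Fork Pi Pl)) (Seq (While cond body) (Seq R L))"])
    fix rt x assume rt: "root_choice (rt :: 'a poly \<Rightarrow> 'a)"
    show "runs \<sigma> rt (Seq (Fork Skip (Fork Pi Pl)) (Seq (While cond body) (Seq R L))) (A x)
        (B (foldl (\<lambda>b e. s rt x b e) (i rt x) (l rt x)))"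
      by (rule runs.seq[OF runs.fork[OF runs.skip runs.fork[OF Pi[OF rt] Pl[OF rt]]] runs.seq[OF loop[OF rt] runs.seq[OF R L]]])
  qed
qed

named_theorems compute

lemmas [compute] = c_id c_Pair c_fst c_snd c_if c_const_nat c_const_bool c_const_nats c_const_Nil c_zero c_one
  c_add c_mult c_uminus c_inverse c_sigma c_sigma_inv c_not c_and c_or c_eq_elem c_eq_bool
  c_Cons c_is_Nil c_tl c_head_or c_foldl

lemma c_rev [compute]: "computable A (eL B) f \<Longrightarrow> computable A (eL B) (\<lambda>rt x. rev (f rt x))"
proof -
  assume f: "computable A (eL B) f"
  have eq: "rev xs = foldl (\<lambda>b e. e # b) [] xs" for xs :: "'c list"
    by (simp add: foldl_conv_fold rev_conv_fold)
  show ?thesis unfolding eq by (rule f compute)+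
qed

lemma c_map [compute]:
  assumes "computable A (eL E) l" "computable (eP A E) B (\<lambda>rt z. f rt (fst z) (snd z))"
  shows "computable A (eL B) (\<lambda>rt x. map (\<lambda>e. f rt x e) (l rt x))"
proof -
  have "foldl (\<lambda>b e. f rt x e # b) acc xs = rev (map (f rt x) xs) @ acc" for rt x xs acc
    by (induction xs arbitrary: acc) auto
  then have eq: "map (\<lambda>e. f rt x e) xs = rev (foldl (\<lambda>b e. f rt x e # b) [] xs)" for rt x xs by simp
  have f: "computable (eP A (eP (eL B) E)) B (\<lambda>rt z. f rt (fst z) (snd (snd z)))"
    by (rule c_2[OF assms(2)]) (rule compute)+
  show ?thesis unfolding eq by (rule assms(1) f compute)+
qed

lemma c_append [compute]:
  assumes "computable A (eL B) f" "computable A (eL B) g"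
  shows "computable A (eL B) (\<lambda>rt x. f rt x @ g rt x)"
proof -
  have "foldl (\<lambda>b e. e # b) ys (rev xs) = xs @ ys" for xs ys :: "'c list"
    by (simp add: foldl_conv_fold fold_Cons_rev)
  then have eq: "xs @ ys = foldl (\<lambda>b e. e # b) ys (rev xs)" for xs ys :: "'c list" by simp
  show ?thesis unfolding eq by (rule assms compute)+
qed

lemma c_concat [compute]:
  assumes "computable A (eL (eL B)) f"
  shows "computable A (eL B) (\<lambda>rt x. concat (f rt x))"
proof -
  have "foldl (@) acc xss = acc @ concat xss" for acc and xss :: "'c list list"
    by (induction xss arbitrary: acc) auto
  then have eq: "concat xss = foldl (\<lambda>b e. b @ e) [] xss" for xss :: "'c list list" by simp
  show ?thesis unfolding eq by (rule assms compute)+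
qed

lemma c_filter [compute]:
  assumes "computable A (eL E) l" "computable (eP A E) eB (\<lambda>rt z. f rt (fst z) (snd z))"
  shows "computable A (eL E) (\<lambda>rt x. filter (\<lambda>e. f rt x e) (l rt x))"
proof -
  have eq: "filter (\<lambda>e. f rt x e) xs = concat (map (\<lambda>e. if f rt x e then [e] else []) xs)" for rt x xs
    by (induction xs) auto
  show ?thesis unfolding eq by (rule assms compute)+
qed

lemma c_list_all [compute]:
  assumes "computable A (eL E) l" "computable (eP A E) eB (\<lambda>rt z. f rt (fst z) (snd z))"
  shows "computable A eB (\<lambda>rt x. list_all (\<lambda>e. f rt x e) (l rt x))"
proof -
  have eq: "list_all (\<lambda>e. f rt x e) xs = (filter (\<lambda>e. \<not> f rt x e) xs = [])" for rt x xs
    by (induction xs) auto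
  show ?thesis unfolding eq by (rule assms compute)+
qed

lemma c_list_ex [compute]:
  assumes "computable A (eL E) l" "computable (eP A E) eB (\<lambda>rt z. f rt (fst z) (snd z))"
  shows "computable A eB (\<lambda>rt x. list_ex (\<lambda>e. f rt x e) (l rt x))"
proof -
  have eq: "list_ex (\<lambda>e. f rt x e) xs = (\<not> (filter (\<lambda>e. f rt x e) xs = []))" for rt x xs
    by (induction xs) auto
  show ?thesis unfolding eq by (rule assms compute)+
qed

lemma c_sorted_wrt [compute]:
  assumes "computable A (eL E) l" "computable (eP A (eP E E)) eB (\<lambda>rt z. f rt (fst z) (fst (snd z)) (snd (snd z)))"
  shows "computable A eB (\<lambda>rt x. sorted_wrt (\<lambda>g h. f rt x g h) (l rt x))"
proof -
  have "foldl (\<lambda>b e. (fst b \<and> list_all (\<lambda>h. f rt x h e) (snd b), e # snd b)) (True, []) xs =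
      (sorted_wrt (\<lambda>g h. f rt x g h) xs, rev xs)" for rt x xs
    by (induction xs rule: rev_induct) (auto simp: sorted_wrt_append list_all_iff)
  then have eq: "sorted_wrt (\<lambda>g h. f rt x g h) xs =
      fst (foldl (\<lambda>b e. (fst b \<and> list_all (\<lambda>h. f rt x h e) (snd b), e # snd b)) (True, []) xs)" for rt x xs
    by simp
  have f: "computable (eP (eP A (eP (eP eB (eL E)) E)) E) eB (\<lambda>rt z. f rt (fst (fst z)) (snd z) (snd (snd (fst z))))"
    by (rule c_3[OF assms(2)]) (rule compute)+
  show ?thesis unfolding eq by (rule assms(1) f compute)+
qed

subsection \<open>Arithmetic\<close>

text \<open>Numbers are encoded in unary, as lists of leaves, so that iteration is a special case of \<open>c_foldl\<close>.\<close>

lemma eN_unit: "eN k = eL (\<lambda>u :: unit. Leaf) (replicate k ())"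
proof -
  have "eL (\<lambda>u. Leaf) xs = eL (\<lambda>u :: unit. Leaf) (replicate (length xs) ())" for xs :: "nat list"
    by (induction xs) auto
  from this[of "[0..<k]"] show ?thesis by (simp add: tree_nat_def)
qed

lemma c_funpow [compute]:
  assumes "computable A eN k" "computable A B i" "computable (eP A B) B (\<lambda>rt z. s rt (fst z) (snd z))"
  shows "computable A B (\<lambda>rt x. ((\<lambda>b. s rt x b) ^^ k rt x) (i rt x))"
proof -
  have eq: "((\<lambda>b. s rt x b) ^^ m) a = foldl (\<lambda>b e. s rt x b) a (replicate m ())" for rt x m a
    by (induction m arbitrary: a) (simp_all add: funpow_swap1 del: funpow.simps(2) add: funpow_Suc_right)
  have k: "computable A (eL (\<lambda>u :: unit. Leaf)) (\<lambda>rt x. replicate (k rt x) ())"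
    using assms(1) by (simp add: computable_def eN_unit)
  have s: "computable (eP A (eP B (\<lambda>u :: unit. Leaf))) B (\<lambda>rt z. s rt (fst z) (fst (snd z)))"
    by (rule c_2[OF assms(3)]) (rule compute)+
  show ?thesis unfolding eq by (rule k s assms(2) compute)+
qed

lemma c_Suc [compute]: "computable A eN f \<Longrightarrow> computable A eN (\<lambda>rt x. Suc (f rt x))"
proof -
  assume f: "computable A eN f"
  have "computable A (eL (\<lambda>u :: unit. Leaf)) (\<lambda>rt x. () # replicate (f rt x) ())"
    by (intro c_Cons c_const) (use f in \<open>simp_all add: computable_def eN_unit\<close>)
  then show ?thesis by (simp add: computable_def eN_unit)
qed

lemma c_pred: "computable A eN f \<Longrightarrow> computable A eN (\<lambda>rt x. f rt x - 1)"
proof -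
  assume f: "computable A eN f"
  have "computable A (eL (\<lambda>u :: unit. Leaf)) (\<lambda>rt x. tl (replicate (f rt x) ()))"
    by (intro c_tl) (use f in \<open>simp add: computable_def eN_unit\<close>)
  then show ?thesis by (simp add: computable_def eN_unit)
qed

lemma c_is_zero_nat: "computable A eN f \<Longrightarrow> computable A eB (\<lambda>rt x. f rt x = 0)"
proof -
  assume f: "computable A eN f"
  have "computable A eB (\<lambda>rt x. replicate (f rt x) () = [])"
    by (intro c_is_Nil[where B = "\<lambda>u. Leaf"]) (use f in \<open>simp add: computable_def eN_unit\<close>)
  then show ?thesis by simp
qed

lemma c_add_nat [compute]: "computable A eN f \<Longrightarrow> computable A eN g \<Longrightarrow> computable A eN (\<lambda>rt x. f rt x + g rt x)"
proof -
  assume fg: "computable A eN f" "computable A eN g"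
  have eq: "m + n = ((\<lambda>b. Suc b) ^^ m) n" for m n by (induction m) auto
  show ?thesis unfolding eq by (rule fg compute)+
qed

lemma c_diff_nat [compute]: "computable A eN f \<Longrightarrow> computable A eN g \<Longrightarrow> computable A eN (\<lambda>rt x. f rt x - g rt x)"
proof -
  assume fg: "computable A eN f" "computable A eN g"
  have "((\<lambda>b. b - 1) ^^ n) m = m - n" for m n :: nat by (induction n) auto
  then have eq: "(\<lambda>rt x. f rt x - g rt x) = (\<lambda>rt x. ((\<lambda>b. b - 1) ^^ g rt x) (f rt x))" by simp
  show ?thesis unfolding eq by (rule fg c_funpow c_pred compute)+
qed

lemma c_mult_nat [compute]: "computable A eN f \<Longrightarrow> computable A eN g \<Longrightarrow> computable A eN (\<lambda>rt x. f rt x * g rt x)"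
proof -
  assume fg: "computable A eN f" "computable A eN g"
  have "((\<lambda>b. n + b) ^^ m) 0 = m * n" for m n :: nat by (induction m) auto
  then have eq: "m * n = ((\<lambda>b. n + b) ^^ m) 0" for m n :: nat by simp
  show ?thesis unfolding eq by (rule fg c_1[OF fg(2)] compute)+
qed

lemma c_le_nat [compute]: "computable A eN f \<Longrightarrow> computable A eN g \<Longrightarrow> computable A eB (\<lambda>rt x. f rt x \<le> g rt x)"
  using c_is_zero_nat[OF c_diff_nat, of A f g] by simp

lemma c_less_nat [compute]: "computable A eN f \<Longrightarrow> computable A eN g \<Longrightarrow> computable A eB (\<lambda>rt x. f rt x < g rt x)"
  using c_not[OF c_le_nat, of A g f] by (simp add: not_le)

lemma c_eq_nat [compute]: "computable A eN f \<Longrightarrow> computable A eN g \<Longrightarrow> computable A eB (\<lambda>rt x. f rt x = g rt x)"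
  using c_and[OF c_le_nat c_le_nat, of A f g g f] by (simp add: eq_iff)

lemma c_length [compute]: "computable A (eL B) f \<Longrightarrow> computable A eN (\<lambda>rt x. length (f rt x))"
proof -
  assume f: "computable A (eL B) f"
  have "foldl (\<lambda>b e. Suc b) k xs = k + length xs" for k and xs :: "'c list" by (induction xs arbitrary: k) auto
  then have eq: "length xs = foldl (\<lambda>b e. Suc b) 0 xs" for xs :: "'c list" by simp
  show ?thesis unfolding eq by (rule f compute)+
qed

lemma c_replicate [compute]:
  assumes "computable A eN k" "computable A B f"
  shows "computable A (eL B) (\<lambda>rt x. replicate (k rt x) (f rt x))"
proof -
  have eq: "replicate k a = ((\<lambda>b. a # b) ^^ k) []" for k and a :: 'c by (induction k) auto
  show ?thesis unfolding eq by (rule assms(1) c_1[OF assms(2)] compute)+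
qed

lemma c_drop: "computable A (eL B) f \<Longrightarrow> computable A eN k \<Longrightarrow> computable A (eL B) (\<lambda>rt x. drop (k rt x) (f rt x))"
proof -
  assume fk: "computable A (eL B) f" "computable A eN k"
  have "(tl ^^ k) xs = drop k xs" for k and xs :: "'c list" by (induction k arbitrary: xs) (simp_all add: drop_Suc funpow_Suc_right del: funpow.simps(2))
  then have eq: "drop k xs = ((\<lambda>b. tl b) ^^ k) xs" for k and xs :: "'c list" by simp
  show ?thesis unfolding eq by (rule fk compute)+
qed

lemma c_eq_var [compute]:
  assumes "computable A (eP eN eN) f" "computable A (eP eN eN) g"
  shows "computable A eB (\<lambda>rt x. f rt x = g rt x)"
  unfolding prod_eq_iff by (rule assms compute)+

lemma c_less_var [compute]:
  assumes "computable A (eP eN eN) f" "computable A (eP eN eN) g"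
  shows "computable A eB (\<lambda>rt x. f rt x < g rt x)"
  unfolding less_prod_def' by (rule assms compute)+

lemma c_root:
  assumes "computable A (eL eE) f"
  shows "computable A eE (\<lambda>rt x. poly_root rt (f rt x))"
proof (rule c_1[of "eL eE" eE poly_root, OF _ assms])
  have elems: "elems (eL eE cs) = cs" for cs :: "'a list" by (induction cs) auto
  show "computable (eL eE) eE poly_root"
  proof (rule computableI[of "Cond (Prim Root) (Prim Root) (Prim Make_zero)"])
    fix rt and cs :: "'a list"
    have R: "runs \<sigma> rt (Prim Root) (eL eE cs) (if degree (Poly cs) > 0 then Elem (rt (Poly cs)) else Leaf)"
      using runs.prim[of \<sigma> rt Root "eL eE cs"] by (simp only: run_primitive.simps elems)
    have Z: "runs \<sigma> rt (Prim Make_zero) (eL eE cs) (Elem 0)"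
      using runs.prim[of \<sigma> rt Make_zero "eL eE cs"] by simp
    show "runs \<sigma> rt (Cond (Prim Root) (Prim Root) (Prim Make_zero)) (eL eE cs) (Elem (poly_root rt cs))"
    proof (cases "degree (Poly cs) > 0")
      case True
      then have "runs \<sigma> rt (Prim Root) (eL eE cs) (Elem (rt (Poly cs)))" using R by simp
      from runs.cond_true[OF this _ this] show ?thesis using True by (simp add: poly_root_def)
    next
      case False
      then have "runs \<sigma> rt (Prim Root) (eL eE cs) Leaf" using R by simp
      from runs.cond_false[OF this Z] show ?thesis using False by (simp add: poly_root_def)
    qed
  qed
qed

subsection \<open>Enumerations and unbounded search\<close>

definition enumerates :: "('x \<Rightarrow> 'a tree) \<Rightarrow> (nat \<Rightarrow> 'x) \<Rightarrow> bool" where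
  "enumerates A d \<longleftrightarrow> computable eN A (\<lambda>rt k. d k) \<and> surj d"

text \<open>The enumeration of pairs along antidiagonals, as an iteration.\<close>

definition diagonal :: "nat \<Rightarrow> nat \<times> nat" where
  "diagonal k = ((\<lambda>p. if snd p = 0 then (0, Suc (fst p)) else (Suc (fst p), snd p - 1)) ^^ k) (0, 0)"

lemma diagonal_Suc: "diagonal (Suc k) = (if snd (diagonal k) = 0 then (0, Suc (fst (diagonal k))) else (Suc (fst (diagonal k)), snd (diagonal k) - 1))"
  by (simp add: diagonal_def)

lemma surj_diagonal: "surj diagonal"
proof -
  have row: "\<exists>k. diagonal k = (a, s - a)" if "\<exists>k. diagonal k = (0, s)" "a \<le> s" for a s
    using that(2)
  proof (induction a)
    case (Suc a)
    then obtain k where "diagonal k = (a, s - a)" by auto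
    then show ?case using Suc.prems by (intro exI[of _ "Suc k"]) (simp add: diagonal_Suc)
  qed (use that in simp)
  have start: "\<exists>k. diagonal k = (0, s)" for s
  proof (induction s)
    case 0
    show ?case by (rule exI[of _ 0]) (simp add: diagonal_def)
  next
    case (Suc s)
    obtain k where "diagonal k = (s, 0)" using row[OF Suc, of s] by auto
    then show ?case by (intro exI[of _ "Suc k"]) (simp add: diagonal_Suc)
  qed
  have "\<exists>k. p = diagonal k" for p
    using row[OF start, of "fst p" "fst p + snd p"] by (metis add_diff_cancel_left' le_add1 prod.collapse)
  then show ?thesis unfolding surj_def by blast
qed

lemma c_diagonal [compute]:
  assumes "computable A eN f"
  shows "computable A (eP eN eN) (\<lambda>rt x. diagonal (f rt x))"
  unfolding diagonal_def by (rule assms c_is_zero_nat c_pred compute)+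

lemma enum_nat: "enumerates eN (\<lambda>k. k)"
  by (simp add: enumerates_def c_id)

lemma enum_bool: "enumerates eB (\<lambda>k. k = 0)"
  unfolding enumerates_def surj_def
proof (intro conjI allI)
  show "computable eN eB (\<lambda>rt k. k = 0)" by (rule compute)+
  show "\<exists>k. b = (k = (0::nat))" for b by (cases b) auto
qed

lemma enum_pair:
  assumes "enumerates A d" "enumerates B e"
  shows "enumerates (eP A B) (\<lambda>k. (d (fst (diagonal k)), e (snd (diagonal k))))"
  unfolding enumerates_def surj_def
proof (intro conjI allI)
  have d: "computable eN A (\<lambda>rt k. d k)" "computable eN B (\<lambda>rt k. e k)" using assms by (simp_all add: enumerates_def)
  show "computable eN (eP A B) (\<lambda>rt k. (d (fst (diagonal k)), e (snd (diagonal k))))"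
    by (rule c_Pair c_1[OF d(1)] c_1[OF d(2)] compute)+
  fix p :: "'b \<times> 'c"
  obtain i where i: "d i = fst p" using assms(1) unfolding enumerates_def surj_def by metis
  obtain j where j: "e j = snd p" using assms(2) unfolding enumerates_def surj_def by metis
  obtain k where "diagonal k = (i, j)" using surj_diagonal unfolding surj_def by metis
  then show "\<exists>k. p = (d (fst (diagonal k)), e (snd (diagonal k)))"
    using i j by (intro exI[of _ k]) simp
qed

text \<open>A number codes a length and a seed, from which the elements of the list are unpacked one after the other.\<close>

lemma enum_list:
  assumes "enumerates A d"
  shows "\<exists>e. enumerates (eL A) e"
proof -
  define step where "step s = (snd (diagonal (fst s)), d (fst (diagonal (fst s))) # snd s)" for s :: "nat \<times> 'b list"
  define e where "e k = snd ((step ^^ fst (diagonal k)) (snd (diagonal k), []))" for k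
  have d: "computable eN A (\<lambda>rt k. d k)" using assms by (simp add: enumerates_def)
  have "computable eN (eL A) (\<lambda>rt k. e k)"
    unfolding e_def step_def by (rule c_1[OF d] compute)+
  moreover have "surj e"
  proof -
    have build: "\<exists>c. snd ((step ^^ length xs) (c, acc)) = rev xs @ acc" for xs acc
    proof (induction xs arbitrary: acc)
      case (Cons x xs)
      obtain c where c: "snd ((step ^^ length xs) (c, x # acc)) = rev xs @ x # acc" using Cons by blast
      obtain i where i: "d i = x" using assms unfolding enumerates_def surj_def by metis
      obtain k where k: "diagonal k = (i, c)" using surj_diagonal unfolding surj_def by metis
      have "step (k, acc) = (c, x # acc)" by (simp add: step_def k i)
      then show ?case using c by (intro exI[of _ k]) (simp add: funpow_swap1)
    qed simp
    have "\<exists>k. xs = e k" for xs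
    proof -
      obtain c where c: "snd ((step ^^ length (rev xs)) (c, [])) = rev (rev xs) @ []" using build by blast
      obtain k where "diagonal k = (length xs, c)" using surj_diagonal unfolding surj_def by metis
      then show ?thesis using c by (intro exI[of _ k]) (simp add: e_def)
    qed
    then show ?thesis unfolding surj_def by blast
  qed
  ultimately show ?thesis by (auto simp: enumerates_def)
qed

text \<open>The loop tries all numbers and hence terminates on inputs for which a witness exists.\<close>

lemma search:
  assumes d: "enumerates C d" and chk: "computable (eP A C) eB (\<lambda>rt z. chk (fst z) (snd z))"
  shows "\<exists>P. \<forall>rt. root_choice rt \<longrightarrow> (\<forall>x. (\<exists>c. chk x c) \<longrightarrow> (\<exists>c. chk x c \<and> runs \<sigma> rt P (A x) (eP A C (x, c))))"
proof -
  have dc: "computable eN C (\<lambda>rt k. d k)" using d by (simp add: enumerates_def)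
  have "computable (eP A eN) eB (\<lambda>rt z. \<not> chk (fst z) (d (snd z)))"
    by (rule c_not c_2[OF chk] c_1[OF dc] compute)+
  then obtain Pc where Pc: "\<And>rt z. root_choice rt \<Longrightarrow> runs \<sigma> rt Pc (eP A eN z) (eB (\<not> chk (fst z) (d (snd z))))"
    unfolding computable_def by blast
  have "computable (eP A eN) (eP A eN) (\<lambda>rt z. (fst z, Suc (snd z)))" by (rule compute)+
  then obtain Pn where Pn: "\<And>rt z. root_choice rt \<Longrightarrow> runs \<sigma> rt Pn (eP A eN z) (eP A eN (fst z, Suc (snd z)))"
    unfolding computable_def by blast
  have "computable A (eP A eN) (\<lambda>rt x. (x, 0))" by (rule compute)+
  then obtain Pi where Pi: "\<And>rt x. root_choice rt \<Longrightarrow> runs \<sigma> rt Pi (A x) (eP A eN (x, 0))"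
    unfolding computable_def by blast
  have "computable (eP A eN) (eP A C) (\<lambda>rt z. (fst z, d (snd z)))" by (rule c_1[OF dc] compute)+
  then obtain Po where Po: "\<And>rt z. root_choice rt \<Longrightarrow> runs \<sigma> rt Po (eP A eN z) (eP A C (fst z, d (snd z)))"
    unfolding computable_def by blast
  show ?thesis
  proof (intro exI[of _ "Seq Pi (Seq (While Pc Pn) Po)"] allI impI)
    fix rt :: "'a poly \<Rightarrow> 'a" and x assume rt: "root_choice rt" and ex: "\<exists>c. chk x c"
    then have "\<exists>k. chk x (d k)" using d unfolding enumerates_def surj_def by metis
    define k where "k = (LEAST k. chk x (d k))"
    have k: "chk x (d k)" "\<And>j. j < k \<Longrightarrow> \<not> chk x (d j)"
      unfolding k_def using LeastI_ex[OF \<open>\<exists>k. chk x (d k)\<close>] not_less_Least by blast+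
    have "runs \<sigma> rt (While Pc Pn) (eP A eN (x, j)) (eP A eN (x, k))" if "j \<le> k" for j
      using that
    proof (induction "k - j" arbitrary: j)
      case 0
      then have "j = k" by simp
      have "runs \<sigma> rt Pc (eP A eN (x, k)) Leaf" using Pc[OF rt, of "(x, k)"] k(1) by (simp add: of_bool_tree_def)
      from runs.while_false[OF this] show ?case by (simp add: \<open>j = k\<close>)
    next
      case (Suc i)
      then have j: "j < k" by simp
      have 1: "runs \<sigma> rt Pc (eP A eN (x, j)) (Node Leaf Leaf)"
        using Pc[OF rt, of "(x, j)"] k(2)[OF j] by (simp add: of_bool_tree_def)
      have 2: "runs \<sigma> rt Pn (eP A eN (x, j)) (eP A eN (x, Suc j))" using Pn[OF rt, of "(x, j)"] by simp
      have 3: "runs \<sigma> rt (While Pc Pn) (eP A eN (x, Suc j)) (eP A eN (x, k))"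
        by (rule Suc(1)) (use Suc(2) j in simp_all)
      show ?case by (rule runs.while_true[OF 1 _ 2 3]) simp
    qed
    from this[of 0] have "runs \<sigma> rt (While Pc Pn) (eP A eN (x, 0)) (eP A eN (x, k))" by simp
    then have "runs \<sigma> rt (Seq Pi (Seq (While Pc Pn) Po)) (A x) (eP A C (x, d k))"
      using runs.seq[OF Pi[OF rt] runs.seq[OF _ Po[OF rt, of "(x, k)"]]] by simp
    then show "\<exists>c. chk x c \<and> runs \<sigma> rt (Seq Pi (Seq (While Pc Pn) Po)) (A x) (eP A C (x, c))"
      using k(1) by blast
  qed
qed

end

context computation
begin

subsection \<open>The decomposition as a program\<close>

abbreviation "eV \<equiv> eP eN eN"
abbreviation "eW \<equiv> eL (eP eB eV)"
abbreviation "eG \<equiv> eP eV (eP eN eW)"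
abbreviation "eQ \<equiv> eP eN (eP eN eW)"
abbreviation "eC \<equiv> eP (eL eG) (eP (eL eG) (eP (eL eW) (eL eQ)))"
abbreviation "eF \<equiv> eL (eP eW eE)"
abbreviation "eT \<equiv> eP eE (eL (eP eV eN))"

lemma c_const_natss: "computable A (eL (eL eN)) (\<lambda>rt x. Ss)"
  by (rule c_const) (intro pure_eL pure_eN)

lemmas [compute] = c_const_natss c_drop c_root c_Suc

lemma generator_at_head_or: "generator_at F i = head_or ([], 1) (drop i F)"
  by (simp add: generator_at_def head_or_def hd_drop_conv_nth)

text \<open>Each function is computable by its definition; its rule is then available for the functions below.\<close>

lemma occurrences_base: "computable (eP eB (eP eV eW)) eN (\<lambda>rt z. occurrences (fst z) (fst (snd z)) (snd (snd z)))"
  unfolding occurrences_def by (rule compute)+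

lemmas [compute] = c_3[OF occurrences_base]

lemma neg_word_base: "computable eW eW (\<lambda>rt z. neg_word z)"
  unfolding neg_word_def by (rule compute)+

lemmas [compute] = c_1[OF neg_word_base]

lemma sign_word_base: "computable (eP eB eW) eW (\<lambda>rt z. sign_word (fst z) (snd z))"
  unfolding sign_word_def by (rule compute)+

lemmas [compute] = c_2[OF sign_word_base]

lemma shift_word_base: "computable (eP eN eW) eW (\<lambda>rt z. shift_word (fst z) (snd z))"
  unfolding shift_word_def by (rule compute)+

lemmas [compute] = c_2[OF shift_word_base]

lemma raise_word_base: "computable eW eW (\<lambda>rt z. raise_word n z)"
  unfolding raise_word_def by (rule compute)+

lemmas [compute] = c_1[OF raise_word_base]

lemma null_word_base: "computable eW eB (\<lambda>rt z. null_word z)"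
  unfolding null_word_def by (rule compute)+

lemmas [compute] = c_1[OF null_word_base]

lemma same_vector_base: "computable (eP eW eW) eB (\<lambda>rt z. same_vector (fst z) (snd z))"
  unfolding same_vector_def by (rule compute)+

lemmas [compute] = c_2[OF same_vector_base]

lemma matches_base: "computable (eP eG eV) eB (\<lambda>rt z. matches (fst z) (snd z))"
  unfolding matches_def by (rule compute)+

lemmas [compute] = c_2[OF matches_base]

lemma has_lead_base: "computable (eP (eL eG) eV) eB (\<lambda>rt z. has_lead (fst z) (snd z))"
  unfolding has_lead_def by (rule compute)+

lemmas [compute] = c_2[OF has_lead_base]

lemma entry_word_base: "computable eG eW (\<lambda>rt z. entry_word z)"
  unfolding entry_word_def by (rule compute)+

lemmas [compute] = c_1[OF entry_word_base]

lemma basis_word_base: "computable (eP (eL eG) eV) eW (\<lambda>rt z. basis_word (fst z) (snd z))"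
  unfolding basis_word_def by (rule compute)+

lemmas [compute] = c_2[OF basis_word_base]

lemma combination_base: "computable (eP (eL eG) eW) eW (\<lambda>rt z. combination (fst z) (snd z))"
  unfolding combination_def by (rule compute)+

lemmas [compute] = c_2[OF combination_base]

lemma span_ok_base: "computable (eP (eL eG) (eP eW eW)) eB (\<lambda>rt z. span_ok (fst z) (fst (snd z)) (snd (snd z)))"
  unfolding span_ok_def by (rule compute)+

lemmas [compute] = c_3[OF span_ok_base]

lemma in_span_base: "computable (eP (eL eG) (eP (eL eW) eW)) eB (\<lambda>rt z. in_span (fst z) (fst (snd z)) (snd (snd z)))"
  unfolding in_span_def by (rule compute)+

lemmas [compute] = c_3[OF in_span_base]

lemma entry_ok_base: "computable eG eB (\<lambda>rt z. entry_ok n z)"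
  unfolding entry_ok_def by (rule compute)+

lemmas [compute] = c_1[OF entry_ok_base]

lemma reduced_ok_base: "computable (eP eG eG) eB (\<lambda>rt z. reduced_ok (fst z) (snd z))"
  unfolding reduced_ok_def by (rule compute)+

lemmas [compute] = c_2[OF reduced_ok_base]

lemma prev_var_base: "computable eV eV (\<lambda>rt z. prev_var z)"
  unfolding prev_var_def by (rule compute)+

lemmas [compute] = c_1[OF prev_var_base]

lemma boundary_ok_base: "computable (eP (eL eG) (eP (eL eW) eG)) eB (\<lambda>rt z. boundary_ok (fst z) (fst (snd z)) (snd (snd z)))"
  unfolding boundary_ok_def by (rule compute)+

lemmas [compute] = c_3[OF boundary_ok_base]

lemma gb_ok_base: "computable (eP (eL eG) (eL eW)) eB (\<lambda>rt z. gb_ok n (fst z) (snd z))"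
  unfolding gb_ok_def by (rule compute)+

lemmas [compute] = c_2[OF gb_ok_base]

lemma lead_product_base: "computable (eL eG) eN (\<lambda>rt z. lead_product z)"
  unfolding lead_product_def by (rule compute)+

lemmas [compute] = c_1[OF lead_product_base]

lemma graph_generator_base: "computable (eP eN eN) eW (\<lambda>rt z. graph_generator n (fst z) (snd z))"
  unfolding graph_generator_def by (rule compute)+

lemmas [compute] = c_2[OF graph_generator_base]

lemma sat_ok_base: "computable (eP (eL eG) (eP (eL eG) (eL eW))) eB (\<lambda>rt z. sat_ok n (fst z) (fst (snd z)) (snd (snd z)))"
  unfolding sat_ok_def by (rule compute)+

lemmas [compute] = c_3[OF sat_ok_base]

lemma generator_at_base: "computable (eP eF eN) (eP eW eE) (\<lambda>rt z. generator_at (fst z) (snd z))"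
  unfolding generator_at_head_or by (rule compute)+

lemmas [compute] = c_2[OF generator_at_base]

lemma generator_combination_base: "computable (eP eF eW) eW (\<lambda>rt z. generator_combination (fst z) (snd z))"
  unfolding generator_combination_def by (rule compute)+

lemmas [compute] = c_2[OF generator_combination_base]

lemma pow_ok_base: "computable (eP eF (eP eG eQ)) eB (\<lambda>rt z. pow_ok (fst z) (fst (snd z)) (snd (snd z)))"
  unfolding pow_ok_def by (rule compute)+

lemmas [compute] = c_3[OF pow_ok_base]

lemma check_base: "computable (eP eF eC) eB (\<lambda>rt z. check n (fst z) (snd z))"
  unfolding check_def by (rule compute)+

lemmas [compute] = c_2[OF check_base]

lemma signed_base: "computable (eP eB eE) eE (\<lambda>rt z. signed (fst z) (snd z))"
  unfolding signed_def by (rule compute)+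

lemmas [compute] = c_2[OF signed_base]

lemma basis_value_base: "computable (eP (eL (eP eG eE)) eV) eE (\<lambda>rt z. basis_value \<sigma> (fst z) (snd z))"
  unfolding basis_value_def by (rule compute)+

lemmas [compute] = c_2[OF basis_value_base]

lemma combination_value_base: "computable (eP (eL (eP eG eE)) eW) eE (\<lambda>rt z. combination_value \<sigma> (fst z) (snd z))"
  unfolding combination_value_def by (rule compute)+

lemmas [compute] = c_2[OF combination_value_base]

lemma generator_value_base: "computable (eP eF eW) eE (\<lambda>rt z. generator_value \<sigma> (fst z) (snd z))"
  unfolding generator_value_def by (rule compute)+

lemmas [compute] = c_2[OF generator_value_base]

lemma consistent_base: "computable (eP eF (eP (eL eW) (eL (eP eG eE)))) eB (\<lambda>rt z. consistent \<sigma> (fst z) (fst (snd z)) (snd (snd z)))"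
  unfolding consistent_def by (rule compute)+

lemmas [compute] = c_3[OF consistent_base]

lemma in_positions_base: "computable (eP (eL eN) eN) eB (\<lambda>rt z. in_positions (fst z) (snd z))"
  unfolding in_positions_def by (rule compute)+

lemmas [compute] = c_2[OF in_positions_base]

lemma entry_poly_base: "computable (eP (eL eN) (eP eG eE)) (eL eT) (\<lambda>rt z. entry_poly (fst z) (snd z))"
  unfolding entry_poly_def by (rule compute)+

lemmas [compute] = c_2[OF entry_poly_base]

lemma horner_base: "computable (eP eE (eL eE)) (eL eE) (\<lambda>rt z. horner (fst z) (snd z))"
  unfolding horner_def foldr_conv_foldl by (rule compute)+

lemmas [compute] = c_2[OF horner_base]

lemma root_step_base: "computable (eP (eL eE) (eL eE)) (eP (eL eE) (eL eE)) (\<lambda>rt z. root_step rt z)"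
  unfolding root_step_def by (rule compute)+

lemmas [compute] = c_1[OF root_step_base]

lemma nth_roots_base: "computable (eP eN eE) (eL eE) (\<lambda>rt z. nth_roots rt (fst z) (snd z))"
  unfolding nth_roots_def by (rule compute)+

lemmas [compute] = c_2[OF nth_roots_base]

lemma root_candidates_base: "computable (eP eF (eP (eL eQ) eG)) (eL eE) (\<lambda>rt z. root_candidates \<sigma> rt (fst z) (fst (snd z)) (snd (snd z)))"
  unfolding root_candidates_def by (rule compute)+

lemmas [compute] = c_3[OF root_candidates_base]

lemma solutions_base: "computable (eP eF eC) (eL (eL (eP eG eE))) (\<lambda>rt z. solutions \<sigma> rt (fst z) (snd z))"
  unfolding solutions_def tuples_def by (rule compute)+

lemmas [compute] = c_2[OF solutions_base]

lemma expand_base: "computable eT (eL eV) (\<lambda>rt z. expand z)"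
  unfolding expand_def by (rule compute)+

lemmas [compute] = c_1[OF expand_base]

lemma multiplicity_in_base: "computable (eP eV (eL eV)) eN (\<lambda>rt z. multiplicity_in (fst z) (snd z))"
  unfolding multiplicity_in_def by (rule compute)+

lemmas [compute] = c_2[OF multiplicity_in_base]

lemma same_mono_base: "computable (eP (eL eV) (eL eV)) eB (\<lambda>rt z. same_mono (fst z) (snd z))"
  unfolding same_mono_def by (rule compute)+

lemmas [compute] = c_2[OF same_mono_base]

lemma avoids_listed_base: "computable (eP (eL eN) eT) eB (\<lambda>rt z. avoids_listed (fst z) (snd z))"
  unfolding avoids_listed_def by (rule compute)+

lemmas [compute] = c_2[OF avoids_listed_base]

lemma coef_of_base: "computable (eP (eL eT) (eL eV)) eE (\<lambda>rt z. coef_of (fst z) (snd z))"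
  unfolding coef_of_def by (rule compute)+

lemmas [compute] = c_2[OF coef_of_base]

lemma surviving_base: "computable (eL eT) (eL eT) (\<lambda>rt z. surviving z)"
  unfolding surviving_def by (rule compute)+

lemmas [compute] = c_1[OF surviving_base]

lemma other_terms_base: "computable (eL eT) (eL eT) (\<lambda>rt z. other_terms z)"
  unfolding other_terms_def by (rule compute)+

lemmas [compute] = c_1[OF other_terms_base]

lemma parse_terms_base: "computable (eL eT) eF (\<lambda>rt z. parse_terms z)"
  unfolding parse_terms_def by (rule compute)+

lemmas [compute] = c_1[OF parse_terms_base]

lemma parse_base: "computable (eP (eL eN) (eL eT)) eF (\<lambda>rt z. parse (fst z) (snd z))"
  unfolding parse_def by (rule compute)+

lemmas [compute] = c_2[OF parse_base]

lemma system_base: "computable (eP (eL eN) (eL (eL eT))) eF (\<lambda>rt z. system (fst z) (snd z))"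
  unfolding system_def by (rule compute)+

lemmas [compute] = c_2[OF system_base]

lemma solvable_base: "computable (eP (eL eN) (eL (eL eT))) eB (\<lambda>rt z. solvable (fst z) (snd z))"
  unfolding solvable_def by (rule compute)+

lemmas [compute] = c_2[OF solvable_base]

lemma all_chains_base: "computable (eP (eL (eL eT)) (eL eC)) (eL (eL (eL eT))) (\<lambda>rt z. all_chains \<sigma> rt n Ss z)"
  unfolding all_chains_def by (rule compute)+

lemmas [compute] = c_1[OF all_chains_base]

lemma certified_base: "computable (eP (eL (eL eT)) (eL eC)) eB (\<lambda>rt z. certified n Ss z)"
  unfolding certified_def by (rule compute)+

lemmas [compute] = c_1[OF certified_base]

lemma tree_list_map: "tree_list A (map f xs) = tree_list (\<lambda>x. A (f x)) xs"
  by (simp add: tree_list_def foldr_map o_def)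

lemma tree_list_cong:
  assumes "\<And>x. x \<in> set xs \<Longrightarrow> A x = B x"
  shows "tree_list A xs = tree_list B xs"
  using assms by (induction xs) (simp_all add: tree_list_def)

lemma tree_var_nvar: "tree_var v = eV (nvar v)"
  by (simp add: tree_var_def nvar_def position_def eP_def)

lemma tree_pterm_numbered: "tree_pterm t = eT (numbered t)"
proof -
  have "(\<lambda>(v, e). Node (tree_var v) (tree_nat e)) = (\<lambda>p. eP eV eN ((\<lambda>(v, e). (nvar v, e)) p))"
    by (auto simp: fun_eq_iff tree_var_nvar eP_def)
  from this[THEN arg_cong, of "\<lambda>A. tree_list A (snd t)"] show ?thesis
    unfolding tree_pterm_def numbered_def eP_def[of eE] by (simp only: tree_list_map fst_conv snd_conv)
qed

lemma tree_input: "tree_list tree_dpoly fs = eL (eL eT) (map (map numbered) fs)"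
  unfolding tree_list_map tree_dpoly_def by (intro tree_list_cong tree_pterm_numbered)

text \<open>Programs know the indeterminates by their positions only, so the output is meaningful as long as the positions
  stay below $n$.\<close>

lemma tree_output:
  assumes "\<And>Y g t p. Y \<in> set X \<Longrightarrow> g \<in> set Y \<Longrightarrow> t \<in> set g \<Longrightarrow> p \<in> set (snd t) \<Longrightarrow>
    fst (fst p) < card (UNIV :: 'n set)"
  shows "tree_list (tree_list tree_dpoly)
      (map (map (map unnumbered)) X :: ('n::{finite,linorder}, 'a) pterm list list list) = eL (eL (eL eT)) X"
proof -
  have t: "tree_pterm (unnumbered t :: ('n, 'a) pterm) = eT t"
    if "\<And>p. p \<in> set (snd t) \<Longrightarrow> fst (fst p) < card (UNIV :: 'n set)" for t
  proof -
    have "map (\<lambda>p. (nvar (unvar (fst p) :: 'n dvar), snd p)) (snd t) = map (\<lambda>p. p) (snd t)"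
      by (rule map_cong[OF refl]) (simp add: nvar_unvar that)
    then have "numbered (unnumbered t :: ('n, 'a) pterm) = t"
      by (simp add: numbered_def unnumbered_def o_def split_def)
    then show ?thesis by (simp add: tree_pterm_numbered)
  qed
  show ?thesis unfolding tree_list_map tree_dpoly_def
    by (intro tree_list_cong t) (rule assms)
qed

lemma all_chains_positions:
  assumes "Y \<in> set (all_chains \<sigma> rt n Ss x)" "q \<in> set Y" "t \<in> set q" "p \<in> set (snd t)"
  shows "fst (fst p) < n"
proof -
  obtain SL C GV where C: "check n (system SL (fst x)) C" "GV \<in> set (solutions \<sigma> rt (system SL (fst x)) C)"
    and Y: "Y = map (\<lambda>g. entry_poly SL g) GV"
    using assms(1) by (auto simp: all_chains_def split: if_splits)
  obtain g where g: "g \<in> set GV" "q = entry_poly SL g" using assms(2) Y by auto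
  have "map fst GV = fst C" using C(2) by (simp add: solutions_def in_tuples)
  then have "fst g \<in> set (fst C)" using g(1) by (metis image_eqI set_map)
  then have ok: "entry_ok n (fst g)" using C(1) by (simp add: check_def gb_ok_def list_all_iff)
  have b: "fst (fst (fst g)) < n" using ok by (simp add: entry_ok_def)
  have "fst (snd l) < n" if l: "l \<in> set (snd (snd (fst g)))" for l
  proof -
    have "snd l < fst (fst g)" using ok l by (simp add: entry_ok_def list_all_iff)
    then have "fst (snd l) \<le> fst (fst (fst g))" by (auto simp: less_prod_def')
    then show ?thesis using b by simp
  qed
  then show ?thesis using assms(3,4) b unfolding g(2)
    by (auto simp: entry_poly_def split: if_splits)
qed

lemma certificate_lists_enumerable: "\<exists>d. enumerates (eL eC) d"
proof -
  note v = enum_pair[OF enum_nat enum_nat]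
  obtain w where w: "enumerates eW w" using enum_list[OF enum_pair[OF enum_bool v]] by blast
  obtain g where g: "enumerates (eL eG) g" using enum_list[OF enum_pair[OF v enum_pair[OF enum_nat w]]] by blast
  obtain u where u: "enumerates (eL eW) u" using enum_list[OF w] by blast
  obtain q where q: "enumerates (eL eQ) q" using enum_list[OF enum_pair[OF enum_nat enum_pair[OF enum_nat w]]] by blast
  show ?thesis by (rule enum_list[OF enum_pair[OF g enum_pair[OF g enum_pair[OF u q]]]])
qed

lemma chains_program:
  "\<exists>P. \<forall>rt. root_choice rt \<longrightarrow> (\<forall>fs. (\<exists>CS. certified n Ss (fs, CS)) \<longrightarrow>
     (\<exists>CS. certified n Ss (fs, CS) \<and> runs \<sigma> rt P (eL (eL eT) fs) (eL (eL (eL eT)) (all_chains \<sigma> rt n Ss (fs, CS)))))"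
proof -
  obtain d where d: "enumerates (eL eC) d" using certificate_lists_enumerable by blast
  have chk: "computable (eP (eL (eL eT)) (eL eC)) eB (\<lambda>rt z. certified n Ss (fst z, snd z))"
    using certified_base by simp
  obtain P where P: "\<forall>rt. root_choice rt \<longrightarrow> (\<forall>fs. (\<exists>CS. certified n Ss (fs, CS)) \<longrightarrow>
      (\<exists>CS. certified n Ss (fs, CS) \<and> runs \<sigma> rt P (eL (eL eT) fs) (eP (eL (eL eT)) (eL eC) (fs, CS))))"
    using search[OF d chk] by blast
  obtain R where R: "\<forall>rt. root_choice rt \<longrightarrow> (\<forall>z. runs \<sigma> rt R (eP (eL (eL eT)) (eL eC) z) (eL (eL (eL eT)) (all_chains \<sigma> rt n Ss z)))"
    using all_chains_base unfolding computable_def by blast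
  show ?thesis
  proof (intro exI[of _ "Seq P R"] allI impI)
    fix rt :: "'a poly \<Rightarrow> 'a" and fs :: "'a numbered_term list list"
    assume rt: "root_choice rt" and "\<exists>CS. certified n Ss (fs, CS)"
    then obtain CS where CS: "certified n Ss (fs, CS)" "runs \<sigma> rt P (eL (eL eT) fs) (eP (eL (eL eT)) (eL eC) (fs, CS))"
      using P by blast
    have "runs \<sigma> rt (Seq P R) (eL (eL eT) fs) (eL (eL (eL eT)) (all_chains \<sigma> rt n Ss (fs, CS)))"
      by (rule runs.seq[OF CS(2)]) (use R rt in blast)
    then show "\<exists>CS. certified n Ss (fs, CS) \<and> runs \<sigma> rt (Seq P R) (eL (eL eT) fs) (eL (eL (eL eT)) (all_chains \<sigma> rt n Ss (fs, CS)))"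
      using CS(1) by blast
  qed
qed

end

theorem theorem1p4:
  fixes \<sigma> :: "'a::{alg_closed_field, field_char_0} \<Rightarrow> 'a"
  assumes "inversive_difference_field \<sigma>"
  shows "\<exists>P. \<forall>rt. root_choice rt \<longrightarrow>
    (\<forall>fs :: ('n::{finite,linorder}, 'a) pterm list list.
      (\<forall>f\<in>set (map dpoly_of fs). difference_binomial \<sigma> f) \<longrightarrow>
      (\<exists>As :: ('n, 'a) pterm list list list.
        runs \<sigma> rt P (tree_list tree_dpoly fs) (tree_list (tree_list tree_dpoly) As) \<and>
        (\<forall>A\<in>set (map (map dpoly_of) As).
           regular_chain \<sigma> A \<and> coherent_chain \<sigma> A \<and>
           (\<forall>g\<in>set A. (\<exists>c. g = yvar (c, 0)) \<or> difference_binomial \<sigma> g) \<and>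
           reflexive_sigma_ideal \<sigma> (sat \<sigma> A) \<and> is_prime_ideal (sat \<sigma> A)) \<and>
        perfect_ideal_generated \<sigma> (set (map dpoly_of fs)) =
          (\<Inter>A\<in>set (map (map dpoly_of) As). sat \<sigma> A)))"
proof -
  interpret computation \<sigma> .
  let ?n = "card (UNIV :: 'n set)"
  let ?Ss = "subseqs [0..<?n]"
  obtain P where P: "\<forall>rt. root_choice rt \<longrightarrow> (\<forall>fs. (\<exists>CS. certified ?n ?Ss (fs, CS)) \<longrightarrow>
     (\<exists>CS. certified ?n ?Ss (fs, CS) \<and> runs \<sigma> rt P (eL (eL eT) fs) (eL (eL (eL eT)) (all_chains \<sigma> rt ?n ?Ss (fs, CS)))))"
    using chains_program by blast
  show ?thesis
  proof (intro exI[of _ P] allI impI)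
    fix rt :: "'a poly \<Rightarrow> 'a" and fs :: "('n, 'a) pterm list list"
    assume rt: "root_choice rt" and "\<forall>f\<in>set (map dpoly_of fs). difference_binomial \<sigma> f"
    then have bin: "\<And>f. f \<in> set fs \<Longrightarrow> difference_binomial \<sigma> (dpoly_of f)" by simp
    have df: "difference_field \<sigma>" using assms by (simp add: inversive_difference_field_def)
    obtain CS where cert: "certified ?n ?Ss (map (map numbered) fs, CS)"
      and run: "runs \<sigma> rt P (eL (eL eT) (map (map numbered) fs)) (eL (eL (eL eT)) (all_chains \<sigma> rt ?n ?Ss (map (map numbered) fs, CS)))"
      using P rt certified_exists[OF df bin] by blast
    let ?X = "all_chains \<sigma> rt ?n ?Ss (map (map numbered) fs, CS)"
    have "tree_list (tree_list tree_dpoly) (map (map (map unnumbered)) ?X :: ('n, 'a) pterm list list list) = eL (eL (eL eT)) ?X"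
      by (rule tree_output) (rule all_chains_positions)
    then have "runs \<sigma> rt P (tree_list tree_dpoly fs)
        (tree_list (tree_list tree_dpoly) (map (map (map unnumbered)) ?X :: ('n, 'a) pterm list list list))"
      using run by (simp add: tree_input)
    then show "\<exists>As :: ('n, 'a) pterm list list list.
        runs \<sigma> rt P (tree_list tree_dpoly fs) (tree_list (tree_list tree_dpoly) As) \<and>
        (\<forall>A\<in>set (map (map dpoly_of) As).
           regular_chain \<sigma> A \<and> coherent_chain \<sigma> A \<and>
           (\<forall>g\<in>set A. (\<exists>c. g = yvar (c, 0)) \<or> difference_binomial \<sigma> g) \<and>
           reflexive_sigma_ideal \<sigma> (sat \<sigma> A) \<and> is_prime_ideal (sat \<sigma> A)) \<and>
        perfect_ideal_generated \<sigma> (set (map dpoly_of fs)) =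
          (\<Inter>A\<in>set (map (map dpoly_of) As). sat \<sigma> A)"
      using decomposition[OF assms rt bin cert] by blast
  qed
qed

end
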